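(* Let $(\Sigma,\sigma)$ be a transitive countable Markov shift and $\tau\in\mathcal{R}$. Then the space $\mathcal{M}_{\le 1}(\Sigma,\sigma,\tau)$ of invariant sub-probability measures of the suspension flow over $(\Sigma,\sigma)$ with roof function $\tau$, endowed with the topology of convergence on cylinders for the suspension flow, is affinely homeomorphic to the Poulsen simplex. In particular $\mathcal{M}_{\le 1}(\Sigma,\sigma,\tau)$ is compact with respect to the topology of convergence on cylinders.
   Context: Let $\mathbb{N}=\{1,2,\dots\}$ and let $B=(B(i,j))_{i,j\in\mathbb{N}}$ be a matrix with entries in $\{0,1\}$ having no zero row and no zero column. The (one-sided) countable Markov shift defined by $B$ is $\Sigma=\{(x_n)_{n\in\mathbb{N}}\in\mathbb{N}^{\mathbb{N}}: B(x_n,x_{n+1})=1 \text{ for all } n\}$ with the shift map $\sigma(x_1,x_2,\dots)=(x_2,x_3,\dots)$. A cylinder of length $n$ is $[a_1\dots a_n]=\{x\in\Sigma: x_j=a_j,\ 1\le j\le n\}$; $\Sigma$ has the topology generated by cylinders. $(\Sigma,\sigma)$ is transitive if for all nonempty open $U,V\subset\Sigma$ there is $n\in\mathbb{N}$ with $U\cap\sigma^{-n}V\ne\emptyset$. $\Sigma$ carries the metric $\tilde d(x,y)=2^{-k}$, where $k$ is the number of initial coordinates on which $x\neq y$ agree, and $\tilde d(x,x)=0$. For $\phi:\Sigma\to\mathbb{R}$, $var_n(\phi)=\sup\{|\phi(x)-\phi(y)|: x_i=y_i,\ 1\le i\le n\}$. Class $\mathcal{R}$: a positive function $\tau:\Sigma\to\mathbb{R}$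 belongs to $\mathcal{R}$ if (a) $\tau$ is uniformly continuous (i.e. $var_n(\tau)\to0$), bounded away from zero, and $var_2(\tau)<\infty$; (b) $\lim_{k\to\infty}\inf_{x:\,x_1\ge k}\tau(x)=\infty$. Suspension flow: $Y=\{(x,t)\in\Sigma\times\mathbb{R}: 0\le t\le\tau(x)\}$ with $(x,\tau(x))$ and $(\sigma(x),0)$ identified; the semi-flow $\Theta=(\theta_t)_{t\ge0}$ on $Y$ is determined by $\theta_t(x,s)=(x,s+t)$ whenever $s+t\in[0,\tau(x)]$. $\mathcal{M}_{\le 1}(\Sigma,\sigma,\tau)$ is the set of $\Theta$-invariant nonnegative Borel measures on $Y$ of total mass at most $1$ (including the zero measure). Topology of convergence on cylinders for the suspension flow: fix $c>0$ with $\inf\tau>c$; $\nu_n\to\nu$ iff $\nu_n(C\times[0,c])\to\nu(C\times[0,c])$ for every cylinder $C\subset\Sigma$. This convergence is induced by a metrizable topology, the coarsest making all maps $\nu\mapsto\nu(C\times[0,c])$ continuous. A Poulsen simplex is a metrizable compact convex Choquet simplex with at least two points whose extreme points are dense; it is unique up to affine homeomorphism. *)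

theory Defs
  imports "HOL-Probability.Probability"
begin

section \<open>Countable Markov shifts\<close>

text \<open>
  Letters and coordinates are numbered from \<open>0\<close>: the letter \<open>i\<close> stands for \<open>i + 1\<close> in
  \<open>{1, 2, ...}\<close>, and \<open>x k\<close> is the coordinate with number \<open>k + 1\<close>.  A \<open>0\<close>-\<open>1\<close> matrix is a
  binary predicate on letters, true where the entry is \<open>1\<close>.
\<close>

definition no_zero_lines :: "(nat \<Rightarrow> nat \<Rightarrow> bool) \<Rightarrow> bool" where
  "no_zero_lines B \<longleftrightarrow> (\<forall>i. \<exists>j. B i j) \<and> (\<forall>j. \<exists>i. B i j)"

definition markov_shift :: "(nat \<Rightarrow> nat \<Rightarrow> bool) \<Rightarrow> (nat \<Rightarrow> nat) set" where
  "markov_shift B = {x. \<forall>n. B (x n) (x (Suc n))}"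

definition left_shift :: "(nat \<Rightarrow> nat) \<Rightarrow> (nat \<Rightarrow> nat)" where
  "left_shift x = (\<lambda>n. x (Suc n))"

definition cylinder :: "(nat \<Rightarrow> nat \<Rightarrow> bool) \<Rightarrow> nat list \<Rightarrow> (nat \<Rightarrow> nat) set" where
  "cylinder B w = {x \<in> markov_shift B. \<forall>j < length w. x j = w ! j}"

text \<open>
  Cylinders have length at least one.  Admitting the empty word would turn convergence on
  cylinders into a topology that also controls \<open>markov_shift B \<times> {0..c}\<close>.
\<close>

definition cylinders :: "(nat \<Rightarrow> nat \<Rightarrow> bool) \<Rightarrow> (nat \<Rightarrow> nat) set set" where
  "cylinders B = {cylinder B w | w. w \<noteq> []}"

definition shift_topology :: "(nat \<Rightarrow> nat \<Rightarrow> bool) \<Rightarrow> (nat \<Rightarrow> nat) topology" where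
  "shift_topology B = topology_generated_by (cylinders B)"

definition transitive_shift :: "(nat \<Rightarrow> nat \<Rightarrow> bool) \<Rightarrow> bool" where
  "transitive_shift B \<longleftrightarrow>
     (\<forall>U V. openin (shift_topology B) U \<and> U \<noteq> {} \<and> openin (shift_topology B) V \<and> V \<noteq> {} \<longrightarrow>
        (\<exists>n\<ge>1. U \<inter> (left_shift ^^ n) -` V \<noteq> {}))"

definition variation ::
    "(nat \<Rightarrow> nat \<Rightarrow> bool) \<Rightarrow> ((nat \<Rightarrow> nat) \<Rightarrow> real) \<Rightarrow> nat \<Rightarrow> ennreal" where
  "variation B \<phi> n =
     Sup {ennreal \<bar>\<phi> x - \<phi> y\<bar> | x y. x \<in> markov_shift B \<and> y \<in> markov_shift B \<and> (\<forall>i<n. x i = y i)}"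

text \<open>
  The first conjunct after positivity says that \<open>\<tau>\<close> is uniformly continuous for the metric
  \<open>2\<close> to the power \<open>-k\<close>, with \<open>k\<close> the number of initial coordinates that agree.
\<close>

definition class_R :: "(nat \<Rightarrow> nat \<Rightarrow> bool) \<Rightarrow> ((nat \<Rightarrow> nat) \<Rightarrow> real) \<Rightarrow> bool" where
  "class_R B \<tau> \<longleftrightarrow>
     (\<forall>x \<in> markov_shift B. \<tau> x > 0) \<and>
     (variation B \<tau> \<longlonglongrightarrow> 0) \<and>
     (\<exists>\<delta>>0. \<forall>x \<in> markov_shift B. \<delta> \<le> \<tau> x) \<and>
     variation B \<tau> 2 < \<infinity> \<and>
     ((\<lambda>k. INF x \<in> {x \<in> markov_shift B. k \<le> x 0}. ereal (\<tau> x)) \<longlonglongrightarrow> \<infinity>)"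

lemma topspace_shift_topology: "topspace (shift_topology B) = markov_shift B"
proof -
  have "x \<in> \<Union>(cylinders B)" if "x \<in> markov_shift B" for x
  proof (rule UnionI)
    show "cylinder B [x 0] \<in> cylinders B" by (auto simp: cylinders_def)
    show "x \<in> cylinder B [x 0]" using that by (simp add: cylinder_def)
  qed
  moreover have "\<Union>(cylinders B) \<subseteq> markov_shift B"
    by (auto simp: cylinders_def cylinder_def)
  ultimately show ?thesis
    unfolding shift_topology_def topology_generated_by_topspace by blast
qed

lemma shift_in_markov_shift: "x \<in> markov_shift B \<Longrightarrow> (left_shift ^^ n) x \<in> markov_shift B"
  by (induction n) (auto simp: markov_shift_def left_shift_def)


section \<open>Suspension flows\<close>

text \<open>
  The closed region under the graph of \<open>\<tau>\<close>, before gluing.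
\<close>

definition region :: "(nat \<Rightarrow> nat \<Rightarrow> bool) \<Rightarrow> ((nat \<Rightarrow> nat) \<Rightarrow> real) \<Rightarrow> ((nat \<Rightarrow> nat) \<times> real) set" where
  "region B \<tau> = {(x, t). x \<in> markov_shift B \<and> 0 \<le> t \<and> t \<le> \<tau> x}"

definition region_topology ::
    "(nat \<Rightarrow> nat \<Rightarrow> bool) \<Rightarrow> ((nat \<Rightarrow> nat) \<Rightarrow> real) \<Rightarrow> ((nat \<Rightarrow> nat) \<times> real) topology" where
  "region_topology B \<tau> = subtopology (prod_topology (shift_topology B) euclideanreal) (region B \<tau>)"

text \<open>
  For positive \<open>\<tau>\<close>, every class of the equivalence relation generated by
  \<open>(x, \<tau> x) \<sim> (left_shift x, 0)\<close> contains exactly one point \<open>(x, t)\<close> with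
  \<open>t < \<tau> x\<close>.  The glued space is the set of these representatives, \<open>glue\<close> is the
  quotient map, and the topology is the quotient topology; see the lemmas \<open>glue_eq_iff\<close> and \<open>quotient_map_glue\<close>.
\<close>

definition glue :: "((nat \<Rightarrow> nat) \<Rightarrow> real) \<Rightarrow> (nat \<Rightarrow> nat) \<times> real \<Rightarrow> (nat \<Rightarrow> nat) \<times> real" where
  "glue \<tau> = (\<lambda>(x, t). if t = \<tau> x then (left_shift x, 0) else (x, t))"

definition suspension :: "(nat \<Rightarrow> nat \<Rightarrow> bool) \<Rightarrow> ((nat \<Rightarrow> nat) \<Rightarrow> real) \<Rightarrow> ((nat \<Rightarrow> nat) \<times> real) set" where
  "suspension B \<tau> = glue \<tau> ` region B \<tau>"

definition suspension_topology ::
    "(nat \<Rightarrow> nat \<Rightarrow> bool) \<Rightarrow> ((nat \<Rightarrow> nat) \<Rightarrow> real) \<Rightarrow> ((nat \<Rightarrow> nat) \<times> real) topology" where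
  "suspension_topology B \<tau> =
     topology (\<lambda>U. U \<subseteq> suspension B \<tau> \<and>
                   openin (region_topology B \<tau>) {p \<in> region B \<tau>. glue \<tau> p \<in> U})"

definition suspension_borel ::
    "(nat \<Rightarrow> nat \<Rightarrow> bool) \<Rightarrow> ((nat \<Rightarrow> nat) \<Rightarrow> real) \<Rightarrow> ((nat \<Rightarrow> nat) \<times> real) measure" where
  "suspension_borel B \<tau> = sigma (suspension B \<tau>) {U. openin (suspension_topology B \<tau>) U}"

definition birkhoff_sum :: "((nat \<Rightarrow> nat) \<Rightarrow> real) \<Rightarrow> nat \<Rightarrow> (nat \<Rightarrow> nat) \<Rightarrow> real" where
  "birkhoff_sum \<tau> n x = (\<Sum>k<n. \<tau> ((left_shift ^^ k) x))"

text \<open>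
  Starting at \<open>(x, s)\<close> and moving up for time \<open>t\<close>, the orbit crosses the roof \<open>n\<close> times, where
  \<open>birkhoff_sum \<tau> n x \<le> s + t < birkhoff_sum \<tau> (Suc n) x\<close>.  The lemmas \<open>flow_zero\<close>, \<open>flow_add\<close>
  and \<open>flow_glue\<close> show that this is the semi-flow determined by \<open>(x, s) \<mapsto> (x, s + t)\<close>.
\<close>

definition suspension_flow ::
    "((nat \<Rightarrow> nat) \<Rightarrow> real) \<Rightarrow> real \<Rightarrow> (nat \<Rightarrow> nat) \<times> real \<Rightarrow> (nat \<Rightarrow> nat) \<times> real" where
  "suspension_flow \<tau> t = (\<lambda>(x, s).
     let n = (LEAST n. s + t < birkhoff_sum \<tau> (Suc n) x)
     in ((left_shift ^^ n) x, s + t - birkhoff_sum \<tau> n x))"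

definition invariant_subprobs ::
    "(nat \<Rightarrow> nat \<Rightarrow> bool) \<Rightarrow> ((nat \<Rightarrow> nat) \<Rightarrow> real) \<Rightarrow> ((nat \<Rightarrow> nat) \<times> real) measure set" where
  "invariant_subprobs B \<tau> =
     {\<nu>. space \<nu> = suspension B \<tau> \<and> sets \<nu> = sets (suspension_borel B \<tau>) \<and>
          emeasure \<nu> (space \<nu>) \<le> 1 \<and>
          (\<forall>t\<ge>0. \<forall>A \<in> sets \<nu>. emeasure \<nu> (suspension_flow \<tau> t -` A \<inter> space \<nu>) = emeasure \<nu> A)}"

text \<open>
  The coarsest topology on \<open>invariant_subprobs B \<tau>\<close> for which the maps sending \<open>\<nu>\<close> to its value
  on \<open>C \<times> {0..c}\<close>, with \<open>C\<close> a cylinder, are continuous.  If \<open>c\<close> is smaller than the infimum of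
  \<open>\<tau>\<close>, then \<open>C \<times> {0..c}\<close> consists of representatives of points of the glued space.
\<close>

definition cylinder_topology ::
    "(nat \<Rightarrow> nat \<Rightarrow> bool) \<Rightarrow> ((nat \<Rightarrow> nat) \<Rightarrow> real) \<Rightarrow> real \<Rightarrow> ((nat \<Rightarrow> nat) \<times> real) measure topology" where
  "cylinder_topology B \<tau> c =
     topology_generated_by
       {{\<nu> \<in> invariant_subprobs B \<tau>. measure \<nu> (C \<times> {0..c}) \<in> U} | C U.
          C \<in> cylinders B \<and> open (U :: real set)}"

lemma topspace_cylinder_topology: "topspace (cylinder_topology B \<tau> c) = invariant_subprobs B \<tau>"
proof -
  have "cylinder B [0] \<in> cylinders B"
    by (auto simp: cylinders_def)
  then have "invariant_subprobs B \<tau> \<in>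
      {{\<nu> \<in> invariant_subprobs B \<tau>. measure \<nu> (C \<times> {0..c}) \<in> U} | C U.
          C \<in> cylinders B \<and> open (U :: real set)}"
    by (intro CollectI exI[of _ "cylinder B [0]"] exI[of _ UNIV]) auto
  then show ?thesis
    unfolding cylinder_topology_def topology_generated_by_topspace by blast
qed

lemma suspension_eq:
  assumes "\<forall>x\<in>markov_shift B. 0 < \<tau> x"
  shows "suspension B \<tau> = {(x, t). x \<in> markov_shift B \<and> 0 \<le> t \<and> t < \<tau> x}" (is "_ = ?R")
proof
  show "suspension B \<tau> \<subseteq> ?R"
  proof
    fix p assume "p \<in> suspension B \<tau>"
    then obtain x t where xt: "p = glue \<tau> (x, t)" "x \<in> markov_shift B" "0 \<le> t" "t \<le> \<tau> x"
      by (auto simp: suspension_def region_def)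
    have "left_shift x \<in> markov_shift B"
      using shift_in_markov_shift[OF xt(2), of 1] by simp
    with xt assms show "p \<in> ?R"
      by (auto simp: glue_def)
  qed
  show "?R \<subseteq> suspension B \<tau>"
  proof
    fix p assume p: "p \<in> ?R"
    then have "p \<in> region B \<tau>" "glue \<tau> p = p"
      by (auto simp: region_def glue_def)
    then show "p \<in> suspension B \<tau>"
      unfolding suspension_def by force
  qed
qed

lemma openin_suspension_topology:
  "openin (suspension_topology B \<tau>) U \<longleftrightarrow>
     U \<subseteq> suspension B \<tau> \<and> openin (region_topology B \<tau>) {p \<in> region B \<tau>. glue \<tau> p \<in> U}"
proof -
  have "istopology (\<lambda>U. U \<subseteq> suspension B \<tau> \<and>
                   openin (region_topology B \<tau>) {p \<in> region B \<tau>. glue \<tau> p \<in> U})"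
    unfolding istopology_def
  proof (intro conjI allI impI)
    fix S T
    assume "S \<subseteq> suspension B \<tau> \<and> openin (region_topology B \<tau>) {p \<in> region B \<tau>. glue \<tau> p \<in> S}"
      and "T \<subseteq> suspension B \<tau> \<and> openin (region_topology B \<tau>) {p \<in> region B \<tau>. glue \<tau> p \<in> T}"
    moreover have "{p \<in> region B \<tau>. glue \<tau> p \<in> S \<inter> T} =
        {p \<in> region B \<tau>. glue \<tau> p \<in> S} \<inter> {p \<in> region B \<tau>. glue \<tau> p \<in> T}"
      by auto
    ultimately show "S \<inter> T \<subseteq> suspension B \<tau>"
      and "openin (region_topology B \<tau>) {p \<in> region B \<tau>. glue \<tau> p \<in> S \<inter> T}"
      by auto
  next
    fix K
    assume K: "\<forall>S\<in>K. S \<subseteq> suspension B \<tau> \<and>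
        openin (region_topology B \<tau>) {p \<in> region B \<tau>. glue \<tau> p \<in> S}"
    then show "\<Union>K \<subseteq> suspension B \<tau>" by blast
    have "{p \<in> region B \<tau>. glue \<tau> p \<in> \<Union>K} = (\<Union>S\<in>K. {p \<in> region B \<tau>. glue \<tau> p \<in> S})"
      by auto
    then show "openin (region_topology B \<tau>) {p \<in> region B \<tau>. glue \<tau> p \<in> \<Union>K}"
      using K by auto
  qed
  then show ?thesis
    unfolding suspension_topology_def by (simp add: topology_inverse')
qed

lemma topspace_region_topology: "topspace (region_topology B \<tau>) = region B \<tau>"
  by (auto simp: region_topology_def topspace_shift_topology region_def)

lemma topspace_suspension_topology: "topspace (suspension_topology B \<tau>) = suspension B \<tau>"
proof -
  have "{p \<in> region B \<tau>. glue \<tau> p \<in> suspension B \<tau>} = topspace (region_topology B \<tau>)"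
    by (auto simp: topspace_region_topology suspension_def)
  then have "openin (suspension_topology B \<tau>) (suspension B \<tau>)"
    by (simp add: openin_suspension_topology)
  then show ?thesis
    by (metis openin_subset openin_suspension_topology openin_topspace subset_antisym)
qed

lemma quotient_map_glue: "quotient_map (region_topology B \<tau>) (suspension_topology B \<tau>) (glue \<tau>)"
  unfolding quotient_map_def topspace_region_topology topspace_suspension_topology
  by (auto simp: openin_suspension_topology suspension_def)

lemma glue_eq_iff:
  assumes pos: "\<forall>x\<in>markov_shift B. 0 < \<tau> x"
    and p: "p \<in> region B \<tau>" and q: "q \<in> region B \<tau>"
  defines "r \<equiv> {((x, \<tau> x), (left_shift x, 0)) | x. x \<in> markov_shift B}"
  shows "glue \<tau> p = glue \<tau> q \<longleftrightarrow> (p, q) \<in> (r \<union> r\<inverse>)\<^sup>*"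
proof
  have to_glue: "(a, glue \<tau> a) \<in> (r \<union> r\<inverse>)\<^sup>* \<and> (glue \<tau> a, a) \<in> (r \<union> r\<inverse>)\<^sup>*" if "a \<in> region B \<tau>" for a
  proof (cases "snd a = \<tau> (fst a)")
    case True
    then have "(a, glue \<tau> a) \<in> r"
      using that by (cases a) (auto simp: glue_def r_def region_def)
    then show ?thesis by auto
  next
    case False
    then show ?thesis by (cases a) (auto simp: glue_def)
  qed
  assume "glue \<tau> p = glue \<tau> q"
  then show "(p, q) \<in> (r \<union> r\<inverse>)\<^sup>*"
    using to_glue[OF p] to_glue[OF q] by (metis rtrancl_trans)
next
  have glue_step: "glue \<tau> a = glue \<tau> b" if "(a, b) \<in> r \<union> r\<inverse>" for a b
  proof -
    have "glue \<tau> (left_shift x, 0) = (left_shift x, 0)" if "x \<in> markov_shift B" for x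
      using bspec[OF pos, of "left_shift x"] shift_in_markov_shift[of x B 1] that
      by (auto simp: glue_def)
    then show ?thesis
      using that by (auto simp: r_def glue_def)
  qed
  assume "(p, q) \<in> (r \<union> r\<inverse>)\<^sup>*"
  then show "glue \<tau> p = glue \<tau> q"
    proof (induction rule: rtrancl_induct)
    case (step a b)
    then show ?case using glue_step by metis
  qed simp
qed

lemma birkhoff_sum_add:
  "birkhoff_sum \<tau> (m + n) x = birkhoff_sum \<tau> m x + birkhoff_sum \<tau> n ((left_shift ^^ m) x)"
proof (induction n)
  case (Suc n)
  have "(left_shift ^^ (m + n)) x = (left_shift ^^ n) ((left_shift ^^ m) x)"
    by (metis add.commute comp_apply funpow_add)
  with Suc show ?case by (simp add: birkhoff_sum_def)
qed (simp add: birkhoff_sum_def)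

lemma suspension_flow_eq:
  assumes pos: "\<forall>x\<in>markov_shift B. 0 < \<tau> x" and x: "x \<in> markov_shift B"
    and n: "birkhoff_sum \<tau> n x \<le> s + t" "s + t < birkhoff_sum \<tau> (Suc n) x"
  shows "suspension_flow \<tau> t (x, s) = ((left_shift ^^ n) x, s + t - birkhoff_sum \<tau> n x)"
proof -
  have mono: "birkhoff_sum \<tau> k x \<le> birkhoff_sum \<tau> m x" if "k \<le> m" for k m
    unfolding birkhoff_sum_def using that bspec[OF pos shift_in_markov_shift[OF x]]
    by (intro sum_mono2) (auto intro: less_imp_le)
  have "(LEAST n. s + t < birkhoff_sum \<tau> (Suc n) x) = n"
  proof (rule Least_equality)
    fix m assume "s + t < birkhoff_sum \<tau> (Suc m) x"
    then show "n \<le> m"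
      using n(1) mono[of "Suc m" n] by (meson not_less_eq_eq not_le order.strict_trans1 order.trans)
  qed (rule n(2))
  then show ?thesis by (simp add: suspension_flow_def)
qed

lemma birkhoff_sum_bracket:
  assumes "0 < \<delta>" and low: "\<forall>x\<in>markov_shift B. \<delta> \<le> \<tau> x"
    and x: "x \<in> markov_shift B" and "0 \<le> (u::real)"
  obtains n where "birkhoff_sum \<tau> n x \<le> u" "u < birkhoff_sum \<tau> (Suc n) x"
proof -
  have ge: "real n * \<delta> \<le> birkhoff_sum \<tau> n x" for n
  proof (induction n)
    case (Suc n)
    then show ?case
      using bspec[OF low shift_in_markov_shift[OF x, of n]] by (simp add: birkhoff_sum_def algebra_simps)
  qed (simp add: birkhoff_sum_def)
  obtain N where "u < real N * \<delta>"
    using \<open>0 < \<delta>\<close> reals_Archimedean3 by blast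
  with ge[of N] have N: "u < birkhoff_sum \<tau> N x" by linarith
  define m where "m = (LEAST m. u < birkhoff_sum \<tau> m x)"
  have m: "u < birkhoff_sum \<tau> m x"
    unfolding m_def by (rule LeastI[of _ N]) (rule N)
  have "m \<noteq> 0"
    using m \<open>0 \<le> u\<close> by (auto simp: birkhoff_sum_def intro: ccontr)
  then obtain n where n: "m = Suc n" using not0_implies_Suc by blast
  then have "\<not> u < birkhoff_sum \<tau> n x"
    unfolding m_def by (metis lessI not_less_Least)
  with m n that[of n] show thesis by simp
qed

lemma flow_zero:
  assumes pos: "\<forall>x\<in>markov_shift B. 0 < \<tau> x" and p: "p \<in> suspension B \<tau>"
  shows "suspension_flow \<tau> 0 p = p"
proof -
  obtain x s where xs: "p = (x, s)" "x \<in> markov_shift B" "0 \<le> s" "s < \<tau> x"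
    using p by (auto simp: suspension_eq[OF pos])
  show ?thesis
    using suspension_flow_eq[OF pos xs(2), of 0 s 0] xs by (simp add: birkhoff_sum_def)
qed

lemma flow_in_suspension_and_add:
  assumes "0 < \<delta>" and low: "\<forall>x\<in>markov_shift B. \<delta> \<le> \<tau> x"
    and p: "p \<in> suspension B \<tau>" and st: "0 \<le> s" "0 \<le> t"
  shows "suspension_flow \<tau> s p \<in> suspension B \<tau>"
    and "suspension_flow \<tau> t (suspension_flow \<tau> s p) = suspension_flow \<tau> (s + t) p"
proof -
  have pos: "\<forall>x\<in>markov_shift B. 0 < \<tau> x"
    using low \<open>0 < \<delta>\<close> by force
  obtain x u where xu: "p = (x, u)" "x \<in> markov_shift B" "0 \<le> u" "u < \<tau> x"
    using p by (auto simp: suspension_eq[OF pos])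
  have us: "0 \<le> u + s" using xu st by simp
  obtain n where n: "birkhoff_sum \<tau> n x \<le> u + s" "u + s < birkhoff_sum \<tau> (Suc n) x"
    using birkhoff_sum_bracket[OF \<open>0 < \<delta>\<close> low xu(2) us] by blast
  define y v where "y = (left_shift ^^ n) x" and "v = u + s - birkhoff_sum \<tau> n x"
  have fs: "suspension_flow \<tau> s p = (y, v)"
    using suspension_flow_eq[OF pos xu(2) n] by (simp add: xu(1) y_def v_def)
  have y: "y \<in> markov_shift B"
    unfolding y_def by (rule shift_in_markov_shift[OF xu(2)])
  have v: "0 \<le> v" "v < \<tau> y"
    using n by (auto simp: v_def y_def birkhoff_sum_def)
  show "suspension_flow \<tau> s p \<in> suspension B \<tau>"
    using y v by (simp add: fs suspension_eq[OF pos])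
  have vt: "0 \<le> v + t" using v st by simp
  obtain m where m: "birkhoff_sum \<tau> m y \<le> v + t" "v + t < birkhoff_sum \<tau> (Suc m) y"
    using birkhoff_sum_bracket[OF \<open>0 < \<delta>\<close> low y vt] by blast
  have "suspension_flow \<tau> t (y, v) = ((left_shift ^^ m) y, v + t - birkhoff_sum \<tau> m y)"
    by (rule suspension_flow_eq[OF pos y m])
  moreover have "birkhoff_sum \<tau> (n + m) x \<le> u + (s + t)"
    and "u + (s + t) < birkhoff_sum \<tau> (Suc (n + m)) x"
    using m birkhoff_sum_add[of \<tau> n m x] birkhoff_sum_add[of \<tau> n "Suc m" x]
    by (auto simp: y_def v_def)
  then have "suspension_flow \<tau> (s + t) (x, u) =
      ((left_shift ^^ (n + m)) x, u + (s + t) - birkhoff_sum \<tau> (n + m) x)"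
    by (rule suspension_flow_eq[OF pos xu(2)])
  moreover have "(left_shift ^^ (n + m)) x = (left_shift ^^ m) y"
    unfolding y_def by (metis add.commute comp_apply funpow_add)
  ultimately show "suspension_flow \<tau> t (suspension_flow \<tau> s p) = suspension_flow \<tau> (s + t) p"
    using birkhoff_sum_add[of \<tau> n m x] fs by (simp add: xu(1) y_def v_def)
qed

lemmas flow_add = flow_in_suspension_and_add(2)

lemma flow_glue:
  assumes pos: "\<forall>x\<in>markov_shift B. 0 < \<tau> x"
    and x: "x \<in> markov_shift B" and st: "0 \<le> s" "0 \<le> t" "s + t \<le> \<tau> x"
  shows "suspension_flow \<tau> t (glue \<tau> (x, s)) = glue \<tau> (x, s + t)"
proof -
  have x': "left_shift x \<in> markov_shift B" using shift_in_markov_shift[OF x, of 1] by simp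
  consider (below) "s + t < \<tau> x" | (roof) "s + t = \<tau> x" "s < \<tau> x" | (stay) "s = \<tau> x" "t = 0"
    using st by linarith
  then show ?thesis
  proof cases
    case below
    then show ?thesis
      using suspension_flow_eq[OF pos x, of 0 s t] st by (simp add: glue_def birkhoff_sum_def)
  next
    case roof
    then show ?thesis
      using suspension_flow_eq[OF pos x, of 1 s t] bspec[OF pos x']
      by (simp add: glue_def birkhoff_sum_def)
  next
    case stay
    then show ?thesis
      using suspension_flow_eq[OF pos x', of 0 0 0] bspec[OF pos x']
      by (simp add: glue_def birkhoff_sum_def)
  qed
qed


section \<open>The Poulsen simplex and affine homeomorphisms\<close>

text \<open>
  In a metrizable compact convex set the set of extreme points is a countable intersection of
  open sets, so it is Borel.  A Choquet simplex is a compact convex set all of whose points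
  have a unique representing probability measure carried by the extreme points.
\<close>

definition represents :: "'a::real_normed_vector measure \<Rightarrow> 'a \<Rightarrow> bool" where
  "represents \<mu> x \<longleftrightarrow> (\<forall>f :: 'a \<Rightarrow> real. bounded_linear f \<longrightarrow> (\<integral>y. f y \<partial>\<mu>) = f x)"

definition choquet_simplex :: "'a::real_normed_vector set \<Rightarrow> bool" where
  "choquet_simplex K \<longleftrightarrow> compact K \<and> convex K \<and>
     (\<forall>x\<in>K. \<exists>!\<mu>. prob_space \<mu> \<and> sets \<mu> = sets borel \<and>
                  emeasure \<mu> {e. e extreme_point_of K} = 1 \<and> represents \<mu> x)"

text \<open>
  Metrizability is automatic in a normed space.  Working in normed spaces loses nothing: if
  \<open>K\<close> is a metrizable compact convex subset of a locally convex Hausdorff space, choose affine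
  continuous functions \<open>f n\<close> on \<open>K\<close> that are bounded by \<open>1\<close> and separate points; then sending
  \<open>x\<close> to the sequence of the \<open>f n x / 2 ^ n\<close> is an affine homeomorphism of \<open>K\<close> onto a
  norm-compact convex set of bounded sequences.
\<close>

definition poulsen_simplex :: "'a::real_normed_vector set \<Rightarrow> bool" where
  "poulsen_simplex K \<longleftrightarrow> choquet_simplex K \<and> (\<exists>x\<in>K. \<exists>y\<in>K. x \<noteq> y) \<and>
     K \<subseteq> closure {e. e extreme_point_of K}"

definition convex_comb_measure :: "real \<Rightarrow> 'b measure \<Rightarrow> 'b measure \<Rightarrow> 'b measure" where
  "convex_comb_measure u \<mu> \<nu> =
     measure_of (space \<mu>) (sets \<mu>) (\<lambda>A. ennreal (1 - u) * emeasure \<mu> A + ennreal u * emeasure \<nu> A)"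

definition affine_homeomorphism ::
    "'b measure topology \<Rightarrow> 'a::real_normed_vector set \<Rightarrow> ('b measure \<Rightarrow> 'a) \<Rightarrow> bool" where
  "affine_homeomorphism T K F \<longleftrightarrow>
     homeomorphic_map T (top_of_set K) F \<and>
     (\<forall>\<mu>\<in>topspace T. \<forall>\<nu>\<in>topspace T. \<forall>u\<in>{0..1}.
        F (convex_comb_measure u \<mu> \<nu>) = (1 - u) *\<^sub>R F \<mu> + u *\<^sub>R F \<nu>)"

end

theory Submission
  imports Defs
begin

text \<open>
  An invariant measure \<open>\<nu>\<close> of the flow is determined by its weights \<open>m w = \<nu> (cylinder B w \<times> {0..c})\<close>.
  They are the cylinder values of a finite shift invariant measure on sequences, and the total mass
  of \<open>\<nu>\<close> is the integral of \<open>\<tau> / c\<close> against it.  With infima of \<open>\<tau> / c\<close> over cylinders in place of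
  \<open>\<tau> / c\<close> the condition of having mass at most \<open>1\<close> becomes closed for pointwise convergence of
  weights; since \<open>\<tau>\<close> tends to infinity with the first letter, it also prevents mass from being
  lost in the limit of the sums over letters.  This gives compactness.

  The extreme points are zero and the ergodic measures of mass \<open>1\<close>.  By the mean ergodic theorem
  the frequencies of words converge almost surely along a subsequence; the limits are the weights
  of the ergodic component, which yields the unique decomposition into extreme points.

  Measures on periodic orbits, normalized to mass \<open>1\<close>, are extreme.  The closure of the set of these
  is convex, because by transitivity a periodic orbit may follow two given ones in any proportion,
  the distortion of Birkhoff sums of \<open>\<tau>\<close> being sublinear in their length.
  It contains zero, as the limit of shortest loops through larger and larger letters.  Finally, a typical long
  orbit segment starts and ends in a bounded set of letters and so can be closed up at bounded cost;
  hence every invariant measure is approximated by combinations of periodic ones and zero.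
\<close>

text \<open>The obstacle is the infinite alphabet: pointwise limits of weights may lose mass in the
  sums over letters. Since the roof over large letters is large and the cost is at most
  \<open>1\<close>, Markov's inequality bounds the weight of large letters uniformly, and no mass of
  the base escapes. Mass of the flow can escape upwards, under an unbounded roof; so limits of
  states of cost \<open>1\<close> may have smaller cost, down to zero. Words and measures live on
  the full sequence space. The shift space enters through the cost alone: a word with empty cylinder
  costs infinity, so finite cost puts the measure on the shift space. Ergodicity is used as a
  vanishing mean deviation of word counts. This is a condition on weights, so it makes sense for the
  random weights given by limit frequencies, and for a periodic orbit it holds exactly at multiples
  of the period. In the decomposition an ergodic component is weighted by its cost, because states
  are normalized by their mass in the flow and not on the base; the missing weight, one minus the
  cost, sits at zero.\<close>

section \<open>Cylinders of the full sequence space and the Borel sets they generate\<close>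

definition cyl :: "nat list \<Rightarrow> (nat \<Rightarrow> nat) set" where
  "cyl w = {x. \<forall>j<length w. x j = w ! j}"

lemma cylinder_eq: "cylinder B w = markov_shift B \<inter> cyl w"
  by (auto simp: cylinder_def cyl_def)

lemma mem_cyl_iff: "x \<in> cyl w \<longleftrightarrow> map x [0..<length w] = w"
  by (subst list_eq_iff_nth_eq) (auto simp: cyl_def)

lemma cyl_Nil [simp]: "cyl [] = UNIV"
  by (simp add: cyl_def)

lemma mem_cyl_snoc: "x \<in> cyl (w @ [a]) \<longleftrightarrow> x \<in> cyl w \<and> x (length w) = a"
  by (auto simp: mem_cyl_iff)

lemma mem_cyl_Cons: "x \<in> cyl (a # w) \<longleftrightarrow> x 0 = a \<and> left_shift x \<in> cyl w"
  by (simp add: cyl_def left_shift_def All_less_Suc2)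

lemma funpow_left_shift: "(left_shift ^^ n) x k = x (k + n)"
  by (induction n arbitrary: k) (auto simp: left_shift_def)

lemma open_cyl: "open (cyl w)"
proof -
  have "open ((\<lambda>x::nat \<Rightarrow> nat. x j) -` {w ! j})" for j
    by (rule open_vimage) (simp_all add: discrete_topology_class.open_discrete)
  moreover have "cyl w = (\<Inter>j<length w. (\<lambda>x. x j) -` {w ! j})"
    by (auto simp: cyl_def)
  ultimately show ?thesis by auto
qed

lemma closed_cyl: "closed (cyl w)"
proof -
  have "closed ((\<lambda>x::nat \<Rightarrow> nat. x j) -` {w ! j})" for j
    by (rule closed_vimage) simp_all
  moreover have "cyl w = (\<Inter>j\<in>{..<length w}. (\<lambda>x. x j) -` {w ! j})"
    by (auto simp: cyl_def)
  ultimately show ?thesis by (metis (no_types, lifting) closed_INT)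
qed

lemma cyl_sets [measurable, simp]: "cyl w \<in> sets borel"
  by (simp add: open_cyl)

text \<open>A basic open set of the product restricts finitely many coordinates, so an initial word
  of \<open>x\<close> that reaches past all of them suffices.\<close>

lemma open_contains_cyl:
  assumes "open U" "x \<in> U"
  obtains n where "cyl (map x [0..<n]) \<subseteq> U"
proof -
  have "openin (product_topology (\<lambda>i. euclidean) UNIV) U"
    using assms(1) unfolding open_fun_def .
  from product_topology_open_contains_basis[OF this assms(2)] obtain X where
    X: "x \<in> (\<Pi>\<^sub>E i\<in>UNIV. X i)" "finite {i. X i \<noteq> topspace (euclidean :: nat topology)}"
      "(\<Pi>\<^sub>E i\<in>UNIV. X i) \<subseteq> U"
    by blast
  have "finite {i. X i \<noteq> UNIV}" using X(2) by simp
  then obtain n where n: "\<forall>i\<in>{i. X i \<noteq> UNIV}. i < n"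
    using finite_nat_set_iff_bounded by blast
  have xX: "x i \<in> X i" for i using X(1) by (simp add: PiE_iff)
  have "cyl (map x [0..<n]) \<subseteq> (\<Pi>\<^sub>E i\<in>UNIV. X i)"
  proof
    fix y assume "y \<in> cyl (map x [0..<n])"
    then have y: "y i = x i" if "i < n" for i using that by (simp add: cyl_def)
    have "y i \<in> X i" for i
    proof (cases "X i = UNIV")
      case False
      then have "i < n" using n by simp
      then show ?thesis using y xX by simp
    qed simp
    then show "y \<in> (\<Pi>\<^sub>E i\<in>UNIV. X i)" by (simp add: PiE_iff)
  qed
  then show ?thesis using X(3) that by (meson order_trans)
qed

text \<open>There are only countably many words, so an open set is a countable union of cylinders.
  The empty set belongs to the generator to make it stable under intersection.\<close>

lemma sets_borel_eq_sigma_cyl: "sets borel = sigma_sets UNIV (insert {} (range cyl))"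
proof (rule antisym)
  have "U \<in> sigma_sets UNIV (insert {} (range cyl))" if "open U" for U
  proof -
    define I where "I = {w. cyl w \<subseteq> U}"
    have "U = (\<Union>w\<in>I. cyl w)"
    proof
      show "U \<subseteq> (\<Union>w\<in>I. cyl w)"
      proof
        fix x assume "x \<in> U"
        with that obtain n where "cyl (map x [0..<n]) \<subseteq> U" by (rule open_contains_cyl)
        moreover have "x \<in> cyl (map x [0..<n])" by (simp add: cyl_def)
        ultimately show "x \<in> (\<Union>w\<in>I. cyl w)" by (auto simp: I_def)
      qed
    qed (auto simp: I_def)
    moreover have "(\<Union>w\<in>I. cyl w) \<in> sigma_sets UNIV (insert {} (range cyl))"
      by (rule sigma_sets_UNION) (auto intro: sigma_sets.Basic)
    ultimately show ?thesis by simp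
  qed
  then have "Collect open \<subseteq> sigma_sets UNIV (insert {} (range cyl))" by auto
  then show "sets borel \<subseteq> sigma_sets UNIV (insert {} (range cyl))"
    unfolding borel_def by (simp add: sigma_sets_mono)
  show "sigma_sets UNIV (insert {} (range cyl)) \<subseteq> sets borel"
    using sets.sigma_sets_subset[of "insert {} (range cyl)" borel]
    by (simp add: image_subset_iff)
qed

text \<open>Cylinders are nested or disjoint, according to whether the shorter word is a prefix of
  the longer one.\<close>

lemma Int_stable_cyl: "Int_stable (insert {} (range cyl))"
proof -
  have aux: "cyl u \<inter> cyl v \<in> insert {} (range cyl)" if le: "length u \<le> length v" for u v
  proof (cases "u = take (length u) v")
    case True
    then have "u ! j = v ! j" if "j < length u" for j
      using that by (metis nth_take)
    then have "cyl u \<inter> cyl v = cyl v" using that by (fastforce simp: cyl_def)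
    then show ?thesis by simp
  next
    case False
    then obtain j where j: "j < length u" "u ! j \<noteq> v ! j"
      using le by (subst (asm) list_eq_iff_nth_eq) auto
    then have "cyl u \<inter> cyl v = {}"
      using that by (fastforce simp: cyl_def)
    then show ?thesis by simp
  qed
  show ?thesis
  proof (rule Int_stableI)
    fix a b assume "a \<in> insert {} (range cyl)" "b \<in> insert {} (range cyl)"
    then consider "a = {} \<or> b = {}" | u v where "a = cyl u" "b = cyl v" by auto
    then show "a \<inter> b \<in> insert {} (range cyl)"
    proof cases
      case 2
      then show ?thesis using aux[of u v] aux[of v u] by (metis Int_commute linear)
    qed auto
  qed
qed

lemma measure_eqI_cyl:
  fixes M N :: "(nat \<Rightarrow> nat) measure"
  assumes "sets M = sets borel" "sets N = sets borel"
    and "\<And>w. emeasure M (cyl w) = emeasure N (cyl w)" and "emeasure M (cyl []) \<noteq> \<infinity>"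
  shows "M = N"
proof (rule measure_eqI_generator_eq[OF Int_stable_cyl, where \<Omega> = UNIV and A = "\<lambda>i. cyl []"])
  show "emeasure M X = emeasure N X" if "X \<in> insert {} (range cyl)" for X
    using that assms(3) by auto
qed (use assms sets_borel_eq_sigma_cyl rangeI[of cyl "[]"] in auto)

lemma measurable_borel_seqI:
  assumes "\<And>w. f -` cyl w \<inter> space M \<in> sets M"
  shows "f \<in> borel_measurable M"
  by (rule measurable_sigma_sets[OF sets_borel_eq_sigma_cyl]) (use assms in auto)

lemma left_shift_measurable [measurable]: "left_shift \<in> borel_measurable borel"
  unfolding left_shift_def by (intro measurable_coordinatewise_then_product) simp

text \<open>The bridge between measures and weights: quantities such as cost and dispersion are
  defined as sums over words and become integrals once the weights belong to a measure.\<close>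

lemma nn_integral_initial_word:
  fixes M :: "(nat \<Rightarrow> nat) measure" and f :: "nat list \<Rightarrow> ennreal"
  assumes [measurable_cong]: "sets M = sets borel"
  shows "(\<integral>\<^sup>+x. f (map x [0..<n]) \<partial>M) =
    (\<integral>\<^sup>+w. f w * emeasure M (cyl w) \<partial>count_space {w. length w = n})"
proof -
  have "(\<integral>\<^sup>+x. f (map x [0..<n]) \<partial>M) =
      (\<integral>\<^sup>+x. \<integral>\<^sup>+w. f w * indicator (cyl w) x \<partial>count_space {w. length w = n} \<partial>M)"
  proof (rule nn_integral_cong)
    fix x
    have "(\<integral>\<^sup>+w. f w * indicator (cyl w) x \<partial>count_space {w. length w = n}) =
        (\<integral>\<^sup>+w. f w * indicator {map x [0..<n]} w \<partial>count_space {w. length w = n})"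
      by (intro nn_integral_cong) (auto simp: mem_cyl_iff split: split_indicator)
    also have "\<dots> = f (map x [0..<n])"
      by (subst nn_integral_indicator_singleton) auto
    finally show "f (map x [0..<n]) = (\<integral>\<^sup>+w. f w * indicator (cyl w) x \<partial>count_space {w. length w = n})" ..
  qed
  also have "\<dots> = (\<integral>\<^sup>+w. \<integral>\<^sup>+x. f w * indicator (cyl w) x \<partial>M \<partial>count_space {w. length w = n})"
    by (rule nn_integral_count_space_nn_integral) auto
  also have "\<dots> = (\<integral>\<^sup>+w. f w * emeasure M (cyl w) \<partial>count_space {w. length w = n})"
    by (simp add: nn_integral_cmult)
  finally show ?thesis .
qed

section \<open>Measures with prescribed values on cylinders\<close>

text \<open>Kolmogorov's consistency condition for the cylinder values of a finite measure on
  sequences.\<close>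

definition consistent :: "(nat list \<Rightarrow> real) \<Rightarrow> bool" where
  "consistent m \<longleftrightarrow> (\<forall>w. 0 \<le> m w) \<and> (\<forall>w. (\<lambda>a. m (w @ [a])) sums m w)"

text \<open>
  The measure is the image of Lebesgue measure: the interval of length \<open>m []\<close> is cut into
  consecutive half-open intervals of lengths \<open>m [0], m [1], ...\<close>, each of these is cut in the
  same way according to the second letter, and so on; a point is coded by the intervals that
  contain it.
\<close>

definition word_start :: "(nat list \<Rightarrow> real) \<Rightarrow> nat list \<Rightarrow> real" where
  "word_start m w = (\<Sum>i<length w. \<Sum>b<w ! i. m (take i w @ [b]))"

definition word_interval :: "(nat list \<Rightarrow> real) \<Rightarrow> nat list \<Rightarrow> real set" where
  "word_interval m w = {word_start m w ..< word_start m w + m w}"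

text \<open>The description is proper only for \<open>t\<close> in the interval of the empty word;
  elsewhere it denotes an unspecified letter, and \<open>cyl_measure\<close> restricts Lebesgue
  measure accordingly.\<close>

primrec coding_word :: "(nat list \<Rightarrow> real) \<Rightarrow> real \<Rightarrow> nat \<Rightarrow> nat list" where
  "coding_word m t 0 = []"
| "coding_word m t (Suc n) =
     coding_word m t n @ [THE a. t \<in> word_interval m (coding_word m t n @ [a])]"

definition coding :: "(nat list \<Rightarrow> real) \<Rightarrow> real \<Rightarrow> nat \<Rightarrow> nat" where
  "coding m t n = last (coding_word m t (Suc n))"

definition cyl_measure :: "(nat list \<Rightarrow> real) \<Rightarrow> (nat \<Rightarrow> nat) measure" where
  "cyl_measure m = distr (restrict_space lborel (word_interval m [])) borel (coding m)"

lemma word_start_snoc: "word_start m (w @ [a]) = word_start m w + (\<Sum>b<a. m (w @ [b]))"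
  by (simp add: word_start_def nth_append)

lemma word_interval_snoc_unique:
  assumes "consistent m" "t \<in> word_interval m (w @ [a])" "t \<in> word_interval m (w @ [b])"
  shows "a = b"
proof -
  have *: False if "a < b" "t \<in> word_interval m (w @ [a])" "t \<in> word_interval m (w @ [b])" for a b
  proof -
    have "(\<Sum>i<Suc a. m (w @ [i])) \<le> (\<Sum>i<b. m (w @ [i]))"
      using that assms(1) by (intro sum_mono2) (auto simp: consistent_def)
    with that show False by (simp add: word_interval_def word_start_snoc)
  qed
  show ?thesis
    using *[of a b] *[of b a] assms(2,3) by (metis linorder_neqE_nat)
qed

lemma word_interval_snoc_subset:
  assumes "consistent m"
  shows "word_interval m (w @ [a]) \<subseteq> word_interval m w"
proof -
  have s: "(\<lambda>a. m (w @ [a])) sums m w" and nn: "\<And>w. 0 \<le> m w"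
    using assms by (auto simp: consistent_def)
  have "(\<Sum>i<Suc a. m (w @ [i])) \<le> m w"
    using sum_le_suminf[OF sums_summable[OF s], of "{..<Suc a}"] nn sums_unique[OF s] by auto
  moreover have "0 \<le> (\<Sum>i<a. m (w @ [i]))" using nn by (intro sum_nonneg) auto
  ultimately show ?thesis by (auto simp: word_interval_def word_start_snoc)
qed

text \<open>The partial sums of the lengths increase to \<open>m w\<close>, so there is a first one
  that exceeds the offset \<open>d\<close> of \<open>t\<close>. The interval that ends there
  contains \<open>t\<close>.\<close>

lemma word_interval_snoc_ex:
  assumes "consistent m" "t \<in> word_interval m w"
  shows "\<exists>a. t \<in> word_interval m (w @ [a])"
proof -
  define d where "d = t - word_start m w"
  have d: "0 \<le> d" "d < m w" using assms(2) by (auto simp: word_interval_def d_def)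
  have "(\<lambda>n. \<Sum>i<n. m (w @ [i])) \<longlonglongrightarrow> m w"
    using assms(1) by (auto simp: consistent_def sums_def)
  then have "\<exists>n. d < (\<Sum>i<n. m (w @ [i]))"
    using order_tendstoD(1)[OF _ d(2)] eventually_sequentially by fastforce
  then have ex: "d < (\<Sum>i<(LEAST n. d < (\<Sum>i<n. m (w @ [i]))). m (w @ [i]))"
    by (rule LeastI_ex)
  define n where "n = (LEAST n. d < (\<Sum>i<n. m (w @ [i])))"
  obtain a where a: "n = Suc a"
    using ex d(1) unfolding n_def[symmetric] by (cases n) auto
  have "\<not> d < (\<Sum>i<a. m (w @ [i]))"
    using not_less_Least[of a "\<lambda>n. d < (\<Sum>i<n. m (w @ [i]))"] a n_def by auto
  with ex a n_def have "t \<in> word_interval m (w @ [a])"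
    by (auto simp: word_interval_def word_start_snoc d_def)
  then show ?thesis ..
qed

lemma coding_word_eq: "map (coding m t) [0..<n] = coding_word m t n"
  by (induction n) (auto simp: coding_def)

lemma coding_word_interval:
  assumes "consistent m" "t \<in> word_interval m []"
  shows "t \<in> word_interval m (coding_word m t n)"
proof (induction n)
  case (Suc n)
  have "\<exists>!a. t \<in> word_interval m (coding_word m t n @ [a])"
    using word_interval_snoc_ex[OF assms(1) Suc] word_interval_snoc_unique[OF assms(1)] by blast
  from theI'[OF this] show ?case by simp
qed (use assms in auto)

lemma coding_in_cyl_iff:
  assumes "consistent m" "t \<in> word_interval m []"
  shows "coding m t \<in> cyl w \<longleftrightarrow> t \<in> word_interval m w"
proof
  assume "coding m t \<in> cyl w"
  then show "t \<in> word_interval m w"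
    using coding_word_interval[OF assms, of "length w"] by (simp add: mem_cyl_iff coding_word_eq)
next
  have "coding_word m t (length w) = w" if "t \<in> word_interval m w"
    using that
  proof (induction w rule: rev_induct)
    case (snoc a w)
    then have "coding_word m t (length w) = w"
      using word_interval_snoc_subset[OF assms(1)] by auto
    moreover have "(THE a. t \<in> word_interval m (w @ [a])) = a"
      using snoc.prems word_interval_snoc_unique[OF assms(1)] by (intro the_equality) auto
    ultimately show ?case by simp
  qed simp
  then show "t \<in> word_interval m w \<Longrightarrow> coding m t \<in> cyl w"
    by (simp add: mem_cyl_iff coding_word_eq)
qed

lemma word_interval_subset:
  assumes "consistent m"
  shows "word_interval m w \<subseteq> word_interval m []"
proof (induction w rule: rev_induct)
  case (snoc a w)
  then show ?case using word_interval_snoc_subset[OF assms] by blast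
qed simp

lemma sets_cyl_measure [simp, measurable_cong]: "sets (cyl_measure m) = sets borel"
  by (simp add: cyl_measure_def)

lemma space_cyl_measure [simp]: "space (cyl_measure m) = UNIV"
  by (simp add: cyl_measure_def)

text \<open>The coding pulls the cylinder of \<open>w\<close> back to the interval of
  \<open>w\<close>, which has length \<open>m w\<close>. The same fact makes the coding
  measurable.\<close>

lemma emeasure_cyl_measure:
  assumes "consistent m"
  shows "emeasure (cyl_measure m) (cyl w) = ennreal (m w)"
proof -
  have J [measurable]: "word_interval m w \<in> sets borel" for w by (simp add: word_interval_def)
  have sp: "space (restrict_space lborel (word_interval m [])) = word_interval m []"
    by (simp add: space_restrict_space)
  have pre: "coding m -` cyl w \<inter> word_interval m [] = word_interval m w" for w
    using coding_in_cyl_iff[OF assms] word_interval_subset[OF assms, of w] by auto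
  have in_sets: "word_interval m w \<in> sets (restrict_space lborel (word_interval m []))" for w
    using J word_interval_subset[OF assms, of w]
    by (subst sets_restrict_space_iff) auto
  have meas: "coding m \<in> borel_measurable (restrict_space lborel (word_interval m []))"
    by (rule measurable_borel_seqI) (use pre in_sets in \<open>simp add: sp\<close>)
  have "emeasure (cyl_measure m) (cyl w) = emeasure lborel (word_interval m w)"
    unfolding cyl_measure_def using meas
    by (subst emeasure_distr)
       (use word_interval_subset[OF assms, of w] J in \<open>auto simp: sp pre emeasure_restrict_space\<close>)
  also have "\<dots> = ennreal (m w)"
    using assms by (simp add: word_interval_def consistent_def)
  finally show ?thesis .
qed

lemma cyl_measure_unique:
  assumes "consistent m" "sets M = sets borel" "\<And>w. emeasure M (cyl w) = ennreal (m w)"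
  shows "M = cyl_measure m"
  by (rule measure_eqI_cyl) (use assms emeasure_cyl_measure[OF assms(1)] assms(3)[of "[]"] in auto)

lemma finite_measure_cyl_measure:
  assumes "consistent m"
  shows "finite_measure (cyl_measure m)"
  by (rule finite_measureI) (use emeasure_cyl_measure[OF assms, of "[]"] in simp)

lemma measure_cyl_measure:
  assumes "consistent m"
  shows "measure (cyl_measure m) (cyl w) = m w"
  using emeasure_cyl_measure[OF assms] assms by (simp add: measure_def consistent_def)

lemma consistent_measure:
  assumes "finite_measure M" and [measurable_cong]: "sets M = sets borel"
  shows "consistent (\<lambda>w. measure M (cyl w))"
proof -
  interpret finite_measure M by fact
  have [measurable]: "cyl w \<in> sets M" for w using assms(2) by simp
  have "(\<lambda>a. measure M (cyl (w @ [a]))) sums measure M (\<Union>a. cyl (w @ [a]))" for w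
    by (rule finite_measure_UNION) (auto simp: disjoint_family_on_def mem_cyl_snoc)
  moreover have "(\<Union>a. cyl (w @ [a])) = cyl w" for w by (auto simp: mem_cyl_snoc)
  ultimately show ?thesis by (simp add: consistent_def)
qed

text \<open>The sum over a prepended letter is the weight of the preimage of the cylinder under the
  shift, so the second clause is shift invariance.\<close>

definition stationary :: "(nat list \<Rightarrow> real) \<Rightarrow> bool" where
  "stationary m \<longleftrightarrow> consistent m \<and> (\<forall>w. (\<lambda>a. m (a # w)) sums m w)"

lemma stationaryD:
  assumes "stationary m"
  shows "consistent m" "0 \<le> m w" "(\<lambda>a. m (w @ [a])) sums m w" "(\<lambda>a. m (a # w)) sums m w"
  using assms by (auto simp: stationary_def consistent_def)

lemma stationary_measure:
  assumes "finite_measure M" and [measurable_cong]: "sets M = sets borel"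
    and inv: "distr M borel left_shift = M"
  shows "stationary (\<lambda>w. measure M (cyl w))"
proof -
  interpret finite_measure M by fact
  have sp [simp]: "space M = UNIV" using assms(2) sets_eq_imp_space_eq by fastforce
  have [measurable]: "cyl w \<in> sets M" for w using assms(2) by simp
  have "(\<lambda>a. measure M (cyl (a # w))) sums measure M (\<Union>a. cyl (a # w))" for w
    by (rule finite_measure_UNION) (auto simp: disjoint_family_on_def mem_cyl_Cons)
  moreover have "(\<Union>a. cyl (a # w)) = left_shift -` cyl w" for w by (auto simp: mem_cyl_Cons)
  moreover have "measure M (left_shift -` cyl w) = measure M (cyl w)" for w
    by (subst (2) inv[symmetric], subst measure_distr) auto
  ultimately show ?thesis
    using consistent_measure[OF assms(1,2)] by (simp add: stationary_def)
qed

lemma left_shift_cyl_measure: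
  assumes "stationary m"
  shows "distr (cyl_measure m) borel left_shift = cyl_measure m"
proof (rule cyl_measure_unique)
  show c: "consistent m" using assms by (simp add: stationary_def)
  interpret finite_measure "cyl_measure m" by (rule finite_measure_cyl_measure[OF c])
  fix w
  have "(\<lambda>a. measure (cyl_measure m) (cyl (a # w))) sums measure (cyl_measure m) (\<Union>a. cyl (a # w))"
    by (rule finite_measure_UNION) (auto simp: disjoint_family_on_def mem_cyl_Cons)
  moreover have "(\<Union>a. cyl (a # w)) = left_shift -` cyl w" by (auto simp: mem_cyl_Cons)
  ultimately have "measure (cyl_measure m) (left_shift -` cyl w) = m w"
    using stationaryD(4)[OF assms, of w] by (simp add: measure_cyl_measure[OF c] sums_unique2)
  then show "emeasure (distr (cyl_measure m) borel left_shift) (cyl w) = ennreal (m w)"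
    by (subst emeasure_distr) (auto simp: emeasure_eq_measure)
qed simp

section \<open>Frequencies and the mean ergodic theorem\<close>

definition freq :: "nat \<Rightarrow> nat list \<Rightarrow> (nat \<Rightarrow> nat) \<Rightarrow> real" where
  "freq N w x = birkhoff_sum (indicator (cyl w)) N x / real N"

text \<open>The value \<open>0\<close> at points of divergence keeps the function total, measurable,
  within \<open>[0, 1]\<close> and invariant at every point.\<close>

definition limfreq :: "(nat \<Rightarrow> nat) \<Rightarrow> nat list \<Rightarrow> (nat \<Rightarrow> nat) \<Rightarrow> real" where
  "limfreq N w x = (if convergent (\<lambda>k. freq (N k) w x) then lim (\<lambda>k. freq (N k) w x) else 0)"

text \<open>Mean convergence gives almost sure convergence only along a subsequence; one subsequence
  has to serve all words at once.\<close>

definition generic_times :: "(nat \<Rightarrow> nat) measure \<Rightarrow> (nat \<Rightarrow> nat) \<Rightarrow> bool" where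
  "generic_times M N \<longleftrightarrow> strict_mono N \<and> (AE x in M. \<forall>w. convergent (\<lambda>k. freq (N k) w x))"

lemma funpow_left_shift_measurable [measurable]: "left_shift ^^ n \<in> borel_measurable borel"
proof -
  have "left_shift ^^ n = (\<lambda>x k. x (k + n))"
    by (intro ext) (simp add: funpow_left_shift)
  then show ?thesis by (simp add: measurable_coordinatewise_then_product)
qed

lemma birkhoff_sum_measurable [measurable]:
  assumes [measurable]: "f \<in> borel_measurable borel"
  shows "birkhoff_sum f n \<in> borel_measurable borel"
  unfolding birkhoff_sum_def by measurable

lemma freq_measurable [measurable]: "freq N w \<in> borel_measurable borel"
  unfolding freq_def by measurable

lemma freq_nonneg: "0 \<le> freq N w x"
  by (auto simp: freq_def birkhoff_sum_def intro!: divide_nonneg_nonneg sum_nonneg)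

lemma birkhoff_sum_indicator_le: "birkhoff_sum (indicator A) N x \<le> real N"
proof -
  have "birkhoff_sum (indicator A) N x \<le> (\<Sum>k<N. 1 :: real)"
    unfolding birkhoff_sum_def by (intro sum_mono) (auto split: split_indicator)
  then show ?thesis by simp
qed

lemma freq_le_1: "freq N w x \<le> 1"
  using birkhoff_sum_indicator_le[of "cyl w" N x] by (cases "N = 0") (simp_all add: freq_def divide_le_eq_1)

lemma birkhoff_sum_left_shift:
  "birkhoff_sum f n (left_shift x) = birkhoff_sum f n x + f ((left_shift ^^ n) x) - f x"
  by (induction n) (auto simp: birkhoff_sum_def funpow_swap1)

lemma freq_left_shift_bound: "\<bar>freq N w (left_shift x) - freq N w x\<bar> \<le> 1 / real N"
proof -
  have "\<bar>birkhoff_sum (indicator (cyl w)) N (left_shift x) - birkhoff_sum (indicator (cyl w)) N x\<bar> \<le> (1::real)"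
    by (auto simp: birkhoff_sum_left_shift split: split_indicator)
  then show ?thesis
    by (simp add: freq_def diff_divide_distrib[symmetric] divide_right_mono)
qed

lemma freq_funpow_left_shift_bound: "\<bar>freq N w ((left_shift ^^ i) x) - freq N w x\<bar> \<le> real i / real N"
proof (induction i)
  case (Suc i)
  then show ?case
    using freq_left_shift_bound[of N w "(left_shift ^^ i) x"] by (simp add: add_divide_distrib)
qed simp

lemma limfreq_measurable [measurable]: "limfreq N w \<in> borel_measurable borel"
proof -
  have [measurable]: "{x \<in> space borel. convergent (\<lambda>k. freq (N k) w x)} \<in> sets borel"
    unfolding Cauchy_convergent_iff[symmetric] by (rule sets_Collect_Cauchy) measurable
  show ?thesis unfolding limfreq_def by measurable
qed

lemma limfreq_tendsto:
  "convergent (\<lambda>k. freq (N k) w x) \<Longrightarrow> (\<lambda>k. freq (N k) w x) \<longlonglongrightarrow> limfreq N w x"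
  by (simp add: limfreq_def convergent_LIMSEQ_iff)

lemma limfreq_nonneg: "0 \<le> limfreq N w x"
proof (cases "convergent (\<lambda>k. freq (N k) w x)")
  case True
  show ?thesis
    by (rule LIMSEQ_le_const[OF limfreq_tendsto[OF True]]) (auto simp: freq_nonneg)
qed (simp add: limfreq_def)

lemma limfreq_le_1: "limfreq N w x \<le> 1"
proof (cases "convergent (\<lambda>k. freq (N k) w x)")
  case True
  show ?thesis
    by (rule LIMSEQ_le_const2[OF limfreq_tendsto[OF True]]) (auto simp: freq_le_1)
qed (simp add: limfreq_def)

text \<open>Frequencies at \<open>x\<close> and at its shift differ by at most
  \<open>1 / N k\<close>, so they converge together and to the same limit. Thus invariance holds
  everywhere and not just almost everywhere, which allows \<open>limfreq\<close> to act as an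
  invariant factor in integrals.\<close>

lemma limfreq_left_shift:
  assumes "strict_mono N"
  shows "limfreq N w (left_shift x) = limfreq N w x"
proof -
  have "(\<lambda>k. 1 / real (N k)) \<longlonglongrightarrow> 0"
    using LIMSEQ_subseq_LIMSEQ[OF lim_1_over_n assms] by (simp add: o_def)
  then have z: "(\<lambda>k. freq (N k) w (left_shift x) - freq (N k) w x) \<longlonglongrightarrow> 0"
    by (rule Lim_null_comparison[rotated]) (simp add: freq_left_shift_bound)
  have eq: "(\<lambda>k. freq (N k) w (left_shift x)) \<longlonglongrightarrow> l \<longleftrightarrow> (\<lambda>k. freq (N k) w x) \<longlonglongrightarrow> l" for l
    using tendsto_add[OF z, of "\<lambda>k. freq (N k) w x" l]
      tendsto_diff[OF _ z, of "\<lambda>k. freq (N k) w (left_shift x)" l] by auto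
  then show ?thesis by (simp add: limfreq_def convergent_def lim_def)
qed

locale shift_measure = finite_measure M for M :: "(nat \<Rightarrow> nat) measure" +
  assumes sets_M [measurable_cong, simp]: "sets M = sets borel"
    and distr_left_shift: "distr M borel left_shift = M"
begin

lemma space_M [simp]: "space M = UNIV"
  using sets_eq_imp_space_eq[OF sets_M] by simp

lemma distr_funpow: "distr M borel (left_shift ^^ n) = M"
proof (induction n)
  case 0
  show ?case by (rule measure_eqI) (auto simp: emeasure_distr)
next
  case (Suc n)
  have "distr M borel (left_shift ^^ Suc n) = distr (distr M borel (left_shift ^^ n)) borel left_shift"
    by (subst distr_distr) (auto simp: o_def)
  then show ?case using Suc distr_left_shift by (simp only:)
qed

lemma nn_integral_funpow:
  "f \<in> borel_measurable borel \<Longrightarrow> (\<integral>\<^sup>+x. f ((left_shift ^^ n) x) \<partial>M) = (\<integral>\<^sup>+x. f x \<partial>M)"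
  by (subst (2) distr_funpow[of n, symmetric]) (simp add: nn_integral_distr)

lemma integral_funpow:
  fixes f :: "(nat \<Rightarrow> nat) \<Rightarrow> real"
  shows "f \<in> borel_measurable borel \<Longrightarrow> (\<integral>x. f ((left_shift ^^ n) x) \<partial>M) = (\<integral>x. f x \<partial>M)"
  by (subst (2) distr_funpow[of n, symmetric]) (simp add: integral_distr)

lemma integrable_bounded:
  fixes f :: "(nat \<Rightarrow> nat) \<Rightarrow> real"
  assumes "f \<in> borel_measurable borel" "\<And>x. \<bar>f x\<bar> \<le> C"
  shows "integrable M f"
  by (rule integrable_const_bound[where B = C]) (use assms in auto)

lemma integral_birkhoff_sum:
  fixes f :: "(nat \<Rightarrow> nat) \<Rightarrow> real"
  assumes [measurable]: "f \<in> borel_measurable borel" and "\<And>x. \<bar>f x\<bar> \<le> C"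
  shows "(\<integral>x. birkhoff_sum f n x \<partial>M) = real n * (\<integral>x. f x \<partial>M)"
proof -
  have "integrable M (\<lambda>x. f ((left_shift ^^ k) x))" for k
    by (rule integrable_bounded[where C = C]) (auto simp: assms(2))
  then have "(\<integral>x. birkhoff_sum f n x \<partial>M) = (\<Sum>k<n. \<integral>x. f ((left_shift ^^ k) x) \<partial>M)"
    unfolding birkhoff_sum_def by (rule Bochner_Integration.integral_sum)
  then show ?thesis by (simp add: integral_funpow)
qed

text \<open>By Cauchy-Schwarz the square of an average is at most the average of the squares, and by
  invariance the latter has the integral of the square of \<open>p\<close>.\<close>

lemma integral_birkhoff_average_square_le:
  fixes p :: "(nat \<Rightarrow> nat) \<Rightarrow> real"
  assumes [measurable]: "p \<in> borel_measurable borel" and bd: "\<And>x. \<bar>p x\<bar> \<le> 1" and "0 < K"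
  shows "(\<integral>x. (birkhoff_sum p K x / real K)\<^sup>2 \<partial>M) \<le> (\<integral>x. (p x)\<^sup>2 \<partial>M)"
proof -
  have sq: "\<bar>(p x)\<^sup>2\<bar> \<le> 1" for x using bd[of x] by (simp add: abs_square_le_1)
  have le: "(birkhoff_sum p K x / real K)\<^sup>2 \<le> birkhoff_sum (\<lambda>x. (p x)\<^sup>2) K x / real K" for x
  proof -
    have "(birkhoff_sum p K x)\<^sup>2 \<le> birkhoff_sum (\<lambda>x. (p x)\<^sup>2) K x * real K"
      unfolding birkhoff_sum_def using sum_squared_le_sum_of_squares[of "\<lambda>k. p ((left_shift ^^ k) x)" "{..<K}"] by simp
    then show ?thesis using \<open>0 < K\<close> by (simp add: power_divide field_simps power2_eq_square)
  qed
  have b2: "\<bar>birkhoff_sum (\<lambda>x. (p x)\<^sup>2) K x / real K\<bar> \<le> 1" for x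
  proof -
    have "\<bar>birkhoff_sum (\<lambda>x. (p x)\<^sup>2) K x\<bar> \<le> (\<Sum>k<K. 1)"
      unfolding birkhoff_sum_def using sq by (intro order_trans[OF sum_abs] sum_mono) auto
    then show ?thesis using \<open>0 < K\<close> by (simp add: field_simps)
  qed
  have b1: "\<bar>(birkhoff_sum p K x / real K)\<^sup>2\<bar> \<le> 1" for x using order_trans[OF le[of x] order_trans[OF abs_ge_self b2[of x]]] by (simp only: abs_power2)
  have "(\<integral>x. (birkhoff_sum p K x / real K)\<^sup>2 \<partial>M) \<le> (\<integral>x. birkhoff_sum (\<lambda>x. (p x)\<^sup>2) K x / real K \<partial>M)"
    by (intro integral_mono integrable_bounded[where C = 1]) (use le b1 b2 in auto)
  also have "\<dots> = (\<integral>x. (p x)\<^sup>2 \<partial>M)"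
    using integral_birkhoff_sum[of "\<lambda>x. (p x)\<^sup>2" 1 K] sq \<open>0 < K\<close> by simp
  finally show ?thesis .
qed

text \<open>
  The squared norms of the averages \<open>freq K w\<close> converge to their infimum \<open>d\<close>: averaging does not
  increase norms and hardly changes long averages.  For the same reason the midpoint of two
  averages has squared norm at least \<open>d\<close>, and the parallelogram law gives the Cauchy property.
\<close>

lemma birkhoff_average_freq_bound:
  assumes "0 < N" "0 < K"
  shows "\<bar>birkhoff_sum (freq N w) K x / real K - freq K w x\<bar> \<le> real N / real K"
proof -
  \<comment> \<open>Exchanging the two sums turns a \<open>K\<close>-average of
    \<open>N\<close>-averages into an \<open>N\<close>-average of shifted \<open>K\<close>-averages,
    and a shift by \<open>j\<close> moves a \<open>K\<close>-average by at most
    \<open>j / K\<close>.\<close>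
  have "birkhoff_sum (freq N w) K x / real K = (\<Sum>j<N. freq K w ((left_shift ^^ j) x)) / real N"
  proof -
    have "birkhoff_sum (freq N w) K x = (\<Sum>k<K. \<Sum>j<N. indicator (cyl w) ((left_shift ^^ (j + k)) x)) / real N"
      by (simp add: birkhoff_sum_def freq_def sum_divide_distrib funpow_add)
    also have "(\<Sum>k<K. \<Sum>j<N. indicator (cyl w) ((left_shift ^^ (j + k)) x) :: real) =
        (\<Sum>j<N. \<Sum>k<K. indicator (cyl w) ((left_shift ^^ (k + j)) x))"
      by (subst sum.swap) (simp add: add.commute)
    also have "\<dots> = (\<Sum>j<N. freq K w ((left_shift ^^ j) x)) * real K"
      using \<open>0 < K\<close> by (simp add: birkhoff_sum_def freq_def sum_divide_distrib[symmetric] funpow_add)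
    finally show ?thesis using assms by simp
  qed
  then have "birkhoff_sum (freq N w) K x / real K - freq K w x =
      (\<Sum>j<N. freq K w ((left_shift ^^ j) x) - freq K w x) / real N"
    using assms by (simp add: sum_subtractf field_simps)
  also have "\<bar>\<dots>\<bar> \<le> (\<Sum>j<N. real N / real K) / real N"
    unfolding abs_divide
  proof (intro divide_mono order_trans[OF sum_abs] sum_mono)
    fix j assume "j \<in> {..<N}"
    then show "\<bar>freq K w ((left_shift ^^ j) x) - freq K w x\<bar> \<le> real N / real K"
      by (intro order_trans[OF freq_funpow_left_shift_bound] divide_right_mono) auto
  qed (use assms in auto)
  finally show ?thesis using assms by simp
qed

text \<open>Averaging the midpoint over \<open>K\<close> steps does not increase its norm and gives
  \<open>freq K w\<close> up to an error of order \<open>1 / K\<close>. With \<open>N = N'\<close>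
  this bounds the norms of long averages from above; in general it bounds the norm of the midpoint
  from below.\<close>

lemma freq_square_le:
  assumes "0 < N" "0 < N'" "0 < K"
  shows "(\<integral>x. (freq K w x)\<^sup>2 \<partial>M) \<le> (\<integral>x. ((freq N w x + freq N' w x) / 2)\<^sup>2 \<partial>M)
           + 2 * (real N + real N') / real K * measure M UNIV"
proof -
  define p where "p x = (freq N w x + freq N' w x) / 2" for x
  have [measurable]: "p \<in> borel_measurable borel" unfolding p_def by measurable
  have p01: "0 \<le> p x" "p x \<le> 1" for x
    using freq_nonneg[of N w x] freq_nonneg[of N' w x] freq_le_1[of N w x] freq_le_1[of N' w x]
    by (auto simp: p_def)
  define q where "q x = birkhoff_sum p K x / real K" for x
  have [measurable]: "q \<in> borel_measurable borel" unfolding q_def by measurable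
  have q01: "0 \<le> q x" "q x \<le> 1" for x
  proof -
    show "0 \<le> q x" unfolding q_def birkhoff_sum_def using p01 by (intro divide_nonneg_nonneg sum_nonneg) auto
    have "birkhoff_sum p K x \<le> (\<Sum>k<K. 1)" unfolding birkhoff_sum_def using p01 by (intro sum_mono) auto
    then show "q x \<le> 1" using \<open>0 < K\<close> by (simp add: q_def)
  qed
  have "q x = (birkhoff_sum (freq N w) K x / real K + birkhoff_sum (freq N' w) K x / real K) / 2" for x
    by (simp add: q_def p_def birkhoff_sum_def sum.distrib sum_divide_distrib[symmetric] add_divide_distrib)
  then have "\<bar>q x - freq K w x\<bar> \<le> (real N + real N') / real K" for x
    using birkhoff_average_freq_bound[OF assms(1,3), of w x] birkhoff_average_freq_bound[OF assms(2,3), of w x]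
    by (simp add: add_divide_distrib abs_le_iff)
  then have diff: "(freq K w x)\<^sup>2 \<le> (q x)\<^sup>2 + 2 * (real N + real N') / real K" for x
  proof -
    have "(freq K w x)\<^sup>2 - (q x)\<^sup>2 = (freq K w x - q x) * (freq K w x + q x)"
      by (simp add: power2_eq_square algebra_simps)
    also have "\<dots> \<le> \<bar>freq K w x - q x\<bar> * 2"
      using q01[of x] freq_nonneg[of K w x] freq_le_1[of K w x] by (intro mult_mono) auto
    also have "\<dots> \<le> ((real N + real N') / real K) * 2"
      using \<open>\<bar>q x - freq K w x\<bar> \<le> (real N + real N') / real K\<close>
      by (intro mult_right_mono) (simp_all add: abs_minus_commute)
    finally show ?thesis by (simp add: algebra_simps)
  qed
  have iq: "integrable M (\<lambda>x. (q x)\<^sup>2)"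
    by (rule integrable_bounded[where C = 1]) (use q01 in \<open>auto simp: abs_square_le_1\<close>)
  have "(\<integral>x. (freq K w x)\<^sup>2 \<partial>M) \<le> (\<integral>x. (q x)\<^sup>2 + 2 * (real N + real N') / real K \<partial>M)"
  proof (rule integral_mono)
    show "integrable M (\<lambda>x. (freq K w x)\<^sup>2)"
      by (rule integrable_bounded[where C = 1]) (use freq_nonneg freq_le_1 in \<open>auto simp: abs_square_le_1\<close>)
  qed (use iq diff in auto)
  also have "\<dots> = (\<integral>x. (q x)\<^sup>2 \<partial>M) + 2 * (real N + real N') / real K * measure M UNIV"
    using iq by simp
  also have "(\<integral>x. (q x)\<^sup>2 \<partial>M) \<le> (\<integral>x. (p x)\<^sup>2 \<partial>M)"
    unfolding q_def by (rule integral_birkhoff_average_square_le) (use p01 \<open>0 < K\<close> in auto)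
  finally show ?thesis by (simp add: p_def)
qed

lemma freq_L2_Cauchy:
  assumes "0 < e"
  obtains K where "0 < K" "\<And>N N'. K \<le> N \<Longrightarrow> K \<le> N' \<Longrightarrow> (\<integral>x. (freq N w x - freq N' w x)\<^sup>2 \<partial>M) \<le> e"
proof -
  define a where "a n = (\<integral>x. (freq n w x)\<^sup>2 \<partial>M)" for n
  define d where "d = (INF n\<in>{0<..}. a n)"
  have bdd: "bdd_below (a ` {0<..})" by (intro bdd_belowI[of _ 0]) (auto simp: a_def)
  have d_le: "d \<le> a n" if "0 < n" for n
    unfolding d_def using that by (intro cINF_lower[OF bdd]) auto
  \<comment> \<open>One \<open>e / 16\<close> is spent here and one on the error of
    \<open>freq_square_le\<close>, so norms of long averages are at most \<open>d + e / 8\<close>;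
    the parallelogram law then leaves \<open>e / 2\<close>.\<close>
  have "\<exists>n\<in>{0<..}. a n < d + e / 16"
    using cINF_less_iff[of "{0::nat<..}" a "d + e / 16"] bdd assms by (auto simp: d_def[symmetric] intro: exI[of _ "1::nat"])
  then obtain n where n: "0 < n" "a n < d + e / 16" by auto
  have lim0: "(\<lambda>K. C / real K) \<longlonglongrightarrow> 0" for C
    using tendsto_mult_right_zero[OF lim_1_over_n, of C] by simp
  have "eventually (\<lambda>K. 2 * (real n + real n) * measure M UNIV / real K < e / 16) sequentially"
    using order_tendstoD(2)[OF lim0] assms by auto
  then obtain K0 where K0: "\<And>K. K0 \<le> K \<Longrightarrow> 2 * (real n + real n) * measure M UNIV / real K < e / 16"
    by (auto simp: eventually_sequentially)
  have a_le: "a K \<le> d + e / 8" if "max K0 1 \<le> K" for K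
    using freq_square_le[OF n(1) n(1), of K w] n(2) K0[of K] that assms by (simp add: a_def)
  \<comment> \<open>In \<open>freq_square_le\<close> the left side is at least \<open>d\<close> for
    all \<open>K\<close>, while the error term vanishes as \<open>K\<close> grows.\<close>
  have mid: "d \<le> (\<integral>x. ((freq N w x + freq N' w x) / 2)\<^sup>2 \<partial>M)" if "0 < N" "0 < N'" for N N'
  proof (rule field_le_epsilon)
    fix r :: real assume "0 < r"
    then have "eventually (\<lambda>K. 2 * (real N + real N') * measure M UNIV / real K < r) sequentially"
      using order_tendstoD(2)[OF lim0] by auto
    then obtain K where K: "1 \<le> K" "2 * (real N + real N') * measure M UNIV / real K < r"
      unfolding eventually_sequentially by (meson max.cobounded1 max.cobounded2)
    then show "d \<le> (\<integral>x. ((freq N w x + freq N' w x) / 2)\<^sup>2 \<partial>M) + r"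
      using freq_square_le[OF that, of K w] d_le[of K] by (simp add: a_def algebra_simps)
  qed
  show thesis
  proof (rule that[of "max K0 1"])
    fix N N' assume N: "max K0 1 \<le> N" "max K0 1 \<le> N'"
    have int: "integrable M (\<lambda>x. (freq n w x)\<^sup>2)" for n
      by (rule integrable_bounded[where C = 1]) (use freq_nonneg freq_le_1 in \<open>auto simp: abs_square_le_1\<close>)
    have int2: "integrable M (\<lambda>x. ((freq N w x + freq N' w x) / 2)\<^sup>2)"
    proof (rule integrable_bounded[where C = 1])
      show "\<bar>((freq N w x + freq N' w x) / 2)\<^sup>2\<bar> \<le> 1" for x
        using freq_nonneg[of N w x] freq_nonneg[of N' w x] freq_le_1[of N w x] freq_le_1[of N' w x]
        by (subst abs_power2) (simp add: abs_square_le_1)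
    qed measurable
    have "(\<integral>x. (freq N w x - freq N' w x)\<^sup>2 \<partial>M) =
        (\<integral>x. 2 * (freq N w x)\<^sup>2 + 2 * (freq N' w x)\<^sup>2 - 4 * ((freq N w x + freq N' w x) / 2)\<^sup>2 \<partial>M)"
      by (intro Bochner_Integration.integral_cong) (auto simp: power2_eq_square field_simps)
    also have "\<dots> = 2 * a N + 2 * a N' - 4 * (\<integral>x. ((freq N w x + freq N' w x) / 2)\<^sup>2 \<partial>M)"
      using int[of N] int[of N'] int2 by (simp add: a_def del: power_divide)
    also have "\<dots> \<le> e"
      using a_le[OF N(1)] a_le[OF N(2)] mid[of N N'] N assms by auto
    finally show "(\<integral>x. (freq N w x - freq N' w x)\<^sup>2 \<partial>M) \<le> e" .
  qed simp
qed

lemma freq_L1_Cauchy: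
  assumes "0 < e"
  shows "\<exists>K. \<forall>N\<ge>K. \<forall>N'\<ge>K. (\<integral>x. \<bar>freq N w x - freq N' w x\<bar> \<partial>M) \<le> e"
proof -
  define r where "r = e / (measure M UNIV + 1)"
  have m: "0 \<le> measure M UNIV" by simp
  have r: "0 < r" "r * measure M UNIV \<le> e"
    using assms m by (auto simp: r_def divide_simps add_nonneg_pos mult_left_mono)
  obtain K where K: "\<And>N N'. K \<le> N \<Longrightarrow> K \<le> N' \<Longrightarrow> (\<integral>x. (freq N w x - freq N' w x)\<^sup>2 \<partial>M) \<le> r * e"
    using freq_L2_Cauchy[of "r * e" w] assms r(1) by (metis mult_pos_pos)
  have "(\<integral>x. \<bar>freq N w x - freq N' w x\<bar> \<partial>M) \<le> e" if N: "K \<le> N" "K \<le> N'" for N N'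
  proof -
    have bd: "\<bar>freq N w x - freq N' w x\<bar> \<le> 1" for x
      using freq_nonneg[of N w x] freq_nonneg[of N' w x] freq_le_1[of N w x] freq_le_1[of N' w x] by auto
    have i1: "integrable M (\<lambda>x. \<bar>freq N w x - freq N' w x\<bar>)"
      by (rule integrable_bounded[where C = 1]) (use bd in auto)
    have i2: "integrable M (\<lambda>x. (freq N w x - freq N' w x)\<^sup>2)"
      by (rule integrable_bounded[where C = 1]) (use bd in \<open>auto simp: abs_square_le_1\<close>)
    \<comment> \<open>The arithmetic-geometric mean inequality replaces Cauchy-Schwarz;
      \<open>r\<close> is so small that its constant term integrates to at most
      \<open>e / 2\<close>.\<close>
    have "\<bar>t\<bar> \<le> r / 2 + t\<^sup>2 / (2 * r)" for t
    proof -
      have "0 \<le> (\<bar>t\<bar> - r)\<^sup>2" by simp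
      then show ?thesis using r(1) by (simp add: power2_diff field_simps power2_eq_square)
    qed
    then have "(\<integral>x. \<bar>freq N w x - freq N' w x\<bar> \<partial>M) \<le> (\<integral>x. r / 2 + (freq N w x - freq N' w x)\<^sup>2 / (2 * r) \<partial>M)"
      using i1 i2 by (intro integral_mono) auto
    also have "\<dots> = r / 2 * measure M UNIV + (\<integral>x. (freq N w x - freq N' w x)\<^sup>2 \<partial>M) / (2 * r)"
      using i2 by simp
    also have "\<dots> \<le> e / 2 + (r * e) / (2 * r)"
      using r K[OF N] by (intro add_mono divide_right_mono) auto
    also have "\<dots> = e" using r by simp
    finally show ?thesis .
  qed
  then show ?thesis by blast
qed

text \<open>If successive frequencies differ by \<open>2\<close> to the power \<open>-k\<close> in
  mean, the sum of their differences has finite integral, hence is finite almost everywhere, and the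
  telescoping series converges.\<close>

lemma generic_times_exist: "\<exists>N. generic_times M N"
proof -
  have "\<exists>K. \<forall>N\<ge>K. \<forall>N'\<ge>K. (\<integral>x. \<bar>freq N (from_nat i) x - freq N' (from_nat i) x\<bar> \<partial>M) \<le> (1/2) ^ j" for i j
    by (rule freq_L1_Cauchy) simp
  then obtain T where T: "\<And>i j N N'. T i j \<le> N \<Longrightarrow> T i j \<le> N' \<Longrightarrow>
      (\<integral>x. \<bar>freq N (from_nat i) x - freq N' (from_nat i) x\<bar> \<partial>M) \<le> (1/2) ^ j"
    by metis
  \<comment> \<open>\<open>T i j\<close> is a threshold for the word with number \<open>i\<close>
    and accuracy \<open>2\<close> to the power \<open>-j\<close>. Summing dominates all thresholds
    with indices up to \<open>k\<close>, and the summand \<open>k\<close> makes \<open>N\<close>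
    strictly increasing.\<close>
  define N where "N k = k + (\<Sum>i\<le>k. \<Sum>j\<le>k. T i j)" for k
  have sm: "strict_mono N"
  proof (rule strict_mono_Suc_iff[THEN iffD2], rule allI)
    fix k
    have "(\<Sum>i\<le>k. \<Sum>j\<le>k. T i j) \<le> (\<Sum>i\<le>Suc k. \<Sum>j\<le>Suc k. T i j)"
      by (intro order_trans[OF sum_mono sum_mono2]) (auto intro!: sum_mono2)
    then show "N k < N (Suc k)" by (simp add: N_def)
  qed
  have T_le: "T i j \<le> N k" if "i \<le> k" "j \<le> k" for i j k
  proof -
    have "T i j \<le> (\<Sum>j\<le>k. T i j)" using that by (intro member_le_sum) auto
    also have "\<dots> \<le> (\<Sum>i\<le>k. \<Sum>j\<le>k. T i j)"
      using that by (intro member_le_sum[of i _ "\<lambda>i. \<Sum>j\<le>k. T i j"]) auto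
    finally show ?thesis by (simp add: N_def)
  qed
  have "AE x in M. convergent (\<lambda>k. freq (N k) w x)" for w
  proof -
    define i where "i = to_nat w"
    have w: "from_nat i = w" by (simp add: i_def)
    \<comment> \<open>The word with number \<open>i\<close> is under control only from index
      \<open>i\<close> on, hence the offset.\<close>
    define D where "D k x = \<bar>freq (N (Suc (k + i))) w x - freq (N (k + i)) w x\<bar>" for k x
    have [measurable]: "D k \<in> borel_measurable borel" for k unfolding D_def by measurable
    have bd: "\<bar>D k x\<bar> \<le> 1" for k x
      using freq_nonneg[of _ w x] freq_le_1[of _ w x] unfolding D_def
      by (simp add: abs_le_iff add_increasing2 diff_le_eq)
    have int: "(\<integral>\<^sup>+x. ennreal (D k x) \<partial>M) \<le> ennreal ((1/2) ^ k)" for k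
    proof -
      have "(\<integral>\<^sup>+x. ennreal (D k x) \<partial>M) = ennreal (\<integral>x. D k x \<partial>M)"
        by (rule nn_integral_eq_integral) (auto intro!: integrable_bounded[where C = 1] bd, auto simp: D_def)
      also have "(\<integral>x. D k x \<partial>M) \<le> (1/2) ^ (k + i)"
        unfolding D_def using T[of i "k + i" "N (Suc (k + i))" "N (k + i)"] T_le[of i _ "k + i"] T_le w by simp
      also have "(1/2 :: real) ^ (k + i) \<le> (1/2) ^ k" by (intro power_decreasing) auto
      finally show ?thesis by (simp add: ennreal_leI)
    qed
    have "(\<integral>\<^sup>+x. (\<Sum>k. ennreal (D k x)) \<partial>M) = (\<Sum>k. \<integral>\<^sup>+x. ennreal (D k x) \<partial>M)"
      by (rule nn_integral_suminf) measurable
    also have "\<dots> \<le> (\<Sum>k. ennreal ((1/2) ^ k))" by (intro suminf_le int) auto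
    also have "\<dots> = ennreal (\<Sum>k. (1/2) ^ k)" by (rule suminf_ennreal2) (auto simp: summable_geometric)
    finally have "(\<integral>\<^sup>+x. (\<Sum>k. ennreal (D k x)) \<partial>M) \<noteq> \<infinity>"
      by (auto simp: top_unique)
    then have "AE x in M. (\<Sum>k. ennreal (D k x)) \<noteq> \<infinity>"
      by (rule nn_integral_noteq_infinite[rotated]) measurable
    then show ?thesis
    proof eventually_elim
      case (elim x)
      have "summable (\<lambda>k. D k x)"
        by (rule summable_suminf_not_top) (use elim in \<open>auto simp: D_def\<close>)
      then have "summable (\<lambda>k. freq (N (Suc (k + i))) w x - freq (N (k + i)) w x)"
        unfolding D_def by (rule summable_rabs_cancel)
      then have "convergent (\<lambda>n. \<Sum>k<n. freq (N (Suc k + i)) w x - freq (N (k + i)) w x)"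
        by (simp add: summable_iff_convergent)
      then have "convergent (\<lambda>n. freq (N (n + i)) w x - freq (N (0 + i)) w x)"
        by (subst (asm) sum_lessThan_telescope)
      then have "convergent (\<lambda>n. freq (N (n + i)) w x)"
        by (simp add: convergent_diff_const_right_iff)
      then show ?case by (simp add: convergent_ignore_initial_segment[of "\<lambda>k. freq (N k) w x"])
    qed
  qed
  then have "AE x in M. \<forall>w. convergent (\<lambda>k. freq (N k) w x)"
    by (simp add: AE_all_countable)
  with sm show ?thesis by (auto simp: generic_times_def)
qed

text \<open>By invariance of \<open>h\<close> and of the measure, the integral of \<open>h\<close>
  times \<open>freq n w\<close> does not depend on \<open>n\<close>; dominated convergence gives the
  claim. In effect \<open>limfreq\<close> is the conditional expectation of the indicator of the
  cylinder with respect to the invariant sets.\<close>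

lemma integral_limfreq:
  fixes h :: "(nat \<Rightarrow> nat) \<Rightarrow> real"
  assumes gen: "generic_times M N" and [measurable]: "h \<in> borel_measurable borel"
    and bd: "\<And>x. \<bar>h x\<bar> \<le> C" and inv: "\<And>x. h (left_shift x) = h x"
  shows "(\<integral>x. h x * limfreq N w x \<partial>M) = (\<integral>x. h x * indicator (cyl w) x \<partial>M)"
proof -
  have inv': "h ((left_shift ^^ i) x) = h x" for i x
    by (induction i) (auto simp: inv)
  have C: "0 \<le> C" using bd[of undefined] by simp
  have bd1: "\<bar>h x * indicator (cyl w) y\<bar> \<le> C" for x y :: "nat \<Rightarrow> nat"
    using bd[of x] C by (auto split: split_indicator)
  have eq: "(\<integral>x. h x * freq n w x \<partial>M) = (\<integral>x. h x * indicator (cyl w) x \<partial>M)" if "0 < n" for n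
  proof -
    have "h x * freq n w x = birkhoff_sum (\<lambda>x. h x * indicator (cyl w) x) n x / real n" for x
      by (simp add: freq_def birkhoff_sum_def inv' sum_distrib_left)
    then show ?thesis
      using integral_birkhoff_sum[of "\<lambda>x. h x * indicator (cyl w) x" C n] bd1 that by simp
  qed
  have sm: "strict_mono N" using gen by (simp add: generic_times_def)
  have lim: "(\<lambda>k. \<integral>x. h x * freq (N k) w x \<partial>M) \<longlonglongrightarrow> (\<integral>x. h x * limfreq N w x \<partial>M)"
  proof (rule integral_dominated_convergence[where w = "\<lambda>_. C"])
    show "AE x in M. (\<lambda>k. h x * freq (N k) w x) \<longlonglongrightarrow> h x * limfreq N w x"
      using gen unfolding generic_times_def
      by (auto elim!: eventually_mono intro!: tendsto_intros limfreq_tendsto)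
    show "AE x in M. norm (h x * freq (N i) w x) \<le> C" for i
    proof (rule AE_I2)
      fix x
      have "\<bar>h x\<bar> * \<bar>freq (N i) w x\<bar> \<le> C * 1"
        using bd[of x] freq_nonneg[of "N i" w x] freq_le_1[of "N i" w x] C by (intro mult_mono) auto
      then show "norm (h x * freq (N i) w x) \<le> C" by (simp add: abs_mult)
    qed
  qed auto
  have ev: "eventually (\<lambda>k. (\<integral>x. h x * freq (N k) w x \<partial>M) = (\<integral>x. h x * indicator (cyl w) x \<partial>M)) sequentially"
  proof (rule eventually_sequentiallyI[of 1])
    fix k :: nat assume "1 \<le> k"
    then have "0 < N k" using seq_suble[OF sm, of k] by simp
    then show "(\<integral>x. h x * freq (N k) w x \<partial>M) = (\<integral>x. h x * indicator (cyl w) x \<partial>M)" by (rule eq)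
  qed
  have "(\<lambda>k. \<integral>x. h x * freq (N k) w x \<partial>M) \<longlonglongrightarrow> (\<integral>x. h x * indicator (cyl w) x \<partial>M)"
    by (rule tendsto_eventually[OF ev])
  with lim show ?thesis by (rule LIMSEQ_unique)
qed

lemma nn_integral_limfreq:
  fixes h :: "(nat \<Rightarrow> nat) \<Rightarrow> real"
  assumes gen: "generic_times M N" and [measurable]: "h \<in> borel_measurable borel"
    and h: "\<And>x. 0 \<le> h x" "\<And>x. h x \<le> C" and inv: "\<And>x. h (left_shift x) = h x"
  shows "(\<integral>\<^sup>+x. ennreal (h x) * ennreal (limfreq N w x) \<partial>M) = (\<integral>\<^sup>+x. ennreal (h x) * indicator (cyl w) x \<partial>M)"
proof -
  have C: "0 \<le> C" using h[of undefined] by simp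
  have "h x * limfreq N w x \<le> C * 1" for x
    using h limfreq_nonneg limfreq_le_1 C by (intro mult_mono) auto
  then have 1: "integrable M (\<lambda>x. h x * limfreq N w x)"
    by (intro integrable_bounded[where C = C]) (use h limfreq_nonneg in auto)
  have 2: "integrable M (\<lambda>x. h x * indicator (cyl w) x)"
    by (intro integrable_bounded[where C = C]) (use h C in \<open>auto split: split_indicator\<close>)
  have "(\<integral>\<^sup>+x. ennreal (h x) * ennreal (limfreq N w x) \<partial>M) = (\<integral>\<^sup>+x. ennreal (h x * limfreq N w x) \<partial>M)"
    by (simp add: ennreal_mult h limfreq_nonneg)
  also have "\<dots> = ennreal (\<integral>x. h x * limfreq N w x \<partial>M)"
    by (rule nn_integral_eq_integral[OF 1]) (simp add: h limfreq_nonneg)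
  also have "\<dots> = ennreal (\<integral>x. h x * indicator (cyl w) x \<partial>M)"
    using integral_limfreq[OF gen, of h C w] h inv by simp
  also have "\<dots> = (\<integral>\<^sup>+x. ennreal (h x * indicator (cyl w) x) \<partial>M)"
    by (rule nn_integral_eq_integral[OF 2, symmetric]) (simp add: h)
  also have "\<dots> = (\<integral>\<^sup>+x. ennreal (h x) * indicator (cyl w) x \<partial>M)"
    by (intro nn_integral_cong) (auto split: split_indicator)
  finally show ?thesis .
qed

lemma nn_integral_limfreq_eq_emeasure:
  assumes "generic_times M N"
  shows "(\<integral>\<^sup>+x. ennreal (limfreq N w x) \<partial>M) = emeasure M (cyl w)"
  using nn_integral_limfreq[OF assms, of "\<lambda>_. 1" 1 w] by simp

text \<open>Pointwise limits yield only an inequality, because a sum over infinitely many letters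
  may lose mass. Both sides have the same finite integral, so the nonnegative difference vanishes
  almost everywhere.\<close>

lemma AE_limfreq_sums:
  assumes gen: "generic_times M N"
    and sums: "(\<lambda>a. measure M (cyl (u a))) sums measure M (cyl w)"
    and le: "AE x in M. \<forall>n. (\<Sum>a<n. limfreq N (u a) x) \<le> limfreq N w x"
  shows "AE x in M. (\<lambda>a. limfreq N (u a) x) sums limfreq N w x"
proof -
  define S where "S x = (\<Sum>a. ennreal (limfreq N (u a) x))" for x
  have [measurable]: "S \<in> borel_measurable borel" unfolding S_def by measurable
  have "(\<integral>\<^sup>+x. S x \<partial>M) = (\<Sum>a. emeasure M (cyl (u a)))"
    unfolding S_def by (subst nn_integral_suminf) (simp_all add: nn_integral_limfreq_eq_emeasure[OF gen])
  also have "\<dots> = ennreal (measure M (cyl w))"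
    unfolding emeasure_eq_measure by (rule suminf_ennreal_eq[OF _ sums]) simp
  finally have S: "(\<integral>\<^sup>+x. S x \<partial>M) = ennreal (measure M (cyl w))" .
  have le': "AE x in M. S x \<le> ennreal (limfreq N w x)"
    using le
  proof eventually_elim
    case (elim x)
    then show ?case unfolding S_def
      by (intro suminf_le_const) (auto simp: sum_ennreal limfreq_nonneg intro!: ennreal_leI)
  qed
  have "(\<integral>\<^sup>+x. ennreal (limfreq N w x) - S x \<partial>M) = 0"
    by (subst nn_integral_diff)
       (auto simp: le' S nn_integral_limfreq_eq_emeasure[OF gen] emeasure_eq_measure)
  then have "AE x in M. ennreal (limfreq N w x) - S x = 0"
    by (subst (asm) nn_integral_0_iff_AE) auto
  with le' show ?thesis
  proof eventually_elim
    case (elim x)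
    then have eq: "(\<Sum>a. ennreal (limfreq N (u a) x)) = ennreal (limfreq N w x)"
      unfolding S_def[symmetric] by (simp add: diff_eq_0_iff_ennreal)
    have sm: "summable (\<lambda>a. limfreq N (u a) x)"
      by (rule summable_suminf_not_top) (auto simp: limfreq_nonneg eq)
    then have "ennreal (\<Sum>a. limfreq N (u a) x) = ennreal (limfreq N w x)"
      using eq by (simp add: suminf_ennreal2 limfreq_nonneg)
    then have "(\<Sum>a. limfreq N (u a) x) = limfreq N w x"
      by (subst (asm) ennreal_inj) (auto simp: limfreq_nonneg intro!: suminf_nonneg sm)
    with sm show ?case by (simp add: sums_iff)
  qed
qed

text \<open>For finitely many letters the inequality holds for frequencies and passes to the limit;
  \<open>AE_limfreq_sums\<close> supplies equality. Counts of \<open>a # w\<close> along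
  \<open>x\<close> are compared with counts of \<open>w\<close> along the shifted point, so
  convergence is also required there.\<close>

lemma AE_stationary_limfreq:
  assumes gen: "generic_times M N"
  shows "AE x in M. stationary (\<lambda>w. limfreq N w x) \<and> limfreq N [] x = 1"
proof -
  have sm: "strict_mono N" using gen by (simp add: generic_times_def)
  have stat: "stationary (\<lambda>w. measure M (cyl w))"
    by (rule stationary_measure) (auto simp: distr_left_shift finite_measure_axioms)
  have AE: "AE x in M. \<forall>w. convergent (\<lambda>k. freq (N k) w x)"
    using gen by (simp add: generic_times_def)
  have AE_left_shift: "AE x in M. \<forall>w. convergent (\<lambda>k. freq (N k) w (left_shift x))"
  proof (rule AE_distrD[of left_shift M borel])
    show "AE x in distr M borel left_shift. \<forall>w. convergent (\<lambda>k. freq (N k) w x)"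
      unfolding distr_left_shift by (rule AE)
  qed simp
  \<comment> \<open>Used with \<open>f\<close> the identity for appended letters and with
    \<open>f\<close> the shift for prepended ones.\<close>
  have freq_sum: "(\<Sum>a<n. freq K (u a) x) \<le> freq K w (f x)"
    if "\<And>y. (\<Sum>a<n. indicator (cyl (u a)) y :: real) \<le> indicator (cyl w) (f y)"
      and "\<And>k x. (left_shift ^^ k) (f x) = f ((left_shift ^^ k) x)" for n K :: nat and u :: "nat \<Rightarrow> nat list" and w f x
    unfolding freq_def birkhoff_sum_def sum_divide_distrib[symmetric]
    by (subst sum.swap) (intro divide_right_mono sum_mono, auto simp: that)
  have "AE x in M. (\<lambda>a. limfreq N (w @ [a]) x) sums limfreq N w x" for w
  proof (rule AE_limfreq_sums[OF gen stationaryD(3)[OF stat]])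
    show "AE x in M. \<forall>n. (\<Sum>a<n. limfreq N (w @ [a]) x) \<le> limfreq N w x"
      using AE
    proof eventually_elim
      case (elim x)
      show ?case
      proof
        fix n
        have 1: "(\<lambda>k. \<Sum>a<n. freq (N k) (w @ [a]) x) \<longlonglongrightarrow> (\<Sum>a<n. limfreq N (w @ [a]) x)"
          by (intro tendsto_sum limfreq_tendsto) (use elim in simp)
        have 2: "(\<lambda>k. freq (N k) w x) \<longlonglongrightarrow> limfreq N w x"
          by (intro limfreq_tendsto) (use elim in simp)
        have "(\<Sum>a<n. indicator (cyl (w @ [a])) y :: real) \<le> indicator (cyl w) y" for y
        proof -
          have "(\<Sum>a<n. indicator (cyl (w @ [a])) y :: real) = (\<Sum>a<n. if a = y (length w) then indicator (cyl w) y else 0)"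
            by (intro sum.cong) (auto simp: indicator_def mem_cyl_snoc)
          then show ?thesis by simp
        qed
        then have "(\<Sum>a<n. freq K (w @ [a]) x) \<le> freq K w x" for K
          using freq_sum[where n = n and u = "\<lambda>a. w @ [a]" and w = w and f = "\<lambda>x. x" and K = K and x = x] by simp
        then show "(\<Sum>a<n. limfreq N (w @ [a]) x) \<le> limfreq N w x"
          by (intro LIMSEQ_le[OF 1 2]) auto
      qed
    qed
  qed
  moreover have "AE x in M. (\<lambda>a. limfreq N (a # w) x) sums limfreq N w x" for w
  proof (rule AE_limfreq_sums[OF gen stationaryD(4)[OF stat]])
    show "AE x in M. \<forall>n. (\<Sum>a<n. limfreq N (a # w) x) \<le> limfreq N w x"
      using AE AE_left_shift
    proof eventually_elim
      case (elim x)
      show ?case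
      proof
        fix n
        have 1: "(\<lambda>k. \<Sum>a<n. freq (N k) (a # w) x) \<longlonglongrightarrow> (\<Sum>a<n. limfreq N (a # w) x)"
          by (intro tendsto_sum limfreq_tendsto) (use elim in simp)
        have 2: "(\<lambda>k. freq (N k) w (left_shift x)) \<longlonglongrightarrow> limfreq N w (left_shift x)"
          by (intro limfreq_tendsto) (use elim in simp)
        have "(\<Sum>a<n. indicator (cyl (a # w)) y :: real) \<le> indicator (cyl w) (left_shift y)" for y
        proof -
          have "(\<Sum>a<n. indicator (cyl (a # w)) y :: real) = (\<Sum>a<n. if a = y 0 then indicator (cyl w) (left_shift y) else 0)"
            by (intro sum.cong) (auto simp: indicator_def mem_cyl_Cons)
          then show ?thesis by simp
        qed
        then have "(\<Sum>a<n. freq K (a # w) x) \<le> freq K w (left_shift x)" for K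
          using freq_sum[where n = n and u = "\<lambda>a. a # w" and w = w and f = left_shift and K = K and x = x] by (simp add: funpow_swap1)
        then have "(\<Sum>a<n. limfreq N (a # w) x) \<le> limfreq N w (left_shift x)"
          by (intro LIMSEQ_le[OF 1 2]) auto
        then show "(\<Sum>a<n. limfreq N (a # w) x) \<le> limfreq N w x"
          by (simp add: limfreq_left_shift[OF sm])
      qed
    qed
  qed
  moreover have "AE x in M. limfreq N [] x = 1"
    using AE
  proof eventually_elim
    case (elim x)
    have "(\<lambda>k. freq (N k) [] x) \<longlonglongrightarrow> 1"
    proof (rule tendsto_eventually, rule eventually_sequentiallyI[of 1])
      fix k :: nat assume "1 \<le> k"
      then have "0 < N k" using seq_suble[OF sm, of k] by simp
      then show "freq (N k) [] x = 1" by (simp add: freq_def birkhoff_sum_def)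
    qed
    then show ?case using limfreq_tendsto[of N "[]" x] elim LIMSEQ_unique by blast
  qed
  ultimately show ?thesis
    unfolding stationary_def consistent_def
    by (simp add: AE_all_countable AE_conj_iff limfreq_nonneg)
qed

end

section \<open>Dispersion\<close>

text \<open>
  Words are padded with zeros to sequences; the count of \<open>w\<close> at the first \<open>N\<close> places of \<open>x\<close> depends only
  on the first \<open>N + length w\<close> letters.
\<close>

definition word_freq :: "nat \<Rightarrow> nat list \<Rightarrow> nat list \<Rightarrow> real" where
  "word_freq N w v = freq N w (\<lambda>j. if j < length v then v ! j else 0)"

text \<open>The mean deviation of the \<open>N\<close>-step frequency of \<open>w\<close> from
  \<open>m w\<close> under the measure with weights \<open>m\<close>. Being a sum over words, it is
  a measurable function of weights that may themselves be random.\<close>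

definition dispersion :: "nat \<Rightarrow> nat list \<Rightarrow> (nat list \<Rightarrow> real) \<Rightarrow> ennreal" where
  "dispersion N w m = (\<integral>\<^sup>+v. ennreal \<bar>word_freq N w v - m w\<bar> * ennreal (m v)
     \<partial>count_space {v. length v = N + length w})"

lemma freq_cong:
  assumes "\<And>j. j < N + length w \<Longrightarrow> x j = y j"
  shows "freq N w x = freq N w y"
proof -
  have "(left_shift ^^ i) x \<in> cyl w \<longleftrightarrow> (left_shift ^^ i) y \<in> cyl w" if "i < N" for i
    using assms that by (auto simp: cyl_def funpow_left_shift)
  then show ?thesis by (auto simp: freq_def birkhoff_sum_def indicator_def intro!: sum.cong)
qed

lemma word_freq_initial_word: "word_freq N w (map x [0..<N + length w]) = freq N w x"
  unfolding word_freq_def by (rule freq_cong) (auto simp del: upt_Suc)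

lemma nn_integral_freq_deviation:
  assumes "sets M = sets borel"
  shows "(\<integral>\<^sup>+x. ennreal \<bar>freq N w x - b\<bar> \<partial>M) =
    (\<integral>\<^sup>+v. ennreal \<bar>word_freq N w v - b\<bar> * emeasure M (cyl v) \<partial>count_space {v. length v = N + length w})"
  using nn_integral_initial_word[OF assms, of "\<lambda>v. ennreal \<bar>word_freq N w v - b\<bar>" "N + length w"]
  by (simp add: word_freq_initial_word)

lemma borel_measurable_nn_integral_countable [measurable]:
  fixes f :: "'i::countable \<Rightarrow> 'a \<Rightarrow> ennreal"
  assumes "\<And>v. f v \<in> borel_measurable M"
  shows "(\<lambda>x. \<integral>\<^sup>+v. f v x \<partial>count_space A) \<in> borel_measurable M"
proof -
  interpret sigma_finite_measure "count_space A"
    by (rule sigma_finite_measure_count_space_countable) simp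
  have "(\<lambda>(v, x). f v x) \<in> borel_measurable (count_space A \<Otimes>\<^sub>M M)"
    by (rule measurable_pair_measure_countable1) (use assms in auto)
  then have "(\<lambda>(x, v). f v x) \<in> borel_measurable (M \<Otimes>\<^sub>M count_space A)"
    by (subst measurable_pair_swap_iff) (simp add: case_prod_beta')
  then show ?thesis by (rule borel_measurable_nn_integral)
qed

context shift_measure
begin

text \<open>The deviation of \<open>word_freq K w v\<close> from \<open>limfreq N w\<close> is an
  invariant function, so \<open>limfreq N v\<close> may be replaced under the integral by the
  indicator of the cylinder of \<open>v\<close>. The sum over \<open>v\<close> then collapses to the
  initial word of \<open>x\<close>.\<close>

lemma nn_integral_dispersion_limfreq:
  assumes gen: "generic_times M N"
  shows "(\<integral>\<^sup>+x. dispersion K w (\<lambda>v. limfreq N v x) \<partial>M) = (\<integral>\<^sup>+x. ennreal \<bar>freq K w x - limfreq N w x\<bar> \<partial>M)"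
proof -
  have sm: "strict_mono N" using gen by (simp add: generic_times_def)
  let ?A = "{v. length v = K + length w}"
  have "(\<integral>\<^sup>+x. dispersion K w (\<lambda>v. limfreq N v x) \<partial>M) =
      (\<integral>\<^sup>+v. \<integral>\<^sup>+x. ennreal \<bar>word_freq K w v - limfreq N w x\<bar> * ennreal (limfreq N v x) \<partial>M \<partial>count_space ?A)"
    unfolding dispersion_def by (rule nn_integral_count_space_nn_integral) auto
  also have "\<dots> = (\<integral>\<^sup>+v. \<integral>\<^sup>+x. ennreal \<bar>word_freq K w v - limfreq N w x\<bar> * indicator (cyl v) x \<partial>M \<partial>count_space ?A)"
  proof (rule nn_integral_cong, rule nn_integral_limfreq[OF gen, where C = 1])
    fix v x
    show "\<bar>word_freq K w v - limfreq N w x\<bar> \<le> 1"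
      using freq_nonneg[of K w "\<lambda>j. if j < length v then v ! j else 0"] freq_le_1[of K w "\<lambda>j. if j < length v then v ! j else 0"]
        limfreq_nonneg[of N w x] limfreq_le_1[of N w x] unfolding word_freq_def by linarith
  qed (auto simp: limfreq_left_shift[OF sm])
  also have "\<dots> = (\<integral>\<^sup>+x. \<integral>\<^sup>+v. ennreal \<bar>word_freq K w v - limfreq N w x\<bar> * indicator (cyl v) x \<partial>count_space ?A \<partial>M)"
    by (rule nn_integral_count_space_nn_integral[symmetric]) auto
  also have "\<dots> = (\<integral>\<^sup>+x. ennreal \<bar>freq K w x - limfreq N w x\<bar> \<partial>M)"
  proof (rule nn_integral_cong)
    fix x :: "nat \<Rightarrow> nat"
    let ?v = "map x [0..<K + length w]"
    have "(\<integral>\<^sup>+v. ennreal \<bar>word_freq K w v - limfreq N w x\<bar> * indicator (cyl v) x \<partial>count_space ?A) =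
        (\<integral>\<^sup>+v. ennreal \<bar>word_freq K w v - limfreq N w x\<bar> * indicator {?v} v \<partial>count_space ?A)"
      by (intro nn_integral_cong) (auto simp: mem_cyl_iff split: split_indicator)
    also have "\<dots> = ennreal \<bar>word_freq K w ?v - limfreq N w x\<bar>"
      by (subst nn_integral_indicator_singleton) auto
    finally show "(\<integral>\<^sup>+v. ennreal \<bar>word_freq K w v - limfreq N w x\<bar> * indicator (cyl v) x \<partial>count_space ?A) =
        ennreal \<bar>freq K w x - limfreq N w x\<bar>"
      by (simp only: word_freq_initial_word)
  qed
  finally show ?thesis .
qed

lemma freq_L1_tendsto_limfreq:
  assumes gen: "generic_times M N"
  shows "(\<lambda>k. \<integral>\<^sup>+x. ennreal \<bar>freq (N k) w x - limfreq N w x\<bar> \<partial>M) \<longlonglongrightarrow> 0"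
proof -
  have bd: "\<bar>freq k w x - limfreq N w x\<bar> \<le> 1" for k and x :: "nat \<Rightarrow> nat"
    using freq_nonneg[of k w x] freq_le_1[of k w x] limfreq_nonneg[of N w x] limfreq_le_1[of N w x] by linarith
  have "(\<lambda>k. \<integral>\<^sup>+x. ennreal \<bar>freq (N k) w x - limfreq N w x\<bar> \<partial>M) \<longlonglongrightarrow> (\<integral>\<^sup>+x. 0 \<partial>M)"
  proof (rule nn_integral_dominated_convergence[where w = "\<lambda>_. 1"])
    show "AE x in M. (\<lambda>k. ennreal \<bar>freq (N k) w x - limfreq N w x\<bar>) \<longlonglongrightarrow> 0"
      using conjunct2[OF gen[unfolded generic_times_def]]
    proof eventually_elim
      case (elim x)
      have "(\<lambda>k. \<bar>freq (N k) w x - limfreq N w x\<bar>) \<longlonglongrightarrow> 0"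
        using LIM_zero[OF limfreq_tendsto[of N w x]] elim by (intro tendsto_rabs_zero) auto
      then show ?case using tendsto_ennrealI[of "\<lambda>k. \<bar>freq (N k) w x - limfreq N w x\<bar>" 0] by simp
    qed
    show "AE x in M. ennreal \<bar>freq (N k) w x - limfreq N w x\<bar> \<le> 1" for k
      using bd by (intro AE_I2) (simp add: ennreal_le_1)
  qed (auto simp: emeasure_eq_measure)
  then show ?thesis by simp
qed

text \<open>Fatou's lemma: the integrals of the dispersions tend to zero, so the lower limit
  vanishes almost everywhere, and this is the form in which \<open>extremalI_dispersion\<close>
  takes it.\<close>

lemma AE_dispersion_limfreq:
  assumes gen: "generic_times M N"
  shows "AE x in M. liminf (\<lambda>k. dispersion (N k) w (\<lambda>v. limfreq N v x)) = 0"
proof -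
  have [measurable]: "(\<lambda>x. dispersion k w (\<lambda>v. limfreq N v x)) \<in> borel_measurable borel" for k
    unfolding dispersion_def by measurable
  have "(\<integral>\<^sup>+x. liminf (\<lambda>k. dispersion (N k) w (\<lambda>v. limfreq N v x)) \<partial>M) \<le>
      liminf (\<lambda>k. \<integral>\<^sup>+x. dispersion (N k) w (\<lambda>v. limfreq N v x) \<partial>M)"
    by (rule nn_integral_liminf) measurable
  also have "\<dots> = 0"
    unfolding nn_integral_dispersion_limfreq[OF gen]
    using lim_imp_Liminf[OF _ freq_L1_tendsto_limfreq[OF gen, of w]] by simp
  finally have "(\<integral>\<^sup>+x. liminf (\<lambda>k. dispersion (N k) w (\<lambda>v. limfreq N v x)) \<partial>M) = 0" by simp
  then show ?thesis by (subst (asm) nn_integral_0_iff_AE) auto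
qed

end

section \<open>The compact convex set of stationary weights of bounded cost\<close>

definition roof :: "(nat list \<Rightarrow> ennreal) \<Rightarrow> (nat \<Rightarrow> nat) \<Rightarrow> ennreal" where
  "roof r x = (SUP n. r (map x [0..<n]))"

definition level :: "(nat list \<Rightarrow> ennreal) \<Rightarrow> (nat list \<Rightarrow> real) \<Rightarrow> nat \<Rightarrow> ennreal" where
  "level r m n = (\<integral>\<^sup>+w. r w * ennreal (m w) \<partial>count_space {w. length w = n})"

text \<open>For consistent weights this is the integral of \<open>roof r\<close>. As a supremum of
  levels, each lower semicontinuous by Fatou, it can only drop in the limit, so the bound by
  \<open>1\<close> is a closed condition.\<close>

definition cost :: "(nat list \<Rightarrow> ennreal) \<Rightarrow> (nat list \<Rightarrow> real) \<Rightarrow> ennreal" where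
  "cost r m = (SUP n. level r m n)"

definition states :: "(nat list \<Rightarrow> ennreal) \<Rightarrow> (nat list \<Rightarrow> real) set" where
  "states r = {m. stationary m \<and> cost r m \<le> 1}"

text \<open>The factors \<open>2\<close> to the power \<open>-n\<close> make the supremum norm
  induce pointwise convergence on bounded weights. Clipping to \<open>[0, 1]\<close> changes no
  state and makes the map continuous on all functions of words.\<close>

definition embed :: "(nat list \<Rightarrow> real) \<Rightarrow> (nat \<Rightarrow>\<^sub>C real)" where
  "embed m = Bcontfun (\<lambda>n. (1 / 2) ^ n * max 0 (min 1 (m (from_nat n))))"

definition decode :: "(nat \<Rightarrow>\<^sub>C real) \<Rightarrow> nat list \<Rightarrow> real" where
  "decode y w = 2 ^ to_nat w * apply_bcontfun y (to_nat w)"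

lemma sum_le_nn_integral_count_space:
  fixes f :: "'i \<Rightarrow> ennreal"
  assumes "finite W" "W \<subseteq> A"
  shows "(\<Sum>w\<in>W. f w) \<le> (\<integral>\<^sup>+w. f w \<partial>count_space A)"
proof -
  have "(\<Sum>w\<in>W. f w) = (\<integral>\<^sup>+w. f w \<partial>count_space W)"
    using assms by (simp add: nn_integral_count_space_finite)
  also have "\<dots> = (\<integral>\<^sup>+w. f w * indicator W w \<partial>count_space UNIV)"
    by (rule nn_integral_count_space_indicator) simp
  also have "\<dots> \<le> (\<integral>\<^sup>+w. f w * indicator A w \<partial>count_space UNIV)"
    using assms by (intro nn_integral_mono) (auto split: split_indicator)
  also have "\<dots> = (\<integral>\<^sup>+w. f w \<partial>count_space A)"
    by (rule nn_integral_count_space_indicator[symmetric]) simp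
  finally show ?thesis .
qed

lemma consistent_lincomb:
  assumes "consistent m" "consistent m'" "0 \<le> a" "0 \<le> b"
  shows "consistent (\<lambda>w. a * m w + b * m' w)"
  using assms by (auto simp: consistent_def intro!: sums_add sums_mult)

lemma stationary_lincomb:
  assumes "stationary m" "stationary m'" "0 \<le> a" "0 \<le> b"
  shows "stationary (\<lambda>w. a * m w + b * m' w)"
  using assms consistent_lincomb[of m m' a b]
  by (auto simp: stationary_def intro!: sums_add sums_mult)

lemma stationary_scale:
  "stationary m \<Longrightarrow> 0 \<le> a \<Longrightarrow> stationary (\<lambda>w. a * m w)"
  using stationary_lincomb[of m m a 0] by simp

lemma stationary_zero: "stationary (\<lambda>w. 0)"
  by (simp add: stationary_def consistent_def)

lemma consistent_append_le:
  assumes "consistent m"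
  shows "m (w @ v) \<le> m w"
proof (induction v rule: rev_induct)
  case (snoc a v)
  have s: "(\<lambda>a. m ((w @ v) @ [a])) sums m (w @ v)" and nn: "\<And>w. 0 \<le> m w"
    using assms unfolding consistent_def by blast+
  have "sum (\<lambda>a. m ((w @ v) @ [a])) {a} \<le> m (w @ v)"
    using sum_le_suminf[OF sums_summable[OF s], of "{a}"] nn sums_unique[OF s] by simp
  with snoc show ?case by simp
qed simp

lemma stationary_Cons_le:
  assumes "stationary m"
  shows "m (a # w) \<le> m w"
proof -
  note s = stationaryD(4)[OF assms, of w]
  have "sum (\<lambda>a. m (a # w)) {a} \<le> m w"
    using sum_le_suminf[OF sums_summable[OF s], of "{a}"] stationaryD(2)[OF assms] sums_unique[OF s] by simp
  then show ?thesis by simp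
qed

lemma stationary_append_le:
  assumes "stationary m"
  shows "m (v @ w) \<le> m w"
  by (induction v) (auto intro: order_trans[OF stationary_Cons_le[OF assms]])

lemma apply_embed: "apply_bcontfun (embed m) n = (1 / 2) ^ n * max 0 (min 1 (m (from_nat n)))"
proof -
  have "\<bar>(1 / 2) ^ n * max 0 (min 1 (m (from_nat n)))\<bar> \<le> (1 :: real)" for n
    by (simp add: abs_mult mult_le_one power_le_one)
  then have "(\<lambda>n. (1 / 2) ^ n * max 0 (min 1 (m (from_nat n)))) \<in> bcontfun"
    by (intro bcontfun_normI[where b = 1]) auto
  then show ?thesis by (simp add: embed_def Bcontfun_inverse)
qed

lemma decode_embed:
  assumes "0 \<le> m w" "m w \<le> 1"
  shows "decode (embed m) w = m w"
  using assms by (simp add: decode_def apply_embed power_divide)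

lemma tendsto_embed:
  assumes "\<And>w. ((\<lambda>i. f i w) \<longlongrightarrow> m w) F"
  shows "((\<lambda>i. embed (f i)) \<longlongrightarrow> embed m) F"
proof (rule tendstoI)
  fix e :: real assume e: "0 < e"
  obtain n0 where n0: "(1 / 2 :: real) ^ n0 < e / 2"
    using real_arch_pow_inv[of "e / 2" "1 / 2"] e by auto
  have "eventually (\<lambda>i. \<forall>n\<in>{..<n0}. dist (f i (from_nat n)) (m (from_nat n)) < e / 2) F"
    using e assms by (intro eventually_ball_finite ballI tendstoD) auto
  then show "eventually (\<lambda>i. dist (embed (f i)) (embed m) < e) F"
  proof eventually_elim
    case (elim i)
    have "dist (embed (f i) n) (embed m n) \<le> e / 2" for n
    proof -
      define s t where "s = max 0 (min 1 (f i (from_nat n)))" and "t = max 0 (min 1 (m (from_nat n)))"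
      have st: "\<bar>s - t\<bar> \<le> 1" "\<bar>s - t\<bar> \<le> dist (f i (from_nat n)) (m (from_nat n))"
        by (auto simp: s_def t_def dist_real_def max_def min_def)
      have d: "dist (embed (f i) n) (embed m n) = (1 / 2) ^ n * \<bar>s - t\<bar>"
        by (simp add: apply_embed s_def t_def dist_real_def right_diff_distrib[symmetric] abs_mult)
      show ?thesis
      proof (cases "n < n0")
        case True
        have "(1 / 2) ^ n * \<bar>s - t\<bar> \<le> 1 * dist (f i (from_nat n)) (m (from_nat n))"
          using st by (intro mult_mono) (auto simp: power_le_one)
        also have "\<dots> \<le> e / 2" using elim True by (auto simp: less_imp_le)
        finally show ?thesis by (simp add: d)
      next
        case False
        have "(1 / 2) ^ n * \<bar>s - t\<bar> \<le> (1 / 2) ^ n0 * 1"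
          using st False by (intro mult_mono power_decreasing) auto
        then show ?thesis using n0 by (simp add: d)
      qed
    qed
    then have "dist (embed (f i)) (embed m) \<le> e / 2" by (rule dist_bound)
    then show ?case using e by simp
  qed
qed

lemma continuous_on_embed: "continuous_on UNIV embed"
proof -
  have "(embed \<longlongrightarrow> embed m) (at m)" for m
  proof (rule tendsto_embed[of "\<lambda>m. m"])
    fix w
    have "continuous_on UNIV (\<lambda>m :: nat list \<Rightarrow> real. m w)" by simp
    then show "((\<lambda>m. m w) \<longlongrightarrow> m w) (at m)"
      by (simp add: continuous_on_def)
  qed
  then show ?thesis by (simp add: continuous_on_def)
qed

lemma embed_measurable [measurable]: "embed \<in> borel_measurable borel"
  by (rule borel_measurable_continuous_onI[OF continuous_on_embed])

lemma bounded_linear_apply_bcontfun: "bounded_linear (\<lambda>y :: nat \<Rightarrow>\<^sub>C real. apply_bcontfun y n)"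
  by (rule bounded_linear_intro[where K = 1])
     (auto simp: plus_bcontfun.rep_eq scaleR_bcontfun.rep_eq
       intro: norm_bounded[where 'b = real, unfolded real_norm_def])

lemma apply_bcontfun_measurable [measurable]:
  "(\<lambda>y :: nat \<Rightarrow>\<^sub>C real. apply_bcontfun y n) \<in> borel_measurable borel"
  by (rule borel_measurable_continuous_onI)
     (rule linear_continuous_on[OF bounded_linear_apply_bcontfun])

lemma decode_measurable [measurable]: "(\<lambda>y. decode y w) \<in> borel_measurable borel"
  unfolding decode_def by measurable

definition cube :: "(nat \<Rightarrow>\<^sub>C real) set" where
  "cube = embed ` {m. \<forall>w. m w \<in> {0..1}}"

lemma compact_cube: "compact cube"
proof -
  have "compactin (product_topology (\<lambda>i. euclidean) UNIV) (PiE UNIV (\<lambda>w :: nat list. {0..1 :: real}))"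
    by (subst compactin_PiE) auto
  then have "compact (PiE UNIV (\<lambda>w :: nat list. {0..1 :: real}))"
    by (simp add: euclidean_product_topology)
  moreover have "PiE UNIV (\<lambda>w :: nat list. {0..1 :: real}) = {m. \<forall>w. m w \<in> {0..1}}"
    by (auto simp: PiE_iff)
  ultimately show ?thesis
    unfolding cube_def
    using compact_continuous_image continuous_on_subset[OF continuous_on_embed subset_UNIV] by metis
qed

lemma cube_bounds:
  assumes "y \<in> cube"
  shows "0 \<le> apply_bcontfun y n" "apply_bcontfun y n \<le> (1 / 2) ^ n"
  using assms by (auto simp: cube_def apply_embed mult_left_le)

lemma embed_decode:
  assumes "y \<in> cube"
  shows "embed (decode y) = y" "decode y w \<in> {0..1}"
proof -
  obtain m where m: "y = embed m" "\<And>w. m w \<in> {0..1}" using assms by (auto simp: cube_def)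
  have "decode y w = m w" for w using m(2)[of w] by (simp add: m(1) decode_embed)
  then have "decode y = m" by auto
  with m show "embed (decode y) = y" "decode y w \<in> {0..1}" by auto
qed

lemma consistent_level_eq:
  assumes "consistent m"
  shows "level r m n = (\<integral>\<^sup>+x. r (map x [0..<n]) \<partial>cyl_measure m)"
  by (simp add: level_def nn_integral_initial_word emeasure_cyl_measure[OF assms])

lemma level_lincomb:
  assumes "0 \<le> a" "0 \<le> b" "\<And>w. 0 \<le> m w" "\<And>w. 0 \<le> m' w"
  shows "level r (\<lambda>w. a * m w + b * m' w) n = ennreal a * level r m n + ennreal b * level r m' n"
proof -
  have "level r (\<lambda>w. a * m w + b * m' w) n =
      (\<integral>\<^sup>+w. ennreal a * (r w * ennreal (m w)) + ennreal b * (r w * ennreal (m' w)) \<partial>count_space {w. length w = n})"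
    unfolding level_def using assms
    by (intro nn_integral_cong) (simp add: ennreal_plus ennreal_mult distrib_left ac_simps)
  then show ?thesis unfolding level_def by (simp add: nn_integral_add nn_integral_cmult)
qed

lemma initial_word_measurable [measurable]:
  fixes f :: "nat list \<Rightarrow> 'a :: topological_space"
  shows "(\<lambda>x. f (map x [0..<n])) \<in> borel_measurable (borel :: (nat \<Rightarrow> nat) measure)"
proof -
  have "(\<lambda>x :: nat \<Rightarrow> nat. map x [0..<n]) \<in> measurable borel (count_space UNIV)"
    unfolding measurable_count_space_eq2_countable
  proof (intro conjI ballI)
    fix w
    have "(\<lambda>x. map x [0..<n]) -` {w} = (if length w = n then cyl w else {})"
      by (auto simp: mem_cyl_iff)
    then show "(\<lambda>x. map x [0..<n]) -` {w} \<inter> space borel \<in> sets (borel :: (nat \<Rightarrow> nat) measure)" by simp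
  qed simp
  from measurable_compose[OF this, of f borel] show ?thesis by simp
qed

text \<open>\<open>r w\<close> stands for the infimum of the roof over the cylinder of
  \<open>w\<close>, with value infinity if that is empty. The normalization by \<open>r_ge_1\<close>
  bounds every weight by the cost; \<open>r_tail\<close> says that the roof tends to infinity with
  the first letter.\<close>

locale word_cost =
  fixes r :: "nat list \<Rightarrow> ennreal"
  assumes r_mono: "r w \<le> r (w @ [a])"
    and r_ge_1: "1 \<le> r w"
    and r_tail: "\<exists>k. \<forall>a\<ge>k. ennreal (real j) \<le> r [a]"
begin

lemma incseq_r: "incseq (\<lambda>n. r (map x [0..<n]))"
  by (rule incseq_SucI) (simp add: r_mono)

lemma roof_measurable [measurable]: "roof r \<in> borel_measurable borel"
  unfolding roof_def by measurable

lemma cost_eq_nn_integral: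
  assumes "consistent m"
  shows "cost r m = (\<integral>\<^sup>+x. roof r x \<partial>cyl_measure m)"
proof -
  have "incseq (\<lambda>n x. r (map x [0..<n]))"
    using incseq_r by (auto simp: incseq_def le_fun_def)
  then show ?thesis
    unfolding cost_def roof_def consistent_level_eq[OF assms]
    by (subst nn_integral_monotone_convergence_SUP) auto
qed

lemma incseq_level:
  assumes "consistent m"
  shows "incseq (level r m)"
  using incseq_r unfolding incseq_def consistent_level_eq[OF assms]
  by (auto intro!: nn_integral_mono)

text \<open>Levels are affine in the weights and increase with the length, and suprema of increasing
  sequences add.\<close>

lemma cost_lincomb:
  assumes "0 \<le> a" "0 \<le> b" "consistent m" "consistent m'"
  shows "cost r (\<lambda>w. a * m w + b * m' w) = ennreal a * cost r m + ennreal b * cost r m'"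
proof -
  have "cost r (\<lambda>w. a * m w + b * m' w) = (SUP n. ennreal a * level r m n + ennreal b * level r m' n)"
    using assms level_lincomb[of a b m m' r] by (simp add: cost_def consistent_def)
  also have "\<dots> = (SUP n. ennreal a * level r m n) + (SUP n. ennreal b * level r m' n)"
    using incseq_level[OF assms(3)] incseq_level[OF assms(4)]
    by (intro ennreal_SUP_add) (auto simp: incseq_def intro!: mult_left_mono)
  finally show ?thesis by (simp add: cost_def SUP_mult_left_ennreal)
qed

lemma cost_scale:
  assumes "0 \<le> a" "consistent m"
  shows "cost r (\<lambda>w. a * m w) = ennreal a * cost r m"
  using cost_lincomb[OF assms(1) order_refl assms(2,2)] by simp

lemma cost_zero [simp]: "cost r (\<lambda>w. 0) = 0"
  by (simp add: cost_def level_def)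

lemma level_le_cost: "level r m n \<le> cost r m"
  unfolding cost_def by (rule SUP_upper) simp

lemma mass_le_cost: "ennreal (m w) \<le> cost r m"
proof -
  have "ennreal (m w) \<le> (\<Sum>v\<in>{w}. r v * ennreal (m v))"
    using mult_right_mono[OF r_ge_1[of w], of "ennreal (m w)"] by simp
  also have "\<dots> \<le> level r m (length w)"
    unfolding level_def by (rule sum_le_nn_integral_count_space) auto
  finally show ?thesis using level_le_cost order_trans by blast
qed

lemma states_bounds:
  assumes "m \<in> states r"
  shows "stationary m" "consistent m" "0 \<le> m w" "m w \<le> 1" "cost r m \<le> 1"
proof -
  show *: "stationary m" "cost r m \<le> 1" using assms by (auto simp: states_def)
  show "0 \<le> m w" "consistent m" using stationaryD[OF *(1)] by auto
  show "m w \<le> 1" using order_trans[OF mass_le_cost[of m w] *(2)] by (simp add: ennreal_le_1)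
qed

lemma zero_in_states: "(\<lambda>w. 0) \<in> states r"
  by (simp add: states_def stationary_zero)

lemma states_convex:
  assumes "m \<in> states r" "m' \<in> states r" "0 \<le> u" "u \<le> 1"
  shows "(\<lambda>w. (1 - u) * m w + u * m' w) \<in> states r"
proof -
  have "cost r (\<lambda>w. (1 - u) * m w + u * m' w) \<le> ennreal (1 - u) * 1 + ennreal u * 1"
    using assms states_bounds[OF assms(1)] states_bounds[OF assms(2)]
    by (subst cost_lincomb) (auto intro!: add_mono mult_left_mono simp del: mult_1_right)
  also have "\<dots> = 1" using assms by (simp flip: ennreal_plus)
  finally show ?thesis
    using assms stationary_lincomb[of m m' "1 - u" u] by (simp add: states_def)
qed

definition tail_start :: "nat \<Rightarrow> nat" where
  "tail_start j = (SOME k. \<forall>a\<ge>k. ennreal (real j) \<le> r [a])"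

lemma tail_start: "tail_start j \<le> a \<Longrightarrow> ennreal (real j) \<le> r [a]"
  using someI_ex[OF r_tail[of j]] unfolding tail_start_def by blast

text \<open>Markov's inequality on words of length one: letters beyond \<open>tail_start j\<close>
  cost at least \<open>j\<close> each.\<close>

lemma states_tail:
  assumes "m \<in> states r" "0 < j"
  shows "(\<Sum>a\<in>{tail_start j..<k}. m [a]) \<le> 1 / real j"
proof -
  note b = states_bounds[OF assms(1)]
  let ?A = "{tail_start j..<k}"
  have "ennreal (real j * (\<Sum>a\<in>?A. m [a])) = (\<Sum>a\<in>?A. ennreal (real j) * ennreal (m [a]))"
    using b by (simp add: ennreal_mult sum_nonneg sum_ennreal[symmetric] sum_distrib_left)
  also have "\<dots> \<le> (\<Sum>a\<in>?A. r [a] * ennreal (m [a]))"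
    by (intro sum_mono mult_right_mono tail_start) auto
  also have "\<dots> = (\<Sum>w\<in>(\<lambda>a. [a]) ` ?A. r w * ennreal (m w))"
    by (subst sum.reindex) (auto simp: inj_on_def)
  also have "\<dots> \<le> level r m 1"
    unfolding level_def by (rule sum_le_nn_integral_count_space) auto
  also have "\<dots> \<le> 1" using level_le_cost b(5) order_trans by blast
  finally have "real j * (\<Sum>a\<in>?A. m [a]) \<le> 1" by (simp add: ennreal_le_1)
  then show ?thesis using assms(2) by (simp add: field_simps)
qed

text \<open>Meant for \<open>f a\<close> equal to \<open>m (w @ [a])\<close> or
  \<open>m (a # w)\<close>. Both are at most \<open>m [a]\<close>, the first because by stationarity
  dropping initial letters does not decrease a weight.\<close>

lemma tail_bound:
  assumes m: "m \<in> states r" and "0 < j" and s: "f sums s"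
    and f: "\<And>a. 0 \<le> f a" "\<And>a. f a \<le> m [a]"
  shows "s \<le> (\<Sum>a<tail_start j. f a) + 1 / real j"
proof -
  have s': "(\<lambda>k. \<Sum>a<k. f a) \<longlonglongrightarrow> s" using s by (simp add: sums_def)
  have "(\<Sum>a<k. f a) \<le> (\<Sum>a<tail_start j. f a) + 1 / real j" if "tail_start j \<le> k" for k
  proof -
    have "{..<k} = {..<tail_start j} \<union> {tail_start j..<k}" using that by auto
    then have "(\<Sum>a<k. f a) = (\<Sum>a<tail_start j. f a) + (\<Sum>a\<in>{tail_start j..<k}. f a)"
      by (simp add: sum.union_disjoint ivl_disj_int)
    also have "(\<Sum>a\<in>{tail_start j..<k}. f a) \<le> (\<Sum>a\<in>{tail_start j..<k}. m [a])"
      by (intro sum_mono f)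
    also have "\<dots> \<le> 1 / real j" by (rule states_tail[OF m \<open>0 < j\<close>])
    finally show ?thesis by simp
  qed
  then show ?thesis by (intro LIMSEQ_le_const2[OF s']) blast
qed

lemma states_tail_bounds:
  assumes m: "m \<in> states r" and "0 < j"
  shows "m w \<le> (\<Sum>a<tail_start j. m (w @ [a])) + 1 / real j"
    and "m w \<le> (\<Sum>a<tail_start j. m (a # w)) + 1 / real j"
proof -
  note b = states_bounds[OF m]
  show "m w \<le> (\<Sum>a<tail_start j. m (w @ [a])) + 1 / real j"
    by (rule tail_bound[OF assms stationaryD(3)[OF b(1)]])
       (use b(3) stationary_append_le[OF b(1)] in auto)
  show "m w \<le> (\<Sum>a<tail_start j. m (a # w)) + 1 / real j"
    by (rule tail_bound[OF assms stationaryD(4)[OF b(1)]])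
       (use b(3) consistent_append_le[OF b(2), of "[_]"] in auto)
qed

lemma sumsI_bounds:
  fixes f :: "nat \<Rightarrow> real"
  assumes nn: "\<And>a. 0 \<le> f a" and up: "\<And>k. (\<Sum>a<k. f a) \<le> s"
    and lo: "\<And>j. 0 < j \<Longrightarrow> \<exists>k. s \<le> (\<Sum>a<k. f a) + 1 / real j"
  shows "f sums s"
proof -
  have sm: "summable f" using summableI_nonneg_bounded[OF nn up] .
  have "suminf f \<le> s" by (rule suminf_le_const[OF sm up])
  moreover have "s \<le> suminf f"
  proof (rule field_le_epsilon)
    fix e :: real assume "0 < e"
    then obtain j where j: "0 < j" "1 / real j < e"
      using reals_Archimedean[of e] by (metis inverse_eq_divide zero_less_Suc)
    obtain k where "s \<le> (\<Sum>a<k. f a) + 1 / real j" using lo[OF j(1)] by blast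
    moreover have "(\<Sum>a<k. f a) \<le> suminf f" using sum_le_suminf[OF sm, of "{..<k}"] nn by auto
    ultimately show "s \<le> suminf f + e" using j(2) by linarith
  qed
  ultimately show ?thesis using sm by (simp add: sums_iff)
qed

text \<open>For infinite sums limits give one inequality; the tail bounds, uniform over all states,
  give the other. Fatou's lemma on words of fixed length preserves the cost bound.\<close>

lemma states_limit:
  assumes M: "\<And>i. M i \<in> states r" and lim: "\<And>w. (\<lambda>i. M i w) \<longlonglongrightarrow> m w"
  shows "m \<in> states r"
proof -
  note b = states_bounds[OF M]
  have nn: "0 \<le> m w" for w by (rule LIMSEQ_le_const[OF lim]) (use b in auto)
  have part: "(\<Sum>a<k. m (u a)) \<le> m w"
    if s: "\<And>i. (\<lambda>a. M i (u a)) sums M i w" for u w k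
  proof (rule LIMSEQ_le)
    show "(\<lambda>i. \<Sum>a<k. M i (u a)) \<longlonglongrightarrow> (\<Sum>a<k. m (u a))" by (intro tendsto_sum lim)
    have "(\<Sum>a<k. M i (u a)) \<le> M i w" for i
      using sum_le_suminf[OF sums_summable[OF s], of "{..<k}"] b(3) by (simp add: sums_unique[OF s, symmetric])
    then show "\<exists>N. \<forall>n\<ge>N. (\<Sum>a<k. M n (u a)) \<le> M n w" by blast
  qed (rule lim)
  have low: "m w \<le> (\<Sum>a<k. m (u a)) + c" if "\<And>i. M i w \<le> (\<Sum>a<k. M i (u a)) + c" for u w k c
  proof (rule LIMSEQ_le[OF lim])
    show "(\<lambda>i. (\<Sum>a<k. M i (u a)) + c) \<longlonglongrightarrow> (\<Sum>a<k. m (u a)) + c" by (intro tendsto_intros lim)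
  qed (use that in blast)
  have "(\<lambda>a. m (w @ [a])) sums m w" for w
  proof (rule sumsI_bounds[OF nn part])
    show "(\<lambda>a. M i (w @ [a])) sums M i w" for i by (rule stationaryD(3)[OF b(1)])
    show "\<exists>k. m w \<le> (\<Sum>a<k. m (w @ [a])) + 1 / real j" if "0 < j" for j
      using low[OF states_tail_bounds(1)[OF M that], of w] by (rule exI)
  qed
  moreover have "(\<lambda>a. m (a # w)) sums m w" for w
  proof (rule sumsI_bounds[OF nn part])
    show "(\<lambda>a. M i (a # w)) sums M i w" for i by (rule stationaryD(4)[OF b(1)])
    show "\<exists>k. m w \<le> (\<Sum>a<k. m (a # w)) + 1 / real j" if "0 < j" for j
      using low[OF states_tail_bounds(2)[OF M that], of w] by (rule exI)
  qed
  moreover have "level r m n \<le> 1" for n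
  proof -
    have conv: "(\<lambda>i. r w * ennreal (M i w)) \<longlonglongrightarrow> r w * ennreal (m w)" for w
    \<comment> \<open>Multiplication by infinity is discontinuous at zero, but a word of infinite
      price has weight exactly \<open>0\<close> in every state.\<close>
    proof (cases "r w = \<infinity>")
      case True
      have "M i w = 0" for i
      proof -
        have "(\<Sum>v\<in>{w}. r v * ennreal (M i v)) \<le> level r (M i) (length w)"
          unfolding level_def by (rule sum_le_nn_integral_count_space) auto
        also have "\<dots> \<le> 1" using level_le_cost b(5) order_trans by blast
        finally show ?thesis using True b(3)[of i w] by (auto simp: ennreal_top_mult top_unique split: if_splits)
      qed
      moreover from this have "m w = 0" using LIMSEQ_unique[OF lim[of w]] by simp
      ultimately show ?thesis by simp
    next
      case False
      then show ?thesis by (intro tendsto_mult_ennreal tendsto_const tendsto_ennrealI lim) auto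
    qed
    have "level r m n = (\<integral>\<^sup>+w. liminf (\<lambda>i. r w * ennreal (M i w)) \<partial>count_space {w. length w = n})"
      unfolding level_def using lim_imp_Liminf[OF _ conv] by simp
    also have "\<dots> \<le> liminf (\<lambda>i. level r (M i) n)"
      unfolding level_def by (rule nn_integral_liminf) simp
    also have "\<dots> \<le> 1"
      by (rule Liminf_le) (use b(5) level_le_cost order_trans in \<open>blast intro: always_eventually\<close>)+
    finally show ?thesis .
  qed
  ultimately show ?thesis
    by (auto simp: states_def stationary_def consistent_def nn cost_def intro: SUP_least)
qed

lemma states_subset_cube: "embed ` states r \<subseteq> cube"
  using states_bounds by (auto simp: cube_def)

lemma decode_embed_states: "m \<in> states r \<Longrightarrow> decode (embed m) = m"
  using states_bounds by (intro ext decode_embed) auto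

lemma inj_on_embed: "inj_on embed (states r)"
  by (rule inj_onI) (metis decode_embed_states)

lemma compact_states: "compact (embed ` states r)"
proof -
  have "closed (embed ` states r)"
    unfolding closed_sequential_limits
  proof (intro allI impI, elim conjE)
    fix y l assume y: "\<forall>n. y n \<in> embed ` states r" and l: "y \<longlonglongrightarrow> l"
    define M where "M i = decode (y i)" for i
    have M: "M i \<in> states r" "y i = embed (M i)" for i
      using y decode_embed_states unfolding M_def by (metis imageE)+
    have lc: "l \<in> cube"
      using closed_sequentially[OF compact_imp_closed[OF compact_cube] _ l] y states_subset_cube by blast
    have "(\<lambda>i. M i w) \<longlonglongrightarrow> decode l w" for w
      unfolding M_def decode_def
      by (intro tendsto_intros bounded_linear.tendsto[OF bounded_linear_apply_bcontfun] l)
    then have "decode l \<in> states r" by (rule states_limit[OF M(1)])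
    then show "l \<in> embed ` states r" using embed_decode(1)[OF lc] by (metis imageI)
  qed
  then show ?thesis
    using compact_Int_closed[OF compact_cube] states_subset_cube by (metis inf.absorb2)
qed

lemma embed_lincomb:
  assumes "m \<in> states r" "m' \<in> states r" "0 \<le> u" "u \<le> 1"
  shows "embed (\<lambda>w. (1 - u) * m w + u * m' w) = (1 - u) *\<^sub>R embed m + u *\<^sub>R embed m'"
proof (rule bcontfun_eqI)
  fix n
  have "(1 - u) * m (from_nat n) + u * m' (from_nat n) \<in> {0..1}"
    using states_bounds(3,4)[OF states_convex[OF assms], of "from_nat n"] by simp
  then show "apply_bcontfun (embed (\<lambda>w. (1 - u) * m w + u * m' w)) n =
      apply_bcontfun ((1 - u) *\<^sub>R embed m + u *\<^sub>R embed m') n"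
    using states_bounds(3,4)[OF assms(1), of "from_nat n"] states_bounds(3,4)[OF assms(2), of "from_nat n"]
    by (simp add: apply_embed plus_bcontfun.rep_eq scaleR_bcontfun.rep_eq algebra_simps)
qed

lemma convex_states: "convex (embed ` states r)"
  unfolding convex_alt
proof (intro ballI allI impI)
  fix x y u assume "x \<in> embed ` states r" "y \<in> embed ` states r" and u: "0 \<le> u \<and> u \<le> (1::real)"
  then obtain m m' where m: "m \<in> states r" "m' \<in> states r" and xy: "x = embed m" "y = embed m'" by auto
  have "(1 - u) *\<^sub>R x + u *\<^sub>R y = embed (\<lambda>w. (1 - u) * m w + u * m' w)"
    using embed_lincomb[OF m, of u] u by (simp add: xy)
  then show "(1 - u) *\<^sub>R x + u *\<^sub>R y \<in> embed ` states r"
    using states_convex[OF m, of u] u by simp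
qed

section \<open>Extreme states, their normalization and a criterion by dispersion\<close>

definition extremal :: "(nat list \<Rightarrow> real) \<Rightarrow> bool" where
  "extremal m \<longleftrightarrow> m \<in> states r \<and>
     (\<forall>m1\<in>states r. \<forall>m2\<in>states r. \<forall>u\<in>{0<..<1}. m = (\<lambda>w. (1 - u) * m1 w + u * m2 w) \<longrightarrow> m1 = m2)"

lemma extremalD:
  assumes "extremal m" "m1 \<in> states r" "m2 \<in> states r" "0 < u" "u < 1"
    and "m = (\<lambda>w. (1 - u) * m1 w + u * m2 w)"
  shows "m1 = m2"
proof -
  have "u \<in> {0<..<1}" using assms by simp
  with assms show ?thesis unfolding extremal_def by blast
qed

lemma extreme_point_iff: "embed m extreme_point_of (embed ` states r) \<longleftrightarrow> extremal m"
  if "m \<in> states r"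
proof -
  have eq: "embed m = (1 - u) *\<^sub>R embed m1 + u *\<^sub>R embed m2 \<longleftrightarrow> m = (\<lambda>w. (1 - u) * m1 w + u * m2 w)"
    if "m1 \<in> states r" "m2 \<in> states r" "0 < u" "u < 1" for m1 m2 u
    using embed_lincomb[of m1 m2 u] inj_on_eq_iff[OF inj_on_embed \<open>m \<in> states r\<close> states_convex[of m1 m2 u]] that
    by auto
  have inj: "embed m1 = embed m2 \<longleftrightarrow> m1 = m2" if "m1 \<in> states r" "m2 \<in> states r" for m1 m2
    using inj_on_eq_iff[OF inj_on_embed that] .
  show ?thesis
  proof
    assume L: "embed m extreme_point_of (embed ` states r)"
    show "extremal m"
      unfolding extremal_def
    proof (intro conjI ballI impI)
      fix m1 m2 u
      assume m12: "m1 \<in> states r" "m2 \<in> states r" and u: "u \<in> {0<..<1::real}"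
        and m: "m = (\<lambda>w. (1 - u) * m1 w + u * m2 w)"
      have "embed m = (1 - u) *\<^sub>R embed m1 + u *\<^sub>R embed m2"
        using m eq[OF m12, of u] u by simp
      moreover have "embed m \<notin> open_segment (embed m1) (embed m2)"
        using L m12 by (simp add: extreme_point_of_def)
      ultimately have "embed m1 = embed m2" using u by (auto simp: in_segment)
      then show "m1 = m2" using inj[OF m12] by simp
    qed (rule that)
  next
    assume R: "extremal m"
    have "embed m \<notin> open_segment (embed m1) (embed m2)" if m12: "m1 \<in> states r" "m2 \<in> states r" for m1 m2
    proof
      assume "embed m \<in> open_segment (embed m1) (embed m2)"
      then obtain u where u: "embed m1 \<noteq> embed m2" "0 < u" "u < 1" "embed m = (1 - u) *\<^sub>R embed m1 + u *\<^sub>R embed m2"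
        by (auto simp: in_segment)
      then have "m = (\<lambda>w. (1 - u) * m1 w + u * m2 w)" using eq[OF m12, of u] by simp
      then have "m1 = m2" by (rule extremalD[OF R m12 u(2,3)])
      then show False using u by simp
    qed
    then show "embed m extreme_point_of (embed ` states r)"
      using that by (auto simp: extreme_point_of_def)
  qed
qed

lemma extremal_zero: "extremal (\<lambda>w. 0)"
  unfolding extremal_def
proof (intro conjI ballI impI)
  fix m1 m2 and u :: real
  assume m: "m1 \<in> states r" "m2 \<in> states r" and u: "u \<in> {0<..<1}"
    and eq: "(\<lambda>w. 0) = (\<lambda>w. (1 - u) * m1 w + u * m2 w)"
  have "m1 w = 0 \<and> m2 w = 0" for w
  proof -
    have "(1 - u) * m1 w + u * m2 w = 0" using fun_cong[OF eq, of w] by simp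
    moreover have "0 \<le> (1 - u) * m1 w" "0 \<le> u * m2 w"
      using u states_bounds(3)[OF m(1)] states_bounds(3)[OF m(2)] by auto
    ultimately have "(1 - u) * m1 w = 0" "u * m2 w = 0" by linarith+
    then show ?thesis using u by auto
  qed
  then show "m1 = m2" by auto
qed (rule zero_in_states)

lemma stationary_zeroI: "stationary m \<Longrightarrow> m [] = 0 \<Longrightarrow> m = (\<lambda>w. 0)"
  using consistent_append_le[of m "[]"] stationaryD(1,2)[of m]
  by (intro ext antisym) (auto simp: stationary_def)

lemma scaled_in_states:
  assumes "stationary m" "cost r m = ennreal t" "0 < t"
  shows "(\<lambda>w. m w / t) \<in> states r" "cost r (\<lambda>w. m w / t) = 1"
proof -
  have "cost r (\<lambda>w. inverse t * m w) = ennreal (inverse t) * ennreal t"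
    using assms by (subst cost_scale) (auto simp: stationary_def)
  also have "\<dots> = 1" using assms(3) by (simp flip: ennreal_mult)
  finally show c: "cost r (\<lambda>w. m w / t) = 1" by (simp add: divide_inverse mult.commute)
  then show "(\<lambda>w. m w / t) \<in> states r"
    using stationary_scale[OF assms(1), of "inverse t"] assms(3)
    by (simp add: states_def divide_inverse mult.commute)
qed

text \<open>A nonzero state of cost \<open>t < 1\<close> would lie strictly between zero and the
  state \<open>m / t\<close>.\<close>

lemma cost_extremal:
  assumes ext: "extremal m" and "m [] \<noteq> 0"
  shows "cost r m = 1"
proof (rule ccontr)
  assume ne: "cost r m \<noteq> 1"
  have m: "m \<in> states r" using ext by (simp add: extremal_def)
  note b = states_bounds[OF m]
  obtain t where t: "cost r m = ennreal t" "0 \<le> t" "t < 1"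
    using b(5) ne by (cases "cost r m") (auto simp: ennreal_le_1 top_unique)
  have "0 < t" using mass_le_cost[of m "[]"] b(3)[of "[]"] assms(2) t by (auto simp: less_le)
  have eq: "m = (\<lambda>w. (1 - t) * 0 + t * (m w / t))" using \<open>0 < t\<close> by auto
  have "(\<lambda>w. 0) = (\<lambda>w. m w / t)"
    by (rule extremalD[OF ext zero_in_states scaled_in_states(1)[OF b(1) t(1) \<open>0 < t\<close>] \<open>0 < t\<close> t(3) eq])
  from fun_cong[OF this, of "[]"] show False using assms(2) \<open>0 < t\<close> by simp
qed

text \<open>The costs of \<open>m'\<close> and of \<open>m - m'\<close> add up to \<open>1\<close>,
  so dividing each part by its cost writes \<open>m\<close> as a convex combination of states.
  Extremality makes these equal; a part of cost zero vanishes.\<close>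

lemma extremal_proportional:
  assumes ext: "extremal m" and m0: "m [] \<noteq> 0"
    and st: "stationary m'" "stationary (\<lambda>w. m w - m' w)"
  shows "m' w = m' [] / m [] * m w"
proof -
  have m: "m \<in> states r" using ext by (simp add: extremal_def)
  have c1: "consistent m'" "consistent (\<lambda>w. m w - m' w)" using st by (auto simp: stationary_def)
  have sum: "cost r m' + cost r (\<lambda>w. m w - m' w) = 1"
    using cost_lincomb[of 1 1 m' "\<lambda>w. m w - m' w"] c1 cost_extremal[OF ext m0] by simp
  then obtain t where t: "cost r m' = ennreal t" "0 \<le> t"
    by (cases "cost r m'") auto
  have t1: "t \<le> 1" "cost r (\<lambda>w. m w - m' w) = ennreal (1 - t)"
  proof -
    have "ennreal t \<le> 1" using sum t by (metis le_iff_add)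
    then show "t \<le> 1" by (simp add: ennreal_le_1)
    have "cost r (\<lambda>w. m w - m' w) = 1 - ennreal t"
      using sum t by (metis ennreal_add_diff_cancel_left ennreal_neq_top infinity_ennreal_def)
    then show "cost r (\<lambda>w. m w - m' w) = ennreal (1 - t)"
      using t(2) by (simp add: ennreal_minus flip: ennreal_1)
  qed
  have nn: "0 \<le> m' w" "0 \<le> m w - m' w" for w using stationaryD(2)[OF st(1)] stationaryD(2)[OF st(2)] by auto
  consider "t = 0" | "t = 1" | "0 < t" "t < 1" using t t1 by linarith
  then show ?thesis
  proof cases
    case 1
    then have "m' [] = 0" using mass_le_cost[of m' "[]"] t nn(1)[of "[]"] by simp
    then show ?thesis using stationary_zeroI[OF st(1)] by (simp add: fun_eq_iff)
  next
    case 2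
    then have "m [] - m' [] = 0" using mass_le_cost[of "\<lambda>w. m w - m' w" "[]"] t1 nn(2)[of "[]"] by simp
    then have "m [] = m' []" "m w = m' w" using stationary_zeroI[OF st(2)] by (simp_all add: fun_eq_iff)
    then show ?thesis using m0 by simp
  next
    case 3
    have eq: "m = (\<lambda>w. (1 - (1 - t)) * (m' w / t) + (1 - t) * ((m w - m' w) / (1 - t)))" using 3 by auto
    have "(\<lambda>w. m' w / t) = (\<lambda>w. (m w - m' w) / (1 - t))"
      by (rule extremalD[OF ext _ _ _ _ eq])
         (use scaled_in_states(1)[OF st(1) t(1)] scaled_in_states(1)[OF st(2) t1(2)] 3 in auto)
    then have "m' w / t = (m w - m' w) / (1 - t)" for w by (rule fun_cong)
    then have "m' w = t * m w" for w using 3 by (simp add: field_simps)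
    then show ?thesis using m0 by simp
  qed
qed

text \<open>Under the invariant measure of \<open>m1\<close> the mean of \<open>freq N w\<close> is
  \<open>m1 w\<close> for every \<open>N\<close>. The left side is therefore at most a mean
  deviation under \<open>m1\<close>, and domination by \<open>C * m\<close> carries it over to
  \<open>m\<close>.\<close>

lemma dispersion_bound:
  assumes m: "stationary m" and m1: "stationary m1" and "0 < N"
    and le: "\<And>w. m1 w \<le> C * m w" and "0 \<le> C"
  shows "ennreal \<bar>m1 w - m1 [] * m w\<bar> \<le> ennreal C * dispersion N w m"
proof -
  have c: "consistent m1" using m1 by (simp add: stationary_def)
  interpret shift_measure "cyl_measure m1"
    using finite_measure_cyl_measure[OF c] left_shift_cyl_measure[OF m1]
    by (simp add: shift_measure_def shift_measure_axioms_def)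
  have i: "integrable (cyl_measure m1) (freq N w)"
    by (rule integrable_bounded[where C = 1]) (use freq_nonneg freq_le_1 in auto)
  have "(\<integral>x. freq N w x \<partial>cyl_measure m1) = m1 w"
    using integral_birkhoff_sum[of "indicator (cyl w)" 1 N] \<open>0 < N\<close>
    by (simp add: freq_def measure_cyl_measure[OF c] indicator_le_1)
  then have "m1 w - m1 [] * m w = (\<integral>x. freq N w x - m w \<partial>cyl_measure m1)"
    using i measure_cyl_measure[OF c, of "[]"] by simp
  then have "ennreal \<bar>m1 w - m1 [] * m w\<bar> \<le> ennreal (\<integral>x. \<bar>freq N w x - m w\<bar> \<partial>cyl_measure m1)"
    using integral_abs_bound[of "cyl_measure m1" "\<lambda>x. freq N w x - m w"] by (simp add: ennreal_leI)
  also have "\<dots> = (\<integral>\<^sup>+x. ennreal \<bar>freq N w x - m w\<bar> \<partial>cyl_measure m1)"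
    using i by (intro nn_integral_eq_integral[symmetric]) auto
  also have "\<dots> = (\<integral>\<^sup>+v. ennreal \<bar>word_freq N w v - m w\<bar> * ennreal (m1 v) \<partial>count_space {v. length v = N + length w})"
    by (simp add: nn_integral_freq_deviation emeasure_cyl_measure[OF c])
  also have "\<dots> \<le> (\<integral>\<^sup>+v. ennreal C * (ennreal \<bar>word_freq N w v - m w\<bar> * ennreal (m v)) \<partial>count_space {v. length v = N + length w})"
  proof (intro nn_integral_mono)
    fix v
    have "ennreal (m1 v) \<le> ennreal C * ennreal (m v)"
      using ennreal_leI[OF le[of v]] stationaryD(2)[OF m] \<open>0 \<le> C\<close> by (simp add: ennreal_mult)
    then show "ennreal \<bar>word_freq N w v - m w\<bar> * ennreal (m1 v)
        \<le> ennreal C * (ennreal \<bar>word_freq N w v - m w\<bar> * ennreal (m v))"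
      using mult_left_mono by (metis mult.left_commute zero_le)
  qed
  also have "\<dots> = ennreal C * dispersion N w m"
    unfolding dispersion_def by (simp add: nn_integral_cmult)
  finally show ?thesis .
qed

text \<open>An ergodicity criterion: a summand of a convex decomposition is dominated by a multiple
  of \<open>m\<close>, hence proportional to \<open>m\<close> by \<open>dispersion_bound\<close>
  along the times \<open>N\<close>; the cost bound then fixes the factor.\<close>

lemma extremalI_dispersion:
  assumes m: "stationary m" "m [] = 1" and t: "cost r m = ennreal t"
    and disp: "\<And>w. liminf (\<lambda>k. dispersion (N k) w m) = 0" and N: "strict_mono N"
  shows "extremal (\<lambda>w. m w / t)"
proof -
  have "0 < t" using mass_le_cost[of m "[]"] m(2) t by (cases "t \<le> 0") (auto simp: ennreal_neg)
  have prp: "m1 w = m1 [] * m w" if m1: "m1 \<in> states r" and "0 < u" and le: "\<And>w. u * m1 w \<le> m w / t" for m1 u w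
  proof -
    define C where "C = 1 / (u * t)"
    have C: "0 < C" using \<open>0 < u\<close> \<open>0 < t\<close> by (simp add: C_def)
    have le': "m1 w \<le> C * m w" for w using le[of w] \<open>0 < u\<close> \<open>0 < t\<close> by (simp add: C_def field_simps)
    have "ennreal \<bar>m1 w - m1 [] * m w\<bar> \<le> ennreal C * dispersion (N k) w m" if "0 < k" for k
      using dispersion_bound[OF m(1) states_bounds(1)[OF m1], of "N k" C w] le' C
        seq_suble[OF N, of k] that by simp
    moreover have "ennreal (1 / C) * (ennreal C * d) = d" for d
      using C by (simp add: mult.assoc[symmetric] flip: ennreal_mult)
    ultimately have "ennreal (1 / C) * ennreal \<bar>m1 w - m1 [] * m w\<bar> \<le> dispersion (N k) w m" if "0 < k" for k
      using that mult_left_mono[of _ _ "ennreal (1 / C)"] by (metis zero_le)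
    then have ev: "eventually (\<lambda>k. ennreal (1 / C) * ennreal \<bar>m1 w - m1 [] * m w\<bar> \<le> dispersion (N k) w m) sequentially"
      by (intro eventually_sequentiallyI[of 1]) auto
    have "ennreal (1 / C) * ennreal \<bar>m1 w - m1 [] * m w\<bar> \<le> liminf (\<lambda>k. dispersion (N k) w m)"
      by (rule Liminf_bounded[OF ev])
    then have "ennreal (1 / C * \<bar>m1 w - m1 [] * m w\<bar>) = 0"
      using disp[of w] C by (simp add: ennreal_mult)
    then have "1 / C * \<bar>m1 w - m1 [] * m w\<bar> \<le> 0" by (simp only: ennreal_eq_0_iff)
    then show ?thesis using C by (simp add: divide_le_0_iff)
  qed
  show ?thesis
    unfolding extremal_def
  proof (intro conjI ballI impI)
    show "(\<lambda>w. m w / t) \<in> states r" by (rule scaled_in_states(1)[OF m(1) t \<open>0 < t\<close>])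
    fix m1 m2 and u :: real
    assume m12: "m1 \<in> states r" "m2 \<in> states r" and u: "u \<in> {0<..<1}"
      and eq: "(\<lambda>w. m w / t) = (\<lambda>w. (1 - u) * m1 w + u * m2 w)"
    have eq': "m w / t = (1 - u) * m1 w + u * m2 w" for w using fun_cong[OF eq] .
    have p1: "m1 w = m1 [] * m w" for w
      by (rule prp[OF m12(1), of "1 - u"]) (use u eq' states_bounds(3)[OF m12(2)] in auto)
    have p2: "m2 w = m2 [] * m w" for w
      by (rule prp[OF m12(2), of u]) (use u eq' states_bounds(3)[OF m12(1)] in auto)
    have mass: "m' [] * t \<le> 1" if m': "m' \<in> states r" and p: "\<And>w. m' w = m' [] * m w" for m'
    proof -
      have "m' = (\<lambda>w. m' [] * m w)" by (intro ext p)
      then have "cost r m' = cost r (\<lambda>w. m' [] * m w)" by (rule arg_cong)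
      also have "\<dots> = ennreal (m' []) * ennreal t"
        using states_bounds(3)[OF m'] m(1) t by (subst cost_scale) (auto simp: stationary_def)
      finally have "cost r m' = ennreal (m' []) * ennreal t" .
      then have "ennreal (m' [] * t) \<le> 1"
        using states_bounds(5)[OF m'] states_bounds(3)[OF m'] \<open>0 < t\<close> by (simp add: ennreal_mult)
      then show ?thesis by (simp add: ennreal_le_1)
    qed
    \<comment> \<open>A convex combination of two numbers not above \<open>1\<close> that equals
      \<open>1\<close> forces both to be \<open>1\<close>, so the two summands have the same
      factor.\<close>
    have e: "1 = (1 - u) * (m1 [] * t) + u * (m2 [] * t)"
      using eq'[of "[]"] m(2) \<open>0 < t\<close> by (simp add: field_simps)
    have a: "m1 [] * t \<le> 1" "m2 [] * t \<le> 1" by (rule mass[OF m12(1) p1], rule mass[OF m12(2) p2])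
    have "(1 - u) * (1 - m1 [] * t) + u * (1 - m2 [] * t) = 0" using e by (simp add: algebra_simps)
    moreover have "0 \<le> (1 - u) * (1 - m1 [] * t)" "0 \<le> u * (1 - m2 [] * t)" using a u by auto
    ultimately have "(1 - u) * (1 - m1 [] * t) = 0" "u * (1 - m2 [] * t) = 0" by linarith+
    then have "m1 [] * t = m2 [] * t" using u by simp
    then have "m1 [] = m2 []" using \<open>0 < t\<close> by simp
    then have "m1 w = m2 w" for w using p1[of w] p2[of w] by simp
    then show "m1 = m2" by (rule ext)
  qed
qed

end

text \<open>A point of \<open>K\<close> fails to be extreme exactly if it is the midpoint of two
  distinct points of \<open>K\<close>. Midpoints of pairs at distance at least
  \<open>1 / Suc n\<close> form a compact set.\<close>

lemma borel_extreme_points: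
  fixes K :: "'a::real_normed_vector set"
  assumes K: "compact K" "convex K"
  shows "{e. e extreme_point_of K} \<in> sets borel"
proof -
  define C where "C n = (\<lambda>(a, b). (1/2) *\<^sub>R a + (1/2) *\<^sub>R b) ` ((K \<times> K) \<inter> {p. 1 / real (Suc n) \<le> dist (fst p) (snd p)})" for n
  have "compact (C n)" for n
  proof -
    have "closed {p :: 'a \<times> 'a. 1 / real (Suc n) \<le> dist (fst p) (snd p)}"
      by (intro closed_Collect_le continuous_intros)
    then have "compact ((K \<times> K) \<inter> {p. 1 / real (Suc n) \<le> dist (fst p) (snd p)})"
      using K(1) by (intro compact_Int_closed compact_Times)
    then show ?thesis
      unfolding C_def case_prod_beta by (intro compact_continuous_image continuous_intros)
  qed
  then have C: "C n \<in> sets borel" for n by (simp add: compact_imp_closed)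
  have "{e. e extreme_point_of K} = K - (\<Union>n. C n)"
  proof (intro set_eqI iffI)
    fix x assume x: "x \<in> {e. e extreme_point_of K}"
    then have "x \<in> K" by (simp add: extreme_point_of_def)
    moreover have "x \<notin> C n" for n
    proof
      assume "x \<in> C n"
      then obtain a b where ab: "x = (1/2) *\<^sub>R a + (1/2) *\<^sub>R b" "a \<in> K" "b \<in> K" "1 / real (Suc n) \<le> dist a b"
        by (auto simp: C_def)
      have "a \<noteq> b" using ab(4) by auto
      then have "x \<in> open_segment a b"
        using ab(1) by (auto simp: in_segment intro!: exI[of _ "1/2"])
      then show False using x ab(2,3) by (auto simp: extreme_point_of_def)
    qed
    ultimately show "x \<in> K - (\<Union>n. C n)" by blast
  next
    fix x assume x: "x \<in> K - (\<Union>n. C n)"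
    have "x \<notin> open_segment a b" if ab: "a \<in> K" "b \<in> K" for a b
    proof
      assume "x \<in> open_segment a b"
      then obtain u where u: "a \<noteq> b" "0 < u" "u < 1" "x = (1 - u) *\<^sub>R a + u *\<^sub>R b"
        by (auto simp: in_segment)
      \<comment> \<open>The largest step for which \<open>u - s\<close> and \<open>u + s\<close>
        stay in \<open>[0, 1]\<close>; it recentres the segment so that \<open>x\<close> is its
        midpoint.\<close>
      define s where "s = min u (1 - u)"
      have s: "0 < s" "s \<le> u" "s \<le> 1 - u" using u by (auto simp: s_def)
      define a' b' where "a' = (1 - (u - s)) *\<^sub>R a + (u - s) *\<^sub>R b" and "b' = (1 - (u + s)) *\<^sub>R a + (u + s) *\<^sub>R b"
      have K': "a' \<in> K" "b' \<in> K"
        unfolding a'_def b'_def using K(2) ab s by (auto intro!: convexD_alt)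
      have "x = (1/2) *\<^sub>R a' + (1/2) *\<^sub>R b'"
      proof -
        have "a' + b' = (2 * (1 - u)) *\<^sub>R a + (2 * u) *\<^sub>R b"
        proof -
          have "a' + b' = ((1 - (u - s)) + (1 - (u + s))) *\<^sub>R a + ((u - s) + (u + s)) *\<^sub>R b"
            unfolding a'_def b'_def scaleR_add_left by (simp only: ac_simps)
          then show ?thesis by (simp add: algebra_simps)
        qed
        then have "(1/2) *\<^sub>R (a' + b') = x" by (simp add: u(4) scaleR_add_right)
        then show ?thesis by (simp add: scaleR_add_right)
      qed
      moreover have "a' - b' = (2 * s) *\<^sub>R (a - b)"
      proof -
        have "(p *\<^sub>R a + q *\<^sub>R b) - (p' *\<^sub>R a + q' *\<^sub>R b) = (p - p') *\<^sub>R a - (q' - q) *\<^sub>R b" for p q p' q'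
          by (simp add: algebra_simps)
        then have "a' - b' = ((1 - (u - s)) - (1 - (u + s))) *\<^sub>R a - ((u + s) - (u - s)) *\<^sub>R b"
          unfolding a'_def b'_def by blast
        then show ?thesis by (simp add: scaleR_diff_right)
      qed
      then have "0 < dist a' b'" using u(1) s(1) by (simp add: dist_norm)
      then obtain n where "1 / real (Suc n) < dist a' b'"
        using reals_Archimedean[of "dist a' b'"] by (auto simp: inverse_eq_divide)
      ultimately have "x \<in> C n" using K' by (force simp: C_def)
      then show False using x by blast
    qed
    then show "x \<in> {e. e extreme_point_of K}" using x by (simp add: extreme_point_of_def)
  qed
  then show ?thesis using C K(1) by (simp add: compact_imp_closed sets.Diff sets.countable_UN)
qed

section \<open>Representing measures\<close>

text \<open>Serves to add an atom at zero to the part of the representing measure that comes from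
  ergodic components.\<close>

lemma add_measure_exists:
  assumes "sets N = sets M"
  obtains P where "sets P = sets M" "\<And>A. A \<in> sets M \<Longrightarrow> emeasure P A = emeasure M A + emeasure N A"
proof -
  define P where "P = measure_of (space M) (sets M) (\<lambda>A. emeasure M A + emeasure N A)"
  have sets_P: "sets P = sets M" unfolding P_def by simp
  have "emeasure P A = emeasure M A + emeasure N A" if "A \<in> sets M" for A
  proof (rule emeasure_measure_of[OF P_def sets.space_closed])
    show "positive (sets P) (\<lambda>A. emeasure M A + emeasure N A)" by (simp add: positive_def)
    show "countably_additive (sets P) (\<lambda>A. emeasure M A + emeasure N A)"
    proof (rule countably_additiveI)
      fix A :: "nat \<Rightarrow> 'a set" assume A: "range A \<subseteq> sets P" "disjoint_family A" "(\<Union>i. A i) \<in> sets P"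
      have "(\<Sum>i. emeasure M (A i)) = emeasure M (\<Union>i. A i)" "(\<Sum>i. emeasure N (A i)) = emeasure N (\<Union>i. A i)"
        using A assms sets_P by (auto intro!: suminf_emeasure)
      then show "(\<Sum>i. emeasure M (A i) + emeasure N (A i)) = emeasure M (\<Union>i. A i) + emeasure N (\<Union>i. A i)"
        by (simp add: suminf_add[OF summableI summableI, symmetric])
    qed
  qed (use that sets_P in auto)
  with sets_P that show thesis by blast
qed

lemma nn_integral_emeasure_add:
  assumes f: "f \<in> borel_measurable M"
    and sets [measurable_cong]: "sets N = sets M" "sets P = sets M"
    and em: "\<And>A. A \<in> sets M \<Longrightarrow> emeasure P A = emeasure M A + emeasure N A"
  shows "(\<integral>\<^sup>+x. f x \<partial>P) = (\<integral>\<^sup>+x. f x \<partial>M) + (\<integral>\<^sup>+x. f x \<partial>N)"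
  using f
proof (induction rule: borel_measurable_induct)
  case (cong f g)
  have sp: "space N = space M" "space P = space M"
    using sets_eq_imp_space_eq[OF sets(1)] sets_eq_imp_space_eq[OF sets(2)] by auto
  have "integral\<^sup>N M f = integral\<^sup>N M g" "integral\<^sup>N N f = integral\<^sup>N N g" "integral\<^sup>N P f = integral\<^sup>N P g"
    by (intro nn_integral_cong; use cong(3) sp in simp)+
  then show ?case using cong by simp
next
  case (set A)
  then show ?case using em sets by simp
next
  case (mult u c)
  then show ?case by (simp add: nn_integral_cmult distrib_left)
next
  case (add u v)
  then show ?case by (simp add: nn_integral_add ac_simps)
next
  case (seq U)
  then have [measurable]: "U i \<in> borel_measurable M" for i by simp
  have mono: "incseq (\<lambda>i. integral\<^sup>N M (U i))" "incseq (\<lambda>i. integral\<^sup>N N (U i))"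
    using \<open>incseq U\<close> by (auto simp: incseq_def le_fun_def intro!: nn_integral_mono)
  show ?case
    using seq ennreal_SUP_add[OF mono] unfolding SUP_apply
    by (simp add: nn_integral_monotone_convergence_SUP)
qed

definition unit_seq :: "nat \<Rightarrow> (nat \<Rightarrow>\<^sub>C real)" where
  "unit_seq n = Bcontfun (\<lambda>k. if k = n then 1 else 0)"

lemma apply_unit_seq: "apply_bcontfun (unit_seq n) k = (if k = n then 1 else 0)"
proof -
  have "(\<lambda>k. if k = n then 1 else 0 :: real) \<in> bcontfun"
    by (intro bcontfun_normI[where b = 1]) auto
  then show ?thesis by (simp add: unit_seq_def Bcontfun_inverse)
qed

lemma apply_partial_sum:
  "apply_bcontfun (\<Sum>n<k. apply_bcontfun y n *\<^sub>R unit_seq n) j = (if j < k then apply_bcontfun y j else 0)"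
proof -
  have "apply_bcontfun (\<Sum>n<k. apply_bcontfun y n *\<^sub>R unit_seq n) j =
      (\<Sum>n<k. apply_bcontfun (apply_bcontfun y n *\<^sub>R unit_seq n) j)"
    by (rule linear_sum[OF bounded_linear.linear[OF bounded_linear_apply_bcontfun]])
  also have "\<dots> = (\<Sum>n<k. if n = j then apply_bcontfun y j else 0)"
    by (intro sum.cong) (auto simp: scaleR_bcontfun.rep_eq apply_unit_seq)
  finally show ?thesis by simp
qed

text \<open>Coordinates do not determine a continuous functional on all bounded sequences. On the
  cube they decay geometrically, so truncations converge in norm and coordinates are enough to test
  barycentres.\<close>

lemma partial_sum_tendsto:
  assumes "y \<in> cube"
  shows "(\<lambda>k. \<Sum>n<k. apply_bcontfun y n *\<^sub>R unit_seq n) \<longlonglongrightarrow> y"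
proof -
  have "dist (\<Sum>n<k. apply_bcontfun y n *\<^sub>R unit_seq n) y \<le> (1 / 2) ^ k" for k
  proof (rule dist_bound)
    fix j
    show "dist (apply_bcontfun (\<Sum>n<k. apply_bcontfun y n *\<^sub>R unit_seq n) j) (apply_bcontfun y j) \<le> (1 / 2) ^ k"
    proof (cases "j < k")
      case False
      then have "(1 / 2 :: real) ^ j \<le> (1 / 2) ^ k" by (intro power_decreasing) auto
      with cube_bounds(2)[OF assms, of j] have "apply_bcontfun y j \<le> (1 / 2) ^ k" by (rule order_trans)
      then show ?thesis using cube_bounds(1)[OF assms, of j] False by (simp add: apply_partial_sum)
    qed (simp add: apply_partial_sum)
  qed
  then have "eventually (\<lambda>k. norm (dist (\<Sum>n<k. apply_bcontfun y n *\<^sub>R unit_seq n) y) \<le> (1 / 2) ^ k) sequentially"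
    by simp
  moreover have "(\<lambda>k. (1 / 2 :: real) ^ k) \<longlonglongrightarrow> 0" by (rule LIMSEQ_power_zero) simp
  ultimately have "(\<lambda>k. dist (\<Sum>n<k. apply_bcontfun y n *\<^sub>R unit_seq n) y) \<longlonglongrightarrow> 0"
    by (rule Lim_null_comparison)
  then show ?thesis by (rule tendsto_dist_iff[THEN iffD2])
qed

lemma norm_partial_sum_le:
  assumes "y \<in> cube"
  shows "norm (\<Sum>n<k. apply_bcontfun y n *\<^sub>R unit_seq n) \<le> 1"
proof (rule norm_bound)
  fix j
  have "(1 / 2 :: real) ^ j \<le> 1" by (rule power_le_one) auto
  then show "norm (apply_bcontfun (\<Sum>n<k. apply_bcontfun y n *\<^sub>R unit_seq n) j) \<le> 1"
    using cube_bounds[OF assms, of j] by (simp add: apply_partial_sum)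
qed

lemma represents_cubeD:
  assumes "prob_space P" "sets P = sets borel" "AE y in P. y \<in> cube" "represents P x"
  shows "(\<integral>\<^sup>+y. ennreal (apply_bcontfun y n) \<partial>P) = ennreal (apply_bcontfun x n)"
proof -
  interpret prob_space P by fact
  note [measurable_cong] = assms(2)
  have "AE y in P. norm (apply_bcontfun y n) \<le> 1"
    using assms(3)
  proof eventually_elim
    case (elim y)
    have "(1 / 2 :: real) ^ n \<le> 1" by (rule power_le_one) auto
    then show ?case using cube_bounds[OF elim, of n] by simp
  qed
  then have "integrable P (\<lambda>y. apply_bcontfun y n)" by (rule integrable_const_bound) measurable
  then have "(\<integral>\<^sup>+y. ennreal (apply_bcontfun y n) \<partial>P) = ennreal (\<integral>y. apply_bcontfun y n \<partial>P)"
    by (rule nn_integral_eq_integral) (use assms(3) cube_bounds in \<open>auto elim: eventually_mono\<close>)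
  also have "(\<integral>y. apply_bcontfun y n \<partial>P) = apply_bcontfun x n"
    using assms(4) bounded_linear_apply_bcontfun unfolding represents_def by blast
  finally show ?thesis .
qed

text \<open>A functional is evaluated on truncations, which involve finitely many coordinates;
  dominated convergence passes to the full sequence.\<close>

lemma represents_cubeI:
  assumes "prob_space P" "sets P = sets borel" "AE y in P. y \<in> cube" "x \<in> cube"
    and coord: "\<And>n. (\<integral>\<^sup>+y. ennreal (apply_bcontfun y n) \<partial>P) = ennreal (apply_bcontfun x n)"
  shows "represents P x"
  unfolding represents_def
proof (intro allI impI)
  fix f :: "(nat \<Rightarrow>\<^sub>C real) \<Rightarrow> real" assume f: "bounded_linear f"
  interpret prob_space P by fact
  interpret f: bounded_linear f by fact
  note [measurable_cong] = assms(2)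
  have [measurable]: "f \<in> borel_measurable borel"
    by (rule borel_measurable_continuous_onI[OF linear_continuous_on[OF f]])
  define S where "S k y = (\<Sum>n<k. apply_bcontfun y n * f (unit_seq n))" for k y
  have S_eq: "S k y = f (\<Sum>n<k. apply_bcontfun y n *\<^sub>R unit_seq n)" for k y
    by (simp add: S_def f.sum f.scaleR)
  have [measurable]: "S k \<in> borel_measurable borel" for k unfolding S_def by measurable
  have lim: "(\<lambda>k. S k y) \<longlonglongrightarrow> f y" if "y \<in> cube" for y
    unfolding S_eq by (rule f.tendsto[OF partial_sum_tendsto[OF that]])
  obtain C where C: "0 \<le> C" "\<And>y. norm (f y) \<le> norm y * C" using f.nonneg_bounded by auto
  have bd: "norm (S k y) \<le> C" if "y \<in> cube" for k y
    using order_trans[OF C(2) mult_right_mono[OF norm_partial_sum_le[OF that] C(1)]] by (simp add: S_eq)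
  have "AE y in P. norm (apply_bcontfun y n) \<le> 1" for n
    using assms(3)
  proof eventually_elim
    case (elim y)
    have "(1 / 2 :: real) ^ n \<le> 1" by (rule power_le_one) auto
    then show ?case using cube_bounds[OF elim, of n] by simp
  qed
  then have int: "integrable P (\<lambda>y. apply_bcontfun y n)" for n by (rule integrable_const_bound) measurable
  have coord': "(\<integral>y. apply_bcontfun y n \<partial>P) = apply_bcontfun x n" for n
    using coord[of n] cube_bounds[OF assms(4), of n]
    by (subst integral_eq_nn_integral) (use assms(3) cube_bounds in \<open>auto elim: eventually_mono\<close>)
  have "(\<integral>y. S k y \<partial>P) = S k x" for k
    unfolding S_def by (subst Bochner_Integration.integral_sum) (auto simp: int coord')
  moreover have "(\<lambda>k. \<integral>y. S k y \<partial>P) \<longlonglongrightarrow> (\<integral>y. f y \<partial>P)"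
  proof (rule integral_dominated_convergence[where w = "\<lambda>_. C"])
    show "AE y in P. (\<lambda>k. S k y) \<longlonglongrightarrow> f y" using assms(3) lim by (auto elim: eventually_mono)
    show "AE y in P. norm (S k y) \<le> C" for k using assms(3) bd by (auto elim: eventually_mono)
  qed auto
  ultimately show "(\<integral>y. f y \<partial>P) = f x"
    using lim[OF assms(4)] LIMSEQ_unique by simp
qed

section \<open>Existence and uniqueness of the representing measure\<close>

context word_cost
begin

definition limcost :: "(nat \<Rightarrow> nat) \<Rightarrow> (nat \<Rightarrow> nat) \<Rightarrow> ennreal" where
  "limcost N y = cost r (\<lambda>w. limfreq N w y)"

text \<open>The ergodic component at \<open>y\<close>, rescaled from mass \<open>1\<close> on the
  base to cost \<open>1\<close>. Where the cost is zero or infinite the quotient is \<open>0\<close>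
  by convention; this happens on a null set.\<close>

definition component :: "(nat \<Rightarrow> nat) \<Rightarrow> (nat \<Rightarrow> nat) \<Rightarrow> nat list \<Rightarrow> real" where
  "component N y w = limfreq N w y / enn2real (limcost N y)"

lemma limcost_measurable [measurable]: "limcost N \<in> borel_measurable borel"
  unfolding limcost_def cost_def level_def by measurable

lemma component_measurable [measurable]: "(\<lambda>y. embed (component N y)) \<in> borel_measurable borel"
proof (rule measurable_compose[OF _ embed_measurable])
  have "(\<lambda>y w. component N y w) \<in> borel_measurable borel"
    unfolding component_def by (rule measurable_coordinatewise_then_product) measurable
  then show "component N \<in> borel_measurable borel" .
qed

lemma shift_measure_cyl_measure: "stationary m \<Longrightarrow> shift_measure (cyl_measure m)"
  using finite_measure_cyl_measure[of m] left_shift_cyl_measure[of m]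
  by (simp add: shift_measure_def shift_measure_axioms_def stationary_def)

text \<open>Levels of the limit frequencies increase only where these are consistent, whence the
  almost everywhere form of monotone convergence; each level integrates to the level of
  \<open>m\<close>.\<close>

lemma nn_integral_limcost:
  assumes m: "stationary m" and gen: "generic_times (cyl_measure m) N"
  shows "(\<integral>\<^sup>+y. limcost N y \<partial>cyl_measure m) = cost r m"
proof -
  interpret shift_measure "cyl_measure m" by (rule shift_measure_cyl_measure[OF m])
  have c: "consistent m" using m by (simp add: stationary_def)
  have "(\<integral>\<^sup>+y. limcost N y \<partial>cyl_measure m) = (SUP n. \<integral>\<^sup>+y. level r (\<lambda>w. limfreq N w y) n \<partial>cyl_measure m)"
    unfolding limcost_def cost_def
  proof (rule nn_integral_monotone_convergence_SUP_AE)
    show "AE y in cyl_measure m. level r (\<lambda>w. limfreq N w y) n \<le> level r (\<lambda>w. limfreq N w y) (Suc n)" for n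
      using AE_stationary_limfreq[OF gen]
    proof eventually_elim
      case (elim y)
      then have "incseq (level r (\<lambda>w. limfreq N w y))"
        by (intro incseq_level) (simp add: stationary_def)
      then show ?case by (rule incseq_SucD)
    qed
    show "(\<lambda>y. level r (\<lambda>w. limfreq N w y) n) \<in> borel_measurable (cyl_measure m)" for n
      unfolding level_def by measurable
  qed
  moreover have "(\<integral>\<^sup>+y. level r (\<lambda>w. limfreq N w y) n \<partial>cyl_measure m) = level r m n" for n
    unfolding level_def
    by (subst nn_integral_count_space_nn_integral)
       (auto simp: nn_integral_cmult nn_integral_limfreq_eq_emeasure[OF gen] emeasure_cyl_measure[OF c])
  ultimately show ?thesis by (simp add: cost_def)
qed

lemma AE_component:
  assumes m: "m \<in> states r" and gen: "generic_times (cyl_measure m) N"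
  shows "AE y in cyl_measure m. extremal (component N y) \<and> limcost N y \<noteq> \<infinity> \<and> limcost N y \<noteq> 0 \<and> limfreq N [] y = 1"
proof -
  note st = states_bounds(1)[OF m]
  interpret shift_measure "cyl_measure m" by (rule shift_measure_cyl_measure[OF st])
  have sm: "strict_mono N" using gen by (simp add: generic_times_def)
  have "(\<integral>\<^sup>+y. limcost N y \<partial>cyl_measure m) \<noteq> \<infinity>"
    using nn_integral_limcost[OF st gen] states_bounds(5)[OF m] by (auto simp: top_unique)
  then have "AE y in cyl_measure m. limcost N y \<noteq> \<infinity>"
    by (rule nn_integral_noteq_infinite[rotated]) measurable
  moreover have "AE y in cyl_measure m. \<forall>w. liminf (\<lambda>k. dispersion (N k) w (\<lambda>v. limfreq N v y)) = 0"
    using AE_dispersion_limfreq[OF gen] by (simp add: AE_all_countable)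
  ultimately show ?thesis
    using AE_stationary_limfreq[OF gen]
  proof eventually_elim
    case (elim y)
    then obtain t where t: "limcost N y = ennreal t" "0 \<le> t" by (cases "limcost N y") auto
    have "extremal (\<lambda>w. limfreq N w y / t)"
      using extremalI_dispersion[of "\<lambda>w. limfreq N w y" t N] elim t sm by (simp add: limcost_def)
    moreover have "limcost N y \<noteq> 0"
      using mass_le_cost[of "\<lambda>w. limfreq N w y" "[]"] elim by (auto simp: limcost_def)
    ultimately show ?case using elim t by (simp add: component_def[abs_def])
  qed
qed

text \<open>The density \<open>limcost\<close> undoes the normalization of the components, so the
  image measure has total mass \<open>cost r m = t\<close> and the correct coordinates. The deficit
  \<open>1 - t\<close> becomes an atom at the extreme point zero, which contributes nothing to the
  coordinates.\<close>

lemma representing_measure_exists: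
  assumes m: "m \<in> states r"
  shows "\<exists>P. prob_space P \<and> sets P = sets borel \<and>
    emeasure P {e. e extreme_point_of (embed ` states r)} = 1 \<and> represents P (embed m)"
proof -
  let ?E = "{e. e extreme_point_of (embed ` states r)}"
  let ?M = "cyl_measure m"
  note b = states_bounds[OF m]
  interpret shift_measure ?M by (rule shift_measure_cyl_measure[OF b(1)])
  obtain N where gen: "generic_times ?M N" using generic_times_exist by blast
  note AE = AE_component[OF m gen]
  have E [measurable]: "?E \<in> sets borel" by (rule borel_extreme_points[OF compact_states convex_states])
  obtain t where t: "cost r m = ennreal t" "0 \<le> t" "t \<le> 1"
    using b(5) by (cases "cost r m") (auto simp: ennreal_le_1 top_unique)
  define P0 where "P0 = distr (density ?M (limcost N)) borel (\<lambda>y. embed (component N y))"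
  have sP0 [measurable_cong]: "sets P0 = sets borel" by (simp add: P0_def)
  have P0: "(\<integral>\<^sup>+z. f z \<partial>P0) = (\<integral>\<^sup>+y. limcost N y * f (embed (component N y)) \<partial>?M)"
    if [measurable]: "f \<in> borel_measurable borel" for f
    unfolding P0_def by (simp add: nn_integral_distr nn_integral_density)
  define D where "D = density (return borel (0 :: nat \<Rightarrow>\<^sub>C real)) (\<lambda>_. ennreal (1 - t))"
  have sD [measurable_cong]: "sets D = sets borel" by (simp add: D_def)
  have D: "(\<integral>\<^sup>+z. f z \<partial>D) = ennreal (1 - t) * f 0" if [measurable]: "f \<in> borel_measurable borel" for f
    unfolding D_def by (simp add: nn_integral_density nn_integral_return)
  obtain P where sP: "sets P = sets P0" and P: "\<And>A. A \<in> sets P0 \<Longrightarrow> emeasure P A = emeasure P0 A + emeasure D A"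
    using add_measure_exists[of D P0] sP0 sD by auto
  have sP' [measurable_cong]: "sets P = sets borel" using sP sP0 by simp
  have spP: "space P = UNIV" using sets_eq_imp_space_eq[OF sP'] by simp
  have nnP: "(\<integral>\<^sup>+z. f z \<partial>P) = (\<integral>\<^sup>+y. limcost N y * f (embed (component N y)) \<partial>?M) + ennreal (1 - t) * f 0"
    if [measurable]: "f \<in> borel_measurable borel" for f
  proof -
    have "(\<integral>\<^sup>+z. f z \<partial>P) = (\<integral>\<^sup>+z. f z \<partial>P0) + (\<integral>\<^sup>+z. f z \<partial>D)"
      by (rule nn_integral_emeasure_add) (use sP0 sD sP P in auto)
    then show ?thesis by (simp add: P0 D)
  qed
  have ext0: "0 \<in> ?E"
  proof -
    have "embed (\<lambda>w. 0) = 0" by (rule bcontfun_eqI) (simp add: apply_embed)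
    then show ?thesis using extreme_point_iff[OF zero_in_states] extremal_zero by simp
  qed
  have full: "emeasure P ?E = 1"
  proof -
    have "emeasure P ?E = (\<integral>\<^sup>+z. indicator ?E z \<partial>P)" by simp
    also have "\<dots> = (\<integral>\<^sup>+y. limcost N y * indicator ?E (embed (component N y)) \<partial>?M) + ennreal (1 - t)"
      using ext0 by (subst nnP) auto
    also have "(\<integral>\<^sup>+y. limcost N y * indicator ?E (embed (component N y)) \<partial>?M) = (\<integral>\<^sup>+y. limcost N y \<partial>?M)"
    proof (rule nn_integral_cong_AE)
      show "AE y in ?M. limcost N y * indicator ?E (embed (component N y)) = limcost N y"
        using AE
      proof eventually_elim
        case (elim y)
        then have "component N y \<in> states r" by (simp add: extremal_def)
        then show ?case using extreme_point_iff elim by simp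
      qed
    qed
    also have "\<dots> = ennreal t" using nn_integral_limcost[OF b(1) gen] t by simp
    also have "\<dots> + ennreal (1 - t) = 1" using t by (simp flip: ennreal_plus)
    finally show ?thesis .
  qed
  have prob: "prob_space P"
  proof
    have "emeasure P (space P) = (\<integral>\<^sup>+z. 1 \<partial>P)" by simp
    also have "\<dots> = ennreal t + ennreal (1 - t)"
      using nn_integral_limcost[OF b(1) gen] t by (subst nnP) auto
    also have "\<dots> = 1" using t by (simp flip: ennreal_plus)
    finally show "emeasure P (space P) = 1" .
  qed
  interpret P: prob_space P by fact
  have AE_E: "AE z in P. z \<in> ?E" using full E sP' by (subst P.AE_in_set_eq_1) (auto simp: P.emeasure_eq_measure)
  have "?E \<subseteq> cube" using states_subset_cube by (auto simp: extreme_point_of_def)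
  then have AE_cube: "AE z in P. z \<in> cube" using AE_E by (auto elim: eventually_mono)
  have "represents P (embed m)"
  proof (rule represents_cubeI[OF prob sP' AE_cube])
    show "embed m \<in> cube" using m states_subset_cube by blast
    fix n
    let ?w = "from_nat n :: nat list"
    have "(\<integral>\<^sup>+z. ennreal (apply_bcontfun z n) \<partial>P) =
        (\<integral>\<^sup>+y. limcost N y * ennreal (apply_bcontfun (embed (component N y)) n) \<partial>?M)"
      by (subst nnP) (auto simp: zero_bcontfun.rep_eq)
    \<comment> \<open>The factor \<open>limcost\<close> cancels the denominator of
      \<open>component\<close> and leaves the limit frequency, whose integral is the weight.\<close>
    also have "\<dots> = (\<integral>\<^sup>+y. ennreal ((1 / 2) ^ n) * ennreal (limfreq N ?w y) \<partial>?M)"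
    proof (rule nn_integral_cong_AE)
      show "AE y in ?M. limcost N y * ennreal (apply_bcontfun (embed (component N y)) n) =
          ennreal ((1 / 2) ^ n) * ennreal (limfreq N ?w y)"
        using AE
      proof eventually_elim
        case (elim y)
        then obtain s where s: "limcost N y = ennreal s" "0 < s"
          by (cases "limcost N y") (auto simp: less_le)
        have "component N y \<in> states r" using elim by (simp add: extremal_def)
        then have "apply_bcontfun (embed (component N y)) n = (1 / 2) ^ n * (limfreq N ?w y / s)"
          using states_bounds(3,4)[of "component N y" ?w] s by (simp add: apply_embed) (simp add: component_def)
        then show ?case
          using s limfreq_nonneg[of N ?w y] by (simp flip: ennreal_mult)
      qed
    qed
    also have "\<dots> = ennreal ((1 / 2) ^ n) * ennreal (m ?w)"
      by (simp add: nn_integral_cmult nn_integral_limfreq_eq_emeasure[OF gen] emeasure_cyl_measure[OF b(2)])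
    also have "\<dots> = ennreal (apply_bcontfun (embed m) n)"
      using b(3,4)[of ?w] by (simp add: apply_embed ennreal_mult)
    finally show "(\<integral>\<^sup>+z. ennreal (apply_bcontfun z n) \<partial>P) = ennreal (apply_bcontfun (embed m) n)" .
  qed
  with prob sP' full show ?thesis by blast
qed

text \<open>
  The limit frequency \<open>f\<close> is shift invariant with values in \<open>[0, 1]\<close>, so multiplying the measure by
  \<open>f\<close> and by \<open>1 - f\<close> splits it into two invariant ones; both are proportional to \<open>m\<close> by extremality.
\<close>

lemma AE_limfreq_extremal:
  assumes ext: "extremal m" and m0: "m [] \<noteq> 0" and gen: "generic_times (cyl_measure m) N"
  shows "AE y in cyl_measure m. limfreq N w y = m w / m []"
proof -
  have m: "m \<in> states r" using ext by (simp add: extremal_def)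
  note b = states_bounds[OF m]
  let ?M = "cyl_measure m"
  interpret shift_measure ?M by (rule shift_measure_cyl_measure[OF b(1)])
  have sm: "strict_mono N" using gen by (simp add: generic_times_def)
  have st: "stationary (\<lambda>v. measure (density ?M (\<lambda>y. ennreal (f y))) (cyl v))"
    and fin: "finite_measure (density ?M (\<lambda>y. ennreal (f y)))"
    if [measurable]: "f \<in> borel_measurable borel" and f: "\<And>y. f (left_shift y) = f y" "\<And>y. f y \<le> 1" for f
  proof -
    have fi: "emeasure (density ?M (\<lambda>y. ennreal (f y))) UNIV \<le> emeasure ?M UNIV"
    proof -
      have "(\<integral>\<^sup>+y. ennreal (f y) \<partial>?M) \<le> (\<integral>\<^sup>+y. 1 \<partial>?M)"
        using f(2) by (intro nn_integral_mono) (simp add: ennreal_le_1)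
      then show ?thesis by (simp add: emeasure_density)
    qed
    show fin: "finite_measure (density ?M (\<lambda>y. ennreal (f y)))"
      by (rule finite_measureI) (use fi in \<open>auto simp: emeasure_eq_measure top_unique\<close>)
    have "distr (density ?M (\<lambda>y. ennreal (f y))) borel left_shift = density ?M (\<lambda>y. ennreal (f y))"
    proof (rule measure_eqI)
      fix A assume "A \<in> sets (distr (density ?M (\<lambda>y. ennreal (f y))) borel left_shift)"
      then have [measurable]: "A \<in> sets borel" by simp
      have "emeasure (distr (density ?M (\<lambda>y. ennreal (f y))) borel left_shift) A =
          emeasure (density ?M (\<lambda>y. ennreal (f y))) (left_shift -` A)"
        by (subst emeasure_distr) auto
      also have "\<dots> = (\<integral>\<^sup>+y. ennreal (f y) * indicator (left_shift -` A) y \<partial>?M)"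
        using measurable_sets[OF left_shift_measurable, of A] by (simp add: emeasure_density)
      also have "\<dots> = (\<integral>\<^sup>+y. (\<lambda>y. ennreal (f y) * indicator A y) ((left_shift ^^ 1) y) \<partial>?M)"
        by (simp add: f indicator_vimage[symmetric] vimage_def indicator_def)
      also have "\<dots> = (\<integral>\<^sup>+y. ennreal (f y) * indicator A y \<partial>?M)"
        by (rule nn_integral_funpow) measurable
      finally show "emeasure (distr (density ?M (\<lambda>y. ennreal (f y))) borel left_shift) A = emeasure (density ?M (\<lambda>y. ennreal (f y))) A"
        by (simp add: emeasure_density)
    qed simp
    with fin show "stationary (\<lambda>v. measure (density ?M (\<lambda>y. ennreal (f y))) (cyl v))"
      by (intro stationary_measure) auto
  qed
  define m' where "m' v = measure (density ?M (\<lambda>y. ennreal (limfreq N w y))) (cyl v)" for v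
  have st1: "stationary m'"
    unfolding m'_def by (rule st) (auto simp: limfreq_left_shift[OF sm] limfreq_le_1)
  interpret F1: finite_measure "density ?M (\<lambda>y. ennreal (limfreq N w y))"
    by (rule fin) (auto simp: limfreq_left_shift[OF sm] limfreq_le_1)
  interpret F2: finite_measure "density ?M (\<lambda>y. ennreal (1 - limfreq N w y))"
    by (rule fin) (auto simp: limfreq_left_shift[OF sm] limfreq_nonneg)
  have sum: "m v - m' v = measure (density ?M (\<lambda>y. ennreal (1 - limfreq N w y))) (cyl v)" for v
  proof -
    have "emeasure (density ?M (\<lambda>y. ennreal (limfreq N w y))) (cyl v) + emeasure (density ?M (\<lambda>y. ennreal (1 - limfreq N w y))) (cyl v)
        = (\<integral>\<^sup>+y. ennreal (limfreq N w y) * indicator (cyl v) y + ennreal (1 - limfreq N w y) * indicator (cyl v) y \<partial>?M)"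
      by (subst nn_integral_add) (auto simp: emeasure_density)
    also have "\<dots> = (\<integral>\<^sup>+y. indicator (cyl v) y \<partial>?M)"
      using limfreq_nonneg limfreq_le_1
      by (intro nn_integral_cong) (simp flip: distrib_right ennreal_plus)
    finally have "ennreal (m' v + measure (density ?M (\<lambda>y. ennreal (1 - limfreq N w y))) (cyl v)) = ennreal (m v)"
      by (simp add: emeasure_cyl_measure[OF b(2)] m'_def F1.emeasure_eq_measure F2.emeasure_eq_measure)
    then show ?thesis using b(3)[of v] by (subst (asm) ennreal_inj) (auto simp: m'_def)
  qed
  have st2: "stationary (\<lambda>v. m v - m' v)"
    unfolding sum by (rule st) (auto simp: limfreq_left_shift[OF sm] limfreq_nonneg)
  have "m' [] = m w"
  proof -
    have "ennreal (m' []) = (\<integral>\<^sup>+y. ennreal (limfreq N w y) \<partial>?M)"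
      unfolding m'_def F1.emeasure_eq_measure[symmetric] by (simp add: emeasure_density)
    also have "\<dots> = ennreal (m w)"
      by (simp only: nn_integral_limfreq_eq_emeasure[OF gen] emeasure_cyl_measure[OF b(2)])
    finally show ?thesis using b(3)[of w] by (subst (asm) ennreal_inj) (auto simp: m'_def)
  qed
  then have prp: "m' v = m w / m [] * m v" for v
    using extremal_proportional[OF ext m0 st1 st2, of v] by simp
  have c: "0 \<le> m w / m []" using b(3) by simp
  \<comment> \<open>Both densities give the same measure of all cylinders, so they agree almost
    everywhere.\<close>
  have "density ?M (\<lambda>y. ennreal (limfreq N w y)) = density ?M (\<lambda>y. ennreal (m w / m []))"
  proof (rule measure_eqI_cyl)
    fix v
    have "emeasure (density ?M (\<lambda>y. ennreal (limfreq N w y))) (cyl v) = ennreal (m' v)"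
      by (simp add: m'_def F1.emeasure_eq_measure)
    also have "\<dots> = ennreal (m w / m []) * ennreal (m v)"
      by (simp only: prp ennreal_mult[OF c b(3)])
    finally show "emeasure (density ?M (\<lambda>y. ennreal (limfreq N w y))) (cyl v) = emeasure (density ?M (\<lambda>y. ennreal (m w / m []))) (cyl v)"
      by (simp add: emeasure_density nn_integral_cmult emeasure_cyl_measure[OF b(2)])
  qed (auto simp: F1.emeasure_eq_measure)
  then have "AE y in ?M. ennreal (limfreq N w y) = ennreal (m w / m [])"
    by (intro density_unique) auto
  then show ?thesis
    by eventually_elim (use limfreq_nonneg c in \<open>simp add: ennreal_inj\<close>)
qed

text \<open>The limit frequencies are \<open>m\<close> divided by its mass on the base. Since an
  extreme state with positive base mass has cost \<open>1\<close>, rescaling to cost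
  \<open>1\<close> returns \<open>m\<close>.\<close>

lemma component_extremal:
  assumes ext: "extremal m" and m0: "m [] \<noteq> 0" and gen: "generic_times (cyl_measure m) N"
  shows "AE y in cyl_measure m. component N y = m \<and> limcost N y = ennreal (1 / m [])"
proof -
  have m: "m \<in> states r" using ext by (simp add: extremal_def)
  note b = states_bounds[OF m]
  have "AE y in cyl_measure m. \<forall>w. limfreq N w y = m w / m []"
    using AE_limfreq_extremal[OF assms] by (simp add: AE_all_countable)
  then show ?thesis
  proof eventually_elim
    case (elim y)
    have p: "0 < m []" using m0 b(3)[of "[]"] by simp
    have "limcost N y = cost r (\<lambda>w. inverse (m []) * m w)"
      unfolding limcost_def by (simp add: elim divide_inverse mult.commute)
    also have "\<dots> = ennreal (inverse (m []))"
      using p b(2) cost_extremal[OF ext m0] by (subst cost_scale) auto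
    finally have lc: "limcost N y = ennreal (1 / m [])" by (simp add: inverse_eq_divide)
    then have "component N y = m" using p by (intro HOL.ext) (simp add: component_def elim)
    with lc show ?case by simp
  qed
qed

text \<open>Sends the image of a state to its measure on sequences. The null measure off the compact
  set makes this a measurable kernel on the whole space; it is sub-Markov because states have base
  mass at most \<open>1\<close>.\<close>

definition kernel :: "(nat \<Rightarrow>\<^sub>C real) \<Rightarrow> (nat \<Rightarrow> nat) measure" where
  "kernel z = (if z \<in> embed ` states r then cyl_measure (decode z) else null_measure borel)"

lemma kernel_embed: "m \<in> states r \<Longrightarrow> kernel (embed m) = cyl_measure m"
  by (simp add: kernel_def decode_embed_states)

lemma kernel_measurable [measurable]: "kernel \<in> measurable borel (subprob_algebra borel)"
proof (rule measurable_subprob_algebra_generated[OF sets_borel_eq_sigma_cyl Int_stable_cyl])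
  have K [measurable]: "embed ` states r \<in> sets borel"
    using compact_states by (simp add: compact_imp_closed)
  have em: "emeasure (kernel z) (cyl w) = (if z \<in> embed ` states r then ennreal (decode z w) else 0)" for z w
    using states_bounds(2)
    by (auto simp: kernel_def decode_embed_states emeasure_cyl_measure)
  show "sets (kernel z) = sets borel" for z by (simp add: kernel_def)
  show "subprob_space (kernel z)" for z
  proof
    have sp: "space (kernel z) = cyl []" by (simp add: kernel_def)
    show "emeasure (kernel z) (space (kernel z)) \<le> 1"
      unfolding sp em using states_bounds(4) by (auto simp: decode_embed_states ennreal_le_1)
    show "space (kernel z) \<noteq> {}" unfolding sp by simp
  qed
  have m: "(\<lambda>z. emeasure (kernel z) (cyl w)) \<in> borel_measurable borel" for w
    unfolding em by measurable
  then show "(\<lambda>z. emeasure (kernel z) A) \<in> borel_measurable borel" if "A \<in> insert {} (range cyl)" for A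
    using that by auto
  show "(\<lambda>z. emeasure (kernel z) UNIV) \<in> borel_measurable borel" using m[of "[]"] by simp
qed auto

text \<open>
  The measure of \<open>m\<close> is the mixture of the ergodic measures of the points of the support of \<open>P\<close>.
  The limit frequencies at a point tell in which ergodic measure it lies, so they recover \<open>P\<close>.
\<close>

lemma representing_measure_formula:
  assumes m: "m \<in> states r" and gen: "generic_times (cyl_measure m) N"
    and P: "prob_space P" "sets P = sets borel" "represents P (embed m)"
      "emeasure P {e. e extreme_point_of (embed ` states r)} = 1"
    and S [measurable]: "S \<in> sets borel" and "0 \<notin> S"
  shows "emeasure P S = (\<integral>\<^sup>+y. limcost N y * indicator S (embed (component N y)) \<partial>cyl_measure m)"
proof -
  let ?E = "{e. e extreme_point_of (embed ` states r)}"
  let ?M = "cyl_measure m"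
  interpret P: prob_space P by fact
  note b = states_bounds[OF m] and [measurable_cong] = P(2)
  have sm: "strict_mono N" using gen by (simp add: generic_times_def)
  have E [measurable]: "?E \<in> sets borel" by (rule borel_extreme_points[OF compact_states convex_states])
  have AE_E: "AE z in P. z \<in> ?E" using P(4) E P(2) by (subst P.AE_in_set_eq_1) (auto simp: P.emeasure_eq_measure)
  have EK: "?E \<subseteq> embed ` states r" by (auto simp: extreme_point_of_def)
  have AE_cube: "AE z in P. z \<in> cube"
    using AE_E EK states_subset_cube by (auto elim: eventually_mono)
  have spP: "space P = UNIV" using sets_eq_imp_space_eq[OF P(2)] by simp
  have kP [measurable]: "kernel \<in> measurable P (subprob_algebra borel)" by measurable
  \<comment> \<open>The cylinder values of \<open>kernel z\<close> are multiples of the coordinates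
    of \<open>z\<close>, and these integrate to the coordinates of the barycentre.\<close>
  have bind: "P \<bind> kernel = ?M"
  proof (rule cyl_measure_unique[OF b(2)])
    show "sets (P \<bind> kernel) = sets borel" by (rule sets_bind) (auto simp: kernel_def spP)
    fix w :: "nat list"
    let ?n = "to_nat w"
    have "emeasure (P \<bind> kernel) (cyl w) = (\<integral>\<^sup>+z. emeasure (kernel z) (cyl w) \<partial>P)"
      by (rule emeasure_bind[OF _ kP]) (auto simp: spP)
    also have "\<dots> = (\<integral>\<^sup>+z. ennreal (2 ^ ?n) * ennreal (apply_bcontfun z ?n) \<partial>P)"
    proof (rule nn_integral_cong_AE)
      show "AE z in P. emeasure (kernel z) (cyl w) = ennreal (2 ^ ?n) * ennreal (apply_bcontfun z ?n)"
        using AE_E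
      proof eventually_elim
        case (elim z)
        then obtain m' where m': "m' \<in> states r" "z = embed m'" using EK by blast
        have "0 \<le> apply_bcontfun z ?n" using m' states_subset_cube cube_bounds(1) by blast
        then show ?case
          using emeasure_cyl_measure[OF states_bounds(2)[OF m'(1)], of w] decode_embed_states[OF m'(1)]
          by (simp add: m'(2) kernel_embed[OF m'(1)] ennreal_mult[symmetric] decode_def fun_eq_iff)
      qed
    qed
    also have "\<dots> = ennreal (2 ^ ?n) * ennreal (apply_bcontfun (embed m) ?n)"
      by (simp add: nn_integral_cmult represents_cubeD[OF P(1,2) AE_cube P(3)])
    also have "\<dots> = ennreal (m w)"
      using b(3,4)[of w] by (simp add: apply_embed power_divide flip: ennreal_mult)
    finally show "emeasure (P \<bind> kernel) (cyl w) = ennreal (m w)" .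
  qed
  have pred: "Measurable.pred borel (\<lambda>y. \<forall>w. convergent (\<lambda>k. freq (N k) w y))"
  proof -
    have "{y \<in> space borel. convergent (\<lambda>k. freq (N k) w y)} \<in> sets borel" for w :: "nat list"
      unfolding Cauchy_convergent_iff[symmetric] by (rule sets_Collect_Cauchy) measurable
    then have "Measurable.pred borel (\<lambda>y. convergent (\<lambda>k. freq (N k) w y))" for w :: "nat list"
      by (simp add: pred_def)
    then show ?thesis by measurable
  qed
  \<comment> \<open>Times that are generic for the mixture are generic for almost every constituent,
    so one \<open>N\<close> serves \<open>?M\<close> and the extreme measures alike.\<close>
  have "AE y in P \<bind> kernel. \<forall>w. convergent (\<lambda>k. freq (N k) w y)"
    unfolding bind using gen by (simp add: generic_times_def)
  then have AE_gen: "AE z in P. generic_times (kernel z) N"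
    by (simp only: AE_bind[OF kP pred] generic_times_def sm simp_thms)
  have "(\<integral>\<^sup>+y. limcost N y * indicator S (embed (component N y)) \<partial>?M) =
      (\<integral>\<^sup>+z. \<integral>\<^sup>+y. limcost N y * indicator S (embed (component N y)) \<partial>kernel z \<partial>P)"
    using nn_integral_bind[OF _ kP, of "\<lambda>y. limcost N y * indicator S (embed (component N y))"] by (simp add: bind)
  also have "\<dots> = (\<integral>\<^sup>+z. indicator S z \<partial>P)"
  proof (rule nn_integral_cong_AE)
    show "AE z in P. (\<integral>\<^sup>+y. limcost N y * indicator S (embed (component N y)) \<partial>kernel z) = indicator S z"
      using AE_E AE_gen
    proof eventually_elim
      case (elim z)
      then obtain m' where m': "m' \<in> states r" "z = embed m'" using EK by blast
      have ext: "extremal m'" using elim(1) extreme_point_iff[OF m'(1)] m'(2) by simp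
      have k: "kernel z = cyl_measure m'" using m' kernel_embed by simp
      have em: "emeasure (cyl_measure m') UNIV = ennreal (m' [])"
        using emeasure_cyl_measure[OF states_bounds(2)[OF m'(1)], of "[]"] by simp
      show ?case
      \<comment> \<open>The kernel at zero is the null measure, so the mixture does not see an atom
        of \<open>P\<close> at zero; this is why \<open>S\<close> must avoid it.\<close>
      proof (cases "m' [] = 0")
        case True
        then have "m' = (\<lambda>w. 0)" using stationary_zeroI states_bounds(1)[OF m'(1)] by blast
        then have "z = 0" unfolding m'(2) by (intro bcontfun_eqI) (simp add: apply_embed)
        moreover have "AE y in cyl_measure m'. False"
          using em True by (subst AE_iff_measurable[of UNIV]) auto
        then have "(\<integral>\<^sup>+y. limcost N y * indicator S (embed (component N y)) \<partial>cyl_measure m') = (\<integral>\<^sup>+y. 0 \<partial>cyl_measure m')"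
          by (intro nn_integral_cong_AE) (auto elim: eventually_mono)
        ultimately show ?thesis using \<open>0 \<notin> S\<close> k by simp
      next
        case False
        have "(\<integral>\<^sup>+y. limcost N y * indicator S (embed (component N y)) \<partial>cyl_measure m') =
            (\<integral>\<^sup>+y. ennreal (1 / m' []) * indicator S z \<partial>cyl_measure m')"
          using component_extremal[OF ext False elim(2)[unfolded k]] m'(2)
          by (intro nn_integral_cong_AE) (auto elim: eventually_mono)
        also have "\<dots> = indicator S z * (ennreal (1 / m' []) * ennreal (m' []))"
          by (simp add: em ac_simps)
        also have "ennreal (1 / m' []) * ennreal (m' []) = 1"
          using False states_bounds(3)[OF m'(1), of "[]"] by (simp flip: ennreal_mult)
        finally show ?thesis by (simp add: k)
      qed
    qed
  qed
  also have "\<dots> = emeasure P S" using P(2) by simp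
  finally show ?thesis ..
qed

text \<open>Away from zero the formula for a representing measure involves only \<open>m\<close> and
  \<open>N\<close>. The mass at zero is then determined as the complement to total mass
  \<open>1\<close>.\<close>

theorem choquet_simplex_states: "choquet_simplex (embed ` states r)"
  unfolding choquet_simplex_def
proof (intro conjI ballI compact_states convex_states)
  fix x assume "x \<in> embed ` states r"
  then obtain m where m: "m \<in> states r" "x = embed m" by auto
  let ?E = "{e. e extreme_point_of (embed ` states r)}"
  let ?Q = "\<lambda>P. prob_space P \<and> sets P = sets borel \<and> emeasure P ?E = 1 \<and> represents P x"
  obtain N where gen: "generic_times (cyl_measure m) N"
    using shift_measure.generic_times_exist[OF shift_measure_cyl_measure[OF states_bounds(1)[OF m(1)]]] by blast
  have "P = P'" if P: "?Q P" and P': "?Q P'" for P P'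
  proof (rule measure_eqI)
    interpret P: prob_space P using P by simp
    interpret P': prob_space P' using P' by simp
    have sp: "space P = UNIV" "space P' = UNIV"
      using P P' sets_eq_imp_space_eq[of P borel] sets_eq_imp_space_eq[of P' borel] by simp_all
    have away: "emeasure P S = emeasure P' S" if "S \<in> sets borel" "0 \<notin> S" for S
      using representing_measure_formula[OF m(1) gen _ _ _ _ that] P P' m(2) by simp
    have zero: "emeasure P {0} = emeasure P' {0}"
    proof -
      have "emeasure Q {0} = 1 - emeasure Q (UNIV - {0})" if "prob_space Q" "sets Q = sets borel" "space Q = UNIV" for Q :: "(nat \<Rightarrow>\<^sub>C real) measure"
      proof -
        interpret prob_space Q by fact
        have "UNIV - {0} \<in> sets Q" using borel_open[OF open_Diff[OF open_UNIV closed_singleton]] that(2) by simp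
        from emeasure_compl[OF this] show ?thesis using that emeasure_space_1
          by (simp add: Diff_Diff_Int)
      qed
      then have "emeasure P {0} = 1 - emeasure P (UNIV - {0})" "emeasure P' {0} = 1 - emeasure P' (UNIV - {0})"
        using P P' sp by blast+
      moreover have "emeasure P (UNIV - {0}) = emeasure P' (UNIV - {0})" by (rule away) auto
      ultimately show ?thesis by simp
    qed
    fix S assume "S \<in> sets P"
    then have S: "S \<in> sets borel" using P by simp
    have split: "emeasure Q S = emeasure Q (S - {0}) + (if 0 \<in> S then emeasure Q {0} else 0)" if "sets Q = sets borel" for Q
    proof (cases "0 \<in> S")
      case True
      then have S_eq: "(S - {0}) \<union> {0} = S" by auto
      have "emeasure Q ((S - {0}) \<union> {0}) = emeasure Q (S - {0}) + emeasure Q {0}"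
        using S that by (intro plus_emeasure[symmetric]) auto
      then show ?thesis unfolding S_eq using True by simp
    qed simp
    show "emeasure P S = emeasure P' S"
    proof -
      have "emeasure P (S - {0}) = emeasure P' (S - {0})" by (rule away) (use S in auto)
      moreover have "sets P = sets borel" "sets P' = sets borel" using P P' by blast+
      ultimately show ?thesis by (simp only: split zero)
    qed
  qed (simp add: P P')
  moreover have "\<exists>P. ?Q P" using representing_measure_exists[OF m(1)] m(2) by simp
  ultimately show "\<exists>!P. ?Q P" by blast
qed

end

section \<open>Periodic states are dense\<close>

text \<open>\<open>\<rho>\<close> is the roof in units of \<open>c\<close>. Only variations of order
  at least \<open>2\<close> are controlled, since the roof may oscillate without bound on cylinders
  of length one.\<close>

locale roofed_shift =
  fixes B :: "nat \<Rightarrow> nat \<Rightarrow> bool" and \<rho> :: "(nat \<Rightarrow> nat) \<Rightarrow> real" and v :: "nat \<Rightarrow> real"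
  assumes rho_ge_1: "x \<in> markov_shift B \<Longrightarrow> 1 \<le> \<rho> x"
    and rho_var: "x \<in> markov_shift B \<Longrightarrow> y \<in> markov_shift B \<Longrightarrow> 2 \<le> n \<Longrightarrow> (\<And>i. i < n \<Longrightarrow> x i = y i) \<Longrightarrow>
      \<bar>\<rho> x - \<rho> y\<bar> \<le> v n"
    and v_nonneg: "0 \<le> v n" and v_lim: "v \<longlonglongrightarrow> 0"
    and rho_tail: "\<exists>k. \<forall>x\<in>markov_shift B. k \<le> x 0 \<longrightarrow> real j \<le> \<rho> x"
    and connected: "\<exists>x\<in>markov_shift B. \<exists>l\<ge>1. x 0 = a \<and> x l = b"
begin

definition r :: "nat list \<Rightarrow> ennreal" where
  "r w = (INF x\<in>cylinder B w. ennreal (\<rho> x))"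

sublocale word_cost r
proof
  show "r w \<le> r (w @ [a])" for w a
    unfolding r_def by (rule INF_superset_mono) (auto simp: cylinder_eq mem_cyl_snoc)
  show "1 \<le> r w" for w
    unfolding r_def using rho_ge_1 by (intro INF_greatest) (auto simp: cylinder_eq)
  show "\<exists>k. \<forall>a\<ge>k. ennreal (real j) \<le> r [a]" for j
  proof -
    obtain k where k: "\<And>x. x \<in> markov_shift B \<Longrightarrow> k \<le> x 0 \<Longrightarrow> real j \<le> \<rho> x"
      using rho_tail by blast
    have "ennreal (real j) \<le> r [a]" if "k \<le> a" for a
      unfolding r_def using k that
      by (intro INF_greatest) (auto simp: cylinder_eq mem_cyl_Cons intro!: ennreal_leI simp del: ennreal_of_nat_eq_real_of_nat)
    then show ?thesis by blast
  qed
qed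

text \<open>Uniform continuity makes the infima over shrinking cylinders around \<open>x\<close>
  converge to the value at \<open>x\<close>.\<close>

lemma roof_eq:
  assumes x: "x \<in> markov_shift B"
  shows "roof r x = ennreal (\<rho> x)"
proof (rule antisym)
  have xc: "x \<in> cylinder B (map x [0..<n])" for n using x by (simp add: cylinder_eq mem_cyl_iff)
  show "roof r x \<le> ennreal (\<rho> x)"
    unfolding roof_def r_def using xc by (intro SUP_least INF_lower2) auto
  show "ennreal (\<rho> x) \<le> roof r x"
  proof (rule ennreal_le_epsilon)
    fix e :: real assume "0 < e"
    then have "eventually (\<lambda>n. v n < e) sequentially" using order_tendstoD(2)[OF v_lim] by simp
    then obtain n where n: "2 \<le> n" "v n < e"
      unfolding eventually_sequentially by (meson max.cobounded1 max.cobounded2)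
    have "ennreal (\<rho> x - e) \<le> r (map x [0..<n])"
      unfolding r_def
    proof (rule INF_greatest)
      fix y assume "y \<in> cylinder B (map x [0..<n])"
      then have y: "y \<in> markov_shift B" "\<And>i. i < n \<Longrightarrow> x i = y i" by (auto simp: cylinder_eq cyl_def)
      show "ennreal (\<rho> x - e) \<le> ennreal (\<rho> y)"
        using rho_var[OF x y(1) n(1) y(2)] n(2) by (intro ennreal_leI) (simp add: abs_le_iff)
    qed
    also have "\<dots> \<le> roof r x" unfolding roof_def by (rule SUP_upper) simp
    finally have "ennreal (\<rho> x - e) + ennreal e \<le> roof r x + ennreal e" by (rule add_right_mono)
    moreover have "ennreal (\<rho> x) \<le> ennreal (\<rho> x - e) + ennreal e"
    proof (cases "e \<le> \<rho> x")
      case True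
      then show ?thesis using \<open>0 < e\<close> by (simp flip: ennreal_plus)
    next
      case False
      then show ?thesis using \<open>0 < e\<close> by (simp add: ennreal_neg ennreal_leI)
    qed
    ultimately show "ennreal (\<rho> x) \<le> roof r x + ennreal e" by (rule order_trans[rotated])
  qed
qed

text \<open>A forbidden transition empties the cylinder of an initial word, and an infimum over the
  empty set is infinity. So finite cost forces a measure onto the shift space.\<close>

lemma roof_outside:
  assumes "x \<notin> markov_shift B"
  shows "roof r x = \<infinity>"
proof -
  obtain n where n: "\<not> B (x n) (x (Suc n))" using assms by (auto simp: markov_shift_def)
  have "cylinder B (map x [0..<n + 2]) = {}"
  proof (rule ccontr)
    assume "cylinder B (map x [0..<n + 2]) \<noteq> {}"
    then obtain y where y: "y \<in> markov_shift B" "\<forall>j<n + 2. y j = x j"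
      by (auto simp: cylinder_eq cyl_def simp del: upt_Suc)
    then have "y n = x n" "y (Suc n) = x (Suc n)" by auto
    with n y(1) show False unfolding markov_shift_def by (metis mem_Collect_eq)
  qed
  then have "r (map x [0..<n + 2]) = \<infinity>" unfolding r_def by (simp del: upt_Suc)
  moreover have "r (map x [0..<n + 2]) \<le> roof r x" unfolding roof_def by (rule SUP_upper) simp
  ultimately show ?thesis by (simp add: top_unique)
qed

subsection \<open>Orbit segments\<close>

definition total_var :: "nat \<Rightarrow> real" where
  "total_var n = (\<Sum>i<n. v (i + 2))"

lemma total_var_mono: "m \<le> n \<Longrightarrow> total_var m \<le> total_var n"
  unfolding total_var_def by (rule sum_mono2) (auto simp: v_nonneg)

text \<open>From some index on every further summand is below \<open>e\<close>; the earlier ones go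
  into the constant.\<close>

lemma total_var_sublinear:
  assumes "0 < e"
  shows "\<exists>D. \<forall>n. total_var n \<le> e * real n + D"
proof -
  obtain n0 where n0: "\<And>n. n0 \<le> n \<Longrightarrow> v n < e"
    using order_tendstoD(2)[OF v_lim assms] by (auto simp: eventually_sequentially)
  have "total_var n \<le> e * real n + total_var n0" for n
  proof (induction n)
    case 0
    show ?case by (simp add: total_var_def sum_nonneg v_nonneg)
  next
    case (Suc n)
    show ?case
    proof (cases "n0 \<le> n + 2")
      case True
      then show ?thesis using Suc n0[of "n + 2"] by (simp add: total_var_def algebra_simps)
    next
      case False
      then have "total_var (Suc n) \<le> total_var n0" by (intro total_var_mono) simp
      moreover have "0 \<le> e * real (Suc n)" using assms by simp
      ultimately show ?thesis by linarith
    qed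
  qed
  then show ?thesis by blast
qed

text \<open>The agreement includes place \<open>n\<close>, one beyond the summed places. So after
  \<open>i < n\<close> shifts there remain \<open>n - i + 1\<close> common letters, at least the two
  for which the variation is controlled.\<close>

lemma birkhoff_sum_rho_close:
  assumes x: "x \<in> markov_shift B" and y: "y \<in> markov_shift B" and agree: "\<And>i. i \<le> n \<Longrightarrow> x i = y i"
  shows "\<bar>birkhoff_sum \<rho> n x - birkhoff_sum \<rho> n y\<bar> \<le> total_var n"
proof -
  have "\<bar>birkhoff_sum \<rho> n x - birkhoff_sum \<rho> n y\<bar> \<le> (\<Sum>i<n. \<bar>\<rho> ((left_shift ^^ i) x) - \<rho> ((left_shift ^^ i) y)\<bar>)"
    unfolding birkhoff_sum_def sum_subtractf[symmetric] by (rule sum_abs)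
  also have "\<dots> \<le> (\<Sum>i<n. v (n - Suc i + 2))"
  proof (rule sum_mono)
    fix i assume i: "i \<in> {..<n}"
    show "\<bar>\<rho> ((left_shift ^^ i) x) - \<rho> ((left_shift ^^ i) y)\<bar> \<le> v (n - Suc i + 2)"
      using i by (intro rho_var shift_in_markov_shift x y) (auto simp: funpow_left_shift intro!: agree)
  qed
  also have "\<dots> = total_var n"
    unfolding total_var_def by (rule sum.nat_diff_reindex)
  finally show ?thesis .
qed

lemma birkhoff_sum_indicator_nonneg: "0 \<le> (birkhoff_sum (indicator A) n x :: real)"
  by (simp add: birkhoff_sum_def sum_nonneg)

text \<open>Only occurrences starting in the last \<open>length w\<close> places can depend on
  letters past the agreement.\<close>

lemma birkhoff_sum_indicator_close:
  assumes agree: "\<And>i. i < n \<Longrightarrow> x i = y i"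
  shows "\<bar>birkhoff_sum (indicator (cyl w)) n x - birkhoff_sum (indicator (cyl w)) n y\<bar> \<le> real (length w)"
proof -
  let ?f = "indicator (cyl w) :: (nat \<Rightarrow> nat) \<Rightarrow> real"
  define k where "k = n - length w"
  have n: "n = k + (n - k)" by (simp add: k_def)
  have "birkhoff_sum ?f k x = birkhoff_sum ?f k y"
  proof -
    have "(left_shift ^^ i) x \<in> cyl w \<longleftrightarrow> (left_shift ^^ i) y \<in> cyl w" if "i < k" for i
      using agree that unfolding k_def by (auto simp: cyl_def funpow_left_shift)
    then show ?thesis unfolding birkhoff_sum_def by (intro sum.cong) (auto simp: indicator_def)
  qed
  moreover define h where "h z = birkhoff_sum ?f (n - k) ((left_shift ^^ k) z)" for z
  have "birkhoff_sum ?f n z = birkhoff_sum ?f k z + h z" for z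
    unfolding h_def by (subst n) (rule birkhoff_sum_add)
  moreover have "h z \<le> real (length w)" "0 \<le> h z" for z
    using birkhoff_sum_indicator_le[of "cyl w" "n - k" "(left_shift ^^ k) z"] birkhoff_sum_indicator_nonneg
    by (simp_all add: k_def h_def)
  from this[of x] this[of y] have "\<bar>h x - h y\<bar> \<le> real (length w)" by linarith
  ultimately show ?thesis by simp
qed

definition join :: "(nat \<Rightarrow> nat) \<Rightarrow> nat \<Rightarrow> (nat \<Rightarrow> nat) \<Rightarrow> nat \<Rightarrow> nat" where
  "join x n y i = (if i < n then x i else y (i - n))"

lemma join_in_shift:
  assumes "x \<in> markov_shift B" "y \<in> markov_shift B" "x n = y 0"
  shows "join x n y \<in> markov_shift B"
proof -
  have "B (join x n y i) (join x n y (Suc i))" for i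
  proof -
    consider "Suc i < n" | "Suc i = n" | "n \<le> i" by linarith
    then show ?thesis
    proof cases
      case 2
      then have "B (x i) (x n)" using assms(1) by (auto simp: markov_shift_def)
      then show ?thesis using 2 assms(3) by (auto simp: join_def)
    qed (use assms(1,2) in \<open>auto simp: join_def markov_shift_def Suc_diff_le\<close>)
  qed
  then show ?thesis by (simp add: markov_shift_def)
qed

lemma join_left: "x n = y 0 \<Longrightarrow> i \<le> n \<Longrightarrow> join x n y i = x i"
  by (cases "i = n") (auto simp: join_def)

lemma join_right: "join x n y (n + i) = y i"
  by (simp add: join_def)

lemma funpow_join: "(left_shift ^^ n) (join x n y) = y"
  by (intro ext) (simp add: funpow_left_shift join_def)

definition periodic :: "(nat \<Rightarrow> nat) \<Rightarrow> nat \<Rightarrow> bool" where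
  "periodic z n \<longleftrightarrow> z \<in> markov_shift B \<and> 0 < n \<and> (left_shift ^^ n) z = z"

text \<open>Repeats the first \<open>n\<close> letters; the agreement at \<open>i = n\<close> comes
  from \<open>x n = x 0\<close> and is what the distortion estimate asks for.\<close>

lemma close_orbit:
  assumes x: "x \<in> markov_shift B" and n: "0 < n" "x n = x 0"
  obtains z where "periodic z n" "\<And>i. i \<le> n \<Longrightarrow> z i = x i"
proof
  define z where "z i = x (i mod n)" for i
  have "B (z i) (z (Suc i))" for i
  proof -
    have "B (x (i mod n)) (x (Suc (i mod n)))" using x by (simp add: markov_shift_def)
    moreover have "x (Suc (i mod n)) = x (Suc i mod n)"
      using n by (simp add: mod_Suc)
    ultimately show ?thesis by (simp add: z_def)
  qed
  moreover have "(left_shift ^^ n) z = z" by (intro ext) (simp add: funpow_left_shift z_def)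
  ultimately show "periodic z n" using n by (simp add: periodic_def markov_shift_def)
  show "z i = x i" if "i \<le> n" for i using that n by (cases "i = n") (auto simp: z_def)
qed

lemma close_two_segments:
  assumes x: "x \<in> markov_shift B" and y: "y \<in> markov_shift B"
    and ends: "x n = y 0" "y k = x 0" and "0 < n + k"
  obtains z where "periodic z (n + k)" "\<And>i. i \<le> n \<Longrightarrow> z i = x i"
    "\<And>i. i \<le> k \<Longrightarrow> (left_shift ^^ n) z i = y i"
proof -
  have "join x n y 0 = x 0" by (rule join_left[where x = x and n = n and y = y, OF ends(1)]) simp
  then have "join x n y (n + k) = join x n y 0" using ends by (simp add: join_right)
  then obtain z where z: "periodic z (n + k)" "\<And>i. i \<le> n + k \<Longrightarrow> z i = join x n y i"
    using close_orbit[OF join_in_shift[OF x y ends(1)] \<open>0 < n + k\<close>] by blast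
  show thesis
  proof (rule that[OF z(1)])
    show "z i = x i" if "i \<le> n" for i using z(2)[of i] that join_left[where x = x and n = n and y = y and i = i, OF ends(1) that] by simp
    show "(left_shift ^^ n) z i = y i" if "i \<le> k" for i
      using z(2)[of "n + i"] that join_right[of x n y i] by (simp add: funpow_left_shift add.commute)
  qed
qed

lemma two_segments_estimate:
  assumes z: "z \<in> markov_shift B" and x: "x \<in> markov_shift B" and y: "y \<in> markov_shift B"
    and agree: "\<And>i. i \<le> n \<Longrightarrow> z i = x i" "\<And>i. i \<le> k \<Longrightarrow> (left_shift ^^ n) z i = y i"
  shows "\<bar>birkhoff_sum \<rho> (n + k) z - (birkhoff_sum \<rho> n x + birkhoff_sum \<rho> k y)\<bar> \<le> total_var n + total_var k"
    and "\<bar>birkhoff_sum (indicator (cyl w)) (n + k) z -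
        (birkhoff_sum (indicator (cyl w)) n x + birkhoff_sum (indicator (cyl w)) k y)\<bar> \<le> 2 * real (length w)"
  using birkhoff_sum_rho_close[where n = n, OF z x agree(1)]
    birkhoff_sum_rho_close[where n = k, OF shift_in_markov_shift[OF z] y agree(2)]
    birkhoff_sum_indicator_close[of n z x w] birkhoff_sum_indicator_close[of k "(left_shift ^^ n) z" y w] agree
  unfolding birkhoff_sum_add by (simp_all add: abs_le_iff)

subsection \<open>Periodic states\<close>

text \<open>Division by the Birkhoff sum of \<open>\<rho>\<close>, the length of the closed flow
  orbit in units of \<open>c\<close>, normalizes the cost to \<open>1\<close>.\<close>

definition periodic_state :: "(nat \<Rightarrow> nat) \<Rightarrow> nat \<Rightarrow> nat list \<Rightarrow> real" where
  "periodic_state z n w = birkhoff_sum (indicator (cyl w)) n z / birkhoff_sum \<rho> n z"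

lemma birkhoff_sum_periodic_shift:
  fixes f :: "(nat \<Rightarrow> nat) \<Rightarrow> real"
  assumes "periodic z n"
  shows "birkhoff_sum f n ((left_shift ^^ i) z) = birkhoff_sum f n z"
proof (induction i)
  case (Suc i)
  have "(left_shift ^^ n) ((left_shift ^^ i) z) = (left_shift ^^ i) ((left_shift ^^ n) z)"
    by (metis add.commute comp_apply funpow_add)
  also have "\<dots> = (left_shift ^^ i) z" using assms by (simp add: periodic_def)
  finally have "birkhoff_sum f n (left_shift ((left_shift ^^ i) z)) = birkhoff_sum f n ((left_shift ^^ i) z)"
    by (simp add: birkhoff_sum_left_shift)
  with Suc show ?case by simp
qed simp

lemma birkhoff_sum_periodic_mult:
  fixes f :: "(nat \<Rightarrow> nat) \<Rightarrow> real"
  assumes "periodic z n"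
  shows "birkhoff_sum f (k * n) z = real k * birkhoff_sum f n z"
proof (induction k)
  case (Suc k)
  have "birkhoff_sum f (n + k * n) z = birkhoff_sum f n z + birkhoff_sum f (k * n) ((left_shift ^^ n) z)"
    by (rule birkhoff_sum_add)
  with Suc assms show ?case by (simp add: periodic_def algebra_simps)
qed (simp add: birkhoff_sum_def)

lemma birkhoff_sum_rho_ge: "x \<in> markov_shift B \<Longrightarrow> real n \<le> birkhoff_sum \<rho> n x"
  using sum_mono[of "{..<n}" "\<lambda>_. 1" "\<lambda>i. \<rho> ((left_shift ^^ i) x)"] rho_ge_1[OF shift_in_markov_shift]
  by (simp add: birkhoff_sum_def)

lemma indicator_cyl_sums:
  "(\<lambda>a. indicator (cyl (w @ [a])) y :: real) sums indicator (cyl w) y"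
  "(\<lambda>a. indicator (cyl (a # w)) y :: real) sums indicator (cyl w) (left_shift y)"
proof -
  have 1: "(\<lambda>a. indicator (cyl (w @ [a])) y :: real) = (\<lambda>a. if a = y (length w) then indicator (cyl w) y else 0)"
    by (auto simp: indicator_def mem_cyl_snoc)
  show "(\<lambda>a. indicator (cyl (w @ [a])) y :: real) sums indicator (cyl w) y"
    unfolding 1 by (rule sums_single)
  have 2: "(\<lambda>a. indicator (cyl (a # w)) y :: real) = (\<lambda>a. if a = y 0 then indicator (cyl w) (left_shift y) else 0)"
    by (auto simp: indicator_def mem_cyl_Cons)
  show "(\<lambda>a. indicator (cyl (a # w)) y :: real) sums indicator (cyl w) (left_shift y)"
    unfolding 2 by (rule sums_single)
qed

lemma stationary_freq_periodic:
  assumes z: "periodic z n"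
  shows "stationary (\<lambda>w. freq n w z)"
proof -
  have "(\<lambda>a. birkhoff_sum (indicator (cyl (w @ [a]))) n z :: real) sums birkhoff_sum (indicator (cyl w)) n z" for w
    unfolding birkhoff_sum_def by (intro sums_sum indicator_cyl_sums)
  moreover have "(\<lambda>a. birkhoff_sum (indicator (cyl (a # w))) n z :: real) sums birkhoff_sum (indicator (cyl w)) n z" for w
  proof -
    have "(\<lambda>a. birkhoff_sum (indicator (cyl (a # w))) n z :: real) sums (\<Sum>k<n. indicator (cyl w) (left_shift ((left_shift ^^ k) z)))"
      unfolding birkhoff_sum_def by (intro sums_sum indicator_cyl_sums)
    also have "(\<Sum>k<n. indicator (cyl w) (left_shift ((left_shift ^^ k) z)) :: real) = birkhoff_sum (indicator (cyl w)) n ((left_shift ^^ 1) z)"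
      by (simp add: birkhoff_sum_def funpow_swap1)
    finally show ?thesis by (simp only: birkhoff_sum_periodic_shift[OF z])
  qed
  ultimately show ?thesis
    unfolding stationary_def consistent_def freq_def
    by (auto intro!: sums_divide divide_nonneg_nonneg birkhoff_sum_indicator_nonneg)
qed

text \<open>The weights are an average of \<open>n\<close> point masses, and the supremum over word
  lengths passes through the finite sum.\<close>

lemma cost_freq_periodic:
  assumes z: "periodic z n"
  shows "cost r (\<lambda>w. freq n w z) = ennreal (birkhoff_sum \<rho> n z / real n)"
proof -
  have n: "0 < n" and zs: "z \<in> markov_shift B" using z by (auto simp: periodic_def)
  define y where "y i = (left_shift ^^ i) z" for i
  have ys: "y i \<in> markov_shift B" for i unfolding y_def by (rule shift_in_markov_shift[OF zs])
  have "level r (\<lambda>w. freq n w z) k = (\<Sum>i<n. ennreal (1 / real n) * r (map (y i) [0..<k]))" for k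
  proof -
    have "r w * ennreal (freq n w z) = (\<Sum>i<n. ennreal (1 / real n) * (r w * indicator (cyl w) (y i)))" for w
    proof -
      have "freq n w z = (\<Sum>i<n. 1 / real n * indicator (cyl w) (y i))"
        by (simp add: freq_def birkhoff_sum_def y_def sum_divide_distrib)
      then have "ennreal (freq n w z) = (\<Sum>i<n. ennreal (1 / real n * indicator (cyl w) (y i)))"
        by (simp only:) (rule sum_ennreal[symmetric], simp)
      also have "\<dots> = (\<Sum>i<n. ennreal (1 / real n) * indicator (cyl w) (y i))"
        by (intro sum.cong) (auto simp: indicator_def)
      finally show ?thesis
        by (simp only: sum_distrib_left) (intro sum.cong refl mult.left_commute)
    qed
    then have "level r (\<lambda>w. freq n w z) k =
        (\<Sum>i<n. ennreal (1 / real n) * (\<integral>\<^sup>+w. r w * indicator (cyl w) (y i) \<partial>count_space {w. length w = k}))"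
      unfolding level_def by (simp add: nn_integral_sum nn_integral_cmult)
    moreover have "(\<integral>\<^sup>+w. r w * indicator (cyl w) (y i) \<partial>count_space {w. length w = k}) = r (map (y i) [0..<k])" for i
    proof -
      have "(\<integral>\<^sup>+w. r w * indicator (cyl w) (y i) \<partial>count_space {w. length w = k}) =
          (\<integral>\<^sup>+w. r w * indicator {map (y i) [0..<k]} w \<partial>count_space {w. length w = k})"
        by (intro nn_integral_cong) (auto simp: mem_cyl_iff split: split_indicator)
      also have "\<dots> = r (map (y i) [0..<k])" by (subst nn_integral_indicator_singleton) auto
      finally show ?thesis .
    qed
    ultimately show ?thesis by simp
  qed
  then have "cost r (\<lambda>w. freq n w z) = (SUP k. \<Sum>i<n. ennreal (1 / real n) * r (map (y i) [0..<k]))"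
    by (simp add: cost_def)
  also have "\<dots> = (\<Sum>i<n. SUP k. ennreal (1 / real n) * r (map (y i) [0..<k]))"
    using incseq_r by (intro ennreal_SUP_sum) (auto simp: incseq_def intro!: mult_left_mono)
  also have "\<dots> = (\<Sum>i<n. ennreal (1 / real n) * roof r (y i))"
    by (simp add: roof_def SUP_mult_left_ennreal)
  also have "\<dots> = (\<Sum>i<n. ennreal (\<rho> (y i) / real n))"
    using rho_ge_1[OF ys] by (intro sum.cong) (simp_all add: roof_eq[OF ys] flip: ennreal_mult')
  also have "\<dots> = ennreal (\<Sum>i<n. \<rho> (y i) / real n)"
    using rho_ge_1[OF ys] by (intro sum_ennreal) (simp add: order_trans[OF zero_le_one])
  finally show ?thesis by (simp add: birkhoff_sum_def y_def sum_divide_distrib)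
qed

lemma freq_periodic_mult:
  assumes z: "periodic z n" and "0 < k"
  shows "freq (k * n) w ((left_shift ^^ i) z) = freq n w z"
proof -
  have p: "periodic ((left_shift ^^ i) z) n"
    using z unfolding periodic_def by (metis add.commute comp_apply funpow_add shift_in_markov_shift)
  have "0 < n" using z by (simp add: periodic_def)
  then show ?thesis
    using \<open>0 < k\<close> by (simp add: freq_def birkhoff_sum_periodic_mult[OF p] birkhoff_sum_periodic_shift[OF z])
qed

text \<open>At multiples of the period the frequency of a word is the same from every point of the
  orbit and equals its limit, so the dispersion is exactly zero.\<close>

lemma extremal_periodic_state:
  assumes z: "periodic z n"
  shows "extremal (periodic_state z n)"
proof -
  have n: "0 < n" and zs: "z \<in> markov_shift B" using z by (auto simp: periodic_def)
  let ?m = "\<lambda>w. freq n w z"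
  \<comment> \<open>\<open>Suc k\<close> keeps the time positive; at time \<open>0\<close> the
    frequency is \<open>0\<close> by convention.\<close>
  have disp: "dispersion (Suc k * n) w ?m = 0" for k w
  proof -
    have zero: "ennreal \<bar>word_freq (Suc k * n) w v - ?m w\<bar> * ennreal (?m v) = 0"
      if len: "length v = Suc k * n + length w" for v
    proof (cases "?m v = 0")
      case False
      then obtain i where "i < n" "(left_shift ^^ i) z \<in> cyl v"
        by (auto simp: freq_def birkhoff_sum_def elim!: sum.not_neutral_contains_not_neutral split: split_indicator_asm)
      then have "v = map ((left_shift ^^ i) z) [0..<Suc k * n + length w]"
        using len by (simp only: mem_cyl_iff)
      then have "word_freq (Suc k * n) w v = freq (Suc k * n) w ((left_shift ^^ i) z)"
        by (simp only: word_freq_initial_word)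
      then show ?thesis using freq_periodic_mult[OF z, of "Suc k" w i] by simp
    qed simp
    have "dispersion (Suc k * n) w ?m = (\<integral>\<^sup>+v. 0 \<partial>count_space {v :: nat list. length v = Suc k * n + length w})"
      unfolding dispersion_def by (rule nn_integral_cong) (simp add: zero del: mult_Suc)
    then show ?thesis by simp
  qed
  have "extremal (\<lambda>w. ?m w / (birkhoff_sum \<rho> n z / real n))"
  proof (rule extremalI_dispersion[OF stationary_freq_periodic[OF z] _ cost_freq_periodic[OF z]])
    show "freq n [] z = 1" using n by (simp add: freq_def birkhoff_sum_def)
    show "liminf (\<lambda>k. dispersion (Suc k * n) w ?m) = 0" for w by (simp only: disp Liminf_const[OF sequentially_bot])
    show "strict_mono (\<lambda>k. Suc k * n)" using n by (intro strict_monoI mult_strict_right_mono) auto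
  qed
  also have "(\<lambda>w. ?m w / (birkhoff_sum \<rho> n z / real n)) = periodic_state z n"
    using n by (auto simp: periodic_state_def freq_def)
  finally show ?thesis .
qed

lemma periodic_state_in_states: "periodic z n \<Longrightarrow> periodic_state z n \<in> states r"
  using extremal_periodic_state by (simp add: extremal_def)

definition periodic_points :: "(nat \<Rightarrow>\<^sub>C real) set" where
  "periodic_points = {embed (periodic_state z n) | z n. periodic z n}"

lemma periodic_points_extreme: "periodic_points \<subseteq> {e. e extreme_point_of (embed ` states r)}"
  using extreme_point_iff[OF periodic_state_in_states] extremal_periodic_state
  by (auto simp: periodic_points_def)

text \<open>A shortest loop through a letter passes through no letter twice.\<close>

lemma simple_loop:
  obtains z n where "periodic z n" "z 0 = a" "inj_on z {..<n}"
proof -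
  define Q where "Q n \<longleftrightarrow> 0 < n \<and> (\<exists>x\<in>markov_shift B. x 0 = a \<and> x n = a)" for n
  obtain x l where "x \<in> markov_shift B" "1 \<le> l" "x 0 = a" "x l = a" using connected[of a a] by blast
  then have "Q l" unfolding Q_def by auto
  define n where "n = (LEAST n. Q n)"
  have Qn: "Q n" unfolding n_def by (rule LeastI[of Q, OF \<open>Q l\<close>])
  then obtain x where x: "0 < n" "x \<in> markov_shift B" "x 0 = a" "x n = a" by (auto simp: Q_def)
  have ne: "x i \<noteq> x j" if ij: "i < j" "j < n" for i j
  proof
    assume eq: "x i = x j"
    define y where "y = join x i ((left_shift ^^ j) x)"
    have e: "x i = (left_shift ^^ j) x 0" using eq by (simp add: funpow_left_shift)
    have "y \<in> markov_shift B" unfolding y_def by (rule join_in_shift[OF x(2) shift_in_markov_shift[OF x(2)] e])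
    moreover have "y 0 = a" unfolding y_def using join_left[where x = x and n = i and y = "(left_shift ^^ j) x" and i = 0, OF e] x(3) by simp
    moreover have "y (i + (n - j)) = a" unfolding y_def join_right using ij x(4) by (simp add: funpow_left_shift)
    ultimately have "Q (i + (n - j))" using ij by (auto simp: Q_def)
    then have "n \<le> i + (n - j)" unfolding n_def by (rule Least_le)
    with ij show False by simp
  qed
  have "x n = x 0" using x by simp
  then obtain z where z: "periodic z n" "\<And>i. i \<le> n \<Longrightarrow> z i = x i" using close_orbit[OF x(2,1)] by blast
  have "inj_on z {..<n}"
    using ne z(2) by (intro linorder_inj_onI) (auto simp: less_imp_le)
  with z x(3) show thesis by (intro that[of z n]) auto
qed

text \<open>
  A loop without repeated letters meets every fixed letter at most once, and its Birkhoff sum is large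
  if the roof over its starting letter is; so all letters have small weight, and the tail bound on
  states makes the mass small.
\<close>

lemma zero_in_closure_periodic_points: "0 \<in> closure periodic_points"
proof -
  have "\<exists>z n. periodic z n \<and> real (Suc j) \<le> birkhoff_sum \<rho> n z \<and> inj_on z {..<n}" for j
  proof -
    obtain k where k: "\<And>x. x \<in> markov_shift B \<Longrightarrow> k \<le> x 0 \<Longrightarrow> real (Suc j) \<le> \<rho> x"
      using rho_tail[of "Suc j"] by blast
    obtain z n where z: "periodic z n" "z 0 = k" "inj_on z {..<n}" by (rule simple_loop[of k])
    have zs: "z \<in> markov_shift B" and n: "0 < n" using z(1) by (auto simp: periodic_def)
    have "\<rho> ((left_shift ^^ 0) z) \<le> birkhoff_sum \<rho> n z"
      unfolding birkhoff_sum_def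
    proof (rule member_le_sum[of 0 "{..<n}" "\<lambda>k. \<rho> ((left_shift ^^ k) z)"])
      show "0 \<le> \<rho> ((left_shift ^^ i) z)" for i using rho_ge_1[OF shift_in_markov_shift[OF zs], of i] by simp
    qed (use n in auto)
    then have "real (Suc j) \<le> birkhoff_sum \<rho> n z" using k[OF zs] z(2) by simp
    with z show ?thesis by blast
  qed
  then obtain Z n where Zn: "\<And>j. periodic (Z j) (n j)" "\<And>j. real (Suc j) \<le> birkhoff_sum \<rho> (n j) (Z j)"
      "\<And>j. inj_on (Z j) {..<n j}"
    by metis
  define m where "m j = periodic_state (Z j) (n j)" for j
  have m: "m j \<in> states r" for j unfolding m_def by (rule periodic_state_in_states[OF Zn(1)])
  have letter: "m j [a] \<le> 1 / real (Suc j)" for j a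
  proof -
    have "birkhoff_sum (indicator (cyl [a])) (n j) (Z j) = (\<Sum>i<n j. if Z j i = a then 1 else 0 :: real)"
      unfolding birkhoff_sum_def
      by (intro sum.cong) (auto simp: indicator_def mem_cyl_Cons funpow_left_shift)
    also have "\<dots> = real (card {i. i < n j \<and> Z j i = a})"
      by (simp add: sum.If_cases Int_def)
    also have "\<dots> \<le> 1"
    proof -
      have "card {i. i < n j \<and> Z j i = a} \<le> card {a}"
        by (rule card_inj_on_le[where f = "Z j"]) (use Zn(3)[of j] in \<open>auto simp: inj_on_def\<close>)
      then show ?thesis by simp
    qed
    finally have "birkhoff_sum (indicator (cyl [a])) (n j) (Z j) \<le> (1 :: real)" .
    then have "m j [a] \<le> 1 / birkhoff_sum \<rho> (n j) (Z j)"
      unfolding m_def periodic_state_def using Zn(2)[of j] by (intro divide_right_mono) auto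
    also have "\<dots> \<le> 1 / real (Suc j)" using Zn(2)[of j] by (intro divide_left_mono) auto
    finally show ?thesis .
  qed
  have mass: "(\<lambda>j. m j []) \<longlonglongrightarrow> 0"
  proof (rule LIMSEQ_I)
    fix e :: real assume e: "0 < e"
    \<comment> \<open>First \<open>i\<close> is chosen to make the tail of letters small; then each
      of the finitely many remaining letters has weight at most \<open>1 / Suc j\<close>.\<close>
    obtain i where i: "0 < i" "1 / real i < e / 2"
      using reals_Archimedean[of "e / 2"] e by (metis inverse_eq_divide zero_less_Suc half_gt_zero)
    have "(\<lambda>j. real (tail_start i) / real (Suc j)) \<longlonglongrightarrow> 0"
      by (rule LIMSEQ_Suc[OF lim_const_over_n])
    then have "eventually (\<lambda>j. real (tail_start i) / real (Suc j) < e / 2) sequentially"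
      by (rule order_tendstoD(2)) (use e in simp)
    then obtain j0 where j0: "\<And>j. j0 \<le> j \<Longrightarrow> real (tail_start i) / real (Suc j) < e / 2"
      unfolding eventually_sequentially by blast
    have "norm (m j [] - 0) < e" if "j0 \<le> j" for j
    proof -
      have "m j [] \<le> (\<Sum>a<tail_start i. m j ([] @ [a])) + 1 / real i"
        by (rule states_tail_bounds(1)[OF m i(1)])
      also have "(\<Sum>a<tail_start i. m j ([] @ [a])) \<le> (\<Sum>a<tail_start i. 1 / real (Suc j))"
        using letter by (intro sum_mono) simp
      also have "\<dots> = real (tail_start i) / real (Suc j)" by simp
      finally have "m j [] < e" using j0[OF that] i(2) by linarith
      then show ?thesis using states_bounds(3)[OF m, of j "[]"] by simp
    qed
    then show "\<exists>no. \<forall>j\<ge>no. norm (m j [] - 0) < e" by blast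
  qed
  have "(\<lambda>j. m j w) \<longlonglongrightarrow> 0" for w
  proof (rule tendsto_sandwich[where f = "\<lambda>_. 0" and h = "\<lambda>j. m j []"])
    show "eventually (\<lambda>j. m j w \<le> m j []) sequentially"
      using consistent_append_le[OF states_bounds(2)[OF m], of _ "[]" w] by simp
  qed (use states_bounds(3)[OF m] mass in auto)
  then have "(\<lambda>j. embed (m j)) \<longlonglongrightarrow> embed (\<lambda>w. 0)" by (rule tendsto_embed)
  moreover have "embed (\<lambda>w. 0) = 0" by (rule bcontfun_eqI) (simp add: apply_embed)
  moreover have "embed (m j) \<in> periodic_points" for j using Zn(1) by (auto simp: periodic_points_def m_def)
  ultimately show ?thesis unfolding closure_sequential by metis
qed

lemma total_var_affine_tendsto: "(\<lambda>k. total_var (A * k + C) / real k) \<longlonglongrightarrow> 0"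
proof (rule LIMSEQ_I)
  fix e :: real assume e: "0 < e"
  define d where "d = e / (2 * (real A + 1))"
  have d: "0 < d" "d * real A < e / 2" using e by (auto simp: d_def field_simps add_pos_nonneg)
  obtain D where D: "\<And>n. total_var n \<le> d * real n + D" using total_var_sublinear[OF d(1)] by blast
  have "(\<lambda>k. (d * real C + D) / real k) \<longlonglongrightarrow> 0" by (rule lim_const_over_n)
  then have "eventually (\<lambda>k. (d * real C + D) / real k < e / 2) sequentially"
    by (rule order_tendstoD(2)) (use e in simp)
  then obtain k0 where k0: "\<And>k. k0 \<le> k \<Longrightarrow> (d * real C + D) / real k < e / 2"
    unfolding eventually_sequentially by blast
  have "norm (total_var (A * k + C) / real k - 0) < e" if k: "max 1 k0 \<le> k" for k
  proof -
    have "total_var (A * k + C) \<le> d * real A * real k + (d * real C + D)"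
      using D[of "A * k + C"] by (simp add: algebra_simps)
    then have "total_var (A * k + C) / real k \<le> (d * real A * real k + (d * real C + D)) / real k"
      by (intro divide_right_mono) auto
    also have "\<dots> = d * real A + (d * real C + D) / real k" using k by (simp add: add_divide_distrib)
    also have "\<dots> < e"
    proof -
      have "k0 \<le> k" using k by simp
      from k0[OF this] d(2) show ?thesis by linarith
    qed
    finally have "total_var (A * k + C) / real k < e" .
    moreover have "0 \<le> total_var (A * k + C) / real k"
      by (simp add: total_var_def sum_nonneg v_nonneg)
    ultimately show ?thesis by simp
  qed
  then show "\<exists>no. \<forall>k\<ge>no. norm (total_var (A * k + C) / real k - 0) < e" by blast
qed

lemma floor_multiple_tendsto:
  assumes "0 \<le> c"
  shows "(\<lambda>k. real (nat \<lfloor>c * real k\<rfloor>) / real k) \<longlonglongrightarrow> c"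
proof (rule tendsto_sandwich[where f = "\<lambda>k. c - 1 / real k" and h = "\<lambda>_. c"])
  have fl: "c * real k - 1 \<le> real (nat \<lfloor>c * real k\<rfloor>)" "real (nat \<lfloor>c * real k\<rfloor>) \<le> c * real k" for k
    using assms by (simp_all add: of_nat_nat)
  show "eventually (\<lambda>k. c - 1 / real k \<le> real (nat \<lfloor>c * real k\<rfloor>) / real k) sequentially"
  proof (rule eventually_sequentiallyI[of 1])
    fix k :: nat assume "1 \<le> k"
    then show "c - 1 / real k \<le> real (nat \<lfloor>c * real k\<rfloor>) / real k"
      using divide_right_mono[OF fl(1)[of k], of "real k"] by (simp add: diff_divide_distrib)
  qed
  show "eventually (\<lambda>k. real (nat \<lfloor>c * real k\<rfloor>) / real k \<le> c) sequentially"
  proof (rule eventually_sequentiallyI[of 1])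
    fix k :: nat assume "1 \<le> k"
    then show "real (nat \<lfloor>c * real k\<rfloor>) / real k \<le> c"
      using divide_right_mono[OF fl(2)[of k], of "real k"] by simp
  qed
  show "(\<lambda>k. c - 1 / real k) \<longlonglongrightarrow> c"
    using tendsto_diff[OF tendsto_const[of c] lim_1_over_n] by simp
qed simp

text \<open>
  The orbit follows \<open>z\<close> for \<open>a\<close> periods, the connection \<open>x\<close>, then \<open>z'\<close> for \<open>b\<close> periods and the
  connection \<open>x'\<close> back.
\<close>

lemma follow_two_periodic:
  assumes z: "periodic z n" and z': "periodic z' n'"
    and x: "x \<in> markov_shift B" "x 0 = z 0" "x l = z' 0"
    and x': "x' \<in> markov_shift B" "x' 0 = z' 0" "x' l' = z 0" and "0 < l"
  obtains y where "periodic y (a * n + l + (b * n' + l'))"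
    "\<bar>birkhoff_sum \<rho> (a * n + l + (b * n' + l')) y - (real a * birkhoff_sum \<rho> n z + real b * birkhoff_sum \<rho> n' z'
       + birkhoff_sum \<rho> l x + birkhoff_sum \<rho> l' x')\<bar> \<le> 2 * total_var (a * n + l) + 2 * total_var (b * n' + l')
       + total_var l + total_var l'"
    "\<And>w. \<bar>birkhoff_sum (indicator (cyl w)) (a * n + l + (b * n' + l')) y -
       (real a * birkhoff_sum (indicator (cyl w)) n z + real b * birkhoff_sum (indicator (cyl w)) n' z'
       + birkhoff_sum (indicator (cyl w)) l x + birkhoff_sum (indicator (cyl w)) l' x')\<bar> \<le> 6 * real (length w)"
proof -
  have zs: "z \<in> markov_shift B" "z' \<in> markov_shift B" using z z' by (auto simp: periodic_def)
  have per: "z (a * n) = z 0" if "periodic z n" for z n a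
  proof -
    have "(left_shift ^^ (a * n)) z = z"
    proof (induction a)
      case (Suc a)
      have "(left_shift ^^ (n + a * n)) z = (left_shift ^^ n) ((left_shift ^^ (a * n)) z)"
        by (simp add: funpow_add)
      with Suc that show ?case by (simp add: periodic_def)
    qed simp
    from fun_cong[OF this, of 0] show ?thesis by (simp add: funpow_left_shift)
  qed
  define p where "p = join z (a * n) x"
  define q where "q = join z' (b * n') x'"
  have e1: "z (a * n) = x 0" and e2: "z' (b * n') = x' 0" using per z z' x x' by auto
  have ps: "p \<in> markov_shift B" unfolding p_def by (rule join_in_shift[OF zs(1) x(1) e1])
  have qs: "q \<in> markov_shift B" unfolding q_def by (rule join_in_shift[OF zs(2) x'(1) e2])
  have p0: "p 0 = z 0" unfolding p_def by (rule join_left[where x = z and n = "a * n" and y = x, OF e1]) simp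
  have q0: "q 0 = z' 0" unfolding q_def by (rule join_left[where x = z' and n = "b * n'" and y = x', OF e2]) simp
  have pe: "p (a * n + l) = q 0" unfolding p_def join_right q0 by (rule x(3))
  have qe: "q (b * n' + l') = p 0" unfolding q_def join_right p0 by (rule x'(3))
  have "0 < a * n + l + (b * n' + l')" using \<open>0 < l\<close> by simp
  from close_two_segments[OF ps qs pe qe this] obtain y where
    y: "periodic y (a * n + l + (b * n' + l'))" "\<And>i. i \<le> a * n + l \<Longrightarrow> y i = p i"
      "\<And>i. i \<le> b * n' + l' \<Longrightarrow> (left_shift ^^ (a * n + l)) y i = q i"
    by blast
  have ys: "y \<in> markov_shift B" using y(1) by (simp add: periodic_def)
  have pl: "i \<le> a * n \<Longrightarrow> p i = z i" for i unfolding p_def by (rule join_left[where x = z and n = "a * n" and y = x, OF e1])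
  have ql: "i \<le> b * n' \<Longrightarrow> q i = z' i" for i unfolding q_def by (rule join_left[where x = z' and n = "b * n'" and y = x', OF e2])
  have pr: "(left_shift ^^ (a * n)) p i = x i" for i unfolding p_def funpow_join ..
  have qr: "(left_shift ^^ (b * n')) q i = x' i" for i unfolding q_def funpow_join ..
  \<comment> \<open>Three comparisons, of \<open>y\<close> with its two halves and of each half with
    its two pieces. Each costs \<open>2 * length w\<close> in the counts, which adds up to the
    factor \<open>6\<close>.\<close>
  note Y = two_segments_estimate[where n = "a * n + l" and k = "b * n' + l'", OF ys ps qs y(2,3)]
  note P = two_segments_estimate[where n = "a * n" and k = l, OF ps zs(1) x(1) pl pr]
  note Q = two_segments_estimate[where n = "b * n'" and k = l', OF qs zs(2) x'(1) ql qr]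
  note mult = birkhoff_sum_periodic_mult[OF z] birkhoff_sum_periodic_mult[OF z']
  show thesis
  proof (rule that[OF y(1)])
    have "total_var (a * n) \<le> total_var (a * n + l)" "total_var (b * n') \<le> total_var (b * n' + l')"
      by (auto intro: total_var_mono)
    then show "\<bar>birkhoff_sum \<rho> (a * n + l + (b * n' + l')) y - (real a * birkhoff_sum \<rho> n z + real b * birkhoff_sum \<rho> n' z'
       + birkhoff_sum \<rho> l x + birkhoff_sum \<rho> l' x')\<bar> \<le> 2 * total_var (a * n + l) + 2 * total_var (b * n' + l')
       + total_var l + total_var l'"
      using Y(1) P(1) Q(1) unfolding mult by linarith
    show "\<bar>birkhoff_sum (indicator (cyl w)) (a * n + l + (b * n' + l')) y -
       (real a * birkhoff_sum (indicator (cyl w)) n z + real b * birkhoff_sum (indicator (cyl w)) n' z'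
       + birkhoff_sum (indicator (cyl w)) l x + birkhoff_sum (indicator (cyl w)) l' x')\<bar> \<le> 6 * real (length w)" for w
      using Y(2)[of w] P(2)[of w] Q(2)[of w] unfolding mult by linarith
  qed
qed

text \<open>Divided by the scale \<open>k\<close>, the connections have bounded cost and vanish, and
  so does the distortion, which is sublinear; both the length of the joint orbit and its word counts
  become affine.\<close>

lemma segment_in_closure_periodic_points:
  assumes p: "p \<in> periodic_points" and q: "q \<in> periodic_points" and s: "0 \<le> s" "s \<le> (1 :: real)"
  shows "(1 - s) *\<^sub>R p + s *\<^sub>R q \<in> closure periodic_points"
proof -
  obtain z n where z: "periodic z n" "p = embed (periodic_state z n)" using p by (auto simp: periodic_points_def)
  obtain z' n' where z': "periodic z' n'" "q = embed (periodic_state z' n')" using q by (auto simp: periodic_points_def)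
  define T T' where "T = birkhoff_sum \<rho> n z" and "T' = birkhoff_sum \<rho> n' z'"
  have T: "1 \<le> T" "1 \<le> T'"
    using birkhoff_sum_rho_ge[of z n] birkhoff_sum_rho_ge[of z' n'] z(1) z'(1) by (auto simp: periodic_def T_def T'_def)
  obtain x l where x: "x \<in> markov_shift B" "1 \<le> l" "x 0 = z 0" "x l = z' 0" using connected[of "z 0" "z' 0"] by blast
  obtain x' l' where x': "x' \<in> markov_shift B" "1 \<le> l'" "x' 0 = z' 0" "x' l' = z 0" using connected[of "z' 0" "z 0"] by blast
  \<comment> \<open>The repetitions are chosen so that the flow time near the first orbit is about
    \<open>(1 - s) * k\<close> and near the second about \<open>s * k\<close>; counting periods
    without dividing by \<open>T\<close> and \<open>T'\<close> would give wrong proportions.\<close>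
  define a b where "a k = nat \<lfloor>(1 - s) / T * real k\<rfloor>" and "b k = nat \<lfloor>s / T' * real k\<rfloor>" for k
  define L where "L k = a k * n + l + (b k * n' + l')" for k
  have "\<exists>y. periodic y (L k) \<and>
    \<bar>birkhoff_sum \<rho> (L k) y - (real (a k) * T + real (b k) * T' + birkhoff_sum \<rho> l x + birkhoff_sum \<rho> l' x')\<bar>
      \<le> 2 * total_var (a k * n + l) + 2 * total_var (b k * n' + l') + total_var l + total_var l' \<and>
    (\<forall>w. \<bar>birkhoff_sum (indicator (cyl w)) (L k) y -
       (real (a k) * birkhoff_sum (indicator (cyl w)) n z + real (b k) * birkhoff_sum (indicator (cyl w)) n' z'
       + birkhoff_sum (indicator (cyl w)) l x + birkhoff_sum (indicator (cyl w)) l' x')\<bar> \<le> 6 * real (length w))" for k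
  proof -
    have "0 < l" using x(2) by simp
    obtain y where "periodic y (a k * n + l + (b k * n' + l'))"
    "\<bar>birkhoff_sum \<rho> (a k * n + l + (b k * n' + l')) y - (real (a k) * birkhoff_sum \<rho> n z + real (b k) * birkhoff_sum \<rho> n' z'
       + birkhoff_sum \<rho> l x + birkhoff_sum \<rho> l' x')\<bar> \<le> 2 * total_var (a k * n + l) + 2 * total_var (b k * n' + l')
       + total_var l + total_var l'"
    "\<And>w. \<bar>birkhoff_sum (indicator (cyl w)) (a k * n + l + (b k * n' + l')) y -
       (real (a k) * birkhoff_sum (indicator (cyl w)) n z + real (b k) * birkhoff_sum (indicator (cyl w)) n' z'
       + birkhoff_sum (indicator (cyl w)) l x + birkhoff_sum (indicator (cyl w)) l' x')\<bar> \<le> 6 * real (length w)"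
      by (rule follow_two_periodic[OF z(1) z'(1) x(1,3,4) x'(1,3,4) \<open>0 < l\<close>, where a = "a k" and b = "b k"]) blast
    then show ?thesis unfolding L_def T_def T'_def by blast
  qed
  then obtain y where y: "\<And>k. periodic (y k) (L k)"
    and yr: "\<And>k. \<bar>birkhoff_sum \<rho> (L k) (y k) - (real (a k) * T + real (b k) * T' + birkhoff_sum \<rho> l x + birkhoff_sum \<rho> l' x')\<bar>
      \<le> 2 * total_var (a k * n + l) + 2 * total_var (b k * n' + l') + total_var l + total_var l'"
    and yc: "\<And>k w. \<bar>birkhoff_sum (indicator (cyl w)) (L k) (y k) -
       (real (a k) * birkhoff_sum (indicator (cyl w)) n z + real (b k) * birkhoff_sum (indicator (cyl w)) n' z'
       + birkhoff_sum (indicator (cyl w)) l x + birkhoff_sum (indicator (cyl w)) l' x')\<bar> \<le> 6 * real (length w)"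
    by metis
  have ak: "(\<lambda>k. real (a k) / real k) \<longlonglongrightarrow> (1 - s) / T"
    unfolding a_def by (rule floor_multiple_tendsto) (use s T in simp)
  have bk: "(\<lambda>k. real (b k) / real k) \<longlonglongrightarrow> s / T'"
    unfolding b_def by (rule floor_multiple_tendsto) (use s T in simp)
  have le: "nat \<lfloor>c * real k\<rfloor> \<le> k" if "0 \<le> c" "c \<le> 1" for c k
  proof -
    have "c * real k \<le> 1 * real k" using that by (intro mult_right_mono) auto
    then show ?thesis by (simp add: nat_le_iff floor_le_iff)
  qed
  have ab: "a k \<le> k" "b k \<le> k" for k
    unfolding a_def b_def by (rule le; use s T in simp)+
  \<comment> \<open>Common to numerator and denominator of \<open>periodic_state\<close>; they
    differ only in the quantity collected per period and in the error \<open>R\<close>.\<close>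
  have lim_ratio: "(\<lambda>k. X k / real k) \<longlonglongrightarrow> c"
    if "\<And>k. \<bar>X k - (real (a k) * U + real (b k) * V + W)\<bar> \<le> R k" "(\<lambda>k. R k / real k) \<longlonglongrightarrow> 0"
      and c: "c = (1 - s) / T * U + s / T' * V" for X R U V W c
  proof -
    have 1: "(\<lambda>k. (real (a k) * U + real (b k) * V + W) / real k) \<longlonglongrightarrow> (1 - s) / T * U + s / T' * V + 0"
      unfolding add_divide_distrib
      using tendsto_mult_right[OF ak, of U] tendsto_mult_right[OF bk, of V] lim_const_over_n[of W]
      by (intro tendsto_add) simp_all
    have 2: "(\<lambda>k. (X k - (real (a k) * U + real (b k) * V + W)) / real k) \<longlonglongrightarrow> 0"
    proof (rule Lim_null_comparison[OF _ that(2)], rule always_eventually, rule allI)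
      fix k
      show "norm ((X k - (real (a k) * U + real (b k) * V + W)) / real k) \<le> R k / real k"
        unfolding real_norm_def abs_divide abs_of_nat by (rule divide_right_mono[OF that(1)]) simp
    qed
    show ?thesis using tendsto_add[OF 1 2] unfolding c by (simp add: diff_divide_distrib)
  qed
  have den: "(\<lambda>k. birkhoff_sum \<rho> (L k) (y k) / real k) \<longlonglongrightarrow> 1"
  proof (rule lim_ratio[where U = T and V = T' and W = "birkhoff_sum \<rho> l x + birkhoff_sum \<rho> l' x'"])
    let ?R = "\<lambda>k. 2 * total_var (n * k + l) + 2 * total_var (n' * k + l') + (total_var l + total_var l')"
    show "\<bar>birkhoff_sum \<rho> (L k) (y k) - (real (a k) * T + real (b k) * T' + (birkhoff_sum \<rho> l x + birkhoff_sum \<rho> l' x'))\<bar> \<le> ?R k" for k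
    proof -
      have "total_var (a k * n + l) \<le> total_var (n * k + l)" "total_var (b k * n' + l') \<le> total_var (n' * k + l')"
        using ab[of k] by (auto intro!: total_var_mono simp: mult.commute)
      then show ?thesis using yr[of k] by linarith
    qed
    have "(\<lambda>k. 2 * (total_var (n * k + l) / real k) + 2 * (total_var (n' * k + l') / real k) + (total_var l + total_var l') / real k) \<longlonglongrightarrow> 2 * 0 + 2 * 0 + 0"
      by (intro tendsto_add tendsto_mult tendsto_const total_var_affine_tendsto lim_const_over_n)
    then show "(\<lambda>k. ?R k / real k) \<longlonglongrightarrow> 0" by (simp add: add_divide_distrib)
    show "1 = (1 - s) / T * T + s / T' * T'" using T by simp
  qed
  have num: "(\<lambda>k. birkhoff_sum (indicator (cyl w)) (L k) (y k) / real k) \<longlonglongrightarrow>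
      (1 - s) * periodic_state z n w + s * periodic_state z' n' w" for w
  proof (rule lim_ratio)
    show "\<bar>birkhoff_sum (indicator (cyl w)) (L k) (y k) -
       (real (a k) * birkhoff_sum (indicator (cyl w)) n z + real (b k) * birkhoff_sum (indicator (cyl w)) n' z'
       + (birkhoff_sum (indicator (cyl w)) l x + birkhoff_sum (indicator (cyl w)) l' x'))\<bar> \<le> 6 * real (length w)" for k
      using yc[where k = k and w = w] by (simp add: add.assoc)
    show "(\<lambda>k. 6 * real (length w) / real k) \<longlonglongrightarrow> 0" by (rule lim_const_over_n)
    show "(1 - s) * periodic_state z n w + s * periodic_state z' n' w =
        (1 - s) / T * birkhoff_sum (indicator (cyl w)) n z + s / T' * birkhoff_sum (indicator (cyl w)) n' z'"
      by (simp add: periodic_state_def T_def T'_def)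
  qed
  have "(\<lambda>k. periodic_state (y k) (L k) w) \<longlonglongrightarrow> (1 - s) * periodic_state z n w + s * periodic_state z' n' w" for w
  proof -
    have "(\<lambda>k. (birkhoff_sum (indicator (cyl w)) (L k) (y k) / real k) / (birkhoff_sum \<rho> (L k) (y k) / real k)) \<longlonglongrightarrow>
        ((1 - s) * periodic_state z n w + s * periodic_state z' n' w) / 1"
      by (intro tendsto_divide num den) simp
    moreover have "eventually (\<lambda>k. (birkhoff_sum (indicator (cyl w)) (L k) (y k) / real k) / (birkhoff_sum \<rho> (L k) (y k) / real k)
        = periodic_state (y k) (L k) w) sequentially"
      by (rule eventually_sequentiallyI[of 1]) (simp add: periodic_state_def)
    ultimately show ?thesis by (simp add: tendsto_cong)
  qed
  then have "(\<lambda>k. embed (periodic_state (y k) (L k))) \<longlonglongrightarrow>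
      embed (\<lambda>w. (1 - s) * periodic_state z n w + s * periodic_state z' n' w)"
    by (rule tendsto_embed)
  moreover have "embed (\<lambda>w. (1 - s) * periodic_state z n w + s * periodic_state z' n' w) = (1 - s) *\<^sub>R p + s *\<^sub>R q"
    unfolding z(2) z'(2) by (intro embed_lincomb periodic_state_in_states z z' s)
  moreover have "embed (periodic_state (y k) (L k)) \<in> periodic_points" for k
    using y by (auto simp: periodic_points_def)
  ultimately show ?thesis unfolding closure_sequential by metis
qed

lemma convex_closure_periodic_points: "convex (closure periodic_points)"
  unfolding convex_alt
proof (intro ballI allI impI)
  fix p q s assume pq: "p \<in> closure periodic_points" "q \<in> closure periodic_points" and s: "0 \<le> s \<and> s \<le> (1 :: real)"
  have 1: "(1 - s) *\<^sub>R p + s *\<^sub>R q \<in> closure periodic_points" if p: "p \<in> periodic_points" for p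
  proof -
    obtain Q where Q: "\<And>k. Q k \<in> periodic_points" "Q \<longlonglongrightarrow> q" using pq(2) unfolding closure_sequential by blast
    have lim: "(\<lambda>k. (1 - s) *\<^sub>R p + s *\<^sub>R Q k) \<longlonglongrightarrow> (1 - s) *\<^sub>R p + s *\<^sub>R q" by (intro tendsto_intros Q)
    show ?thesis
      by (rule closed_sequentially[OF closed_closure _ lim])
         (use segment_in_closure_periodic_points[OF p Q(1)] s in blast)
  qed
  obtain P where P: "\<And>k. P k \<in> periodic_points" "P \<longlonglongrightarrow> p" using pq(1) unfolding closure_sequential by blast
  have lim: "(\<lambda>k. (1 - s) *\<^sub>R P k + s *\<^sub>R q) \<longlonglongrightarrow> (1 - s) *\<^sub>R p + s *\<^sub>R q" by (intro tendsto_intros P)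
  show "(1 - s) *\<^sub>R p + s *\<^sub>R q \<in> closure periodic_points"
    by (rule closed_sequentially[OF closed_closure 1[OF P(1)] lim])
qed

section \<open>Approximation of an arbitrary state by periodic ones\<close>

text \<open>The coefficients may add up to less than \<open>1\<close>; the rest is given to zero,
  which lies in the closure.\<close>

lemma sum_in_closure_periodic_points:
  assumes "finite V" and th: "\<And>v. v \<in> V \<Longrightarrow> 0 \<le> \<theta> v" "sum \<theta> V \<le> 1"
    and P: "\<And>v. v \<in> V \<Longrightarrow> P v \<in> states r" "\<And>v. v \<in> V \<Longrightarrow> embed (P v) \<in> periodic_points"
  shows "embed (\<lambda>w. \<Sum>v\<in>V. \<theta> v * P v w) \<in> closure periodic_points"
proof -
  have bd: "0 \<le> (\<Sum>v\<in>V. \<theta> v * P v w)" "(\<Sum>v\<in>V. \<theta> v * P v w) \<le> 1" for w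
  proof -
    show "0 \<le> (\<Sum>v\<in>V. \<theta> v * P v w)" using th(1) states_bounds(3)[OF P(1)] by (intro sum_nonneg mult_nonneg_nonneg) auto
    have "(\<Sum>v\<in>V. \<theta> v * P v w) \<le> (\<Sum>v\<in>V. \<theta> v * 1)"
      using th(1) states_bounds(4)[OF P(1)] by (intro sum_mono mult_left_mono) auto
    then show "(\<Sum>v\<in>V. \<theta> v * P v w) \<le> 1" using th(2) by simp
  qed
  have eq: "embed (\<lambda>w. \<Sum>v\<in>V. \<theta> v * P v w) = (\<Sum>v\<in>V. \<theta> v *\<^sub>R embed (P v))"
  proof (rule bcontfun_eqI)
    fix n
    have "apply_bcontfun (\<Sum>v\<in>V. \<theta> v *\<^sub>R embed (P v)) n = (\<Sum>v\<in>V. apply_bcontfun (\<theta> v *\<^sub>R embed (P v)) n)"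
      by (rule linear_sum[OF bounded_linear.linear[OF bounded_linear_apply_bcontfun]])
    also have "\<dots> = (\<Sum>v\<in>V. (1 / 2) ^ n * (\<theta> v * P v (from_nat n)))"
    proof (rule sum.cong[OF refl])
      fix v assume "v \<in> V"
      from states_bounds(3,4)[OF P(1)[OF this], of "from_nat n"]
      show "apply_bcontfun (\<theta> v *\<^sub>R embed (P v)) n = (1 / 2) ^ n * (\<theta> v * P v (from_nat n))"
        by (simp add: scaleR_bcontfun.rep_eq apply_embed)
    qed
    also have "\<dots> = apply_bcontfun (embed (\<lambda>w. \<Sum>v\<in>V. \<theta> v * P v w)) n"
      using bd[of "from_nat n"] by (simp add: apply_embed sum_distrib_left)
    finally show "apply_bcontfun (embed (\<lambda>w. \<Sum>v\<in>V. \<theta> v * P v w)) n = apply_bcontfun (\<Sum>v\<in>V. \<theta> v *\<^sub>R embed (P v)) n" ..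
  qed
  have C: "embed (P v) \<in> closure periodic_points" if "v \<in> V" for v using P(2)[OF that] closure_subset by blast
  show ?thesis
  proof (cases "sum \<theta> V = 0")
    case True
    then have "\<theta> v = 0" if "v \<in> V" for v using sum_nonneg_eq_0_iff[OF \<open>finite V\<close>, of \<theta>] th(1) that by simp
    then show ?thesis unfolding eq using zero_in_closure_periodic_points by simp
  next
    case False
    define t where "t = sum \<theta> V"
    have t: "0 < t" "t \<le> 1" using False th sum_nonneg[of V \<theta>] by (auto simp: t_def less_le)
    have "(\<Sum>v\<in>V. (\<theta> v / t) *\<^sub>R embed (P v)) \<in> closure periodic_points"
      using convex_closure_periodic_points C th(1) t \<open>finite V\<close>
      by (intro convex_sum) (auto simp: t_def sum_divide_distrib[symmetric])
    then have "(1 - t) *\<^sub>R 0 + t *\<^sub>R (\<Sum>v\<in>V. (\<theta> v / t) *\<^sub>R embed (P v)) \<in> closure periodic_points"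
      using t by (intro convexD_alt[OF convex_closure_periodic_points zero_in_closure_periodic_points]) auto
    then show ?thesis unfolding eq using t by (simp add: scaleR_sum_right)
  qed
qed

text \<open>Immediate for the first letter from the tail bound; invariance moves it to place
  \<open>i\<close>.\<close>

lemma letter_tail_measure:
  assumes m: "m \<in> states r" and "0 < j"
  shows "measure (cyl_measure m) {x. tail_start j \<le> x i} \<le> 1 / real j"
proof -
  note b = states_bounds[OF m]
  interpret shift_measure "cyl_measure m" by (rule shift_measure_cyl_measure[OF b(1)])
  let ?q = "tail_start j"
  have U: "{x. ?q \<le> x 0} = UNIV - (\<Union>a\<in>{..<?q}. cyl [a])" by (auto simp: mem_cyl_Cons)
  have meas: "{x. ?q \<le> x 0} \<in> sets borel" unfolding U by auto
  have "measure (cyl_measure m) (\<Union>a\<in>{..<?q}. cyl [a]) = (\<Sum>a<?q. measure (cyl_measure m) (cyl [a]))"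
    by (rule finite_measure_finite_Union) (auto simp: disjoint_family_on_def mem_cyl_Cons)
  then have "measure (cyl_measure m) {x. ?q \<le> x 0} = m [] - (\<Sum>a<?q. m [a])"
    unfolding U using measure_cyl_measure[OF b(2), of "[]"] finite_measure_Diff[of UNIV "\<Union>a\<in>{..<?q}. cyl [a]"]
    by (simp add: measure_cyl_measure[OF b(2)])
  also have "\<dots> \<le> 1 / real j" using states_tail_bounds(1)[OF m \<open>0 < j\<close>, of "[]"] by simp
  finally have 0: "measure (cyl_measure m) {x. ?q \<le> x 0} \<le> 1 / real j" .
  have "measure (distr (cyl_measure m) borel (left_shift ^^ i)) {x. ?q \<le> x 0} = measure (cyl_measure m) {x. ?q \<le> x i}"
    using meas by (subst measure_distr) (auto simp: funpow_left_shift vimage_def)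
  then show ?thesis using 0 unfolding distr_funpow by simp
qed

text \<open>
  Conditioned on its first \<open>n + 1\<close> letters, a point of the base is replaced by the periodic orbit that
  closes up this word; the words with a large letter, or with a first or last letter not below \<open>q\<close>,
  have small weight and are dropped.
\<close>

lemma states_approximation:
  assumes m: "m \<in> states r" and e: "0 < e"
  obtains m' where "embed m' \<in> closure periodic_points"
    "\<And>w. \<bar>m' w - m w\<bar> \<le> (3 * real (length w) + 7) * e"
proof -
  note b = states_bounds[OF m]
  let ?M = "cyl_measure m"
  interpret shift_measure ?M by (rule shift_measure_cyl_measure[OF b(1)])
  have measM: "measure ?M (cyl w) = m w" for w by (rule measure_cyl_measure[OF b(2)])
  obtain j where j: "0 < j" "1 / real j \<le> e"
    using reals_Archimedean[OF e] by (metis inverse_eq_divide less_imp_le zero_less_Suc)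
  \<comment> \<open>Fixed before \<open>n\<close>, so that only the finitely many connections
    between letters below \<open>q\<close> are used and their cost is bounded independently of
    \<open>n\<close>.\<close>
  define q where "q = tail_start j"
  have "\<exists>p. fst p \<in> markov_shift B \<and> 1 \<le> snd p \<and> fst p 0 = a \<and> fst p (snd p) = b'" for a b'
    using connected[of a b'] by auto
  then obtain pc where pc: "\<And>a b. fst (pc a b) \<in> markov_shift B \<and> 1 \<le> snd (pc a b) \<and> fst (pc a b) 0 = a \<and> fst (pc a b) (snd (pc a b)) = b"
    by metis
  define c l where "c a b' = fst (pc a b')" and "l a b' = snd (pc a b')" for a b'
  have cl: "c a b' \<in> markov_shift B" "c a b' 0 = a" "c a b' (l a b') = b'" "1 \<le> l a b'" for a b'
    using pc unfolding c_def l_def by blast+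
  have member_le: "f a b' \<le> (\<Sum>a<q. \<Sum>b'<q. f a b')" if "a < q" "b' < q" "\<And>a b'. 0 \<le> f a b'" for f :: "nat \<Rightarrow> nat \<Rightarrow> real" and a b'
  proof -
    have "f a b' \<le> (\<Sum>b'<q. f a b')" using that by (intro member_le_sum[of b' _ "f a"]) auto
    also have "\<dots> \<le> (\<Sum>a<q. \<Sum>b'<q. f a b')"
      using that by (intro member_le_sum[of a _ "\<lambda>a. \<Sum>b'<q. f a b'"]) (auto intro: sum_nonneg)
    finally show ?thesis .
  qed
  define D where "D = (\<Sum>a<q. \<Sum>b'<q. birkhoff_sum \<rho> (l a b') (c a b') + total_var (l a b'))"
  define L where "L = (\<Sum>a<q. \<Sum>b'<q. real (l a b'))"
  have tv0: "0 \<le> total_var n" for n by (simp add: total_var_def sum_nonneg v_nonneg)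
  have Dnn: "0 \<le> birkhoff_sum \<rho> (l a b') (c a b') + total_var (l a b')" for a b'
    using birkhoff_sum_rho_ge[OF cl(1), of "l a b'" a b'] tv0[of "l a b'"] by linarith
  have D: "birkhoff_sum \<rho> (l a b') (c a b') + total_var (l a b') \<le> D" if "a < q" "b' < q" for a b'
    unfolding D_def by (rule member_le[where f = "\<lambda>a b'. birkhoff_sum \<rho> (l a b') (c a b') + total_var (l a b')"]) (use that Dnn in auto)
  have L: "real (l a b') \<le> L" if "a < q" "b' < q" for a b'
    unfolding L_def by (rule member_le[where f = "\<lambda>a b'. real (l a b')"]) (use that in auto)
  have DL: "0 \<le> D" "0 \<le> L" unfolding D_def L_def using Dnn by (auto intro!: sum_nonneg)
  obtain D1 where D1: "\<And>n. total_var n \<le> e * real n + D1" using total_var_sublinear[OF e] by blast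
  have D1nn: "0 \<le> D1" using D1[of 0] tv0[of 0] by simp
  \<comment> \<open>Long enough for all bounded quantities, the constants of the distortion bound
    and of the connections, to be at most \<open>e\<close> times \<open>n\<close>.\<close>
  obtain n where n0: "(2 * D1 + D + L + 1) / e < real n" using reals_Archimedean2 by blast
  then have n: "2 * D1 + D + L + 1 \<le> e * real n" using e by (simp add: field_simps)
  have npos: "0 < n" using n DL D1nn by (cases n) auto
  \<comment> \<open>An upper bound for the total length of the closed orbits: \<open>n\<close> for
    the base, one \<open>total_var n\<close> for comparing a word with its points, another for
    closing it up, and \<open>D\<close> for the connection.\<close>
  define T where "T = real n + 2 * total_var n + D"
  have T: "real n \<le> T" "T \<le> real n * (1 + 3 * e)" "0 < T"
  proof -
    show "real n \<le> T" using tv0[of n] DL by (simp add: T_def)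
    then show "0 < T" using npos by simp
    show "T \<le> real n * (1 + 3 * e)" using D1[of n] n DL by (simp add: T_def algebra_simps)
  qed
  \<comment> \<open>Each of the \<open>Suc n\<close> places may exceed \<open>t\<close> with measure
    at most \<open>1 / (Suc n * j)\<close>, which sums to \<open>1 / j\<close>.\<close>
  define t where "t = tail_start (Suc n * j)"
  define V where "V = {v. length v = Suc n \<and> set v \<subseteq> {..<t} \<and> v ! 0 < q \<and> v ! n < q}"
  have finV: "finite V"
    by (rule finite_subset[OF _ finite_lists_length_eq[of "{..<t}" "Suc n"]]) (auto simp: V_def)
  have ind: "x \<in> cyl u \<longleftrightarrow> u = map x [0..<Suc n]" if "u \<in> V" for u x
    using that by (auto simp: V_def mem_cyl_iff simp del: upt_Suc)
  define G where "G = (\<Union>u\<in>V. cyl u)"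
  have Gm [measurable]: "G \<in> sets borel" unfolding G_def using finV by auto
  have Gc: "measure ?M (UNIV - G) \<le> 3 * e"
  proof -
    have tm: "{x :: nat \<Rightarrow> nat. k \<le> x i} \<in> sets borel" for k i
    proof -
      have "{x :: nat \<Rightarrow> nat. k \<le> x i} = (\<lambda>x. x i) -` {k..} \<inter> space borel" by auto
      also have "\<dots> \<in> sets borel" by (rule measurable_sets[of _ _ borel]) auto
      finally show ?thesis .
    qed
    have sub: "UNIV - G \<subseteq> ({x. q \<le> x 0} \<union> {x. q \<le> x n}) \<union> (\<Union>i\<in>{..n}. {x. t \<le> x i})"
    proof
      fix x assume x: "x \<in> UNIV - G"
      show "x \<in> ({x. q \<le> x 0} \<union> {x. q \<le> x n}) \<union> (\<Union>i\<in>{..n}. {x. t \<le> x i})"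
      proof (rule ccontr)
        assume "\<not> ?thesis"
        then have "x 0 < q" "x n < q" "\<And>i. i \<le> n \<Longrightarrow> x i < t" by (auto simp: not_le)
        then have "map x [0..<Suc n] \<in> V" by (auto simp: V_def simp del: upt_Suc)
        moreover have "x \<in> cyl (map x [0..<Suc n])" by (simp add: mem_cyl_iff del: upt_Suc)
        ultimately show False using x by (auto simp: G_def simp del: upt_Suc)
      qed
    qed
    have "measure ?M (UNIV - G) \<le> measure ?M (({x. q \<le> x 0} \<union> {x. q \<le> x n}) \<union> (\<Union>i\<in>{..n}. {x. t \<le> x i}))"
      by (rule finite_measure_mono[OF sub]) (use tm in auto)
    also have "\<dots> \<le> (measure ?M {x. q \<le> x 0} + measure ?M {x. q \<le> x n}) + measure ?M (\<Union>i\<in>{..n}. {x. t \<le> x i})"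
      by (rule order_trans[OF measure_Un_le add_right_mono[OF measure_Un_le]]) (use tm in auto)
    also have "measure ?M (\<Union>i\<in>{..n}. {x. t \<le> x i}) \<le> (\<Sum>i\<in>{..n}. measure ?M {x. t \<le> x i})"
      by (rule finite_measure_subadditive_finite) (use tm in auto)
    also have "\<dots> \<le> (\<Sum>i\<in>{..n}. 1 / real (Suc n * j))"
      unfolding t_def by (intro sum_mono letter_tail_measure[OF m]) (use j in simp)
    also have "\<dots> = real (Suc n) * (1 / (real (Suc n) * real j))"
      by (simp only: sum_constant card_atMost of_nat_mult)
    also have "\<dots> = 1 / real j" by (simp del: of_nat_Suc)
    also have "measure ?M {x. q \<le> x 0} \<le> 1 / real j" unfolding q_def by (rule letter_tail_measure[OF m j(1)])
    also have "measure ?M {x. q \<le> x n} \<le> 1 / real j" unfolding q_def by (rule letter_tail_measure[OF m j(1)])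
    finally show ?thesis using j(2) by simp
  qed
  have mV: "(\<Sum>u\<in>V. m u) \<le> 1"
  proof -
    have "(\<Sum>u\<in>V. measure ?M (cyl u)) = measure ?M (\<Union>u\<in>V. cyl u)"
    proof (rule finite_measure_finite_Union[symmetric, OF finV])
      show "disjoint_family_on cyl V" by (auto simp: disjoint_family_on_def V_def mem_cyl_iff simp del: upt_Suc)
    qed auto
    also have "\<dots> \<le> measure ?M UNIV" by (rule finite_measure_mono) auto
    finally show ?thesis using measM[of "[]"] b(4)[of "[]"] by (simp add: measM)
  qed
  \<comment> \<open>A word of positive weight has a point of the shift space in its cylinder, since
    otherwise its price and hence the cost would be infinite.\<close>
  have "\<exists>x. x \<in> cyl u \<and> (m u \<noteq> 0 \<longrightarrow> x \<in> markov_shift B)" for u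
  proof (cases "m u = 0")
    case True
    have "(\<lambda>j. if j < length u then u ! j else 0) \<in> cyl u" by (simp add: cyl_def)
    with True show ?thesis by blast
  next
    case False
    have "cylinder B u \<noteq> {}"
    proof
      assume "cylinder B u = {}"
      then have "r u = \<infinity>" by (simp add: r_def)
      then have "(\<Sum>u\<in>{u}. r u * ennreal (m u)) = \<infinity>"
        using False b(3)[of u] by (simp add: ennreal_top_mult)
      moreover have "(\<Sum>u\<in>{u}. r u * ennreal (m u)) \<le> level r m (length u)"
        unfolding level_def by (rule sum_le_nn_integral_count_space) auto
      ultimately have "\<infinity> \<le> cost r m" using level_le_cost[of m "length u"] by (metis order_trans)
      then show False using b(5) by (simp add: top_unique)
    qed
    then show ?thesis by (auto simp: cylinder_eq)
  qed
  then obtain X where X: "\<And>u. X u \<in> cyl u" "\<And>u. m u \<noteq> 0 \<Longrightarrow> X u \<in> markov_shift B" by metis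
  have Xu: "X u i = u ! i" if "u \<in> V" "i \<le> n" for u i
    using X(1)[of u] that by (auto simp: cyl_def V_def)
  define N where "N u = n + l (u ! n) (u ! 0)" for u
  have "\<exists>z. u \<in> V \<and> m u \<noteq> 0 \<longrightarrow> periodic z (N u) \<and>
      birkhoff_sum \<rho> (N u) z \<le> birkhoff_sum \<rho> n (X u) + total_var n + D \<and>
      (\<forall>w. \<bar>birkhoff_sum (indicator (cyl w)) (N u) z - birkhoff_sum (indicator (cyl w)) n (X u)\<bar> \<le> 2 * real (length w) + L)" for u
  proof (cases "u \<in> V \<and> m u \<noteq> 0")
    case True
    then have u: "u \<in> V" and Xs: "X u \<in> markov_shift B" using X(2) by auto
    let ?c = "c (u ! n) (u ! 0)" and ?l = "l (u ! n) (u ! 0)"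
    have uq: "u ! n < q" "u ! 0 < q" using u by (auto simp: V_def)
    have ends: "X u n = ?c 0" "?c ?l = X u 0" using Xu[OF u] cl by auto
    have "0 < n + ?l" using npos by simp
    from close_two_segments[OF Xs cl(1) ends this] obtain z where
      z: "periodic z (N u)" "\<And>i. i \<le> n \<Longrightarrow> z i = X u i" "\<And>i. i \<le> ?l \<Longrightarrow> (left_shift ^^ n) z i = ?c i"
      unfolding N_def by blast
    have zs: "z \<in> markov_shift B" using z(1) by (simp add: periodic_def)
    note est = two_segments_estimate[where n = n and k = "?l", OF zs Xs cl(1) z(2,3), folded N_def]
    have "birkhoff_sum \<rho> (N u) z \<le> birkhoff_sum \<rho> n (X u) + total_var n + D"
      using est(1) D[OF uq] by linarith
    moreover have "\<bar>birkhoff_sum (indicator (cyl w)) (N u) z - birkhoff_sum (indicator (cyl w)) n (X u)\<bar> \<le> 2 * real (length w) + L" for w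
      using est(2)[of w] L[OF uq] birkhoff_sum_indicator_le[of "cyl w" ?l ?c] birkhoff_sum_indicator_nonneg[of "cyl w" ?l ?c]
      by linarith
    ultimately show ?thesis using z(1) by blast
  qed auto
  then obtain Z where Z: "\<And>u. u \<in> V \<Longrightarrow> m u \<noteq> 0 \<Longrightarrow> periodic (Z u) (N u)"
    and Zr: "\<And>u. u \<in> V \<Longrightarrow> m u \<noteq> 0 \<Longrightarrow> birkhoff_sum \<rho> (N u) (Z u) \<le> birkhoff_sum \<rho> n (X u) + total_var n + D"
    and Zc: "\<And>u w. u \<in> V \<Longrightarrow> m u \<noteq> 0 \<Longrightarrow>
      \<bar>birkhoff_sum (indicator (cyl w)) (N u) (Z u) - birkhoff_sum (indicator (cyl w)) n (X u)\<bar> \<le> 2 * real (length w) + L"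
    by metis
  define U where "U = {u\<in>V. m u \<noteq> 0}"
  have finU: "finite U" using finV by (simp add: U_def)
  have mU: "(\<Sum>u\<in>U. m u * f u) = (\<Sum>u\<in>V. m u * f u)" for f
    unfolding U_def by (rule sum.mono_neutral_left) (use finV in auto)
  define S where "S u = birkhoff_sum \<rho> (N u) (Z u)" for u
  have Spos: "0 < S u" if "u \<in> U" for u
  proof -
    have "periodic (Z u) (N u)" using Z that by (simp add: U_def)
    then show ?thesis using birkhoff_sum_rho_ge[of "Z u" "N u"] by (auto simp: S_def periodic_def)
  qed
  \<comment> \<open>On the cylinder of \<open>u\<close> the Birkhoff sum is at least its value at
    \<open>X u\<close> minus the distortion, and by invariance the mean Birkhoff sum of the roof is
    \<open>n\<close> times the cost.\<close>
  have base: "(\<Sum>u\<in>U. m u * (birkhoff_sum \<rho> n (X u) - total_var n)) \<le> real n"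
  proof -
    \<comment> \<open>The truncation at zero permits the comparison in the extended nonnegative
      reals.\<close>
    define g where "g u = max 0 (birkhoff_sum \<rho> n (X u) - total_var n)" for u
    have pt: "(\<Sum>u\<in>U. ennreal (g u) * indicator (cyl u) x) \<le> (\<Sum>i<n. roof r ((left_shift ^^ i) x))" for x
    proof (cases "x \<in> markov_shift B")
      case False
      have "roof r ((left_shift ^^ 0) x) \<le> (\<Sum>i<n. roof r ((left_shift ^^ i) x))"
        using npos by (intro member_le_sum[of 0 _ "\<lambda>i. roof r ((left_shift ^^ i) x)"]) auto
      then have "(\<Sum>i<n. roof r ((left_shift ^^ i) x)) = top"
        using roof_outside[OF False] by (simp only: funpow_0 infinity_ennreal_def top_unique)
      then show ?thesis by (simp only: top_greatest)
    next
      case True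
      have rx: "(\<Sum>i<n. roof r ((left_shift ^^ i) x)) = ennreal (birkhoff_sum \<rho> n x)"
        unfolding birkhoff_sum_def roof_eq[OF shift_in_markov_shift[OF True]]
        using rho_ge_1[OF shift_in_markov_shift[OF True]] by (intro sum_ennreal) (simp add: order_trans[OF zero_le_one])
      let ?u = "map x [0..<Suc n]"
      have "(\<Sum>u\<in>U. ennreal (g u) * indicator (cyl u) x) = (\<Sum>u\<in>U. if u = ?u then ennreal (g ?u) else 0)"
        by (intro sum.cong) (auto simp: U_def ind indicator_def simp del: upt_Suc)
      also have "\<dots> = (if ?u \<in> U then ennreal (g ?u) else 0)"
        using finU by (simp del: upt_Suc)
      also have "\<dots> \<le> ennreal (birkhoff_sum \<rho> n x)"
      proof (cases "?u \<in> U")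
        case True
        then have u: "?u \<in> V" "X ?u \<in> markov_shift B" using X(2) by (auto simp: U_def simp del: upt_Suc)
        have "X ?u i = x i" if "i \<le> n" for i
          using Xu[OF u(1) that] that by (simp del: upt_Suc)
        then have "birkhoff_sum \<rho> n (X ?u) - total_var n \<le> birkhoff_sum \<rho> n x"
          using birkhoff_sum_rho_close[OF u(2) \<open>x \<in> markov_shift B\<close>, of n] by (simp add: abs_le_iff del: upt_Suc)
        moreover have "0 \<le> birkhoff_sum \<rho> n x"
          using birkhoff_sum_rho_ge[OF \<open>x \<in> markov_shift B\<close>, of n] by simp
        ultimately show ?thesis using True by (simp add: g_def ennreal_leI del: upt_Suc)
      qed (simp del: upt_Suc)
      finally show ?thesis by (simp add: rx)
    qed
    have gnn: "0 \<le> g u" for u by (simp add: g_def)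
    have "ennreal (\<Sum>u\<in>U. m u * g u) = (\<Sum>u\<in>U. ennreal (m u * g u))"
      by (rule sum_ennreal[symmetric]) (simp add: b(3) gnn)
    also have "\<dots> = (\<Sum>u\<in>U. ennreal (g u) * ennreal (m u))"
      by (intro sum.cong refl) (simp add: ennreal_mult[OF b(3) gnn] mult.commute[of "ennreal (m _)"])
    finally have "ennreal (\<Sum>u\<in>U. m u * g u) = (\<Sum>u\<in>U. ennreal (g u) * ennreal (m u))" .
    also have "\<dots> = (\<integral>\<^sup>+x. (\<Sum>u\<in>U. ennreal (g u) * indicator (cyl u) x) \<partial>?M)"
      by (simp add: nn_integral_sum nn_integral_cmult emeasure_cyl_measure[OF b(2)])
    also have "\<dots> \<le> (\<integral>\<^sup>+x. (\<Sum>i<n. roof r ((left_shift ^^ i) x)) \<partial>?M)" by (rule nn_integral_mono[OF pt])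
    also have "\<dots> = (\<Sum>i<n. \<integral>\<^sup>+x. roof r ((left_shift ^^ i) x) \<partial>?M)"
      by (rule nn_integral_sum) measurable
    also have "\<dots> = (\<Sum>i<n. cost r m)"
      by (simp add: nn_integral_funpow cost_eq_nn_integral[OF b(2)])
    also have "\<dots> \<le> (\<Sum>i<n. 1)" using b(5) by (intro sum_mono)
    also have "\<dots> = ennreal (real n)" by (simp add: ennreal_of_nat_eq_real_of_nat)
    finally have "(\<Sum>u\<in>U. m u * g u) \<le> real n" by (simp del: ennreal_of_nat_eq_real_of_nat)
    moreover have "(\<Sum>u\<in>U. m u * (birkhoff_sum \<rho> n (X u) - total_var n)) \<le> (\<Sum>u\<in>U. m u * g u)"
      using b(3) by (intro sum_mono mult_left_mono) (auto simp: g_def)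
    ultimately show ?thesis by simp
  qed
  have mU1: "(\<Sum>u\<in>U. m u * 1) \<le> 1" unfolding mU using mV by simp
  have tot: "(\<Sum>u\<in>U. m u * S u) \<le> T"
  proof -
    have "(\<Sum>u\<in>U. m u * S u) \<le> (\<Sum>u\<in>U. m u * (birkhoff_sum \<rho> n (X u) - total_var n) + m u * (2 * total_var n + D))"
      unfolding distrib_left[symmetric]
    proof (intro sum_mono mult_left_mono b(3))
      fix u assume "u \<in> U"
      then show "S u \<le> birkhoff_sum \<rho> n (X u) - total_var n + (2 * total_var n + D)"
        using Zr[of u] by (simp add: U_def S_def)
    qed
    also have "\<dots> = (\<Sum>u\<in>U. m u * (birkhoff_sum \<rho> n (X u) - total_var n)) + (\<Sum>u\<in>U. m u * 1) * (2 * total_var n + D)"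
      by (simp add: sum.distrib sum_distrib_right)
    also have "\<dots> \<le> real n + 1 * (2 * total_var n + D)"
      using base mU1 tv0[of n] DL by (intro add_mono mult_right_mono) auto
    finally show ?thesis by (simp add: T_def)
  qed
  \<comment> \<open>The factor \<open>S u\<close> cancels the normalization of the periodic state,
    so \<open>T * m' w\<close> is the weighted sum of the plain counts. Dividing by the bound
    \<open>T\<close> rather than by the exact total keeps the coefficients summable to at most
    \<open>1\<close>.\<close>
  define m' where "m' w = (\<Sum>u\<in>U. (m u * S u / T) * periodic_state (Z u) (N u) w)" for w
  have PS: "periodic_state (Z u) (N u) \<in> states r" if "u \<in> U" for u
    using periodic_state_in_states Z that by (simp add: U_def)
  have thnn: "0 \<le> m u * S u / T" if "u \<in> U" for u
    using b(3)[of u] Spos[OF that] T(3) by simp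
  have thsum: "(\<Sum>u\<in>U. m u * S u / T) \<le> 1"
    using tot T(3) by (simp add: sum_divide_distrib[symmetric])
  have in_closure: "embed m' \<in> closure periodic_points"
    unfolding m'_def
  proof (rule sum_in_closure_periodic_points[OF finU thnn thsum PS])
    show "embed (periodic_state (Z u) (N u)) \<in> periodic_points" if "u \<in> U" for u
      using Z that by (auto simp: U_def periodic_points_def)
  qed
  have m'1: "0 \<le> m' w" "m' w \<le> 1" for w
  proof -
    show "0 \<le> m' w" unfolding m'_def using thnn states_bounds(3)[OF PS] by (intro sum_nonneg mult_nonneg_nonneg) auto
    have "m' w \<le> (\<Sum>u\<in>U. m u * S u / T * 1)"
      unfolding m'_def using thnn states_bounds(4)[OF PS] by (intro sum_mono mult_left_mono) auto
    then show "m' w \<le> 1" using thsum by simp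
  qed
  have Tm': "T * m' w = (\<Sum>u\<in>U. m u * birkhoff_sum (indicator (cyl w)) (N u) (Z u))" for w
    unfolding m'_def sum_distrib_left
  proof (rule sum.cong[OF refl])
    fix u assume "u \<in> U"
    with Spos have "S u \<noteq> 0" by force
    then show "T * (m u * S u / T * periodic_state (Z u) (N u) w) = m u * birkhoff_sum (indicator (cyl w)) (N u) (Z u)"
      using T(3) by (simp add: periodic_state_def S_def)
  qed
  \<comment> \<open>The weighted counts at the sample points are compared with the mean count
    \<open>n * m w\<close>: on \<open>G\<close> a point and its sample differ by at most
    \<open>length w\<close>, off \<open>G\<close> by at most \<open>n\<close>.\<close>
  have cnt: "\<bar>(\<Sum>u\<in>V. m u * birkhoff_sum (indicator (cyl w)) n (X u)) - real n * m w\<bar> \<le> real (length w) + real n * (3 * e)" for w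
  proof -
    let ?b = "birkhoff_sum (indicator (cyl w) :: _ \<Rightarrow> real) n"
    define g where "g x = ?b x - (\<Sum>u\<in>V. indicator (cyl u) x * ?b (X u))" for x
    have gb: "\<bar>g x\<bar> \<le> real (length w) + real n * indicator (UNIV - G) x" for x
    proof -
      let ?u = "map x [0..<Suc n]"
      have "(\<Sum>u\<in>V. indicator (cyl u) x * ?b (X u)) = (\<Sum>u\<in>V. if u = ?u then ?b (X ?u) else 0)"
        by (intro sum.cong) (auto simp: ind indicator_def simp del: upt_Suc)
      also have "\<dots> = (if ?u \<in> V then ?b (X ?u) else 0)" using finV by (simp del: upt_Suc)
      finally have g: "g x = ?b x - (if ?u \<in> V then ?b (X ?u) else 0)" unfolding g_def by simp
      show ?thesis
      proof (cases "?u \<in> V")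
        case True
        have "x \<in> cyl ?u" by (simp add: mem_cyl_iff del: upt_Suc)
        then have "x \<in> G" using True unfolding G_def by blast
        moreover have "\<bar>?b x - ?b (X ?u)\<bar> \<le> real (length w)"
        proof (rule birkhoff_sum_indicator_close)
          fix i assume "i < n"
          then show "x i = X ?u i" using Xu[OF True, of i] by (simp del: upt_Suc)
        qed
        ultimately show ?thesis using True g by (simp del: upt_Suc)
      next
        case False
        have "x \<notin> G"
        proof
          assume "x \<in> G"
          then obtain u where "u \<in> V" "x \<in> cyl u" by (auto simp: G_def)
          then have "u = ?u" by (auto simp: V_def mem_cyl_iff simp del: upt_Suc)
          with \<open>u \<in> V\<close> False show False by (simp del: upt_Suc)
        qed
        then show ?thesis
          using g False birkhoff_sum_indicator_le[of "cyl w" n x] birkhoff_sum_indicator_nonneg[of "cyl w" n x]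
          by (simp del: upt_Suc)
      qed
    qed
    have [measurable]: "g \<in> borel_measurable borel" unfolding g_def by measurable
    have ib: "integrable ?M ?b"
      by (rule integrable_bounded[where C = "real n"])
         (use birkhoff_sum_indicator_le birkhoff_sum_indicator_nonneg in auto)
    have bi: "(\<integral>x. ?b x \<partial>?M) = real n * m w"
      using integral_birkhoff_sum[of "indicator (cyl w)" 1 n] by (simp add: measM indicator_le_1)
    have ii: "integrable ?M (\<lambda>x. indicator (cyl u) x * ?b (X u))" for u
      by (intro integrable_mult_left integrable_real_indicator) (auto simp: emeasure_eq_measure)
    have "(\<integral>x. g x \<partial>?M) = real n * m w - (\<Sum>u\<in>V. m u * ?b (X u))"
      unfolding g_def using ib bi ii by (simp add: measM)
    moreover have "\<bar>\<integral>x. g x \<partial>?M\<bar> \<le> (\<integral>x. real (length w) + real n * indicator (UNIV - G) x \<partial>?M)"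
    proof (rule order_trans[OF integral_abs_bound integral_mono])
      show "integrable ?M (\<lambda>x. \<bar>g x\<bar>)"
      proof (rule integrable_bounded[where C = "real (length w) + real n"])
        show "\<bar>\<bar>g x\<bar>\<bar> \<le> real (length w) + real n" for x using gb[of x] by (cases "x \<in> G") auto
      qed measurable
      show "integrable ?M (\<lambda>x. real (length w) + real n * indicator (UNIV - G) x)"
        by (intro Bochner_Integration.integrable_add integrable_mult_right integrable_real_indicator)
           (auto simp: emeasure_eq_measure)
    qed (rule gb)
    moreover have "(\<integral>x. real (length w) + real n * indicator (UNIV - G) x \<partial>?M) \<le> real (length w) + real n * (3 * e)"
    proof -
      have "(\<integral>x. real (length w) + real n * indicator (UNIV - G) x \<partial>?M) = real (length w) * m [] + real n * measure ?M (UNIV - G)"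
        using measM[of "[]"] by (subst Bochner_Integration.integral_add) (auto simp: emeasure_eq_measure intro!: integrable_real_indicator)
      also have "\<dots> \<le> real (length w) * 1 + real n * (3 * e)"
        using Gc b(4)[of "[]"] by (intro add_mono mult_left_mono) auto
      finally show ?thesis by simp
    qed
    ultimately show ?thesis by (simp add: abs_minus_commute)
  qed
  show thesis
  proof (rule that[OF in_closure])
    fix w :: "nat list"
    let ?L = "real (length w)"
    have 1: "\<bar>T * m' w - (\<Sum>u\<in>V. m u * birkhoff_sum (indicator (cyl w)) n (X u))\<bar> \<le> 2 * ?L + L"
    proof -
      have "T * m' w - (\<Sum>u\<in>V. m u * birkhoff_sum (indicator (cyl w)) n (X u)) =
          (\<Sum>u\<in>U. m u * (birkhoff_sum (indicator (cyl w)) (N u) (Z u) - birkhoff_sum (indicator (cyl w)) n (X u)))"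
        unfolding Tm' mU[symmetric] by (simp add: sum_subtractf right_diff_distrib)
      also have "\<bar>\<dots>\<bar> \<le> (\<Sum>u\<in>U. m u * (2 * ?L + L))"
      proof (rule order_trans[OF sum_abs sum_mono])
        fix u assume "u \<in> U"
        then show "\<bar>m u * (birkhoff_sum (indicator (cyl w)) (N u) (Z u) - birkhoff_sum (indicator (cyl w)) n (X u))\<bar> \<le> m u * (2 * ?L + L)"
          unfolding abs_mult using Zc[of u w] b(3)[of u] by (intro mult_mono) (auto simp: U_def)
      qed
      also have "\<dots> = (\<Sum>u\<in>U. m u * 1) * (2 * ?L + L)" by (simp add: sum_distrib_right)
      also have "\<dots> \<le> 1 * (2 * ?L + L)" using mU1 DL by (intro mult_right_mono) auto
      finally show ?thesis by simp
    qed
    have 2: "\<bar>T * m' w - real n * m w\<bar> \<le> 3 * ?L + L + real n * (3 * e)" using 1 cnt[of w] by linarith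
    have 3: "\<bar>T * m' w - real n * m' w\<bar> \<le> real n * (3 * e)"
    proof -
      have "\<bar>T * m' w - real n * m' w\<bar> = (T - real n) * m' w"
        using T(1) m'1[of w] by (simp add: left_diff_distrib[symmetric] abs_mult)
      also have "\<dots> \<le> (real n * (3 * e)) * 1"
        using T m'1[of w] e by (intro mult_mono) (auto simp: algebra_simps)
      finally show ?thesis by simp
    qed
    \<comment> \<open>Besides \<open>3 * length w\<close>, now absorbed because
      \<open>e * real n\<close> is at least \<open>1\<close>, the errors are \<open>1\<close> for
      the connections, \<open>3\<close> for the dropped words and \<open>3\<close> for
      \<open>T\<close> against \<open>n\<close>, in units of \<open>e * real n\<close>.\<close>
    have 4: "L \<le> e * real n" "1 \<le> e * real n" using n DL D1nn by linarith+
    have "3 * ?L \<le> 3 * ?L * (e * real n)" using mult_left_mono[OF 4(2), of "3 * ?L"] by simp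
    then have "\<bar>real n * m' w - real n * m w\<bar> \<le> 3 * ?L * (e * real n) + e * real n + real n * (3 * e) + real n * (3 * e)"
      using 2 3 4(1) by linarith
    also have "\<dots> = real n * ((3 * ?L + 7) * e)" by (simp add: algebra_simps)
    also have "\<bar>real n * m' w - real n * m w\<bar> = real n * \<bar>m' w - m w\<bar>"
      by (simp add: right_diff_distrib[symmetric] abs_mult)
    finally show "\<bar>m' w - m w\<bar> \<le> (3 * ?L + 7) * e" using npos by simp
  qed
qed

theorem states_in_closure_periodic_points:
  assumes m: "m \<in> states r"
  shows "embed m \<in> closure periodic_points"
proof -
  have "\<exists>m'. embed m' \<in> closure periodic_points \<and> (\<forall>w. \<bar>m' w - m w\<bar> \<le> (3 * real (length w) + 7) * (1 / real (Suc k)))" for k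
  proof -
    have "0 < 1 / real (Suc k)" by simp
    from states_approximation[OF m this] show ?thesis by metis
  qed
  then obtain m' where m': "\<And>k. embed (m' k) \<in> closure periodic_points"
    "\<And>k w. \<bar>m' k w - m w\<bar> \<le> (3 * real (length w) + 7) * (1 / real (Suc k))" by metis
  have "(\<lambda>k. m' k w) \<longlonglongrightarrow> m w" for w
  proof -
    have "(\<lambda>k. (3 * real (length w) + 7) / real (Suc k)) \<longlonglongrightarrow> 0" by (rule LIMSEQ_Suc[OF lim_const_over_n])
    then have "(\<lambda>k. m' k w - m w) \<longlonglongrightarrow> 0"
      by (rule Lim_null_comparison[rotated]) (use m'(2)[where w = w] in simp)
    then show ?thesis by (simp only: LIM_zero_iff)
  qed
  then have "(\<lambda>k. embed (m' k)) \<longlonglongrightarrow> embed m" by (rule tendsto_embed)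
  then show ?thesis using closed_sequentially[OF closed_closure, of "\<lambda>k. embed (m' k)"] m'(1) by blast
qed

theorem poulsen_simplex_states: "poulsen_simplex (embed ` states r)"
  unfolding poulsen_simplex_def
proof (intro conjI choquet_simplex_states)
  obtain z n where z: "periodic z n" by (rule simple_loop[of 0])
  have "periodic_state z n [] \<noteq> 0"
    using z birkhoff_sum_rho_ge[of z n] by (auto simp: periodic_state_def periodic_def birkhoff_sum_def[of "\<lambda>x. 1"])
  then have "periodic_state z n \<noteq> (\<lambda>w. 0)" by (auto simp: fun_eq_iff)
  then have "embed (periodic_state z n) \<noteq> embed (\<lambda>w. 0)"
    using inj_on_eq_iff[OF inj_on_embed periodic_state_in_states[OF z] zero_in_states] by simp
  then show "\<exists>x\<in>embed ` states r. \<exists>y\<in>embed ` states r. x \<noteq> y"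
    using periodic_state_in_states[OF z] zero_in_states by blast
  show "embed ` states r \<subseteq> closure {e. e extreme_point_of (embed ` states r)}"
    using states_in_closure_periodic_points closure_mono[OF periodic_points_extreme] by blast
qed

end

section \<open>Invariant measures of the suspension flow\<close>

text \<open>Cauchy's functional equation: nonnegativity gives monotonicity, so \<open>f h\<close> is
  squeezed between neighbouring multiples of \<open>f (b / n)\<close>.\<close>

lemma additive_on_interval:
  fixes f :: "real \<Rightarrow> real"
  assumes b: "0 < b" and nn: "\<And>h. 0 \<le> h \<Longrightarrow> h \<le> b \<Longrightarrow> 0 \<le> f h"
    and add: "\<And>x y. 0 \<le> x \<Longrightarrow> 0 \<le> y \<Longrightarrow> x + y \<le> b \<Longrightarrow> f (x + y) = f x + f y"
    and h: "0 \<le> h" "h \<le> b"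
  shows "f h = h / b * f b"
proof -
  have mono: "f x \<le> f y" if "0 \<le> x" "x \<le> y" "y \<le> b" for x y
    using add[of x "y - x"] nn[of "y - x"] that by simp
  have mult: "f (real k * u) = real k * f u" if "0 \<le> u" "real k * u \<le> b" for k u
    using that(2)
  proof (induction k)
    case 0
    show ?case using add[of 0 0] b by simp
  next
    case (Suc k)
    have e: "real (Suc k) * u = real k * u + u" by (simp add: algebra_simps)
    have "f (real (Suc k) * u) = f (real k * u) + f u"
      unfolding e using Suc.prems that(1) by (intro add) (auto simp: algebra_simps)
    moreover have "f (real k * u) = real k * f u"
      using Suc.prems that(1) by (intro Suc.IH) (auto simp: algebra_simps)
    ultimately show ?case by (simp add: algebra_simps)
  qed
  have close: "\<bar>f h - h / b * f b\<bar> \<le> f b / real n" if n: "0 < n" for n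
  proof -
    define u where "u = b / real n"
    have u: "0 < u" "real n * u = b" using b n by (auto simp: u_def)
    have fu: "f u = f b / real n" using mult[of u n] u n by (simp add: field_simps)
    define k where "k = nat \<lfloor>h / u\<rfloor>"
    have k: "real k \<le> h / u" "h / u < real k + 1" using h u by (simp_all add: k_def)
    have k1: "real k * u \<le> h" and k2: "h < real (Suc k) * u" using k u by (simp_all add: field_simps)
    have lo: "real k * f u \<le> f h" using mult[of u k] mono[of "real k * u" h] k1 h u by simp
    have hi: "f h \<le> real (Suc k) * f u"
    proof (cases "Suc k \<le> n")
      case True
      then have "real (Suc k) * u \<le> b" using u(2) mult_right_mono[of "real (Suc k)" "real n" u] u(1) by simp
      then show ?thesis using mult[of u "Suc k"] mono[of h "real (Suc k) * u"] k2 h u by simp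
    next
      case False
      have "f h \<le> f b" using mono h by simp
      also have "f b = real n * f u" using fu n by simp
      also have "\<dots> \<le> real (Suc k) * f u" using False fu nn[of b] b by (intro mult_right_mono) auto
      finally show ?thesis .
    qed
    have "h / u = h / b * real n" using b n by (simp add: u_def field_simps)
    then have e: "h / b * f b = h / u * f u" using n by (simp add: fu)
    have fu0: "0 \<le> f u" using nn[of b] b by (simp add: fu)
    have "real k * f u \<le> h / u * f u" "h / u * f u \<le> real (Suc k) * f u"
      using mult_right_mono[OF k(1) fu0] mult_right_mono[OF less_imp_le[OF k(2)] fu0]
      by (simp_all add: algebra_simps)
    moreover have "real (Suc k) * f u = real k * f u + f u" by (simp add: algebra_simps)
    ultimately have "f h \<le> h / b * f b + f u" "h / b * f b \<le> f h + f u"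
      using lo hi e by linarith+
    then show ?thesis using fu by (simp add: abs_le_iff)
  qed
  have "(\<lambda>n. f b / real n) \<longlonglongrightarrow> 0" by (rule lim_const_over_n)
  then have "\<bar>f h - h / b * f b\<bar> \<le> 0"
    by (rule LIMSEQ_le_const) (use close in \<open>auto intro!: exI[of _ 1]\<close>)
  then show ?thesis by simp
qed

lemma continuous_on_left_shift: "continuous_on S left_shift"
  unfolding left_shift_def by (rule continuous_on_coordinatewise_then_product) (rule continuous_on_subset[OF _ subset_UNIV], simp)

lemma closed_markov_shift: "closed (markov_shift B)"
proof -
  have "open (- markov_shift B)"
  proof (subst open_subopen, intro ballI)
    fix x assume "x \<in> - markov_shift B"
    then obtain n where n: "\<not> B (x n) (x (Suc n))" by (auto simp: markov_shift_def)
    have "cyl (map x [0..<n + 2]) \<subseteq> - markov_shift B"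
    proof
      fix y assume "y \<in> cyl (map x [0..<n + 2])"
      then have "\<forall>j<n + 2. y j = x j" by (auto simp: cyl_def simp del: upt_Suc)
      then have "y n = x n" "y (Suc n) = x (Suc n)" by auto
      then have "\<not> B (y n) (y (Suc n))" using n by simp
      then show "y \<in> - markov_shift B" by (auto simp: markov_shift_def)
    qed
    moreover have "x \<in> cyl (map x [0..<n + 2])" by (simp add: mem_cyl_iff del: upt_Suc)
    ultimately show "\<exists>T. open T \<and> x \<in> T \<and> T \<subseteq> - markov_shift B" using open_cyl by blast
  qed
  then show ?thesis by (simp add: closed_def)
qed

lemma shift_topology_eq: "shift_topology B = top_of_set (markov_shift B)"
proof (rule topology_eq[THEN iffD2], rule allI, rule iffI)
  fix U assume "openin (shift_topology B) U"
  then have "generate_topology_on (cylinders B) U"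
    unfolding shift_topology_def by (simp add: openin_topology_generated_by_iff)
  then show "openin (top_of_set (markov_shift B)) U"
  proof induction
    case (Basis s)
    then show ?case by (auto simp: cylinders_def cylinder_eq intro: openin_open_Int open_cyl)
  qed (auto intro: openin_Union)
next
  fix U assume "openin (top_of_set (markov_shift B)) U"
  then obtain V where V: "open V" "U = markov_shift B \<inter> V" by (auto simp: openin_open)
  have "U = \<Union>{cylinder B w | w. w \<noteq> [] \<and> cyl w \<subseteq> V}"
  proof
    show "U \<subseteq> \<Union>{cylinder B w | w. w \<noteq> [] \<and> cyl w \<subseteq> V}"
    proof
      fix x assume x: "x \<in> U"
      then obtain n where n: "cyl (map x [0..<n]) \<subseteq> V" using open_contains_cyl[OF V(1), of x] V(2) by blast
      \<comment> \<open>One letter more, because the generating cylinders exclude the empty word and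
        \<open>n\<close> may be \<open>0\<close>.\<close>
      have "cyl (map x [0..<Suc n]) \<subseteq> cyl (map x [0..<n])" by (auto simp: mem_cyl_snoc)
      moreover have "x \<in> cylinder B (map x [0..<Suc n])"
        using x V(2) by (simp add: cylinder_eq mem_cyl_iff del: upt_Suc)
      ultimately show "x \<in> \<Union>{cylinder B w | w. w \<noteq> [] \<and> cyl w \<subseteq> V}"
        using n by (intro UnionI[of "cylinder B (map x [0..<Suc n])"]) auto
    qed
    show "\<Union>{cylinder B w | w. w \<noteq> [] \<and> cyl w \<subseteq> V} \<subseteq> U"
      using V(2) by (auto simp: cylinder_eq)
  qed
  moreover have "openin (shift_topology B) (\<Union>{cylinder B w | w. w \<noteq> [] \<and> cyl w \<subseteq> V})"
    unfolding shift_topology_def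
    by (intro openin_Union ballI topology_generated_by_Basis) (auto simp: cylinders_def)
  ultimately show "openin (shift_topology B) U" by simp
qed

locale suspension_setting =
  fixes B :: "nat \<Rightarrow> nat \<Rightarrow> bool" and \<tau> :: "(nat \<Rightarrow> nat) \<Rightarrow> real" and c \<delta> :: real
  assumes c_pos: "0 < c" and c_less: "c < \<delta>"
    and tau_ge: "x \<in> markov_shift B \<Longrightarrow> \<delta> \<le> \<tau> x"
    and continuous_tau: "continuous_on (markov_shift B) \<tau>"
begin

abbreviation "\<Sigma> \<equiv> markov_shift B"
abbreviation "Y \<equiv> suspension B \<tau>"

text \<open>The roof is controlled only on the shift space; extended by \<open>0\<close> it is a
  Borel function of all sequences.\<close>

definition height :: "(nat \<Rightarrow> nat) \<Rightarrow> real" where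
  "height x = (if x \<in> \<Sigma> then \<tau> x else 0)"

lemma tau_pos: "x \<in> \<Sigma> \<Longrightarrow> 0 < \<tau> x" "x \<in> \<Sigma> \<Longrightarrow> c < \<tau> x"
  using tau_ge[of x] c_pos c_less by auto

lemma tau_nonzero: "x \<in> \<Sigma> \<Longrightarrow> \<tau> x \<noteq> 0"
  using tau_pos(1)[of x] by auto

lemma left_shift_Sigma: "x \<in> \<Sigma> \<Longrightarrow> left_shift x \<in> \<Sigma>"
  using shift_in_markov_shift[of x B 1] by simp

lemma Y_eq: "Y = {(x, t). x \<in> \<Sigma> \<and> 0 \<le> t \<and> t < \<tau> x}"
  by (rule suspension_eq) (use tau_pos in auto)

lemma Sigma_sets [measurable, simp]: "\<Sigma> \<in> sets borel"
  by (rule borel_closed[OF closed_markov_shift])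

lemma height_measurable [measurable]: "height \<in> borel_measurable borel"
  unfolding height_def using continuous_tau
  by (intro borel_measurable_continuous_on_if) auto

lemma Y_sets [measurable, simp]: "Y \<in> sets borel"
proof -
  have "Y = {p \<in> space borel. fst p \<in> \<Sigma> \<and> 0 \<le> snd p \<and> snd p < height (fst p)}"
    by (auto simp: Y_eq height_def)
  also have "\<dots> \<in> sets (borel \<Otimes>\<^sub>M borel)"
    unfolding borel_prod[symmetric] space_pair_measure by measurable
  finally show ?thesis by (simp only: borel_prod)
qed

lemma region_topology_eq: "region_topology B \<tau> = top_of_set (region B \<tau>)"
proof -
  have "prod_topology (top_of_set \<Sigma>) euclideanreal = top_of_set (\<Sigma> \<times> UNIV)"
    using subtopology_Times[of euclidean euclideanreal \<Sigma> UNIV] by simp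
  moreover have "(\<Sigma> \<times> UNIV) \<inter> region B \<tau> = region B \<tau>" by (auto simp: region_def)
  ultimately show ?thesis
    by (simp add: region_topology_def shift_topology_eq subtopology_subtopology)
qed

lemma continuous_on_region:
  "continuous_on (region B \<tau>) (\<lambda>p. \<tau> (fst p) - snd p)"
proof -
  have "continuous_on (region B \<tau>) (\<lambda>p. \<tau> (fst p))"
    by (rule continuous_on_compose2[OF continuous_tau]) (auto simp: region_def intro: continuous_on_fst continuous_on_id)
  then show ?thesis by (intro continuous_intros)
qed

text \<open>Gluing sends roof points to height \<open>0\<close>, so with \<open>a\<close>
  nonnegative the preimage avoids the roof and is relatively open.\<close>

lemma suspension_open_strip:
  assumes "0 \<le> a"
  shows "openin (suspension_topology B \<tau>) {p \<in> Y. fst p \<in> cyl w \<and> a < snd p}"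
  unfolding openin_suspension_topology
proof
  let ?O = "{p \<in> region B \<tau>. \<tau> (fst p) - snd p \<in> {0<..}}"
  have eq: "{p \<in> region B \<tau>. glue \<tau> p \<in> {p \<in> Y. fst p \<in> cyl w \<and> a < snd p}} = ?O \<inter> (cyl w \<times> {a<..})"
    using assms by (auto simp: glue_def Y_eq region_def split: if_splits)
  have op: "openin (top_of_set (region B \<tau>)) ?O"
    using continuous_openin_preimage_gen[OF continuous_on_region, of "{0<..}"] by (simp add: vimage_def Int_def)
  show "openin (region_topology B \<tau>) {p \<in> region B \<tau>. glue \<tau> p \<in> {p \<in> Y. fst p \<in> cyl w \<and> a < snd p}}"
    unfolding region_topology_eq eq by (intro openin_Int_open op open_Times open_cyl open_greaterThan)
qed auto

text \<open>The preimage of a piece of the base has a bottom part and a roof part, and both are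
  closed in the region.\<close>

lemma suspension_open_base_complement:
  "openin (suspension_topology B \<tau>) (Y - cyl w \<times> {0})"
  unfolding openin_suspension_topology
proof
  let ?R = "region B \<tau>"
  have eq: "{p \<in> ?R. glue \<tau> p \<in> Y - cyl w \<times> {0}} =
      ?R - ((?R \<inter> (cyl w \<times> {0})) \<union> ({p \<in> ?R. \<tau> (fst p) - snd p \<in> {0}} \<inter> {p \<in> ?R. left_shift (fst p) \<in> cyl w}))"
    using tau_nonzero left_shift_Sigma by (auto simp: glue_def Y_eq region_def tau_pos split: if_splits)
  have c1: "closedin (top_of_set ?R) {p \<in> ?R. \<tau> (fst p) - snd p \<in> {0}}"
    using continuous_closedin_preimage[OF continuous_on_region, of "{0}"] by (simp add: vimage_def Int_def)
  have "continuous_on ?R (\<lambda>p. left_shift (fst p))"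
    by (rule continuous_on_compose2[OF continuous_on_left_shift[of UNIV]]) (auto intro: continuous_on_fst continuous_on_id)
  from continuous_closedin_preimage[OF this closed_cyl[of w]]
  have c2: "closedin (top_of_set ?R) {p \<in> ?R. left_shift (fst p) \<in> cyl w}" by (simp add: vimage_def Int_def)
  have c3: "closedin (top_of_set ?R) (?R \<inter> (cyl w \<times> {0}))"
    by (rule closedin_closed_Int) (simp add: closed_Times closed_cyl)
  have "openin (top_of_set ?R) ?R" by simp
  from openin_diff[OF this closedin_Un[OF c3 closedin_Int[OF c1 c2]]]
  show "openin (region_topology B \<tau>) {p \<in> ?R. glue \<tau> p \<in> Y - cyl w \<times> {0}}"
    unfolding region_topology_eq eq .
qed auto

lemma space_suspension_borel: "space (suspension_borel B \<tau>) = Y"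
  unfolding suspension_borel_def
  by (rule space_measure_of) (simp add: openin_suspension_topology subset_iff)

text \<open>The quotient topology is coarser than the subspace topology on the representatives: it
  brings points near the roof close to the base. Still the Borel sets agree, because the strips and
  the base pieces make both coordinates measurable.\<close>

lemma sets_suspension_borel: "sets (suspension_borel B \<tau>) = sets (restrict_space borel Y)"
proof
  let ?S = "suspension_borel B \<tau>"
  have open_subset: "U \<subseteq> Y" if "openin (suspension_topology B \<tau>) U" for U
    using that by (simp add: openin_suspension_topology)
  have open_sets: "U \<in> sets ?S" if "openin (suspension_topology B \<tau>) U" for U
    unfolding suspension_borel_def using that
    by (intro in_measure_of) (use open_subset in auto)
  have "U \<in> sets (restrict_space borel Y)" if U: "openin (suspension_topology B \<tau>) U" for U
  proof -
    obtain W where W: "open W" "{p \<in> region B \<tau>. glue \<tau> p \<in> U} = region B \<tau> \<inter> W"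
      using U by (auto simp: openin_suspension_topology region_topology_eq openin_open)
    have "p \<in> U \<longleftrightarrow> p \<in> W" if "p \<in> Y" for p
    proof -
      have "p \<in> region B \<tau>" "glue \<tau> p = p" using that by (auto simp: Y_eq region_def glue_def)
      then show ?thesis using W(2) by (metis (mono_tags, lifting) Int_iff mem_Collect_eq)
    qed
    moreover have "U \<subseteq> Y" using U by (simp add: openin_suspension_topology)
    ultimately have "U = Y \<inter> W" by auto
    then show ?thesis using W(1) by (auto simp: sets_restrict_space)
  qed
  then show "sets ?S \<subseteq> sets (restrict_space borel Y)"
    unfolding suspension_borel_def
    by (subst sets_measure_of)
       (use open_subset sets.sigma_sets_subset[of "{U. openin (suspension_topology B \<tau>) U}" "restrict_space borel Y"]
          in \<open>auto simp: space_restrict_space\<close>)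
  have fst_meas: "fst \<in> borel_measurable ?S"
  proof (rule measurable_borel_seqI)
    fix w
    have "fst -` cyl w \<inter> space ?S = {p \<in> Y. fst p \<in> cyl w \<and> 0 < snd p} \<union> (Y - (Y - cyl w \<times> {0}))"
      by (auto simp: space_suspension_borel Y_eq)
    moreover have "Y \<in> sets ?S" using sets.top[of ?S] by (simp add: space_suspension_borel)
    ultimately show "fst -` cyl w \<inter> space ?S \<in> sets ?S"
      using open_sets[OF suspension_open_strip[of 0 w]] open_sets[OF suspension_open_base_complement[of w]] by auto
  qed
  have snd_meas: "snd \<in> borel_measurable ?S"
  proof (rule borel_measurableI_greater)
    fix a :: real
    have top: "Y \<in> sets ?S" using sets.top[of ?S] unfolding space_suspension_borel .
    show "{p \<in> space ?S. a < snd p} \<in> sets ?S"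
    proof (cases "0 \<le> a")
      case True
      have eq: "{p \<in> Y. a < snd p} = {p \<in> Y. fst p \<in> cyl [] \<and> a < snd p}" by simp
      show ?thesis
        unfolding space_suspension_borel eq by (rule open_sets[OF suspension_open_strip[OF True]])
    next
      case False
      have eq: "{p \<in> Y. a < snd p} = Y"
      proof -
        have "a < snd p" if "p \<in> Y" for p using that False by (auto simp: Y_eq)
        then show ?thesis by blast
      qed
      show ?thesis unfolding space_suspension_borel eq by (rule top)
    qed
  qed
  have "(\<lambda>p. (fst p, snd p)) \<in> measurable ?S (borel \<Otimes>\<^sub>M borel)"
    by (intro measurable_Pair fst_meas snd_meas)
  then have id_meas: "(\<lambda>p. p) \<in> measurable ?S borel" by (simp only: borel_prod prod.collapse)
  show "sets (restrict_space borel Y) \<subseteq> sets ?S"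
  proof
    fix A assume "A \<in> sets (restrict_space borel Y)"
    then obtain W where "W \<in> sets borel" "A = Y \<inter> W" by (auto simp: sets_restrict_space)
    then show "A \<in> sets ?S" using measurable_sets[OF id_meas, of W] by (simp add: space_suspension_borel Int_commute)
  qed
qed

lemma in_sets_suspension_iff: "A \<in> sets (suspension_borel B \<tau>) \<longleftrightarrow> A \<in> sets borel \<and> A \<subseteq> Y"
  unfolding sets_suspension_borel by (subst sets_restrict_space_iff) auto

text \<open>The measure on the suspension with base \<open>M\<close>, product with Lebesgue measure
  under the roof. The factor \<open>1 / c\<close> gives a cylinder times \<open>{0..c}\<close> the
  mass of the cylinder under \<open>M\<close>.\<close>

definition susp :: "(nat \<Rightarrow> nat) measure \<Rightarrow> ((nat \<Rightarrow> nat) \<times> real) measure" where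
  "susp M = restrict_space (scale_measure (ennreal (1 / c)) (M \<Otimes>\<^sub>M lborel)) Y"

lemma sets_pair_lborel:
  assumes "sets M = sets borel"
  shows "sets (M \<Otimes>\<^sub>M lborel) = sets (borel :: ((nat \<Rightarrow> nat) \<times> real) measure)"
proof -
  have "sets (M \<Otimes>\<^sub>M lborel) = sets ((borel :: (nat \<Rightarrow> nat) measure) \<Otimes>\<^sub>M (borel :: real measure))"
    by (rule sets_pair_measure_cong) (simp_all add: assms)
  then show ?thesis by (simp only: borel_prod)
qed

lemma space_susp: "sets M = sets borel \<Longrightarrow> space (susp M) = Y"
  using sets_eq_imp_space_eq[OF sets_pair_lborel[of M]]
  by (simp add: susp_def space_restrict_space space_scale_measure)

lemma sets_susp: "sets M = sets borel \<Longrightarrow> sets (susp M) = sets (suspension_borel B \<tau>)"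
  unfolding sets_suspension_borel susp_def
  by (rule sets_restrict_space_cong) (simp only: sets_scale_measure sets_pair_lborel)

lemma emeasure_susp:
  assumes "sets M = sets borel" "A \<in> sets borel" "A \<subseteq> Y"
  shows "emeasure (susp M) A = ennreal (1 / c) * (\<integral>\<^sup>+x. \<integral>\<^sup>+s. indicator A (x, s) \<partial>lborel \<partial>M)"
proof -
  have "emeasure (susp M) A = emeasure (scale_measure (ennreal (1 / c)) (M \<Otimes>\<^sub>M lborel)) A"
    unfolding susp_def
    by (rule emeasure_restrict_space) (use assms sets_pair_lborel[OF assms(1)] sets_eq_imp_space_eq[OF sets_pair_lborel[OF assms(1)]] in auto)
  also have "\<dots> = ennreal (1 / c) * emeasure (M \<Otimes>\<^sub>M lborel) A" by simp
  also have "emeasure (M \<Otimes>\<^sub>M lborel) A = (\<integral>\<^sup>+x. \<integral>\<^sup>+s. indicator A (x, s) \<partial>lborel \<partial>M)"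
    by (rule lborel.emeasure_pair_measure) (use assms sets_pair_lborel[OF assms(1)] in simp)
  finally show ?thesis .
qed

lemma emeasure_susp_rectangle:
  assumes M: "sets M = sets borel" and A: "A \<in> sets borel" "A \<subseteq> \<Sigma>" and ab: "0 \<le> a" "\<And>x. x \<in> A \<Longrightarrow> b \<le> \<tau> x"
  shows "emeasure (susp M) (A \<times> {a..<b}) = ennreal (1 / c) * ennreal (b - a) * emeasure M A"
proof -
  note [measurable_cong] = M and [measurable] = A(1)
  have R: "A \<times> {a..<b} \<in> sets borel" "A \<times> {a..<b} \<subseteq> Y"
    using A ab(1) by (auto simp: Y_eq intro: order_less_le_trans[OF _ ab(2)])
      (simp_all only: borel_prod[symmetric], auto)
  have "(\<integral>\<^sup>+s. indicator (A \<times> {a..<b}) (x, s) \<partial>lborel) = ennreal (b - a) * indicator A x" for x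
  proof -
    have "(\<integral>\<^sup>+s. indicator (A \<times> {a..<b}) (x, s) \<partial>lborel) = (\<integral>\<^sup>+s. indicator A x * indicator {a..<b} s \<partial>lborel)"
      by (intro nn_integral_cong) (auto split: split_indicator)
    also have "\<dots> = indicator A x * emeasure lborel {a..<b}" by (subst nn_integral_cmult) auto
    also have "emeasure lborel {a..<b} = ennreal (b - a)"
      by (cases "a \<le> b") (auto simp: ennreal_neg)
    finally show ?thesis by (simp add: mult.commute)
  qed
  then show ?thesis
    using emeasure_susp[OF M R] A M by (simp add: nn_integral_cmult mult.assoc)
qed

subsection \<open>The flow\<close>

lemma flow_cases:
  assumes p: "(x, s) \<in> Y" and t: "0 \<le> t"
  obtains n where "birkhoff_sum \<tau> n x \<le> s + t" "s + t < birkhoff_sum \<tau> (Suc n) x"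
    "suspension_flow \<tau> t (x, s) = ((left_shift ^^ n) x, s + t - birkhoff_sum \<tau> n x)"
proof -
  have x: "x \<in> \<Sigma>" "0 \<le> s + t" using p t by (auto simp: Y_eq)
  have d: "0 < \<delta>" "\<forall>x\<in>\<Sigma>. \<delta> \<le> \<tau> x" "\<forall>x\<in>\<Sigma>. 0 < \<tau> x" using c_pos c_less tau_ge tau_pos by auto
  obtain n where n: "birkhoff_sum \<tau> n x \<le> s + t" "s + t < birkhoff_sum \<tau> (Suc n) x"
    using birkhoff_sum_bracket[OF d(1,2) x] by blast
  then show thesis using suspension_flow_eq[OF d(3) x(1) n] that by blast
qed

lemma birkhoff_sum_tau_ge:
  assumes "x \<in> \<Sigma>" "0 < n"
  shows "\<tau> x \<le> birkhoff_sum \<tau> n x"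
proof -
  have "\<tau> ((left_shift ^^ 0) x) \<le> birkhoff_sum \<tau> n x"
    unfolding birkhoff_sum_def
    using assms tau_pos(1)[OF shift_in_markov_shift[OF assms(1)]]
    by (intro member_le_sum[of 0 "{..<n}" "\<lambda>k. \<tau> ((left_shift ^^ k) x)"]) (auto intro: less_imp_le)
  then show ?thesis by simp
qed

lemma flow_vimage_strip:
  assumes A: "A \<subseteq> \<Sigma>" and a: "0 \<le> a" and b: "\<And>x. x \<in> A \<Longrightarrow> b \<le> \<tau> x"
  shows "suspension_flow \<tau> a -` (A \<times> {a..<b}) \<inter> Y = A \<times> {0..<b - a}"
proof (intro equalityI subsetI)
  fix p assume p: "p \<in> suspension_flow \<tau> a -` (A \<times> {a..<b}) \<inter> Y"
  obtain x s where xs: "p = (x, s)" "(x, s) \<in> Y" using p by (cases p) auto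
  obtain n where n: "suspension_flow \<tau> a (x, s) = ((left_shift ^^ n) x, s + a - birkhoff_sum \<tau> n x)"
    by (rule flow_cases[OF xs(2) a])
  have m: "(left_shift ^^ n) x \<in> A" "a \<le> s + a - birkhoff_sum \<tau> n x" "s + a - birkhoff_sum \<tau> n x < b"
    using p xs(1) n by auto
  \<comment> \<open>After a crossing of the roof the new height is less than the elapsed time
    \<open>a\<close>, so the point cannot be in the strip.\<close>
  have "n = 0"
  proof (rule ccontr)
    assume "n \<noteq> 0"
    then have "\<tau> x \<le> birkhoff_sum \<tau> n x" using birkhoff_sum_tau_ge xs(2) by (auto simp: Y_eq)
    then show False using m(2) xs(2) by (auto simp: Y_eq)
  qed
  then show "p \<in> A \<times> {0..<b - a}" using m xs by (auto simp: birkhoff_sum_def Y_eq)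
next
  fix p assume "p \<in> A \<times> {0..<b - a}"
  then obtain x s where xs: "p = (x, s)" "x \<in> A" "0 \<le> s" "s < b - a" by auto
  have x: "x \<in> \<Sigma>" using A xs by auto
  have st: "s + a < \<tau> x" using b[OF xs(2)] xs(4) by simp
  have "suspension_flow \<tau> a (x, s) = ((left_shift ^^ 0) x, s + a - birkhoff_sum \<tau> 0 x)"
    by (rule suspension_flow_eq[OF _ x]) (use tau_pos st xs a in \<open>auto simp: birkhoff_sum_def\<close>)
  then show "p \<in> suspension_flow \<tau> a -` (A \<times> {a..<b}) \<inter> Y"
    using xs x st a by (auto simp: birkhoff_sum_def Y_eq)
qed

text \<open>For times up to \<open>c\<close>, which is below the infimum of the roof, there is at
  most one crossing; this explicit form is visibly Borel.\<close>

definition short_flow :: "real \<Rightarrow> (nat \<Rightarrow> nat) \<times> real \<Rightarrow> (nat \<Rightarrow> nat) \<times> real" where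
  "short_flow t p = (if snd p + t < height (fst p) then (fst p, snd p + t)
     else (left_shift (fst p), snd p + t - height (fst p)))"

lemma short_flow_measurable [measurable]: "short_flow t \<in> measurable borel borel"
proof -
  have "short_flow t \<in> measurable (borel \<Otimes>\<^sub>M borel) (borel \<Otimes>\<^sub>M borel)"
    unfolding short_flow_def by measurable
  then show ?thesis by (simp only: borel_prod)
qed

lemma suspension_flow_short:
  assumes p: "p \<in> Y" and t: "0 \<le> t" "t \<le> c"
  shows "suspension_flow \<tau> t p = short_flow t p"
proof -
  obtain x s where xs: "p = (x, s)" "x \<in> \<Sigma>" "0 \<le> s" "s < \<tau> x" using p by (auto simp: Y_eq)
  have pos: "\<forall>x\<in>\<Sigma>. 0 < \<tau> x" using tau_pos by simp
  have x': "left_shift x \<in> \<Sigma>" using shift_in_markov_shift[OF xs(2), of 1] by simp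
  show ?thesis
  proof (cases "s + t < \<tau> x")
    case True
    then show ?thesis
      using suspension_flow_eq[OF pos xs(2), of 0 s t] xs t by (simp add: birkhoff_sum_def short_flow_def height_def)
  next
    case False
    have "c < \<tau> (left_shift x)" using tau_pos(2)[OF x'] .
    then show ?thesis
      using suspension_flow_eq[OF pos xs(2), of 1 s t] xs t False
      by (simp add: birkhoff_sum_def short_flow_def height_def)
  qed
qed

lemma flow_in_Y: "p \<in> Y \<Longrightarrow> 0 \<le> t \<Longrightarrow> suspension_flow \<tau> t p \<in> Y"
  using flow_in_suspension_and_add(1)[of \<delta> B \<tau> p t 0] c_pos c_less tau_ge by auto

text \<open>On each fibre the flow is a translation, which preserves Lebesgue measure. Points that
  stay in their fibre arrive at heights from \<open>t\<close> on, points that cross arrive below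
  \<open>t\<close> in the next fibre; invariance of \<open>M\<close> returns the second part to the
  same fibre.\<close>

lemma short_flow_preserves_susp:
  assumes M: "sets M = sets borel" and inv: "distr M borel left_shift = M"
    and conc: "AE x in M. x \<in> \<Sigma>" and t: "0 \<le> t" "t \<le> c" and A: "A \<in> sets borel" "A \<subseteq> Y"
  shows "emeasure (susp M) (suspension_flow \<tau> t -` A \<inter> Y) = emeasure (susp M) A"
proof -
  note [measurable_cong] = M and [measurable] = A(1)
  have [measurable]: "A \<in> sets (borel \<Otimes>\<^sub>M borel)" using A(1) by (simp only: borel_prod)
  let ?A' = "suspension_flow \<tau> t -` A \<inter> Y"
  have eqA': "?A' = short_flow t -` A \<inter> Y" using suspension_flow_short t by auto
  have A': "?A' \<in> sets borel" "?A' \<subseteq> Y"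
    unfolding eqA' using measurable_sets[OF short_flow_measurable A(1), of t] by auto
  define h1 h2 where "h1 x = (\<integral>\<^sup>+s. indicator {t..} s * indicator A (x, s) \<partial>lborel)"
    and "h2 x = (\<integral>\<^sup>+s. indicator {0..<t} s * indicator A (x, s) \<partial>lborel)" for x
  have [measurable]: "h1 \<in> borel_measurable borel" "h2 \<in> borel_measurable borel"
    unfolding h1_def h2_def by measurable
  have translate: "(\<integral>\<^sup>+s. f (u + s) \<partial>lborel) = (\<integral>\<^sup>+s. f s \<partial>lborel)"
    if "f \<in> borel_measurable borel" for f :: "real \<Rightarrow> ennreal" and u
    using nn_integral_real_affine[OF that, of 1 u] by simp
  have inner: "(\<integral>\<^sup>+s. indicator ?A' (x, s) \<partial>lborel) = h1 x + h2 (left_shift x)" if x: "x \<in> \<Sigma>" for x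
  proof -
    have x': "left_shift x \<in> \<Sigma>" using shift_in_markov_shift[OF x, of 1] by simp
    have tx: "t < \<tau> x" using tau_pos(2)[OF x] t by simp
    have "(\<integral>\<^sup>+s. indicator ?A' (x, s) \<partial>lborel) =
        (\<integral>\<^sup>+s. indicator {t..} (t + s) * indicator A (x, t + s) +
             indicator {0..<t} (t - \<tau> x + s) * indicator A (left_shift x, t - \<tau> x + s) \<partial>lborel)"
    proof (rule nn_integral_cong)
      fix s :: real
      have mem: "(x, s) \<in> ?A' \<longleftrightarrow> 0 \<le> s \<and> s < \<tau> x \<and> short_flow t (x, s) \<in> A"
        unfolding eqA' using x by (auto simp: Y_eq)
      have sub: "(x, t + s) \<in> A \<Longrightarrow> t + s < \<tau> x" using A(2) by (auto simp: Y_eq)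
      consider "s < 0" | "0 \<le> s" "s + t < \<tau> x" | "0 \<le> s" "\<tau> x \<le> s + t" by linarith
      then show "indicator ?A' (x, s) = (indicator {t..} (t + s) * indicator A (x, t + s) +
             indicator {0..<t} (t - \<tau> x + s) * indicator A (left_shift x, t - \<tau> x + s) :: ennreal)"
      proof cases
        case 1
        then have "\<not> (0 \<le> t - \<tau> x + s)" using tx by simp
        then show ?thesis using 1 mem by (simp add: indicator_def)
      next
        case 2
        then have "\<not> (0 \<le> t - \<tau> x + s)" "s < \<tau> x" using t by simp_all
        then show ?thesis using 2 mem x by (simp add: indicator_def short_flow_def height_def add.commute)
      next
        case 3
        then have "(x, t + s) \<notin> A" using sub by auto
        moreover have "s < \<tau> x \<longleftrightarrow> t - \<tau> x + s < t" "0 \<le> t - \<tau> x + s" using 3 by auto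
        moreover have "short_flow t (x, s) = (left_shift x, t - \<tau> x + s)"
          using 3 x by (simp add: short_flow_def height_def)
        ultimately show ?thesis using 3 mem by (simp add: indicator_def)
      qed
    qed
    also have "\<dots> = (\<integral>\<^sup>+s. indicator {t..} (t + s) * indicator A (x, t + s) \<partial>lborel) +
        (\<integral>\<^sup>+s. indicator {0..<t} (t - \<tau> x + s) * indicator A (left_shift x, t - \<tau> x + s) \<partial>lborel)"
      by (rule nn_integral_add) measurable
    also have "(\<integral>\<^sup>+s. indicator {t..} (t + s) * indicator A (x, t + s) \<partial>lborel) = h1 x"
      unfolding h1_def by (rule translate[of "\<lambda>s. indicator {t..} s * indicator A (x, s)"]) measurable
    also have "(\<integral>\<^sup>+s. indicator {0..<t} (t - \<tau> x + s) * indicator A (left_shift x, t - \<tau> x + s) \<partial>lborel) = h2 (left_shift x)"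
      unfolding h2_def by (rule translate[of "\<lambda>s. indicator {0..<t} s * indicator A (left_shift x, s)"]) measurable
    finally show ?thesis .
  qed
  have "(\<integral>\<^sup>+x. \<integral>\<^sup>+s. indicator ?A' (x, s) \<partial>lborel \<partial>M) = (\<integral>\<^sup>+x. h1 x + h2 (left_shift x) \<partial>M)"
    by (rule nn_integral_cong_AE) (use conc inner in \<open>auto elim: eventually_mono\<close>)
  also have "\<dots> = (\<integral>\<^sup>+x. h1 x \<partial>M) + (\<integral>\<^sup>+x. h2 (left_shift x) \<partial>M)" by (rule nn_integral_add) measurable
  also have "(\<integral>\<^sup>+x. h2 (left_shift x) \<partial>M) = (\<integral>\<^sup>+x. h2 x \<partial>distr M borel left_shift)"
    by (subst nn_integral_distr) auto
  also have "(\<integral>\<^sup>+x. h1 x \<partial>M) + (\<integral>\<^sup>+x. h2 x \<partial>distr M borel left_shift) = (\<integral>\<^sup>+x. h1 x + h2 x \<partial>M)"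
    unfolding inv by (rule nn_integral_add[symmetric]) measurable
  also have "\<dots> = (\<integral>\<^sup>+x. \<integral>\<^sup>+s. indicator A (x, s) \<partial>lborel \<partial>M)"
  proof (rule nn_integral_cong)
    fix x
    have "h1 x + h2 x = (\<integral>\<^sup>+s. indicator {t..} s * indicator A (x, s) + indicator {0..<t} s * indicator A (x, s) \<partial>lborel)"
      unfolding h1_def h2_def by (rule nn_integral_add[symmetric]) measurable
    also have "\<dots> = (\<integral>\<^sup>+s. indicator A (x, s) \<partial>lborel)"
      using A(2) by (intro nn_integral_cong) (auto simp: indicator_def Y_eq)
    finally show "h1 x + h2 x = (\<integral>\<^sup>+s. indicator A (x, s) \<partial>lborel)" .
  qed
  finally show ?thesis by (simp add: emeasure_susp[OF M A'] emeasure_susp[OF M A])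
qed

text \<open>A long time is cut into \<open>k\<close> equal steps of length at most \<open>c\<close>,
  and the semigroup law is applied.\<close>

lemma flow_preserves_susp:
  assumes M: "sets M = sets borel" and inv: "distr M borel left_shift = M"
    and conc: "AE x in M. x \<in> \<Sigma>" and t: "0 \<le> t" and A: "A \<in> sets borel" "A \<subseteq> Y"
  shows "emeasure (susp M) (suspension_flow \<tau> t -` A \<inter> Y) = emeasure (susp M) A"
proof -
  obtain k where k: "t / c < real k" using reals_Archimedean2 by blast
  then have k0: "0 < k" using t c_pos by (cases k) (auto simp: divide_less_0_iff)
  define u where "u = t / real k"
  have u: "0 \<le> u" "u \<le> c" "real k * u = t" using k k0 t c_pos by (auto simp: u_def field_simps)
  have "suspension_flow \<tau> (real n * u) -` A \<inter> Y \<in> sets borel \<and>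
      emeasure (susp M) (suspension_flow \<tau> (real n * u) -` A \<inter> Y) = emeasure (susp M) A" for n
  proof (induction n)
    case 0
    have "suspension_flow \<tau> 0 -` A \<inter> Y = A"
      using flow_zero[of B \<tau>] tau_pos(1) A(2) by auto
    then show ?case using A by simp
  next
    case (Suc n)
    let ?C = "suspension_flow \<tau> (real n * u) -` A \<inter> Y"
    have "suspension_flow \<tau> (real (Suc n) * u) -` A \<inter> Y = suspension_flow \<tau> u -` ?C \<inter> Y"
    proof -
      have "suspension_flow \<tau> (real (Suc n) * u) p = suspension_flow \<tau> (real n * u) (suspension_flow \<tau> u p)" if "p \<in> Y" for p
        using flow_add[of \<delta> B \<tau> p u "real n * u"] that c_pos c_less tau_ge u by (simp add: algebra_simps)
      then show ?thesis using flow_in_Y u by auto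
    qed
    moreover have "suspension_flow \<tau> u -` ?C \<inter> Y = short_flow u -` ?C \<inter> Y"
      using suspension_flow_short u by auto
    moreover have "short_flow u -` ?C \<inter> Y \<in> sets borel"
      using measurable_sets[OF short_flow_measurable, of ?C u] Suc.IH by auto
    ultimately show ?case
      using short_flow_preserves_susp[OF M inv conc u(1,2), of ?C] Suc.IH by auto
  qed
  from this[of k] show ?thesis by (simp add: u)
qed

subsection \<open>The base measure of an invariant measure\<close>

lemma emeasure_susp_space:
  assumes M: "sets M = sets borel" and conc: "AE x in M. x \<in> \<Sigma>"
  shows "emeasure (susp M) Y = (\<integral>\<^sup>+x. ennreal (height x / c) \<partial>M)"
proof -
  note [measurable_cong] = M
  have "(\<integral>\<^sup>+x. \<integral>\<^sup>+s. indicator Y (x, s) \<partial>lborel \<partial>M) = (\<integral>\<^sup>+x. ennreal (height x) \<partial>M)"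
  proof (rule nn_integral_cong_AE)
    show "AE x in M. (\<integral>\<^sup>+s. indicator Y (x, s) \<partial>lborel) = ennreal (height x)"
      using conc
    proof eventually_elim
      case (elim x)
      have "(\<integral>\<^sup>+s. indicator Y (x, s) \<partial>lborel) = (\<integral>\<^sup>+s. indicator {0..<\<tau> x} s \<partial>lborel)"
        using elim by (intro nn_integral_cong) (auto simp: Y_eq indicator_def)
      also have "\<dots> = ennreal (\<tau> x)" using tau_pos(1)[OF elim] by simp
      finally show ?case using elim by (simp add: height_def)
    qed
  qed
  then have "emeasure (susp M) Y = ennreal (1 / c) * (\<integral>\<^sup>+x. ennreal (height x) \<partial>M)"
    using emeasure_susp[OF M Y_sets] by simp
  also have "\<dots> = (\<integral>\<^sup>+x. ennreal (1 / c) * ennreal (height x) \<partial>M)" by (rule nn_integral_cmult[symmetric]) measurable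
  also have "\<dots> = (\<integral>\<^sup>+x. ennreal (height x / c) \<partial>M)"
    using c_pos by (intro nn_integral_cong) (simp flip: ennreal_mult')
  finally show ?thesis .
qed

definition base_weight :: "((nat \<Rightarrow> nat) \<times> real) measure \<Rightarrow> nat list \<Rightarrow> real" where
  "base_weight \<nu> w = measure \<nu> (cylinder B w \<times> {0..c})"

lemma invariantD:
  assumes "\<nu> \<in> invariant_subprobs B \<tau>"
  shows "space \<nu> = Y" "sets \<nu> = sets (suspension_borel B \<tau>)" "emeasure \<nu> Y \<le> 1" "finite_measure \<nu>"
    "A \<in> sets borel \<Longrightarrow> A \<subseteq> Y \<Longrightarrow> A \<in> sets \<nu>"
    "0 \<le> t \<Longrightarrow> A \<in> sets borel \<Longrightarrow> A \<subseteq> Y \<Longrightarrow> emeasure \<nu> (suspension_flow \<tau> t -` A \<inter> Y) = emeasure \<nu> A"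
proof -
  show *: "space \<nu> = Y" "sets \<nu> = sets (suspension_borel B \<tau>)" "emeasure \<nu> Y \<le> 1"
    using assms by (auto simp: invariant_subprobs_def)
  show "finite_measure \<nu>" by (rule finite_measureI) (use * in \<open>auto simp: top_unique\<close>)
  show in_sets: "A \<in> sets borel \<Longrightarrow> A \<subseteq> Y \<Longrightarrow> A \<in> sets \<nu>"
    unfolding *(2) in_sets_suspension_iff by simp
  show "0 \<le> t \<Longrightarrow> A \<in> sets borel \<Longrightarrow> A \<subseteq> Y \<Longrightarrow> emeasure \<nu> (suspension_flow \<tau> t -` A \<inter> Y) = emeasure \<nu> A"
    using assms in_sets by (auto simp: invariant_subprobs_def)
qed

definition base_measure :: "((nat \<Rightarrow> nat) \<times> real) measure \<Rightarrow> (nat \<Rightarrow> nat) measure" where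
  "base_measure \<nu> = distr (density \<nu> (indicator (UNIV \<times> {0..c}))) borel fst"

lemma rect_sets:
  "A \<in> sets borel \<Longrightarrow> I \<in> sets borel \<Longrightarrow> A \<times> I \<in> sets (borel :: ((nat \<Rightarrow> nat) \<times> real) measure)"
  unfolding borel_prod[symmetric] by (rule pair_measureI)

lemma rect_subset: "A \<subseteq> \<Sigma> \<Longrightarrow> 0 \<le> a \<Longrightarrow> (\<And>x. x \<in> A \<Longrightarrow> b \<le> \<tau> x) \<Longrightarrow> A \<times> {a..<b} \<subseteq> Y"
  by (fastforce simp: Y_eq)

lemma measurable_fst_invariant:
  assumes "\<nu> \<in> invariant_subprobs B \<tau>"
  shows "fst \<in> measurable \<nu> borel" "snd \<in> measurable \<nu> borel"
proof -
  have s: "sets \<nu> = sets (restrict_space borel Y)"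
    using invariantD(2)[OF assms] sets_suspension_borel by simp
  have "fst \<in> measurable ((borel :: (nat \<Rightarrow> nat) measure) \<Otimes>\<^sub>M (borel :: real measure)) borel"
    and "snd \<in> measurable ((borel :: (nat \<Rightarrow> nat) measure) \<Otimes>\<^sub>M borel) (borel :: real measure)"
    by measurable
  then show "fst \<in> measurable \<nu> borel" "snd \<in> measurable \<nu> borel"
    unfolding borel_prod measurable_cong_sets[OF s refl] by (auto intro: measurable_restrict_space1)
qed

lemma sets_base_measure [simp]: "sets (base_measure \<nu>) = sets borel"
  by (simp add: base_measure_def)

lemma emeasure_base_measure:
  assumes nu: "\<nu> \<in> invariant_subprobs B \<tau>" and A: "A \<in> sets borel"
  shows "emeasure (base_measure \<nu>) A = emeasure \<nu> ((A \<inter> \<Sigma>) \<times> {0..c})"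
proof -
  note [measurable] = measurable_fst_invariant[OF nu]
  have rs: "(A \<inter> \<Sigma>) \<times> {0..c} \<in> sets \<nu>" "(\<Sigma> \<times> {0..c}) \<in> sets \<nu>"
  proof -
    have "X \<times> {0..c} \<subseteq> Y" if "X \<subseteq> \<Sigma>" for X using that tau_pos(2) by (fastforce simp: Y_eq)
    then show "(A \<inter> \<Sigma>) \<times> {0..c} \<in> sets \<nu>" "(\<Sigma> \<times> {0..c}) \<in> sets \<nu>"
      using A by (auto intro!: invariantD(5)[OF nu] rect_sets)
  qed
  have ind: "indicator (UNIV \<times> {0..c}) p = (indicator (\<Sigma> \<times> {0..c}) p :: ennreal)" if "p \<in> space \<nu>" for p
    using that invariantD(1)[OF nu] by (auto simp: Y_eq indicator_def)
  have im: "(indicator (UNIV \<times> {0..c}) :: _ \<Rightarrow> ennreal) \<in> borel_measurable \<nu>"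
    by (subst measurable_cong[OF ind]) (use rs in auto)
  have pre: "fst -` A \<inter> space \<nu> \<in> sets \<nu>" by (rule measurable_sets[OF measurable_fst_invariant(1)[OF nu] A])
  have "emeasure (base_measure \<nu>) A = emeasure (density \<nu> (indicator (UNIV \<times> {0..c}))) (fst -` A \<inter> space \<nu>)"
    unfolding base_measure_def using A by (subst emeasure_distr) auto
  also have "\<dots> = (\<integral>\<^sup>+p. indicator (UNIV \<times> {0..c}) p * indicator (fst -` A \<inter> space \<nu>) p \<partial>\<nu>)"
    by (rule emeasure_density[OF im pre])
  also have "\<dots> = (\<integral>\<^sup>+p. indicator ((A \<inter> \<Sigma>) \<times> {0..c}) p \<partial>\<nu>)"
    using invariantD(1)[OF nu] by (intro nn_integral_cong) (auto simp: Y_eq indicator_def)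
  also have "\<dots> = emeasure \<nu> ((A \<inter> \<Sigma>) \<times> {0..c})" using rs by simp
  finally show ?thesis .
qed

text \<open>Flowing up by \<open>u\<close> carries \<open>A \<times> {0..<h - u}\<close> to
  \<open>A \<times> {u..<h}\<close>, so the measure of a strip depends only on its thickness. It is
  additive in it, hence linear.\<close>

lemma emeasure_strip:
  assumes nu: "\<nu> \<in> invariant_subprobs B \<tau>" and A: "A \<in> sets borel" "A \<subseteq> \<Sigma>"
    and a: "0 \<le> a" and b: "\<And>x. x \<in> A \<Longrightarrow> b \<le> \<tau> x"
  shows "emeasure \<nu> (A \<times> {a..<b}) = ennreal (1 / c) * ennreal (b - a) * emeasure (base_measure \<nu>) A"
proof -
  interpret finite_measure \<nu> by (rule invariantD(4)[OF nu])
  \<comment> \<open>At least \<open>\<delta>\<close>, so that the reference height \<open>c\<close>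
    lies strictly inside even if \<open>b\<close> is small.\<close>
  define b' where "b' = max b \<delta>"
  have b': "x \<in> A \<Longrightarrow> b' \<le> \<tau> x" for x using b tau_ge A(2) by (auto simp: b'_def)
  have bp: "0 < b'" "c < b'" using c_pos c_less by (auto simp: b'_def)
  have ms: "A \<times> {u..<h} \<in> sets \<nu>" if "0 \<le> u" "h \<le> b'" for u h
  proof (rule invariantD(5)[OF nu])
    show "A \<times> {u..<h} \<subseteq> Y" by (rule rect_subset[OF A(2) that(1)]) (use b' that in fastforce)
  qed (use A in \<open>auto intro!: rect_sets\<close>)
  define f where "f h = measure \<nu> (A \<times> {0..<h})" for h
  have tr: "measure \<nu> (A \<times> {u..<h}) = f (h - u)" if "0 \<le> u" "h \<le> b'" for u h
  proof -
    have le: "h \<le> \<tau> x" if "x \<in> A" for x using b'[OF that] \<open>h \<le> b'\<close> by simp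
    have "emeasure \<nu> (suspension_flow \<tau> u -` (A \<times> {u..<h}) \<inter> Y) = emeasure \<nu> (A \<times> {u..<h})"
      by (rule invariantD(6)[OF nu that(1)]) (use A rect_subset[OF A(2) that(1) le] in \<open>auto intro!: rect_sets\<close>)
    then have "emeasure \<nu> (A \<times> {0..<h - u}) = emeasure \<nu> (A \<times> {u..<h})"
      by (simp only: flow_vimage_strip[OF A(2) that(1) le])
    then show ?thesis by (simp add: measure_def f_def)
  qed
  have lin: "f h = h / b' * f b'" if "0 \<le> h" "h \<le> b'" for h
  proof (rule additive_on_interval[OF bp(1) _ _ that])
    show "0 \<le> f h" for h by (simp add: f_def)
    fix x y :: real assume xy: "0 \<le> x" "0 \<le> y" "x + y \<le> b'"
    have "A \<times> {0..<x + y} = A \<times> {0..<x} \<union> A \<times> {x..<x + y}" using xy by auto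
    then have "f (x + y) = measure \<nu> (A \<times> {0..<x}) + measure \<nu> (A \<times> {x..<x + y})"
      unfolding f_def using ms xy by (simp only:) (rule finite_measure_Union, auto)
    also have "\<dots> = f x + f y" using tr[of x "x + y"] xy by (simp add: f_def)
    finally show "f (x + y) = f x + f y" .
  qed
  have cs: "A \<times> {0..c} \<in> sets \<nu>"
  proof (rule invariantD(5)[OF nu])
    show "A \<times> {0..c} \<subseteq> Y" using A(2) tau_pos(2) by (fastforce simp: Y_eq)
  qed (use A in \<open>auto intro!: rect_sets\<close>)
  have fc: "measure \<nu> (A \<times> {0..c}) = f c"
  proof (rule antisym)
    show "f c \<le> measure \<nu> (A \<times> {0..c})" unfolding f_def by (rule finite_measure_mono) (use cs in auto)
    show "measure \<nu> (A \<times> {0..c}) \<le> f c"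
    proof (rule field_le_epsilon)
      fix e :: real assume e: "0 < e"
      \<comment> \<open>A thickening of \<open>{0..c}\<close> that stays below \<open>b'\<close> and
        adds at most \<open>e\<close>; it shows that the closed upper end has no mass.\<close>
      define h where "h = min (b' - c) (e * b' / (f b' + 1))"
      have fb: "0 \<le> f b'" by (simp add: f_def)
      have h: "0 < h" "c + h \<le> b'" using e bp fb by (auto simp: h_def)
      have "h \<le> e * b' / (f b' + 1)" by (simp add: h_def)
      then have "h * (f b' + 1) \<le> e * b'" using fb by (simp add: field_simps add_nonneg_pos)
      then have "h * f b' \<le> e * b'" using h(1) by (simp add: algebra_simps)
      then have he: "h / b' * f b' \<le> e" using bp by (simp add: field_simps)
      have "measure \<nu> (A \<times> {0..c}) \<le> f (c + h)"
        unfolding f_def by (rule finite_measure_mono) (use ms[of 0 "c + h"] h in auto)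
      also have "\<dots> = f c + h / b' * f b'"
        using lin[of "c + h"] lin[of c] h c_pos bp by (simp add: add_divide_distrib distrib_right)
      finally show "measure \<nu> (A \<times> {0..c}) \<le> f c + e" using he by simp
    qed
  qed
  have AS: "A \<inter> \<Sigma> = A" using A(2) by auto
  have base: "emeasure (base_measure \<nu>) A = ennreal (f c)"
    using emeasure_base_measure[OF nu A(1)] fc unfolding AS by (simp add: emeasure_eq_measure)
  show ?thesis
  proof (cases "a \<le> b")
    case True
    have "emeasure \<nu> (A \<times> {a..<b}) = ennreal (f (b - a))"
      using tr[OF a, of b] by (simp add: emeasure_eq_measure b'_def)
    also have "f (b - a) = 1 / c * (b - a) * f c"
    proof -
      have "b \<le> b'" by (simp add: b'_def)
      then have "f (b - a) = (b - a) / b' * f b'" "f c = c / b' * f b'"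
        using lin[of "b - a"] lin[of c] True a c_pos bp by auto
      then show ?thesis using c_pos by simp
    qed
    also have "ennreal \<dots> = ennreal (1 / c) * ennreal (b - a) * ennreal (f c)"
    proof -
      have "0 \<le> 1 / c" "0 \<le> b - a" "0 \<le> f c" using True c_pos by (auto simp: f_def)
      then show ?thesis by (simp only: ennreal_mult mult_nonneg_nonneg)
    qed
    finally show ?thesis unfolding base .
  next
    case False
    then show ?thesis by (simp add: ennreal_neg)
  qed
qed

text \<open>Both measures agree on strips below the roof. These are stable under intersection,
  generate the Borel sets, and countably many of them cover the space.\<close>

lemma invariant_eq_susp:
  assumes nu: "\<nu> \<in> invariant_subprobs B \<tau>"
  shows "\<nu> = susp (base_measure \<nu>)"
proof -
  let ?M = "base_measure \<nu>"
  define E where "E = {A \<times> {a..<b} | A a b. A \<in> sets borel \<and> A \<subseteq> \<Sigma> \<and> 0 \<le> a \<and> (\<forall>x\<in>A. b \<le> \<tau> x)}"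
  \<comment> \<open>A strip needs a constant upper end. Below the roof every point lies under a
    rational \<open>q\<close> that is still below the roof, so the strips over \<open>L q\<close>
    with rational \<open>q\<close> exhaust the space.\<close>
  define L where "L q = {x \<in> \<Sigma>. q \<le> \<tau> x}" for q
  have L: "L q \<in> sets borel" "L q \<subseteq> \<Sigma>" "\<And>x. x \<in> L q \<Longrightarrow> q \<le> \<tau> x" for q
  proof -
    have "L q = {x \<in> space borel. x \<in> \<Sigma> \<and> q \<le> height x}" by (auto simp: L_def height_def)
    also have "\<dots> \<in> sets borel" by measurable
    finally show "L q \<in> sets borel" .
  qed (auto simp: L_def)
  have EY: "E \<subseteq> Pow Y"
  proof
    fix X assume "X \<in> E"
    then obtain A a b where "X = A \<times> {a..<b}" "A \<subseteq> \<Sigma>" "0 \<le> a" "\<forall>x\<in>A. b \<le> \<tau> x" by (auto simp: E_def)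
    then show "X \<in> Pow Y" using rect_subset[of A a b] by auto
  qed
  have sigma: "sets (restrict_space borel Y) = sigma_sets Y E"
  proof
    have "E \<subseteq> sets (restrict_space borel Y)"
      using EY by (subst subset_iff) (auto simp: sets_restrict_space_iff E_def intro!: rect_sets)
    then show "sigma_sets Y E \<subseteq> sets (restrict_space borel Y)"
      using sets.sigma_sets_subset[of E "restrict_space borel Y"] by (simp add: space_restrict_space)
    let ?S = "sigma Y E"
    have sS: "sets ?S = sigma_sets Y E" "space ?S = Y" using EY by auto
    have inE: "A \<times> {a..<b} \<in> sets ?S" if "A \<in> sets borel" "A \<subseteq> \<Sigma>" "0 \<le> a" "\<And>x. x \<in> A \<Longrightarrow> b \<le> \<tau> x" for A a b
    proof -
      have "A \<times> {a..<b} \<in> E" unfolding E_def using that by blast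
      then show ?thesis unfolding sS by (rule sigma_sets.Basic)
    qed
    have "fst \<in> borel_measurable ?S"
    proof (rule measurable_borel_seqI)
      fix w
      have "fst -` cyl w \<inter> space ?S = (\<Union>q\<in>\<rat>. (cyl w \<inter> L q) \<times> {0..<q})"
        unfolding sS(2)
      proof (intro equalityI subsetI)
        fix p assume "p \<in> fst -` cyl w \<inter> Y"
        then have p: "fst p \<in> cyl w" "fst p \<in> \<Sigma>" "0 \<le> snd p" "snd p < \<tau> (fst p)" by (auto simp: Y_eq)
        obtain q where "q \<in> \<rat>" "snd p < q" "q < \<tau> (fst p)" using Rats_dense_in_real[OF p(4)] by blast
        with p show "p \<in> (\<Union>q\<in>\<rat>. (cyl w \<inter> L q) \<times> {0..<q})" by (cases p) (auto simp: L_def intro!: bexI[of _ q])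
      qed (auto simp: Y_eq L_def)
      also have "\<dots> \<in> sets ?S"
      proof (rule sets.countable_UN''[OF countable_rat])
        show "(cyl w \<inter> L q) \<times> {0..<q} \<in> sets ?S" for q by (rule inE) (use L in auto)
      qed
      finally show "fst -` cyl w \<inter> space ?S \<in> sets ?S" .
    qed
    moreover have "snd \<in> borel_measurable ?S"
    proof (rule borel_measurableI_ge)
      fix a :: real
      have "{p \<in> space ?S. a \<le> snd p} = (\<Union>q\<in>\<rat>. L q \<times> {max a 0..<q})"
        unfolding sS(2)
      proof (intro equalityI subsetI)
        fix p assume "p \<in> {p \<in> Y. a \<le> snd p}"
        then have p: "fst p \<in> \<Sigma>" "0 \<le> snd p" "a \<le> snd p" "snd p < \<tau> (fst p)" by (auto simp: Y_eq)
        obtain q where "q \<in> \<rat>" "snd p < q" "q < \<tau> (fst p)" using Rats_dense_in_real[OF p(4)] by blast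
        with p show "p \<in> (\<Union>q\<in>\<rat>. L q \<times> {max a 0..<q})" by (cases p) (auto simp: L_def intro!: bexI[of _ q])
      qed (auto simp: Y_eq L_def)
      also have "\<dots> \<in> sets ?S"
      proof (rule sets.countable_UN''[OF countable_rat])
        show "L q \<times> {max a 0..<q} \<in> sets ?S" for q by (rule inE) (use L in auto)
      qed
      finally show "{p \<in> space ?S. a \<le> snd p} \<in> sets ?S" .
    qed
    ultimately have "(\<lambda>p. (fst p, snd p)) \<in> measurable ?S (borel \<Otimes>\<^sub>M borel)" by (rule measurable_Pair)
    then have id_meas: "(\<lambda>p. p) \<in> measurable ?S borel" by (simp only: borel_prod prod.collapse)
    show "sets (restrict_space borel Y) \<subseteq> sigma_sets Y E"
    proof
      fix A assume "A \<in> sets (restrict_space borel Y)"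
      then obtain W where "W \<in> sets borel" "A = Y \<inter> W" by (auto simp: sets_restrict_space)
      then show "A \<in> sigma_sets Y E" using measurable_sets[OF id_meas, of W] unfolding sS by (simp add: Int_commute)
    qed
  qed
  show ?thesis
  proof (rule measure_eqI_generator_eq_countable[where E = E and \<Omega> = Y and A = "(\<lambda>q. L q \<times> {0..<q}) ` \<rat>"])
    show "Int_stable E"
    proof (rule Int_stableI)
      fix X X' assume "X \<in> E" "X' \<in> E"
      then obtain A a b A' a' b' where *: "X = A \<times> {a..<b}" "A \<in> sets borel" "A \<subseteq> \<Sigma>" "0 \<le> a" "\<forall>x\<in>A. b \<le> \<tau> x"
        "X' = A' \<times> {a'..<b'}" "A' \<in> sets borel" "\<forall>x\<in>A'. b' \<le> \<tau> x"
        unfolding E_def by blast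
      then have "X \<inter> X' = (A \<inter> A') \<times> {max a a'..<min b b'}" by auto
      moreover have "A \<inter> A' \<in> sets borel" "A \<inter> A' \<subseteq> \<Sigma>" "0 \<le> max a a'" "\<forall>x\<in>A \<inter> A'. min b b' \<le> \<tau> x"
        using * by auto
      ultimately show "X \<inter> X' \<in> E" unfolding E_def by blast
    qed
    show "emeasure \<nu> X = emeasure (susp ?M) X" if XE: "X \<in> E" for X
    proof -
      obtain A a b where X: "X = A \<times> {a..<b}" "A \<in> sets borel" "A \<subseteq> \<Sigma>" "0 \<le> a" and le: "\<forall>x\<in>A. b \<le> \<tau> x"
        using XE unfolding E_def by blast
      note le = le[rule_format]
      show ?thesis
        using emeasure_strip[OF nu X(2-4) le] emeasure_susp_rectangle[OF sets_base_measure X(2-4) le] unfolding X(1) by simp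
    qed
    show "sets \<nu> = sigma_sets Y E" using invariantD(2)[OF nu] sets_suspension_borel sigma by simp
    show "sets (susp ?M) = sigma_sets Y E" using sets_susp[of ?M] sets_suspension_borel sigma by simp
    show "(\<lambda>q. L q \<times> {0..<q}) ` \<rat> \<subseteq> E"
    proof (rule image_subsetI)
      show "L q \<times> {0..<q} \<in> E" for q unfolding E_def using L(1,2)[of q] L(3) by (blast intro: order_refl)
    qed
    show "\<Union>((\<lambda>q. L q \<times> {0..<q}) ` \<rat>) = Y"
    proof (intro equalityI subsetI)
      fix p assume "p \<in> Y"
      then have p: "fst p \<in> \<Sigma>" "0 \<le> snd p" "snd p < \<tau> (fst p)" by (auto simp: Y_eq)
      obtain q where "q \<in> \<rat>" "snd p < q" "q < \<tau> (fst p)" using Rats_dense_in_real[OF p(3)] by blast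
      with p show "p \<in> \<Union>((\<lambda>q. L q \<times> {0..<q}) ` \<rat>)" by (cases p) (auto simp: L_def intro!: bexI[of _ q])
    qed (auto simp: Y_eq L_def)
    show "countable ((\<lambda>q. L q \<times> {0..<q}) ` \<rat>)" using countable_rat by (rule countable_image)
    show "emeasure \<nu> X \<noteq> \<infinity>" for X
      using finite_measure.emeasure_finite[OF invariantD(4)[OF nu]] by simp
  qed (rule EY)
qed

lemma AE_base_measure:
  assumes nu: "\<nu> \<in> invariant_subprobs B \<tau>"
  shows "AE x in base_measure \<nu>. x \<in> \<Sigma>"
proof (rule AE_I[where N = "- \<Sigma>"])
  have "emeasure (base_measure \<nu>) (- \<Sigma>) = emeasure \<nu> ((- \<Sigma> \<inter> \<Sigma>) \<times> {0..c})"
    by (rule emeasure_base_measure[OF nu]) (rule borel_comp[OF Sigma_sets])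
  then show "emeasure (base_measure \<nu>) (- \<Sigma>) = 0" by simp
  show "- \<Sigma> \<in> sets (base_measure \<nu>)" unfolding sets_base_measure by (rule borel_comp[OF Sigma_sets])
qed auto

lemma finite_base_measure:
  assumes nu: "\<nu> \<in> invariant_subprobs B \<tau>"
  shows "finite_measure (base_measure \<nu>)"
proof -
  interpret finite_measure \<nu> by (rule invariantD(4)[OF nu])
  have "space (base_measure \<nu>) = UNIV" by (simp add: base_measure_def)
  then show ?thesis
    using emeasure_base_measure[OF nu, of UNIV] by (intro finite_measureI) simp
qed

text \<open>Flowing for time \<open>c\<close> into the bottom strip over \<open>A0\<close> starts
  from the top strip of thickness \<open>c\<close> over the preimage of \<open>A0\<close>. Both
  strips have the mass of their base, and flow invariance equates them.\<close>

lemma base_measure_invariant: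
  assumes nu: "\<nu> \<in> invariant_subprobs B \<tau>"
  shows "distr (base_measure \<nu>) borel left_shift = base_measure \<nu>"
proof (rule measure_eqI)
  let ?M = "base_measure \<nu>"
  fix A assume "A \<in> sets (distr ?M borel left_shift)"
  then have A: "A \<in> sets borel" by simp
  define A0 where "A0 = A \<inter> \<Sigma>"
  define C where "C = {x \<in> \<Sigma>. left_shift x \<in> A0}"
  have A0: "A0 \<in> sets borel" "A0 \<subseteq> \<Sigma>" "\<And>x. x \<in> A0 \<Longrightarrow> c \<le> \<tau> x"
    using A tau_pos(2) by (auto simp: A0_def less_imp_le)
  have C: "C \<in> sets borel" "C \<subseteq> \<Sigma>"
  proof -
    have "C = (left_shift -` A0 \<inter> space borel) \<inter> \<Sigma>" by (auto simp: C_def)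
    also have "\<dots> \<in> sets borel" by (intro sets.Int measurable_sets[OF left_shift_measurable A0(1)] Sigma_sets)
    finally show "C \<in> sets borel" .
  qed (auto simp: C_def)
  have RY: "A0 \<times> {0..<c} \<subseteq> Y" by (rule rect_subset[OF A0(2) order_refl A0(3)])
  have R: "A0 \<times> {0..<c} \<in> sets borel" using A0 by (auto intro!: rect_sets)
  let ?P = "suspension_flow \<tau> c -` (A0 \<times> {0..<c}) \<inter> Y"
  \<comment> \<open>A point that has not crossed is at height \<open>c\<close> or more and misses
    the half-open bottom strip, so exactly the crossing points remain.\<close>
  have mem: "(x, s) \<in> ?P \<longleftrightarrow> x \<in> C \<and> \<tau> x - c \<le> s \<and> s < \<tau> x" for x s
  proof (cases "(x, s) \<in> Y")
    case True
    then have x: "x \<in> \<Sigma>" "0 \<le> s" "s < \<tau> x" by (auto simp: Y_eq)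
    have "suspension_flow \<tau> c (x, s) = short_flow c (x, s)" by (rule suspension_flow_short[OF True]) (use c_pos in auto)
    then show ?thesis using x True by (auto simp: short_flow_def height_def C_def)
  next
    case False
    then show ?thesis using tau_pos(2)[of x] C(2) by (auto simp: Y_eq)
  qed
  have P: "?P \<in> sets borel" "?P \<subseteq> Y"
  proof -
    have "?P = short_flow c -` (A0 \<times> {0..<c}) \<inter> Y" using suspension_flow_short[of _ c] c_pos by auto
    then show "?P \<in> sets borel" using measurable_sets[OF short_flow_measurable R, of c] by auto
  qed auto
  have "ennreal (1 / c) * (ennreal c * emeasure ?M C) = emeasure (susp ?M) ?P"
  proof -
    have "(\<integral>\<^sup>+s. indicator ?P (x, s) \<partial>lborel) = ennreal c * indicator C x" for x
    proof -
      have "(\<integral>\<^sup>+s. indicator ?P (x, s) \<partial>lborel) = (\<integral>\<^sup>+s. indicator C x * indicator {\<tau> x - c..<\<tau> x} s \<partial>lborel)"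
        by (intro nn_integral_cong) (simp add: indicator_def mem del: vimage_Int Int_iff)
      also have "\<dots> = indicator C x * emeasure lborel {\<tau> x - c..<\<tau> x}" by (rule nn_integral_cmult_indicator) simp
      also have "emeasure lborel {\<tau> x - c..<\<tau> x} = ennreal c" using c_pos by simp
      finally show ?thesis by (simp add: mult.commute)
    qed
    then show ?thesis
      unfolding emeasure_susp[OF sets_base_measure P]
      using C(1) nn_integral_cmult_indicator[of C ?M "ennreal c"] by simp
  qed
  also have "\<dots> = emeasure \<nu> ?P" using invariant_eq_susp[OF nu] by simp
  also have "\<dots> = emeasure \<nu> (A0 \<times> {0..<c})" by (rule invariantD(6)[OF nu _ R RY]) (use c_pos in simp)
  also have "\<dots> = ennreal (1 / c) * (ennreal c * emeasure ?M A0)"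
    using emeasure_strip[OF nu A0(1,2) order_refl A0(3)] by (simp add: mult.assoc)
  finally have "emeasure ?M C = emeasure ?M A0"
    using c_pos by (simp add: mult.assoc[symmetric] flip: ennreal_mult)
  moreover have "emeasure ?M (left_shift -` A \<inter> space ?M) = emeasure ?M C"
  proof (rule emeasure_eq_AE)
    have "x \<in> left_shift -` A \<inter> space ?M \<longleftrightarrow> x \<in> C" if "x \<in> \<Sigma>" for x
      using that left_shift_Sigma by (auto simp: C_def A0_def base_measure_def)
    then show "AE x in ?M. x \<in> left_shift -` A \<inter> space ?M \<longleftrightarrow> x \<in> C"
      using AE_base_measure[OF nu] by (auto elim: eventually_mono)
    show "left_shift -` A \<inter> space ?M \<in> sets ?M"
      using measurable_sets[OF left_shift_measurable A] by (simp add: base_measure_def)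
  qed (use C in simp)
  moreover have "emeasure ?M A = emeasure ?M A0"
    by (rule emeasure_eq_AE) (use AE_base_measure[OF nu] A A0(1) in \<open>auto simp: A0_def elim: eventually_mono\<close>)
  ultimately show "emeasure (distr ?M borel left_shift) A = emeasure ?M A"
    using A by (subst emeasure_distr) (auto simp: measurable_cong_sets[OF sets_base_measure refl])
qed simp

end

section \<open>The space of invariant sub-probability measures\<close>

lemma emeasure_convex_comb_measure:
  assumes "sets \<nu> = sets \<mu>" "A \<in> sets \<mu>"
  shows "emeasure (convex_comb_measure u \<mu> \<nu>) A = ennreal (1 - u) * emeasure \<mu> A + ennreal u * emeasure \<nu> A"
proof (rule emeasure_measure_of[OF convex_comb_measure_def sets.space_closed])
  let ?P = "convex_comb_measure u \<mu> \<nu>" and ?f = "\<lambda>A. ennreal (1 - u) * emeasure \<mu> A + ennreal u * emeasure \<nu> A"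
  have sets_P: "sets ?P = sets \<mu>" by (simp add: convex_comb_measure_def)
  show "positive (sets ?P) ?f" by (simp add: positive_def)
  show "countably_additive (sets ?P) ?f"
  proof (rule countably_additiveI)
    fix A :: "nat \<Rightarrow> 'a set" assume A: "range A \<subseteq> sets ?P" "disjoint_family A" "(\<Union>i. A i) \<in> sets ?P"
    have "(\<Sum>i. emeasure \<mu> (A i)) = emeasure \<mu> (\<Union>i. A i)" "(\<Sum>i. emeasure \<nu> (A i)) = emeasure \<nu> (\<Union>i. A i)"
      using A assms sets_P by (auto intro!: suminf_emeasure)
    then show "(\<Sum>i. ?f (A i)) = ?f (\<Union>i. A i)"
      by (simp add: suminf_add[OF summableI summableI, symmetric])
  qed
  show "A \<in> sets ?P" using assms(2) sets_P by simp
qed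

text \<open>Dividing the roof by \<open>c\<close> makes the cost of the base weights equal to the
  total mass of the flow measure.\<close>

locale suspension_states = suspension_setting B \<tau> c \<delta> + roofed_shift B "\<lambda>x. \<tau> x / c" v
  for B \<tau> c \<delta> v
begin

lemma roof_height: "x \<in> \<Sigma> \<Longrightarrow> roof r x = ennreal (height x / c)"
  by (simp add: roof_eq height_def)

lemma cylinder_sets: "cylinder B w \<in> sets borel" "cylinder B w \<subseteq> \<Sigma>"
  using borel_open[OF open_cyl[of w]] by (auto simp: cylinder_eq)

lemma base_weight_eq:
  assumes "\<nu> \<in> invariant_subprobs B \<tau>"
  shows "base_weight \<nu> w = measure (base_measure \<nu>) (cyl w)"
  using emeasure_base_measure[OF assms borel_open[OF open_cyl[of w]]]
  by (simp add: base_weight_def measure_def cylinder_eq Int_commute)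

lemma base_weight_in_states:
  assumes nu: "\<nu> \<in> invariant_subprobs B \<tau>"
  shows "base_weight \<nu> \<in> states r" "\<nu> = susp (cyl_measure (base_weight \<nu>))"
proof -
  let ?M = "base_measure \<nu>"
  interpret M: finite_measure ?M by (rule finite_base_measure[OF nu])
  have eq: "base_weight \<nu> = (\<lambda>w. measure ?M (cyl w))"
    by (rule HOL.ext) (rule base_weight_eq[OF nu])
  have st: "stationary (base_weight \<nu>)"
    unfolding eq by (rule stationary_measure[OF M.finite_measure_axioms sets_base_measure base_measure_invariant[OF nu]])
  have M: "?M = cyl_measure (base_weight \<nu>)"
    by (rule cyl_measure_unique[OF stationaryD(1)[OF st] sets_base_measure]) (simp add: eq M.emeasure_eq_measure)
  show nu_eq: "\<nu> = susp (cyl_measure (base_weight \<nu>))"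
    using invariant_eq_susp[OF nu] by (simp only: M[symmetric])
  have "cost r (base_weight \<nu>) = (\<integral>\<^sup>+x. roof r x \<partial>?M)"
    unfolding cost_eq_nn_integral[OF stationaryD(1)[OF st]] M ..
  also have "\<dots> = (\<integral>\<^sup>+x. ennreal (height x / c) \<partial>?M)"
    by (rule nn_integral_cong_AE) (use AE_base_measure[OF nu] in \<open>eventually_elim, simp add: roof_height\<close>)
  also have "\<dots> = emeasure (susp ?M) Y"
    by (rule emeasure_susp_space[OF sets_base_measure AE_base_measure[OF nu], symmetric])
  also have "\<dots> \<le> 1" using invariantD(3)[OF nu] invariant_eq_susp[OF nu] by simp
  finally show "base_weight \<nu> \<in> states r" using st by (simp add: states_def)
qed

lemma AE_cyl_measure_states:
  assumes "m \<in> states r"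
  shows "AE x in cyl_measure m. x \<in> \<Sigma>"
proof -
  have "(\<integral>\<^sup>+x. roof r x \<partial>cyl_measure m) \<noteq> \<infinity>"
    using states_bounds(5)[OF assms] cost_eq_nn_integral[OF states_bounds(2)[OF assms]] by (auto simp: top_unique)
  then have "AE x in cyl_measure m. roof r x \<noteq> \<infinity>"
    by (intro nn_integral_noteq_infinite) (auto simp: measurable_cong_sets[OF sets_cyl_measure refl])
  then show ?thesis by eventually_elim (use roof_outside in auto)
qed

lemma emeasure_susp_cylinder:
  assumes M: "sets M = sets borel" and conc: "AE x in M. x \<in> \<Sigma>"
  shows "emeasure (susp M) (cylinder B w \<times> {0..c}) = emeasure M (cyl w)"
proof -
  have R: "cylinder B w \<times> {0..c} \<in> sets borel" "cylinder B w \<times> {0..c} \<subseteq> Y"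
    using cylinder_sets(2)[of w] tau_pos(2) by (auto intro!: rect_sets cylinder_sets(1)) (fastforce simp: Y_eq)
  have cM: "cylinder B w \<in> sets M" using cylinder_sets(1) M by simp
  have "(\<integral>\<^sup>+s. indicator (cylinder B w \<times> {0..c}) (x, s) \<partial>lborel) = ennreal c * indicator (cylinder B w) x" for x
  proof -
    have "(\<integral>\<^sup>+s. indicator (cylinder B w \<times> {0..c}) (x, s) \<partial>lborel) = (\<integral>\<^sup>+s. indicator (cylinder B w) x * indicator {0..c} s \<partial>lborel)"
      by (intro nn_integral_cong) (auto split: split_indicator)
    also have "\<dots> = indicator (cylinder B w) x * emeasure lborel {0..c}" by (rule nn_integral_cmult_indicator) simp
    also have "emeasure lborel {0..c} = ennreal c" using c_pos by simp
    finally show ?thesis by (simp add: mult.commute)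
  qed
  then have "emeasure (susp M) (cylinder B w \<times> {0..c}) = ennreal (1 / c) * (ennreal c * emeasure M (cylinder B w))"
    unfolding emeasure_susp[OF M R] using nn_integral_cmult_indicator[OF cM, of "ennreal c"] by simp
  also have "\<dots> = emeasure M (cylinder B w)"
    using c_pos by (simp add: mult.assoc[symmetric] flip: ennreal_mult)
  also have "\<dots> = emeasure M (cyl w)"
    by (rule emeasure_eq_AE) (use conc cM M borel_open[OF open_cyl[of w]] in \<open>auto simp: cylinder_eq elim: eventually_mono\<close>)
  finally show ?thesis .
qed

lemma susp_in_invariant_subprobs:
  assumes m: "m \<in> states r"
  shows "susp (cyl_measure m) \<in> invariant_subprobs B \<tau>" "base_weight (susp (cyl_measure m)) = m"
proof -
  let ?M = "cyl_measure m"
  note sM = sets_cyl_measure[of m] and conc = AE_cyl_measure_states[OF m]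
  have inv: "distr ?M borel left_shift = ?M" by (rule left_shift_cyl_measure[OF states_bounds(1)[OF m]])
  have "emeasure (susp ?M) Y = (\<integral>\<^sup>+x. ennreal (height x / c) \<partial>?M)"
    by (rule emeasure_susp_space[OF sM conc])
  also have "\<dots> = (\<integral>\<^sup>+x. roof r x \<partial>?M)"
    by (rule nn_integral_cong_AE) (use conc in \<open>eventually_elim, simp add: roof_height\<close>)
  also have "\<dots> \<le> 1"
    using states_bounds(5)[OF m] cost_eq_nn_integral[OF states_bounds(2)[OF m]] by simp
  finally have mass: "emeasure (susp ?M) Y \<le> 1" .
  have "emeasure (susp ?M) (suspension_flow \<tau> t -` A \<inter> Y) = emeasure (susp ?M) A"
    if "0 \<le> t" "A \<in> sets (suspension_borel B \<tau>)" for t A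
    using that(2) by (intro flow_preserves_susp[OF sM inv conc that(1)]) (auto simp: in_sets_suspension_iff)
  then show "susp ?M \<in> invariant_subprobs B \<tau>"
    unfolding invariant_subprobs_def using mass by (simp add: space_susp[OF sM] sets_susp[OF sM])
  show "base_weight (susp ?M) = m"
    using emeasure_susp_cylinder[OF sM conc] measure_cyl_measure[OF states_bounds(2)[OF m]]
    by (intro HOL.ext) (simp add: base_weight_def measure_def)
qed

lemma base_weight_convex_comb:
  assumes mu: "\<mu> \<in> invariant_subprobs B \<tau>" and nu: "\<nu> \<in> invariant_subprobs B \<tau>" and u: "0 \<le> u" "u \<le> 1"
  shows "base_weight (convex_comb_measure u \<mu> \<nu>) = (\<lambda>w. (1 - u) * base_weight \<mu> w + u * base_weight \<nu> w)"
proof (rule HOL.ext)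
  fix w
  interpret mu: finite_measure \<mu> by (rule invariantD(4)[OF mu])
  interpret nu: finite_measure \<nu> by (rule invariantD(4)[OF nu])
  have R: "cylinder B w \<times> {0..c} \<in> sets borel" "cylinder B w \<times> {0..c} \<subseteq> Y"
    using cylinder_sets(2)[of w] tau_pos(2) by (auto intro!: rect_sets cylinder_sets(1)) (fastforce simp: Y_eq)
  have s: "sets \<nu> = sets \<mu>" using invariantD(2)[OF mu] invariantD(2)[OF nu] by simp
  have "emeasure (convex_comb_measure u \<mu> \<nu>) (cylinder B w \<times> {0..c}) =
      ennreal ((1 - u) * base_weight \<mu> w + u * base_weight \<nu> w)"
    unfolding emeasure_convex_comb_measure[OF s invariantD(5)[OF mu R]] base_weight_def
    using u by (simp add: mu.emeasure_eq_measure nu.emeasure_eq_measure ennreal_mult)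
  moreover have "0 \<le> (1 - u) * base_weight \<mu> w + u * base_weight \<nu> w" using u by (simp add: base_weight_def)
  ultimately show "base_weight (convex_comb_measure u \<mu> \<nu>) w = (1 - u) * base_weight \<mu> w + u * base_weight \<nu> w"
    by (simp add: base_weight_def measure_def)
qed

abbreviation "T \<equiv> cylinder_topology B \<tau> c"

definition weight_image :: "((nat \<Rightarrow> nat) \<times> real) measure \<Rightarrow> (nat \<Rightarrow>\<^sub>C real)" where
  "weight_image \<nu> = embed (base_weight \<nu>)"

definition measure_of_image :: "(nat \<Rightarrow>\<^sub>C real) \<Rightarrow> ((nat \<Rightarrow> nat) \<times> real) measure" where
  "measure_of_image y = susp (cyl_measure (decode y))"

lemma openin_base_weight:
  assumes "w \<noteq> []" "open U"
  shows "openin T {\<nu> \<in> invariant_subprobs B \<tau>. base_weight \<nu> w \<in> U}"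
  unfolding cylinder_topology_def base_weight_def
  by (rule topology_generated_by_Basis) (use assms in \<open>auto simp: cylinders_def\<close>)

text \<open>The empty word is not among the subbasic ones, so its weight has to be recovered from the letters.\<close>

lemma Hausdorff_cylinder_topology: "Hausdorff_space T"
  unfolding Hausdorff_space_def topspace_cylinder_topology
proof (intro allI impI)
  fix \<mu> \<nu> assume *: "\<mu> \<in> invariant_subprobs B \<tau> \<and> \<nu> \<in> invariant_subprobs B \<tau> \<and> \<mu> \<noteq> \<nu>"
  have "\<exists>w. w \<noteq> [] \<and> base_weight \<mu> w \<noteq> base_weight \<nu> w"
  proof (rule ccontr)
    assume "\<not> ?thesis"
    then have eq: "base_weight \<mu> w = base_weight \<nu> w" if "w \<noteq> []" for w using that by blast
    have "stationary (base_weight \<mu>)" "stationary (base_weight \<nu>)"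
      using states_bounds(1)[OF base_weight_in_states(1)] * by auto
    from this[THEN stationaryD(3), of "[]"]
    have "base_weight \<mu> [] = base_weight \<nu> []" using eq by (simp add: sums_unique2)
    then have "base_weight \<mu> = base_weight \<nu>" using eq by (intro HOL.ext) (metis (full_types))
    then show False using * base_weight_in_states(2) by metis
  qed
  then obtain w where w: "w \<noteq> []" "base_weight \<mu> w \<noteq> base_weight \<nu> w" by (elim exE conjE)
  from hausdorff[OF w(2)] obtain U V where UV: "open U" "open V" "base_weight \<mu> w \<in> U" "base_weight \<nu> w \<in> V" "U \<inter> V = {}"
    by (elim exE conjE)
  show "\<exists>U V. openin T U \<and> openin T V \<and> \<mu> \<in> U \<and> \<nu> \<in> V \<and> disjnt U V"
    by (rule exI[of _ "{\<nu> \<in> invariant_subprobs B \<tau>. base_weight \<nu> w \<in> U}"],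
        rule exI[of _ "{\<nu> \<in> invariant_subprobs B \<tau>. base_weight \<nu> w \<in> V}"])
      (use UV * openin_base_weight[OF w(1)] in \<open>auto simp: disjnt_def\<close>)
qed

text \<open>Continuity is checked for the map from weights to measures, where a subbasic set pulls
  back to an open condition on one coordinate. Its domain is compact and its range Hausdorff, so the
  inverse is continuous as well.\<close>

lemma homeomorphic_maps_weight_image:
  "homeomorphic_maps T (top_of_set (embed ` states r)) weight_image measure_of_image"
proof -
  let ?K = "embed ` states r"
  have G: "decode y \<in> states r" "measure_of_image y \<in> invariant_subprobs B \<tau>" "weight_image (measure_of_image y) = y"
      "base_weight (measure_of_image y) = decode y" if "y \<in> ?K" for y
    using that susp_in_invariant_subprobs by (auto simp: measure_of_image_def weight_image_def decode_embed_states)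
  have F: "weight_image \<nu> \<in> ?K" "measure_of_image (weight_image \<nu>) = \<nu>" if "\<nu> \<in> invariant_subprobs B \<tau>" for \<nu>
    using base_weight_in_states[OF that] by (auto simp: measure_of_image_def weight_image_def decode_embed_states)
  have cont: "continuous_map (top_of_set ?K) T measure_of_image"
    unfolding cylinder_topology_def
  proof (rule continuous_on_generated_topo)
    fix W assume "W \<in> {{\<nu> \<in> invariant_subprobs B \<tau>. measure \<nu> (C \<times> {0..c}) \<in> U} | C U.
        C \<in> cylinders B \<and> open (U :: real set)}"
    then obtain w U where W: "W = {\<nu> \<in> invariant_subprobs B \<tau>. base_weight \<nu> w \<in> U}" "open U"
      by (auto simp: cylinders_def base_weight_def)
    have "continuous_on UNIV (\<lambda>y. decode y w)"
      unfolding decode_def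
      by (intro continuous_intros linear_continuous_on bounded_linear_apply_bcontfun)
    then have "open ((\<lambda>y. decode y w) -` U)" using W(2) by (rule open_vimage[rotated])
    moreover have "measure_of_image -` W \<inter> topspace (top_of_set ?K) = ?K \<inter> (\<lambda>y. decode y w) -` U"
      using G by (auto simp: W(1))
    ultimately show "openin (top_of_set ?K) (measure_of_image -` W \<inter> topspace (top_of_set ?K))"
      by (simp add: openin_open_Int)
  next
    show "measure_of_image ` topspace (top_of_set ?K) \<subseteq> \<Union> {{\<nu> \<in> invariant_subprobs B \<tau>. measure \<nu> (C \<times> {0..c}) \<in> U} | C U.
        C \<in> cylinders B \<and> open (U :: real set)}"
      unfolding topology_generated_by_topspace[symmetric] cylinder_topology_def[symmetric] topspace_cylinder_topology
      using G by auto
  qed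
  have "homeomorphic_map (top_of_set ?K) T measure_of_image"
  proof (rule continuous_imp_homeomorphic_map[OF cont])
    show "compact_space (top_of_set ?K)" using compact_states by (simp add: compact_space_subtopology)
    show "measure_of_image ` topspace (top_of_set ?K) = topspace T"
      unfolding topspace_cylinder_topology using G(2) F by (auto simp: image_iff) metis
    show "inj_on measure_of_image (topspace (top_of_set ?K))" by (rule inj_on_inverseI[of _ weight_image]) (use G(3) in auto)
  qed (rule Hausdorff_cylinder_topology)
  then obtain g where g: "homeomorphic_maps (top_of_set ?K) T measure_of_image g"
    by (auto simp: homeomorphic_map_maps)
  have "homeomorphic_maps (top_of_set ?K) T measure_of_image weight_image"
  proof (rule homeomorphic_maps_eq[OF g])
    show "g \<nu> = weight_image \<nu>" if "\<nu> \<in> topspace T" for \<nu>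
      using g F[of \<nu>] that unfolding homeomorphic_maps_def topspace_cylinder_topology by (metis topspace_euclidean_subtopology)
  qed simp
  then show ?thesis by (rule homeomorphic_maps_sym[THEN iffD1])
qed

lemma affine_homeomorphism_weight_image: "affine_homeomorphism T (embed ` states r) weight_image"
  unfolding affine_homeomorphism_def topspace_cylinder_topology
proof (intro conjI ballI)
  show "homeomorphic_map T (top_of_set (embed ` states r)) weight_image"
    using homeomorphic_maps_weight_image homeomorphic_maps_imp_map by blast
  fix \<mu> \<nu> and u :: real
  assume "\<mu> \<in> invariant_subprobs B \<tau>" "\<nu> \<in> invariant_subprobs B \<tau>" "u \<in> {0..1}"
  then show "weight_image (convex_comb_measure u \<mu> \<nu>) = (1 - u) *\<^sub>R weight_image \<mu> + u *\<^sub>R weight_image \<nu>"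
    by (simp add: weight_image_def base_weight_convex_comb embed_lincomb base_weight_in_states(1))
qed

lemma compact_cylinder_topology: "compact_space T"
proof -
  have "T homeomorphic_space top_of_set (embed ` states r)"
    unfolding homeomorphic_space_def using homeomorphic_maps_weight_image by blast
  then show ?thesis
    using homeomorphic_compact_space compact_states by (fastforce simp: compact_space_subtopology)
qed

end

section \<open>From the matrix and the class of the roof to the assumptions of the locales\<close>

lemma markov_shift_nonempty_cylinder:
  assumes "no_zero_lines B"
  obtains x where "x \<in> markov_shift B" "x 0 = a"
proof
  define f where "f i = (SOME j. B i j)" for i
  have f: "B i (f i)" for i
    unfolding f_def by (rule someI_ex) (use assms in \<open>auto simp: no_zero_lines_def\<close>)
  show "(\<lambda>n. (f ^^ n) a) \<in> markov_shift B" using f by (simp add: markov_shift_def)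
  show "(f ^^ 0) a = a" by simp
qed

lemma transitive_shift_connected:
  assumes "no_zero_lines B" "transitive_shift B"
  shows "\<exists>x\<in>markov_shift B. \<exists>l\<ge>1. x 0 = a \<and> x l = b"
proof -
  have open_cylinder: "openin (shift_topology B) (cylinder B [d])" "cylinder B [d] \<noteq> {}" for d
  proof -
    show "openin (shift_topology B) (cylinder B [d])"
      unfolding shift_topology_def by (rule topology_generated_by_Basis) (auto simp: cylinders_def)
    obtain x where "x \<in> markov_shift B" "x 0 = d" by (rule markov_shift_nonempty_cylinder[OF assms(1)])
    then show "cylinder B [d] \<noteq> {}" by (auto simp: cylinder_def)
  qed
  then obtain n where n: "1 \<le> n" "cylinder B [a] \<inter> (left_shift ^^ n) -` cylinder B [b] \<noteq> {}"
    using assms(2) unfolding transitive_shift_def by meson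
  then obtain x where "x \<in> cylinder B [a]" "(left_shift ^^ n) x \<in> cylinder B [b]" by blast
  then have "x \<in> markov_shift B" "x 0 = a" "x n = b" by (auto simp: cylinder_def funpow_left_shift)
  with n(1) show ?thesis by blast
qed

lemma variation_bound:
  assumes "x \<in> markov_shift B" "y \<in> markov_shift B" "\<And>i. i < n \<Longrightarrow> x i = y i"
  shows "ennreal \<bar>\<phi> x - \<phi> y\<bar> \<le> variation B \<phi> n"
  unfolding variation_def by (rule Sup_upper) (use assms in blast)

lemma variation_antimono:
  assumes "k \<le> n"
  shows "variation B \<phi> n \<le> variation B \<phi> k"
  unfolding variation_def
proof (rule Sup_subset_mono, rule subsetI)
  fix z assume "z \<in> {ennreal \<bar>\<phi> x - \<phi> y\<bar> |x y. x \<in> markov_shift B \<and> y \<in> markov_shift B \<and> (\<forall>i<n. x i = y i)}"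
  then obtain x y where *: "z = ennreal \<bar>\<phi> x - \<phi> y\<bar>" "x \<in> markov_shift B" "y \<in> markov_shift B" "\<forall>i<n. x i = y i"
    by blast
  have "\<forall>i<k. x i = y i" using *(4) assms by simp
  with * show "z \<in> {ennreal \<bar>\<phi> x - \<phi> y\<bar> |x y. x \<in> markov_shift B \<and> y \<in> markov_shift B \<and> (\<forall>i<k. x i = y i)}"
    by blast
qed

lemma continuous_on_variation:
  assumes "variation B \<phi> \<longlonglongrightarrow> 0"
  shows "continuous_on (markov_shift B) \<phi>"
  unfolding continuous_on_def
proof (intro ballI tendstoI)
  fix x and e :: real assume x: "x \<in> markov_shift B" and e: "0 < e"
  have "eventually (\<lambda>n. variation B \<phi> n < ennreal e) sequentially"
    by (rule order_tendstoD(2)[OF assms]) (use e in simp)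
  then obtain n where n: "variation B \<phi> n < ennreal e" by (auto simp: eventually_sequentially)
  let ?U = "cyl (map x [0..<n])"
  have "x \<in> ?U" by (simp add: mem_cyl_iff)
  then have "eventually (\<lambda>y. y \<in> ?U) (at x within markov_shift B)"
    using open_cyl by (auto simp: eventually_at_topological)
  moreover have "eventually (\<lambda>y. y \<in> markov_shift B) (at x within markov_shift B)"
    by (auto simp: eventually_at_topological intro: exI[of _ UNIV])
  ultimately show "eventually (\<lambda>y. dist (\<phi> y) (\<phi> x) < e) (at x within markov_shift B)"
  proof eventually_elim
    case (elim y)
    have "ennreal \<bar>\<phi> y - \<phi> x\<bar> \<le> variation B \<phi> n"
      by (rule variation_bound) (use elim x in \<open>auto simp: cyl_def\<close>)
    with n have "ennreal \<bar>\<phi> y - \<phi> x\<bar> < ennreal e" by (rule le_less_trans[rotated])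
    then show ?case by (simp add: dist_real_def ennreal_less_iff)
  qed
qed

theorem theorem1p4:
  fixes B :: "nat \<Rightarrow> nat \<Rightarrow> bool" and \<tau> :: "(nat \<Rightarrow> nat) \<Rightarrow> real" and c :: real
  assumes "no_zero_lines B"
    and "transitive_shift B"
    and "class_R B \<tau>"
    and "0 < c" and "c < (INF x \<in> markov_shift B. \<tau> x)"
  shows "(\<exists>(K :: (nat \<Rightarrow>\<^sub>C real) set) F.
            poulsen_simplex K \<and> affine_homeomorphism (cylinder_topology B \<tau> c) K F) \<and>
         compact_space (cylinder_topology B \<tau> c)"
proof -
  define \<delta> where "\<delta> = (INF x \<in> markov_shift B. \<tau> x)"
  \<comment> \<open>The first two variations may be infinite and are replaced by \<open>0\<close>;
    from order \<open>2\<close> on they are finite, so the conversion to reals is faithful.\<close>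
  define v where "v n = (if n < 2 then 0 else enn2real (variation B \<tau> n) / c)" for n
  have R: "variation B \<tau> \<longlonglongrightarrow> 0" "variation B \<tau> 2 < \<infinity>" "\<exists>\<delta>>0. \<forall>x\<in>markov_shift B. \<delta> \<le> \<tau> x"
    "(\<lambda>k. INF x \<in> {x \<in> markov_shift B. k \<le> x 0}. ereal (\<tau> x)) \<longlonglongrightarrow> \<infinity>"
    using assms(3) by (auto simp: class_R_def)
  have delta: "\<delta> \<le> \<tau> x" if "x \<in> markov_shift B" for x
    unfolding \<delta>_def by (rule cINF_lower) (use that R(3) in \<open>auto simp: bdd_below_def\<close>)
  have fin: "variation B \<tau> n < \<infinity>" if "2 \<le> n" for n
    using variation_antimono[OF that] R(2) by (rule le_less_trans)
  interpret suspension_states B \<tau> c \<delta> v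
  proof
    show "0 < c" "c < \<delta>" using assms(4,5) by (auto simp: \<delta>_def)
    show "\<delta> \<le> \<tau> x" if "x \<in> markov_shift B" for x by (rule delta[OF that])
    show "continuous_on (markov_shift B) \<tau>" by (rule continuous_on_variation[OF R(1)])
    show "1 \<le> \<tau> x / c" if "x \<in> markov_shift B" for x
      using delta[OF that] \<open>0 < c\<close> \<open>c < \<delta>\<close> by simp
    show "\<bar>\<tau> x / c - \<tau> y / c\<bar> \<le> v n"
      if "x \<in> markov_shift B" "y \<in> markov_shift B" "2 \<le> n" "\<And>i. i < n \<Longrightarrow> x i = y i" for x y n
    proof -
      have "enn2real (ennreal \<bar>\<tau> x - \<tau> y\<bar>) \<le> enn2real (variation B \<tau> n)"
        using fin[OF that(3)] that(1,2,4) by (intro enn2real_mono variation_bound) simp_all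
      then have "\<bar>\<tau> x - \<tau> y\<bar> / c \<le> enn2real (variation B \<tau> n) / c"
        using \<open>0 < c\<close> by (simp add: divide_right_mono)
      moreover have "\<bar>\<tau> x / c - \<tau> y / c\<bar> = \<bar>\<tau> x - \<tau> y\<bar> / c"
        using \<open>0 < c\<close> by (simp only: diff_divide_distrib[symmetric] abs_divide abs_of_pos)
      ultimately show ?thesis using that(3) by (simp add: v_def)
    qed
    show "0 \<le> v n" for n using \<open>0 < c\<close> by (simp add: v_def)
    have "(\<lambda>n. enn2real (variation B \<tau> n)) \<longlonglongrightarrow> enn2real 0"
      using R(1) by (intro tendsto_enn2real) auto
    then have "(\<lambda>n. enn2real (variation B \<tau> n) / c) \<longlonglongrightarrow> 0"
      by (auto dest: tendsto_divide_zero)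
    moreover have "eventually (\<lambda>n. enn2real (variation B \<tau> n) / c = v n) sequentially"
      using eventually_ge_at_top[of 2] by eventually_elim (simp add: v_def)
    ultimately show "v \<longlonglongrightarrow> 0" by (rule Lim_transform_eventually)
    show "\<exists>k. \<forall>x\<in>markov_shift B. k \<le> x 0 \<longrightarrow> real j \<le> \<tau> x / c" for j
    proof -
      have "eventually (\<lambda>k. ereal (real j * c) < (INF x \<in> {x \<in> markov_shift B. k \<le> x 0}. ereal (\<tau> x))) sequentially"
        by (rule order_tendstoD(1)[OF R(4)]) simp
      then obtain k where k: "ereal (real j * c) < (INF x \<in> {x \<in> markov_shift B. k \<le> x 0}. ereal (\<tau> x))"
        by (auto simp: eventually_sequentially)
      have "real j \<le> \<tau> x / c" if "x \<in> markov_shift B" "k \<le> x 0" for x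
      proof -
        have "ereal (real j * c) < ereal (\<tau> x)"
          by (rule less_le_trans[OF k INF_lower]) (use that in simp)
        then show ?thesis using \<open>0 < c\<close> by (simp add: field_simps)
      qed
      then show ?thesis by blast
    qed
    show "\<exists>x\<in>markov_shift B. \<exists>l\<ge>1. x 0 = a \<and> x l = b" for a b
      by (rule transitive_shift_connected[OF assms(1,2)])
  qed
  show ?thesis
    using poulsen_simplex_states affine_homeomorphism_weight_image compact_cylinder_topology by blast
qed

end
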